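(* Let $n \geq 1$ be an integer, let $q \geq 1$ and $p>1$ (with $p=\infty$ allowed and the convention $1/\infty=0$) be such that $$1\leq q \leq 1+\frac{1}{n}\quad\text{and}\quad \frac{1}{p}+\frac{n}{q}=n.$$ Then there exists a constant $C>0$, depending only on $n$ and $q$, such that for every (possibly infinite) system $(u_j)$ of orthonormal functions in $L^{2}(\mathbb{C}^{n})$ and all coefficients $(n_j)\subset\mathbb{C}$, $$\left\|\sum_{j} n_{j}\left|e^{-i t \mathcal{L}} u_{j}\right|^{2}\right\|_{L_{t}^{p} L_{z}^{q}(\mathbb{T}\times \mathbb{C}^{n})} \leq C \left(\sum_{j}\left|n_{j}\right|^{\frac{2q}{q+1}}\right)^{\frac{q+1}{2 q}}.$$ Here $\mathcal{L}$ is the special Hermite operator (twisted Laplacian) on $\mathbb{C}^n$.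
   Context: $\mathbb{N}_0$ is the set of non-negative integers. For $k\in\mathbb{N}_0$, $h_k(x)=(2^k\sqrt{\pi}\,k!)^{-1/2}H_k(x)e^{-x^2/2}$ is the normalized Hermite function on $\mathbb{R}$, where $H_k(x)=(-1)^k e^{x^2}\frac{d^k}{dx^k}(e^{-x^2})$; for $\alpha\in\mathbb{N}_0^n$ and $x\in\mathbb{R}^n$, $\Phi_\alpha(x)=\prod_{j=1}^n h_{\alpha_j}(x_j)$. For $\mu,\nu\in\mathbb{N}_0^n$ the special Hermite functions on $\mathbb{C}^n$ are $$\Phi_{\mu\nu}(\zeta)=(2\pi)^{-n/2}\int_{\mathbb{R}^n}e^{ix\cdot\xi}\,\Phi_\mu\!\left(\xi+\tfrac{y}{2}\right)\Phi_\nu\!\left(\xi-\tfrac{y}{2}\right)d\xi,\qquad \zeta=x+iy\in\mathbb{C}^n.$$ They form an orthonormal basis of $L^2(\mathbb{C}^n)$ (Lebesgue measure on $\mathbb{C}^n\cong\mathbb{R}^{2n}$). The special Hermite operator $\mathcal{L}$ is the self-adjoint operator on $L^2(\mathbb{C}^n)$ with $\mathcal{L}\Phi_{\mu\nu}=(2|\nu|+n)\Phi_{\mu\nu}$, where $|\nu|=\nu_1+\dots+\nu_n$, and for $t\in\mathbb{R}$ $$e^{-it\mathcal{L}}f=\sum_{\mu,\nu\in\mathbb{N}_0^n}e^{-it(2|\nu|+n)}\langle f,\Phi_{\mu\nu}\rangle\Phi_{\mu\nu},\qquad f\in L^2(\mathbb{C}^n),$$ which is unitary. $\mathbb{T}$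 is identified with $[-\pi,\pi]$ with Lebesgue measure. The mixed norm is $\|F\|_{L^p_tL^q_z(\mathbb{T}\times\mathbb{C}^n)}=\left(\int_{-\pi}^{\pi}\left(\int_{\mathbb{C}^n}|F(t,z)|^q\,dz\right)^{p/q}dt\right)^{1/p}$, with the essential supremum in $t$ when $p=\infty$. *)

theory Defs
  imports "HOL-Probability.Probability"
begin

section \<open>Hermite functions\<close>

definition hermite_H :: "nat \<Rightarrow> real \<Rightarrow> real" where
  "hermite_H k x = (-1) ^ k * exp (x\<^sup>2) * (deriv ^^ k) (\<lambda>y. exp (- y\<^sup>2)) x"

definition hermite_fun :: "nat \<Rightarrow> real \<Rightarrow> real" where
  "hermite_fun k x = (2 ^ k * sqrt pi * fact k) powr (- 1 / 2) * hermite_H k x * exp (- x\<^sup>2 / 2)"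

definition Hermite_Phi :: "nat ^ 'n \<Rightarrow> real ^ 'n \<Rightarrow> real" where
  "Hermite_Phi \<alpha> x = (\<Prod>j\<in>UNIV. hermite_fun (\<alpha> $ j) (x $ j))"

definition Re_vec :: "complex ^ 'n \<Rightarrow> real ^ 'n" where
  "Re_vec \<zeta> = (\<chi> j. Re (\<zeta> $ j))"

definition Im_vec :: "complex ^ 'n \<Rightarrow> real ^ 'n" where
  "Im_vec \<zeta> = (\<chi> j. Im (\<zeta> $ j))"

definition special_hermite :: "nat ^ 'n \<Rightarrow> nat ^ 'n \<Rightarrow> complex ^ 'n \<Rightarrow> complex" where
  "special_hermite \<mu> \<nu> \<zeta> =
     complex_of_real ((2 * pi) powr (- real CARD('n) / 2)) *
     (LINT \<xi>|lebesgue. exp (\<i> * complex_of_real (Re_vec \<zeta> \<bullet> \<xi>)) *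
        complex_of_real (Hermite_Phi \<mu> (\<xi> + (1/2) *\<^sub>R Im_vec \<zeta>)) *
        complex_of_real (Hermite_Phi \<nu> (\<xi> - (1/2) *\<^sub>R Im_vec \<zeta>)))"


section \<open>The space \<open>L\<^sup>2(\<complex>\<^sup>n)\<close>\<close>

text \<open>
  Elements are functions, not classes: equality in \<open>L\<^sup>2\<close> is equality almost everywhere.
\<close>

definition L2_space :: "(complex ^ 'n \<Rightarrow> complex) set" where
  "L2_space = {f \<in> borel_measurable lebesgue. integrable lebesgue (\<lambda>z. (cmod (f z))\<^sup>2)}"

definition L2_inner :: "(complex ^ 'n \<Rightarrow> complex) \<Rightarrow> (complex ^ 'n \<Rightarrow> complex) \<Rightarrow> complex" where
  "L2_inner f g = (LINT z|lebesgue. f z * cnj (g z))"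

definition L2_orthonormal :: "'j set \<Rightarrow> ('j \<Rightarrow> complex ^ 'n \<Rightarrow> complex) \<Rightarrow> bool" where
  "L2_orthonormal J u \<longleftrightarrow>
     (\<forall>j\<in>J. u j \<in> L2_space) \<and>
     (\<forall>j\<in>J. \<forall>k\<in>J. L2_inner (u j) (u k) = (if j = k then 1 else 0))"


section \<open>The special Hermite operator and its unitary group\<close>

definition special_hermite_eigenvalue :: "nat ^ 'n \<Rightarrow> real" where
  "special_hermite_eigenvalue \<nu> = 2 * real (\<Sum>j\<in>UNIV. \<nu> $ j) + real CARD('n)"

text \<open>
  The operator \<open>\<L>\<close> is diagonal in the orthonormal basis of special Hermite functions, and
  \<open>e\<^sup>-\<^sup>i\<^sup>t\<^sup>\<L>\<close> is given by the spectral series, which converges unconditionally in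
  \<open>L\<^sup>2\<close>. Its sum is determined only up to a null set, so a representative is chosen
  for every \<open>t\<close>.
\<close>

definition special_hermite_propagator ::
    "real \<Rightarrow> (complex ^ 'n \<Rightarrow> complex) \<Rightarrow> complex ^ 'n \<Rightarrow> complex" where
  "special_hermite_propagator t f =
     (SOME g. g \<in> L2_space \<and>
        ((\<lambda>F. \<integral>\<^sup>+z. ennreal ((cmod (g z -
              (\<Sum>(\<mu>, \<nu>)\<in>F. exp (- \<i> * complex_of_real (t * special_hermite_eigenvalue \<nu>)) *
                 L2_inner f (special_hermite \<mu> \<nu>) * special_hermite \<mu> \<nu> z)))\<^sup>2) \<partial>lebesgue)
          \<longlongrightarrow> 0) (finite_subsets_at_top UNIV))"


section \<open>Mixed norms\<close>

text \<open>Only used for exponents \<open>a > 0\<close>, where \<open>\<infinity>\<^sup>a = \<infinity>\<close>.\<close>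

definition ennreal_powr :: "ennreal \<Rightarrow> real \<Rightarrow> ennreal" where
  "ennreal_powr x a = (if x = \<infinity> then \<infinity> else ennreal (enn2real x powr a))"

definition Lq_norm :: "real \<Rightarrow> (complex ^ 'n \<Rightarrow> complex) \<Rightarrow> ennreal" where
  "Lq_norm q f = ennreal_powr (\<integral>\<^sup>+z. ennreal (cmod (f z) powr q) \<partial>lebesgue) (1 / q)"

definition mixed_norm ::
    "ereal \<Rightarrow> real \<Rightarrow> (real \<Rightarrow> complex ^ 'n \<Rightarrow> complex) \<Rightarrow> ennreal" where
  "mixed_norm p q F =
     (if p = \<infinity> then esssup (lebesgue_on {-pi..pi}) (\<lambda>t. Lq_norm q (F t))
      else ennreal_powr
        (\<integral>\<^sup>+t. ennreal_powr (Lq_norm q (F t)) (real_of_ereal p) \<partial>lebesgue_on {-pi..pi})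
        (1 / real_of_ereal p))"

end

theory Submission
  imports Defs "HOL-Complex_Analysis.Conformal_Mappings" "HOL-Real_Asymp.Real_Asymp"
begin

text \<open>
  The case \<open>q = 1\<close> is the unitarity bound in \<open>L\<^sup>1\<close>, and Hoelder's inequality in the space variable
  interpolates between it and the endpoint \<open>p = q = 1 + 1/n\<close>. The endpoint is dual to
  \[\textstyle\sum_j b_j \int V |e^{-it\mathcal{L}} u_j|^2 \le C \|b\|_{\ell^\alpha} \|V\|_{L^{n+1}}, \qquad \alpha = (2n+2)/(2n+1).\]
  An orthonormal change of the system \<open>u\<^sub>j\<close> maximising the left-hand side for distinct \<open>b\<^sub>j\<close> makes the
  functions \<open>V\<^sup>1\<^sup>/\<^sup>2 e\<^sup>-\<^sup>i\<^sup>t\<^sup>\<L> u\<^sub>j\<close> pairwise orthogonal, so that the left-hand side becomes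
  a weighted sum of values of a quadratic form at an orthonormal system \<open>g\<^sub>l\<close> of space-time
  functions. Since \<open>exp (-it(2|\<nu>| + n))\<close> only involves characters of the circle, the form extends to an
  analytic family with symbol \<open>(\<zeta> choose k)\<close> in the frequency variable \<open>k\<close>: on \<open>Re \<zeta> = -1\<close> it
  is bounded by Bessel's inequality, on \<open>Re \<zeta> = n\<close> the factor \<open>(1 - s \<eta> \<eta>')\<^sup>\<zeta>\<close> cancels the singularity
  of the dispersive kernel bound \<open>|K| \<le> (2 \<pi> |1 - s \<eta> \<eta>'|)\<^sup>-\<^sup>n\<close>, and the three lines
  theorem gives \<open>\<zeta> = 0\<close>. The damping \<open>s\<^sup>|\<^sup>\<mu>\<^sup>|\<close> makes all series
  absolutely convergent and is removed by Fatou's lemma.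
\<close>

subsection \<open>Square-integrable functions and the three lines theorem\<close>

text \<open>The rotation stands in for trace-ideal duality. If g_l is the l-th rotated function
  after normalisation, its original squared norm is at most the value of the quadratic form at g_l,
  so everything reduces to finite sums of scalar functions of \<zeta>. The exponents come from the
  two edges. On Re \<zeta> = -1 each value of the form is bounded by itself, which pairs with the
  sum of \<open>b\<^sup>\<alpha>\<close>; on Re \<zeta> = n the tensors g_l(x) cnj(g_l(y)) are
  orthonormal on the product space, so the norm of the kernel there bounds the values in l^2, which
  pairs with \<open>b\<^sup>\<alpha>\<^sup>/\<^sup>2\<close>. The point 0 cuts the strip at the
  fraction 1/(n+1), hence 1/\<alpha> = 1 - 1/(2(n+1)). The weight V^((\<zeta>+1)/2) has modulus at
  most 1 on the left edge and V^((n+1)/2) on the right one, which explains the norm of V in L^(n+1).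
  A further obstacle: the propagator is chosen separately for each time, so joint measurability on
  space-time has to be recovered from the damped solutions.\<close>

definition square_integrable :: "'a measure \<Rightarrow> ('a \<Rightarrow> complex) \<Rightarrow> bool" where
  "square_integrable M f \<longleftrightarrow> f \<in> borel_measurable M \<and> integrable M (\<lambda>x. (cmod (f x))\<^sup>2)"

definition inner_L2 :: "'a measure \<Rightarrow> ('a \<Rightarrow> complex) \<Rightarrow> ('a \<Rightarrow> complex) \<Rightarrow> complex" where
  "inner_L2 M f g = (LINT x|M. f x * cnj (g x))"

definition sqnorm_L2 :: "'a measure \<Rightarrow> ('a \<Rightarrow> complex) \<Rightarrow> real" where
  "sqnorm_L2 M f = (LINT x|M. (cmod (f x))\<^sup>2)"

lemma square_integrable_measurable [measurable_dest]:
  "square_integrable M f \<Longrightarrow> f \<in> borel_measurable M"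
  by (simp add: square_integrable_def)

lemma borel_measurable_cnj [measurable (raw)]:
  "f \<in> borel_measurable M \<Longrightarrow> (\<lambda>x. cnj (f x)) \<in> borel_measurable M"
  by (rule borel_measurable_continuous_on[OF continuous_on_cnj[OF continuous_on_id], unfolded id_def])

lemma square_integrable_bound:
  assumes "f \<in> borel_measurable M" "square_integrable M g" "\<And>x. x \<in> space M \<Longrightarrow> cmod (f x) \<le> C * cmod (g x)"
  shows "square_integrable M f"
proof -
  have "integrable M (\<lambda>x. C\<^sup>2 * (cmod (g x))\<^sup>2)"
    using assms(2) by (simp add: square_integrable_def)
  then have "integrable M (\<lambda>x. (cmod (f x))\<^sup>2)"
    by (rule Bochner_Integration.integrable_bound)
      (use assms in \<open>auto simp: power_mult_distrib[symmetric] intro!: AE_I2 power_mono\<close>)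
  then show ?thesis using assms(1) by (simp add: square_integrable_def)
qed

lemma norm_mult_le_squares: "cmod (a * b) \<le> ((cmod a)\<^sup>2 + (cmod b)\<^sup>2) / 2"
  using sum_squares_bound[of "cmod a" "cmod b"] by (simp add: norm_mult)

lemma integrable_inner_L2:
  assumes "square_integrable M f" "square_integrable M g"
  shows "integrable M (\<lambda>x. f x * cnj (g x))"
proof (rule Bochner_Integration.integrable_bound)
  show "integrable M (\<lambda>x. ((cmod (f x))\<^sup>2 + (cmod (g x))\<^sup>2) / 2)"
    using assms by (simp add: square_integrable_def)
  show "AE x in M. norm (f x * cnj (g x)) \<le> norm (((cmod (f x))\<^sup>2 + (cmod (g x))\<^sup>2) / 2)"
    using norm_mult_le_squares[of "f _" "cnj (g _)"] by (intro AE_I2) simp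
  note assms[THEN square_integrable_measurable, measurable]
  show "(\<lambda>x. f x * cnj (g x)) \<in> borel_measurable M" by measurable
qed

lemma cmod_add_squared_le: "(cmod (a + b))\<^sup>2 \<le> 2 * ((cmod a)\<^sup>2 + (cmod b)\<^sup>2)"
proof -
  have "(cmod (a + b))\<^sup>2 \<le> (cmod a + cmod b)\<^sup>2" by (intro power_mono norm_triangle_ineq) auto
  also have "\<dots> \<le> 2 * ((cmod a)\<^sup>2 + (cmod b)\<^sup>2)"
    using sum_squares_bound[of "cmod a" "cmod b"] by (simp add: power2_sum)
  finally show ?thesis .
qed

lemma square_integrable_add:
  assumes "square_integrable M f" "square_integrable M g"
  shows "square_integrable M (\<lambda>x. f x + g x)"
proof -
  note assms[THEN square_integrable_measurable, measurable]
  have "integrable M (\<lambda>x. 2 * ((cmod (f x))\<^sup>2 + (cmod (g x))\<^sup>2))"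
    using assms by (simp add: square_integrable_def)
  then have "integrable M (\<lambda>x. (cmod (f x + g x))\<^sup>2)"
    by (rule Bochner_Integration.integrable_bound)
      (measurable, intro AE_I2, use cmod_add_squared_le in simp)
  then show ?thesis by (simp add: square_integrable_def)
qed

lemma square_integrable_cmult:
  "square_integrable M f \<Longrightarrow> square_integrable M (\<lambda>x. c * f x)"
  by (auto simp: square_integrable_def norm_mult power_mult_distrib)

lemma square_integrable_zero: "square_integrable M (\<lambda>x. 0)"
  by (simp add: square_integrable_def)

lemma square_integrable_cnj:
  "square_integrable M f \<Longrightarrow> square_integrable M (\<lambda>x. cnj (f x))"
  by (auto simp: square_integrable_def)

lemma square_integrable_sum:
  assumes "\<And>i. i \<in> S \<Longrightarrow> square_integrable M (f i)"
  shows "square_integrable M (\<lambda>x. \<Sum>i\<in>S. f i x)"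
  using assms by (induction S rule: infinite_finite_induct)
    (auto intro: square_integrable_zero square_integrable_add)

lemma sqnorm_L2_nonneg [simp]: "0 \<le> sqnorm_L2 M f"
  by (simp add: sqnorm_L2_def)

lemma inner_L2_self: "inner_L2 M f f = of_real (sqnorm_L2 M f)"
  by (simp add: inner_L2_def sqnorm_L2_def complex_norm_square[symmetric] flip: integral_complex_of_real)

lemma inner_L2_commute: "inner_L2 M g f = cnj (inner_L2 M f g)"
  unfolding inner_L2_def using Bochner_Integration.integral_cnj[of M "\<lambda>x. f x * cnj (g x)"] by (simp add: mult.commute)

lemma inner_L2_sum_left:
  assumes "\<And>i. i \<in> S \<Longrightarrow> square_integrable M (f i)" "square_integrable M g"
  shows "inner_L2 M (\<lambda>x. \<Sum>i\<in>S. c i * f i x) g = (\<Sum>i\<in>S. c i * inner_L2 M (f i) g)"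
proof -
  have "inner_L2 M (\<lambda>x. \<Sum>i\<in>S. c i * f i x) g = (LINT x|M. (\<Sum>i\<in>S. c i * (f i x * cnj (g x))))"
    by (simp add: inner_L2_def sum_distrib_right mult.assoc)
  also have "\<dots> = (\<Sum>i\<in>S. LINT x|M. c i * (f i x * cnj (g x)))"
    using assms by (intro Bochner_Integration.integral_sum integrable_mult_right integrable_inner_L2)
  finally show ?thesis by (simp add: inner_L2_def)
qed

lemma inner_L2_sum_right:
  assumes "\<And>i. i \<in> S \<Longrightarrow> square_integrable M (f i)" "square_integrable M g"
  shows "inner_L2 M g (\<lambda>x. \<Sum>i\<in>S. c i * f i x) = (\<Sum>i\<in>S. cnj (c i) * inner_L2 M g (f i))"
  by (subst inner_L2_commute, subst inner_L2_sum_left[OF assms])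
    (auto simp: inner_L2_commute[of M _ g])

lemma inner_L2_cmult_left: "inner_L2 M (\<lambda>x. c * f x) g = c * inner_L2 M f g"
  by (simp add: inner_L2_def mult.assoc)

lemma sqnorm_L2_cmult: "sqnorm_L2 M (\<lambda>x. c * f x) = (cmod c)\<^sup>2 * sqnorm_L2 M f"
  by (simp add: sqnorm_L2_def norm_mult power_mult_distrib)

lemma sqnorm_L2_diff:
  assumes "square_integrable M f" "square_integrable M g"
  shows "sqnorm_L2 M (\<lambda>x. f x - g x) = sqnorm_L2 M f - 2 * Re (inner_L2 M f g) + sqnorm_L2 M g"
proof -
  have *: "(cmod (a - b))\<^sup>2 = (cmod a)\<^sup>2 - 2 * Re (a * cnj b) + (cmod b)\<^sup>2" for a b
    unfolding cmod_power2 by (simp add: power2_eq_square algebra_simps)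
  have i: "integrable M (\<lambda>x. f x * cnj (g x))" by (rule integrable_inner_L2[OF assms])
  have "sqnorm_L2 M (\<lambda>x. f x - g x)
      = (LINT x|M. (cmod (f x))\<^sup>2 - 2 * Re (f x * cnj (g x)) + (cmod (g x))\<^sup>2)"
    by (simp only: sqnorm_L2_def *)
  also have "\<dots> = (LINT x|M. (cmod (f x))\<^sup>2) - (LINT x|M. 2 * Re (f x * cnj (g x))) + (LINT x|M. (cmod (g x))\<^sup>2)"
    using assms i by (subst Bochner_Integration.integral_add Bochner_Integration.integral_diff;
      auto simp: square_integrable_def simp del: complex_cnj times_complex.sel)+
  also have "(LINT x|M. 2 * Re (f x * cnj (g x))) = 2 * Re (inner_L2 M f g)"
    unfolding inner_L2_def integral_Re[OF i, symmetric] by (rule integral_mult_right_zero)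
  finally show ?thesis by (simp add: sqnorm_L2_def)
qed

text \<open>The common squared norm c stays a parameter because the waves on space-time have squared
  norm 2 pi, while other families below are normalised.\<close>

lemma sqnorm_L2_orthogonal_sum:
  assumes "finite S" "\<And>i. i \<in> S \<Longrightarrow> square_integrable M (e i)"
    and "\<And>i j. i \<in> S \<Longrightarrow> j \<in> S \<Longrightarrow> inner_L2 M (e i) (e j) = (if i = j then complex_of_real c else 0)"
  shows "sqnorm_L2 M (\<lambda>x. \<Sum>i\<in>S. a i * e i x) = c * (\<Sum>i\<in>S. (cmod (a i))\<^sup>2)"
proof -
  have "complex_of_real (sqnorm_L2 M (\<lambda>x. \<Sum>i\<in>S. a i * e i x))
      = (\<Sum>i\<in>S. a i * (\<Sum>j\<in>S. cnj (a j) * inner_L2 M (e i) (e j)))"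
    using assms by (simp add: inner_L2_self[symmetric] inner_L2_sum_left inner_L2_sum_right
        square_integrable_sum square_integrable_cmult)
  also have "\<dots> = (\<Sum>i\<in>S. a i * (\<Sum>j\<in>S. if j = i then cnj (a i) * c else 0))"
    using assms(3) by (intro sum.cong refl arg_cong2[of _ _ _ _ "(*)"]) auto
  also have "\<dots> = of_real (c * (\<Sum>i\<in>S. (cmod (a i))\<^sup>2))"
    using assms(1) by (simp add: complex_norm_square sum_distrib_left algebra_simps del: of_real_power)
  finally show ?thesis using of_real_eq_iff by blast
qed

theorem Bessel_finite:
  assumes "finite S" "\<And>i. i \<in> S \<Longrightarrow> square_integrable M (e i)" "c > 0"
    and "\<And>i j. i \<in> S \<Longrightarrow> j \<in> S \<Longrightarrow> inner_L2 M (e i) (e j) = (if i = j then complex_of_real c else 0)"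
    and "square_integrable M f"
  shows "(\<Sum>i\<in>S. (cmod (inner_L2 M f (e i)))\<^sup>2) \<le> c * sqnorm_L2 M f"
proof -
  \<comment> \<open>The coefficients of the orthogonal projection onto the span; the division by c
    compensates for vectors that are not normalised.\<close>
  define a where "a i = inner_L2 M f (e i) / c" for i
  define A where "A = (\<Sum>i\<in>S. (cmod (inner_L2 M f (e i)))\<^sup>2)"
  let ?g = "\<lambda>x. \<Sum>i\<in>S. a i * e i x"
  have g: "square_integrable M ?g"
    by (intro square_integrable_sum square_integrable_cmult assms)
  have "inner_L2 M f ?g = (\<Sum>i\<in>S. cnj (a i) * inner_L2 M f (e i))"
    by (rule inner_L2_sum_right) (use assms in auto)
  also have "\<dots> = of_real (A / c)"
    by (simp add: A_def a_def sum_divide_distrib complex_norm_square mult.commute del: of_real_power)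
  finally have 1: "inner_L2 M f ?g = of_real (A / c)" .
  have 2: "sqnorm_L2 M ?g = A / c"
    using \<open>c > 0\<close> by (subst sqnorm_L2_orthogonal_sum[OF assms(1,2,4)])
      (auto simp: A_def a_def sum_divide_distrib sum_distrib_left norm_divide power2_eq_square)
  have "0 \<le> sqnorm_L2 M (\<lambda>x. f x - ?g x)" by simp
  also have "\<dots> = sqnorm_L2 M f - A / c"
    by (subst sqnorm_L2_diff[OF assms(5) g]) (simp add: 1 2)
  finally show ?thesis using \<open>c > 0\<close> by (simp add: A_def field_simps)
qed

lemma Bessel:
  assumes "\<And>i. square_integrable M (e i)" "c > 0"
    and "\<And>i j. inner_L2 M (e i) (e j) = (if i = j then complex_of_real c else 0)"
    and "square_integrable M f"
  shows "(\<lambda>i. (cmod (inner_L2 M f (e i)))\<^sup>2) summable_on UNIV"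
    and "(\<Sum>\<^sub>\<infinity>i. (cmod (inner_L2 M f (e i)))\<^sup>2) \<le> c * sqnorm_L2 M f"
proof -
  have b: "(\<Sum>i\<in>S. (cmod (inner_L2 M f (e i)))\<^sup>2) \<le> c * sqnorm_L2 M f" if "finite S" for S
    by (rule Bessel_finite) (use assms that in auto)
  then show "(\<lambda>i. (cmod (inner_L2 M f (e i)))\<^sup>2) summable_on UNIV"
    by (intro nonneg_bounded_partial_sums_imp_summable_on) (auto simp: eventually_finite_subsets_at_top intro!: exI[of _ "{}"])
  then show "(\<Sum>\<^sub>\<infinity>i. (cmod (inner_L2 M f (e i)))\<^sup>2) \<le> c * sqnorm_L2 M f"
    by (rule infsum_le_finite_sums) (use b in auto)
qed

section \<open>Unordered sums as limits along an enumeration, and their integrals\<close>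

lemma filterlim_to_nat_finite_subsets:
  "filterlim (\<lambda>m. {k::'a::countable. to_nat k < m}) (finite_subsets_at_top UNIV) sequentially"
  unfolding filterlim_finite_subsets_at_top
proof (intro allI impI)
  fix X :: "'a set" assume X: "finite X \<and> X \<subseteq> UNIV"
  have fin: "finite {k::'a. to_nat k < m}" for m
    by (rule finite_imageD[of to_nat]) (auto intro: finite_subset[of _ "{..<m}"] inj_on_subset[OF inj_to_nat])
  obtain m0 where "\<forall>k\<in>X. to_nat k < m0"
    using X by (metis finite_imageI finite_nat_set_iff_bounded imageI)
  then show "\<forall>\<^sub>F m in sequentially. finite {k::'a. to_nat k < m} \<and> X \<subseteq> {k. to_nat k < m} \<and> {k. to_nat k < m} \<subseteq> UNIV"
    using fin by (intro eventually_sequentiallyI[of m0]) auto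
qed

lemma has_sum_imp_tendsto_to_nat:
  fixes f :: "'a::countable \<Rightarrow> 'b::{comm_monoid_add,topological_space}"
  assumes "(f has_sum S) UNIV"
  shows "(\<lambda>m. \<Sum>k | to_nat k < m. f k) \<longlonglongrightarrow> S"
  using assms filterlim_to_nat_finite_subsets unfolding has_sum_def by (rule filterlim_compose)

lemma finite_to_nat_less: "finite {k::'a::countable. to_nat k < m}"
  by (rule finite_imageD[of to_nat]) (auto intro: finite_subset[of _ "{..<m}"] inj_on_subset[OF inj_to_nat])

lemma borel_measurable_infsum_complex:
  fixes f :: "'k::countable \<Rightarrow> 'a \<Rightarrow> complex"
  assumes "\<And>k. f k \<in> borel_measurable M" "\<And>x. x \<in> space M \<Longrightarrow> (\<lambda>k. f k x) summable_on UNIV"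
  shows "(\<lambda>x. \<Sum>\<^sub>\<infinity>k. f k x) \<in> borel_measurable M"
proof (rule borel_measurable_LIMSEQ_metric)
  show "(\<lambda>x. \<Sum>k | to_nat k < m. f k x) \<in> borel_measurable M" for m
    using assms(1) by (intro borel_measurable_sum)
  show "(\<lambda>m. \<Sum>k | to_nat k < m. f k x) \<longlonglongrightarrow> (\<Sum>\<^sub>\<infinity>k. f k x)" if "x \<in> space M" for x
    using assms(2)[OF that] by (intro has_sum_imp_tendsto_to_nat has_sum_infsum)
qed

text \<open>Dominated convergence along the enumeration gives the value for one order of summation.
  The unconditional summability of the integrals comes from bounding all finite sums of their norms
  by the integral of w.\<close>

lemma has_sum_integral:
  fixes f :: "'k::countable \<Rightarrow> 'a \<Rightarrow> complex"
  assumes f: "\<And>k. f k \<in> borel_measurable M"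
    and s: "\<And>x. x \<in> space M \<Longrightarrow> (\<lambda>k. cmod (f k x)) summable_on UNIV"
    and w: "\<And>x. x \<in> space M \<Longrightarrow> (\<Sum>\<^sub>\<infinity>k. cmod (f k x)) \<le> w x" "integrable M w"
  shows "((\<lambda>k. LINT x|M. f k x) has_sum (LINT x|M. (\<Sum>\<^sub>\<infinity>k. f k x))) UNIV"
proof -
  have s': "(\<lambda>k. f k x) summable_on UNIV" if "x \<in> space M" for x
    by (rule abs_summable_summable[OF s[OF that]])
  have wb: "(\<Sum>k\<in>S. cmod (f k x)) \<le> w x" if "finite S" "x \<in> space M" for S x
    using finite_sum_le_infsum[OF s[OF that(2)] that(1)] w(1)[OF that(2)] by auto
  have i: "integrable M (f k)" for k
    by (rule Bochner_Integration.integrable_bound[OF w(2) f])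
      (use wb[of "{k}"] in \<open>auto intro!: AE_I2 intro: order_trans[OF _ abs_ge_self]\<close>)
  have "(\<Sum>k\<in>S. norm (LINT x|M. f k x)) \<le> (LINT x|M. w x)" if "finite S" for S
  proof -
    have "(\<Sum>k\<in>S. norm (LINT x|M. f k x)) \<le> (\<Sum>k\<in>S. (LINT x|M. norm (f k x)))"
      by (intro sum_mono integral_norm_bound)
    also have "\<dots> = (LINT x|M. (\<Sum>k\<in>S. norm (f k x)))"
      using i by (subst Bochner_Integration.integral_sum) auto
    also have "\<dots> \<le> (LINT x|M. w x)"
      using i w(2) wb[OF that] by (intro integral_mono) auto
    finally show ?thesis .
  qed
  then have "(\<lambda>k. norm (LINT x|M. f k x)) summable_on UNIV"
    by (intro nonneg_bounded_partial_sums_imp_summable_on[of _ _ "LINT x|M. w x"])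
      (auto simp: eventually_finite_subsets_at_top intro!: exI[of _ "{}"])
  then have sm: "(\<lambda>k. LINT x|M. f k x) summable_on UNIV" by (rule abs_summable_summable)
  have "(\<lambda>m. \<Sum>k | to_nat k < m. LINT x|M. f k x) \<longlonglongrightarrow> (LINT x|M. (\<Sum>\<^sub>\<infinity>k. f k x))"
  proof -
    have "(\<lambda>m. LINT x|M. (\<Sum>k | to_nat k < m. f k x)) \<longlonglongrightarrow> (LINT x|M. (\<Sum>\<^sub>\<infinity>k. f k x))"
    proof (rule integral_dominated_convergence[where w=w])
      show "integrable M w" by (rule w(2))
      show "(\<lambda>x. \<Sum>\<^sub>\<infinity>k. f k x) \<in> borel_measurable M"
        by (intro borel_measurable_infsum_complex f s')
      show "AE x in M. (\<lambda>m. \<Sum>k | to_nat k < m. f k x) \<longlonglongrightarrow> (\<Sum>\<^sub>\<infinity>k. f k x)"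
        by (intro AE_I2 has_sum_imp_tendsto_to_nat has_sum_infsum s')
      show "AE x in M. norm (\<Sum>k | to_nat k < m. f k x) \<le> w x" for m
        by (intro AE_I2 order_trans[OF norm_sum wb] finite_to_nat_less)
      show "(\<lambda>x. \<Sum>k | to_nat k < m. f k x) \<in> borel_measurable M" for m
        using f by (intro borel_measurable_sum)
    qed
    also have "(\<lambda>m. LINT x|M. (\<Sum>k | to_nat k < m. f k x)) = (\<lambda>m. \<Sum>k | to_nat k < m. LINT x|M. f k x)"
      by (rule ext) (rule Bochner_Integration.integral_sum, rule i)
    finally show ?thesis .
  qed
  then have "(\<Sum>\<^sub>\<infinity>k. LINT x|M. f k x) = (LINT x|M. (\<Sum>\<^sub>\<infinity>k. f k x))"
    using has_sum_imp_tendsto_to_nat[OF has_sum_infsum[OF sm]] LIMSEQ_unique by blast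
  then show ?thesis using has_sum_infsum[OF sm] by simp
qed

text \<open>The Gaussian factor \<open>exp (2 \<zeta>\<^sup>2)\<close> absorbs both the growth inside the strip and
  the growth of the boundary values.\<close>

lemma three_lines:
  fixes F :: "complex \<Rightarrow> complex"
  assumes hol: "F holomorphic_on UNIV" and ab: "a < 0" "0 < b" and M: "0 < M"
    and left: "\<And>y. cmod (F (Complex a y)) \<le> M * exp (y\<^sup>2)"
    and right: "\<And>y. cmod (F (Complex b y)) \<le> M * exp (y\<^sup>2)"
    and growth: "\<And>z. a \<le> Re z \<Longrightarrow> Re z \<le> b \<Longrightarrow> cmod (F z) \<le> A * exp (B * cmod z)"
    and AB: "0 \<le> A" "0 \<le> B"
  shows "cmod (F 0) \<le> M * exp (2 * (a\<^sup>2 + b\<^sup>2))"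
proof -
  define m where "m = a\<^sup>2 + b\<^sup>2"
  define K where "K = B * (b - a) + 2 * m"
  \<comment> \<open>Half the height of the rectangle. The bound \<open>B + 1\<close> lets
    \<open>2 * Y\<^sup>2\<close> absorb \<open>B * Y\<close> with one Y left over, and the third
    bound makes this Y outweigh the constants; \<open>A + 1\<close> keeps the logarithm meaningful
    when A = 0.\<close>
  define Y where "Y = max 1 (max (B + 1) (K + ln ((A + 1) / M)))"
  have Y: "Y \<ge> 1" "Y \<ge> B + 1" "Y \<ge> K + ln ((A + 1) / M)" unfolding Y_def by linarith+
  have "(B + 1) * Y \<le> Y * Y" using Y by (intro mult_right_mono) auto
  moreover have "0 \<le> Y * Y" by simp
  ultimately have "(B + 1) * Y \<le> 2 * Y\<^sup>2" unfolding power2_eq_square by linarith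
  then have "B * (b - a + Y) + (2 * m - 2 * Y\<^sup>2) \<le> K - Y" by (simp add: K_def algebra_simps)
  also have "\<dots> \<le> ln (M / (A + 1))" using Y(3) M AB by (simp add: ln_div)
  finally have "exp (B * (b - a + Y) + (2 * m - 2 * Y\<^sup>2)) \<le> exp (ln (M / (A + 1)))" by simp
  then have "A * exp (B * (b - a + Y) + (2 * m - 2 * Y\<^sup>2)) \<le> A * (M / (A + 1))"
    using M AB by (intro mult_left_mono) auto
  also have "\<dots> \<le> M" using M AB by (simp add: field_simps)
  finally have bigY: "A * exp (B * (b - a + Y)) * exp (2 * m - 2 * Y\<^sup>2) \<le> M" by (simp add: exp_add mult.assoc)
  \<comment> \<open>The added factor is 1 at the origin, so a bound for G there is a bound for
    F.\<close>
  define G where "G z = F z * exp (2 * z\<^sup>2)" for z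
  have nG: "cmod (G z) = cmod (F z) * exp (2 * ((Re z)\<^sup>2 - (Im z)\<^sup>2))" for z
    by (simp add: G_def norm_mult Re_power2)
  have sq: "(Re z)\<^sup>2 \<le> m" if "a \<le> Re z" "Re z \<le> b" for z
  proof (cases "Re z \<ge> 0")
    case True then have "(Re z)\<^sup>2 \<le> b\<^sup>2" using that by (intro power_mono) auto
    then show ?thesis using zero_le_power2[of a] unfolding m_def by linarith
  next
    case False then have "(- Re z)\<^sup>2 \<le> (- a)\<^sup>2" using that by (intro power_mono) auto
    then show ?thesis using zero_le_power2[of b] unfolding m_def power2_minus by linarith
  qed
  let ?R = "cbox (Complex a (-Y)) (Complex b Y)"
  have holG: "G holomorphic_on X" for X
    unfolding G_def by (intro holomorphic_intros holomorphic_on_subset[OF hol]) auto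
  have "cmod (G 0) \<le> M * exp (2 * m)"
  proof (rule maximum_modulus_frontier[of G ?R])
    show "G holomorphic_on interior ?R" by (rule holG)
    show "continuous_on (closure ?R) G" by (rule holomorphic_on_imp_continuous_on[OF holG])
    show "bounded ?R" by simp
    show "0 \<in> ?R" using ab Y by (simp add: in_cbox_complex_iff)
    fix z assume "z \<in> frontier ?R"
    then have z: "z \<in> ?R" "z \<notin> box (Complex a (-Y)) (Complex b Y)"
      by (auto simp: frontier_def)
    then have re: "a \<le> Re z" "Re z \<le> b" "- Y \<le> Im z" "Im z \<le> Y" by (auto simp: in_cbox_complex_iff)
    have "Re z = a \<or> Re z = b \<or> \<bar>Im z\<bar> = Y"
      using z(2) re by (auto simp: in_box_complex_iff)
    then consider (1) "Re z = a \<or> Re z = b" | (2) "\<bar>Im z\<bar> = Y" by blast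
    then show "cmod (G z) \<le> M * exp (2 * m)"
    proof cases
      case 1
      then have "z = Complex a (Im z) \<or> z = Complex b (Im z)" by (auto simp: complex_eq_iff)
      then have "cmod (F z) \<le> M * exp ((Im z)\<^sup>2)" using left right by metis
      then have "cmod (G z) \<le> M * exp ((Im z)\<^sup>2) * exp (2 * ((Re z)\<^sup>2 - (Im z)\<^sup>2))"
        by (simp add: nG)
      also have "\<dots> = M * exp ((Im z)\<^sup>2 + 2 * ((Re z)\<^sup>2 - (Im z)\<^sup>2))" by (simp only: exp_add mult.assoc)
      also have "\<dots> \<le> M * exp (2 * m)"
      proof (intro mult_left_mono)
        show "exp ((Im z)\<^sup>2 + 2 * ((Re z)\<^sup>2 - (Im z)\<^sup>2)) \<le> exp (2 * m)"
          unfolding exp_le_cancel_iff using sq[OF re(1,2)] zero_le_power2[of "Im z"] by argo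
      qed (use M in simp)
      finally show ?thesis .
    next
      case 2
      have "cmod z \<le> \<bar>Re z\<bar> + \<bar>Im z\<bar>" by (rule cmod_le)
      also have "\<dots> \<le> b - a + Y" using re(1,2) 2 ab by linarith
      finally have cz: "cmod z \<le> b - a + Y" .
      have "cmod (F z) \<le> A * exp (B * cmod z)" using growth re by auto
      also have "\<dots> \<le> A * exp (B * (b - a + Y))" using mult_left_mono[OF cz AB(2)] AB(1) by (intro mult_left_mono, unfold exp_le_cancel_iff)
      finally have "cmod (G z) \<le> A * exp (B * (b - a + Y)) * exp (2 * ((Re z)\<^sup>2 - (Im z)\<^sup>2))"
        by (simp add: nG)
      also have "\<dots> \<le> A * exp (B * (b - a + Y)) * exp (2 * m - 2 * Y\<^sup>2)"
      proof (intro mult_left_mono)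
        show "exp (2 * ((Re z)\<^sup>2 - (Im z)\<^sup>2)) \<le> exp (2 * m - 2 * Y\<^sup>2)"
          unfolding exp_le_cancel_iff using sq[OF re(1,2)] power2_abs[of "Im z"] unfolding 2 by argo
      qed (use AB in simp)
      also have "\<dots> \<le> M" by (rule bigY)
      also have "\<dots> \<le> M * exp (2 * m)" using M by (simp add: m_def)
      finally show ?thesis .
    qed
  qed
  then show ?thesis by (simp add: G_def m_def)
qed

subsection \<open>Binomial series and double series\<close>

text \<open>Each factor \<zeta> - i is replaced by |\<zeta>| + i. Up to sign the majorant is
  \<open>- cmod \<zeta> gchoose k\<close>, so a binomial series is dominated by another binomial
  series, whose sum is explicit.\<close>

lemma norm_gbinomial_le:
  fixes \<zeta> :: complex
  shows "cmod (\<zeta> gchoose k) \<le> pochhammer (cmod \<zeta>) k / fact k"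
proof -
  have "cmod (\<Prod>i = 0..<k. \<zeta> - of_nat i) \<le> (\<Prod>i = 0..<k. cmod \<zeta> + real i)"
    unfolding prod_norm[symmetric]
    by (intro prod_mono conjI norm_ge_zero order_trans[OF norm_triangle_ineq4]) simp
  then show ?thesis
    by (simp add: gbinomial_prod_rev pochhammer_prod norm_divide divide_right_mono)
qed

lemma pochhammer_series_sums:
  fixes s R :: real
  assumes "0 < s" "s < 1"
  shows "(\<lambda>k. pochhammer R k / fact k * s ^ k) sums ((1 - s) powr (- R))"
proof -
  have "(\<lambda>k. (- R gchoose k) * (- s) ^ k) sums (1 + - s) powr (- R)"
    by (rule gen_binomial_real) (use assms in auto)
  moreover have "(- R gchoose k) * (- s) ^ k = pochhammer R k / fact k * s ^ k" for k
  proof -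
    have "(- 1 :: real) ^ k * (- 1) ^ k = 1" by (simp add: power_mult_distrib[symmetric])
    then show ?thesis unfolding gbinomial_pochhammer power_minus[of s] by (simp add: algebra_simps)
  qed
  ultimately show ?thesis by simp
qed

text \<open>With the upper argument -1 + iy the squared modulus is the product of the factors 1 +
  y^2/j^2 over 1 \<le> j \<le> k, which stays bounded because the sum of 1/j^2 converges. This
  uniformity in k is why the left edge of the strip lies at -1.\<close>

lemma norm_gbinomial_minus_one_le:
  "cmod (Complex (- 1) y gchoose k) \<le> exp (y\<^sup>2)"
proof -
  define C where "C k = cmod (Complex (- 1) y gchoose k)" for k
  have step: "(C (Suc k))\<^sup>2 = (C k)\<^sup>2 * (1 + y\<^sup>2 / (real k + 1)\<^sup>2)" for k
  proof -
    have "Complex (- 1) y gchoose Suc k = (Complex (- 1) y gchoose k) * ((Complex (- 1) y - of_nat k) / (of_nat k + 1))"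
      by (simp add: gbinomial_prod_rev field_simps)
    then have "(C (Suc k))\<^sup>2 = (C k)\<^sup>2 * ((cmod (Complex (- 1) y - of_nat k))\<^sup>2 / (cmod (of_nat k + 1))\<^sup>2)"
      by (simp add: C_def norm_mult norm_divide power_mult_distrib power_divide)
    also have "(cmod (Complex (- 1) y - of_nat k))\<^sup>2 = (real k + 1)\<^sup>2 + y\<^sup>2"
      unfolding cmod_power2 by (simp add: power2_eq_square algebra_simps)
    also have "cmod (of_nat k + 1) = real k + 1"
      by (metis add.commute norm_of_nat of_nat_Suc)
    finally show ?thesis by (simp add: add_divide_distrib)
  qed
  \<comment> \<open>The exponent 2 - 1/(k+1) is the telescoping majorant of the sum of 1/j^2 over j
    \<le> k+1. The induction closes with it, but not with the constant 2.\<close>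
  have "(C (Suc k))\<^sup>2 \<le> exp (y\<^sup>2 * (2 - 1 / (real k + 1)))" for k
  proof (induction k)
    case 0
    show ?case using step[of 0] by (simp add: C_def)
  next
    case (Suc k)
    have "(C (Suc (Suc k)))\<^sup>2 = (C (Suc k))\<^sup>2 * (1 + y\<^sup>2 / (real k + 2)\<^sup>2)"
      using step[of "Suc k"] by (simp add: add.commute)
    also have "\<dots> \<le> exp (y\<^sup>2 * (2 - 1 / (real k + 1))) * exp (y\<^sup>2 / (real k + 2)\<^sup>2)"
      by (intro mult_mono Suc) auto
    also have "\<dots> = exp (y\<^sup>2 * (2 - 1 / (real k + 1) + 1 / (real k + 2)\<^sup>2))"
      by (simp add: exp_add[symmetric] algebra_simps)
    also have "\<dots> \<le> exp (y\<^sup>2 * (2 - 1 / (real (Suc k) + 1)))"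
    proof -
      have "1 / (real k + 2)\<^sup>2 \<le> 1 / ((real k + 1) * (real k + 2))"
        by (intro divide_left_mono) (auto simp: power2_eq_square)
      also have "\<dots> = 1 / (real k + 1) - 1 / (real k + 2)"
        by (simp add: field_simps)
      finally have "2 - 1 / (real k + 1) + 1 / (real k + 2)\<^sup>2 \<le> 2 - 1 / (real (Suc k) + 1)" by (simp add: add.commute)
      then show ?thesis unfolding exp_le_cancel_iff by (rule mult_left_mono) simp
    qed
    finally show ?case .
  qed
  note * = this
  have "(C k)\<^sup>2 \<le> exp (y\<^sup>2 * 2)"
  proof (cases k)
    case 0 then show ?thesis by (simp add: C_def)
  next
    case (Suc j)
    have "y\<^sup>2 * (2 - 1 / (real j + 1)) \<le> y\<^sup>2 * 2" by (intro mult_left_mono) auto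
    then show ?thesis using *[of j] Suc by (meson exp_le_cancel_iff order_trans)
  qed
  also have "exp (y\<^sup>2 * 2) = (exp (y\<^sup>2))\<^sup>2" by (simp add: power2_eq_square exp_add[symmetric])
  finally show ?thesis unfolding C_def[symmetric] by (rule power2_le_imp_le) simp
qed

text \<open>The arithmetic-geometric mean form of the Cauchy-Schwarz inequality. It loses nothing
  where both sums have the same bound; elsewhere only summability or a crude bound is wanted, or one
  factor is rescaled first.\<close>

lemma square_summable_product:
  fixes a b :: "'j \<Rightarrow> complex"
  assumes "(\<lambda>j. (cmod (a j))\<^sup>2) summable_on A" "(\<lambda>j. (cmod (b j))\<^sup>2) summable_on A"
  shows "(\<lambda>j. cmod (a j * b j)) summable_on A"
    and "(\<Sum>\<^sub>\<infinity>j\<in>A. cmod (a j * b j)) \<le> ((\<Sum>\<^sub>\<infinity>j\<in>A. (cmod (a j))\<^sup>2) + (\<Sum>\<^sub>\<infinity>j\<in>A. (cmod (b j))\<^sup>2)) / 2"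
proof -
  have s: "(\<lambda>j. ((cmod (a j))\<^sup>2 + (cmod (b j))\<^sup>2) / 2) summable_on A"
    using summable_on_cmult_right[OF summable_on_add[OF assms], of "1/2"] by (simp add: mult.commute)
  show *: "(\<lambda>j. cmod (a j * b j)) summable_on A"
    by (rule Infinite_Sum.abs_summable_on_comparison_test'[OF s]) (rule norm_mult_le_squares)
  have "(\<Sum>\<^sub>\<infinity>j\<in>A. cmod (a j * b j)) \<le> (\<Sum>\<^sub>\<infinity>j\<in>A. ((cmod (a j))\<^sup>2 + (cmod (b j))\<^sup>2) / 2)"
    by (rule infsum_mono[OF * s]) (rule norm_mult_le_squares)
  also have "\<dots> = ((\<Sum>\<^sub>\<infinity>j\<in>A. (cmod (a j))\<^sup>2) + (\<Sum>\<^sub>\<infinity>j\<in>A. (cmod (b j))\<^sup>2)) / 2"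
    using infsum_cmult_right[OF summable_on_add[OF assms], of "1/2"]
    by (simp add: infsum_add[OF assms] mult.commute)
  finally show "(\<Sum>\<^sub>\<infinity>j\<in>A. cmod (a j * b j)) \<le> ((\<Sum>\<^sub>\<infinity>j\<in>A. (cmod (a j))\<^sup>2) + (\<Sum>\<^sub>\<infinity>j\<in>A. (cmod (b j))\<^sup>2)) / 2" .
qed

lemma (in pair_sigma_finite) integral_product_mult:
  fixes f :: "'a \<Rightarrow> complex" and h :: "'b \<Rightarrow> complex"
  assumes "integrable M1 f" "integrable M2 h"
  shows "integrable (M1 \<Otimes>\<^sub>M M2) (\<lambda>p. f (fst p) * h (snd p))"
    and "(LINT p|(M1 \<Otimes>\<^sub>M M2). f (fst p) * h (snd p)) = (LINT x|M1. f x) * (LINT y|M2. h y)"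
proof -
  have [measurable]: "f \<in> borel_measurable M1" "h \<in> borel_measurable M2" using assms by auto
  show i: "integrable (M1 \<Otimes>\<^sub>M M2) (\<lambda>p. f (fst p) * h (snd p))"
  proof (rule Fubini_integrable)
    show "(\<lambda>p. f (fst p) * h (snd p)) \<in> borel_measurable (M1 \<Otimes>\<^sub>M M2)" by measurable
    show "integrable M1 (\<lambda>x. LINT y|M2. norm (f (fst (x, y)) * h (snd (x, y))))"
      using assms by (simp add: norm_mult)
    show "AE x in M1. integrable M2 (\<lambda>y. f (fst (x, y)) * h (snd (x, y)))"
      using assms by (auto intro!: integrable_mult_right)
  qed
  show "(LINT p|(M1 \<Otimes>\<^sub>M M2). f (fst p) * h (snd p)) = (LINT x|M1. f x) * (LINT y|M2. h y)"
    using integral_fst'[OF i] by simp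
qed

lemma infsum_product_complex:
  fixes f :: "'a \<Rightarrow> complex" and g :: "'b \<Rightarrow> complex"
  assumes "(\<lambda>x. cmod (f x)) summable_on UNIV" "(\<lambda>y. cmod (g y)) summable_on UNIV"
  shows "(\<lambda>(x,y). cmod (f x * g y)) summable_on UNIV"
    and "(\<Sum>\<^sub>\<infinity>(x,y). cmod (f x * g y)) = (\<Sum>\<^sub>\<infinity>x. cmod (f x)) * (\<Sum>\<^sub>\<infinity>y. cmod (g y))"
    and "(\<Sum>\<^sub>\<infinity>(x,y). f x * g y) = (\<Sum>\<^sub>\<infinity>x. f x) * (\<Sum>\<^sub>\<infinity>y. g y)"
proof -
  have 1: "((\<lambda>y. cmod (f x) * cmod (g y)) has_sum (cmod (f x) * (\<Sum>\<^sub>\<infinity>y. cmod (g y)))) UNIV" for x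
    by (intro has_sum_cmult_right has_sum_infsum assms)
  have 2: "((\<lambda>x. cmod (f x) * (\<Sum>\<^sub>\<infinity>y. cmod (g y))) has_sum ((\<Sum>\<^sub>\<infinity>x. cmod (f x)) * (\<Sum>\<^sub>\<infinity>y. cmod (g y)))) UNIV"
    by (intro has_sum_cmult_left has_sum_infsum assms)
  have 3: "(\<lambda>(x,y). cmod (f x) * cmod (g y)) summable_on Sigma UNIV (\<lambda>_. UNIV)"
    by (rule summable_on_SigmaI[where g="\<lambda>x. cmod (f x) * (\<Sum>\<^sub>\<infinity>y. cmod (g y))"])
      (use 1 2 in \<open>auto simp: summable_on_def\<close>)
  then show s: "(\<lambda>(x,y). cmod (f x * g y)) summable_on UNIV" by (simp add: norm_mult)
  have "((\<lambda>(x,y). cmod (f x) * cmod (g y)) has_sum ((\<Sum>\<^sub>\<infinity>x. cmod (f x)) * (\<Sum>\<^sub>\<infinity>y. cmod (g y)))) (Sigma UNIV (\<lambda>_. UNIV))"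
    by (rule has_sum_SigmaI[OF _ 2 3]) (use 1 in simp)
  from infsumI[OF this] show "(\<Sum>\<^sub>\<infinity>(x,y). cmod (f x * g y)) = (\<Sum>\<^sub>\<infinity>x. cmod (f x)) * (\<Sum>\<^sub>\<infinity>y. cmod (g y))"
    by (simp add: norm_mult)
  have s': "(\<lambda>(x,y). f x * g y) summable_on Sigma UNIV (\<lambda>_. UNIV)"
    by (rule abs_summable_summable) (use s in \<open>simp add: case_prod_unfold\<close>)
  have "((\<lambda>(x,y). f x * g y) has_sum ((\<Sum>\<^sub>\<infinity>x. f x) * (\<Sum>\<^sub>\<infinity>y. g y))) (Sigma UNIV (\<lambda>_. UNIV))"
  proof (rule has_sum_SigmaI[OF _ _ s'])
    show "((\<lambda>x. f x * (\<Sum>\<^sub>\<infinity>y. g y)) has_sum ((\<Sum>\<^sub>\<infinity>x. f x) * (\<Sum>\<^sub>\<infinity>y. g y))) UNIV"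
      by (intro has_sum_cmult_left has_sum_infsum abs_summable_summable[OF assms(1)])
    show "((\<lambda>y. case (x, y) of (x, y) \<Rightarrow> f x * g y) has_sum (f x * (\<Sum>\<^sub>\<infinity>y. g y))) UNIV" for x
      using has_sum_cmult_right[OF has_sum_infsum[OF abs_summable_summable[OF assms(2)]], of "f x"] by simp
  qed
  from infsumI[OF this] show "(\<Sum>\<^sub>\<infinity>(x,y). f x * g y) = (\<Sum>\<^sub>\<infinity>x. f x) * (\<Sum>\<^sub>\<infinity>y. g y)"
    by simp
qed

text \<open>The factors s and w are kept apart because later w is \<eta>(x) cnj(\<eta>(y)), whose
  k-th power splits into a function of x and a function of y.\<close>

lemma has_sum_binomial_series:
  fixes \<zeta> w :: complex and s :: real
  assumes "0 < s" "s < 1" "cmod w = 1"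
  shows "(\<lambda>k. cmod ((\<zeta> gchoose k) * (- of_real s) ^ k * w ^ k)) summable_on UNIV"
    and "(\<Sum>\<^sub>\<infinity>k. cmod ((\<zeta> gchoose k) * (- of_real s) ^ k * w ^ k)) \<le> (1 - s) powr (- cmod \<zeta>)"
    and "(\<Sum>\<^sub>\<infinity>k. (\<zeta> gchoose k) * (- of_real s) ^ k * w ^ k) = (1 - of_real s * w) powr \<zeta>"
proof -
  have le: "cmod ((\<zeta> gchoose k) * (- of_real s) ^ k * w ^ k) \<le> pochhammer (cmod \<zeta>) k / fact k * s ^ k" for k
    using mult_right_mono[OF norm_gbinomial_le[of \<zeta> k], of "s ^ k"] assms
    by (simp add: norm_mult norm_power)
  have nn: "0 \<le> pochhammer (cmod \<zeta>) k / fact k * s ^ k" for k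
    by (rule order_trans[OF norm_ge_zero le])
  have hs: "((\<lambda>k. pochhammer (cmod \<zeta>) k / fact k * s ^ k) has_sum (1 - s) powr (- cmod \<zeta>)) UNIV"
    by (rule sums_nonneg_imp_has_sum[OF pochhammer_series_sums[OF assms(1,2)] nn])
  show s: "(\<lambda>k. cmod ((\<zeta> gchoose k) * (- of_real s) ^ k * w ^ k)) summable_on UNIV"
    by (rule Infinite_Sum.abs_summable_on_comparison_test'[OF _ le]) (use hs in \<open>auto simp: summable_on_def\<close>)
  show "(\<Sum>\<^sub>\<infinity>k. cmod ((\<zeta> gchoose k) * (- of_real s) ^ k * w ^ k)) \<le> (1 - s) powr (- cmod \<zeta>)"
    by (rule has_sum_mono[OF has_sum_infsum[OF s] hs le])
  have "(\<lambda>k. (\<zeta> gchoose k) * (- of_real s * w) ^ k) sums (1 + - of_real s * w) powr \<zeta>"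
    by (rule gen_binomial_complex) (use assms in \<open>simp add: norm_mult\<close>)
  then have "(\<lambda>k. (\<zeta> gchoose k) * (- of_real s) ^ k * w ^ k) sums (1 - of_real s * w) powr \<zeta>"
    by (simp only: power_mult_distrib mult.assoc[symmetric]) simp
  then show "(\<Sum>\<^sub>\<infinity>k. (\<zeta> gchoose k) * (- of_real s) ^ k * w ^ k) = (1 - of_real s * w) powr \<zeta>"
    using has_sum_imp_sums[OF has_sum_infsum[OF abs_summable_summable[OF s]]] sums_unique2 by blast
qed

text \<open>Since s < 1 the base lies in the right half plane, so its argument is below pi/2 < 2 in
  modulus and the factor caused by the imaginary part of \<zeta> is at most exp(2 |Im \<zeta>|). The
  Gaussian in the bound is of the size that \<open>three_lines\<close> admits on the edges.\<close>

lemma cmod_powr_le: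
  fixes \<zeta> w :: complex and s :: real
  assumes "0 < s" "s < 1" "cmod w = 1"
  shows "cmod ((1 - of_real s * w) powr \<zeta>) \<le> cmod (1 - of_real s * w) powr Re \<zeta> * exp (1 + (Im \<zeta>)\<^sup>2)"
proof -
  have "\<bar>Im \<zeta> * Arg (1 - of_real s * w)\<bar> \<le> 1 + (Im \<zeta>)\<^sup>2"
  proof -
    have "Re (of_real s * w) < 1"
      by (rule le_less_trans[OF complex_Re_le_cmod]) (use assms in \<open>simp add: norm_mult\<close>)
    then have "\<bar>Arg (1 - of_real s * w)\<bar> < pi / 2"
      using Arg_Re_pos[of "1 - of_real s * w"] by simp
    then have "\<bar>Arg (1 - of_real s * w)\<bar> \<le> 2" using pi_less_4 by linarith
    then have "\<bar>Im \<zeta> * Arg (1 - of_real s * w)\<bar> \<le> \<bar>Im \<zeta>\<bar> * 2"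
      unfolding abs_mult by (intro mult_left_mono) auto
    also have "\<dots> \<le> 1 + (Im \<zeta>)\<^sup>2"
      using sum_squares_bound[of "\<bar>Im \<zeta>\<bar>" 1] by simp
    finally show ?thesis .
  qed
  then have "exp (- Im \<zeta> * Arg (1 - of_real s * w)) \<le> exp (1 + (Im \<zeta>)\<^sup>2)" by simp
  then show ?thesis unfolding norm_powr_complex by (intro mult_left_mono) auto
qed

subsection \<open>Complex interpolation for dispersive systems\<close>

lemma summable_on_finite_sum:
  fixes f :: "'b \<Rightarrow> 'a \<Rightarrow> 'c::{topological_comm_monoid_add}"
  assumes "finite S" "\<And>i. i \<in> S \<Longrightarrow> f i summable_on A"
  shows "(\<lambda>x. \<Sum>i\<in>S. f i x) summable_on A"
  using assms by (induction S rule: finite_induct) (auto intro: summable_on_add)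

lemma infsum_of_real_complex: "(\<Sum>\<^sub>\<infinity>i\<in>A. complex_of_real (f i)) = of_real (\<Sum>\<^sub>\<infinity>i\<in>A. f i)"
proof (cases "f summable_on A")
  case True
  then show ?thesis by (intro infsumI has_sum_of_real has_sum_infsum)
next
  case False
  \<comment> \<open>If the real family is not summable, neither is its complex version, and both
    infinite sums take the default value 0.\<close>
  then have "\<not> (\<lambda>i. complex_of_real (f i)) summable_on A"
    using summable_on_Re[of "\<lambda>i. complex_of_real (f i)" A] by auto
  then show ?thesis using False by (simp add: infsum_not_exists)
qed

text \<open>
  In the application \<open>M\<close> is space-time, \<open>e (\<mu>, \<nu>)\<close> is \<open>e\<^sup>-\<^sup>i\<^sup>t\<^sup>\<L> \<Phi>\<^sub>\<mu>\<^sub>\<nu>\<close>, \<open>\<eta>\<close> is \<open>e\<^sup>-\<^sup>2\<^sup>i\<^sup>t\<close> and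
  \<open>\<sigma>\<close> is the damping \<open>s\<^sup>|\<^sup>\<mu>\<^sup>|\<close>. The resulting bounds do not involve \<open>s\<close> and \<open>D\<close>, which only
  serve convergence.
\<close>

locale dispersive_system = sigma_finite_measure M for M :: "'x measure" +
  fixes e :: "'i::countable \<Rightarrow> 'x \<Rightarrow> complex" and \<eta> :: "'x \<Rightarrow> complex" and \<sigma> :: "'i \<Rightarrow> real"
    and s \<kappa> D c :: real and N :: nat
  assumes e_square_integrable: "square_integrable M (e i)"
    and \<eta>_measurable [measurable]: "\<eta> \<in> borel_measurable M" and \<eta>_norm: "cmod (\<eta> x) = 1"
    and e_orthogonal: "inner_L2 M (\<lambda>x. \<eta> x ^ k * e i x) (\<lambda>x. \<eta> x ^ k' * e i' x)
          = (if (k, i) = (k', i') then of_real c else 0)"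
    and c_pos: "c > 0" and \<sigma>_nonneg: "0 \<le> \<sigma> i" and \<sigma>_le_1: "\<sigma> i \<le> 1"
    and s_pos: "0 < s" and s_less_1: "s < 1"
    and diagonal_summable: "(\<lambda>i. \<sigma> i * (cmod (e i x))\<^sup>2) summable_on UNIV"
    and diagonal_le: "(\<Sum>\<^sub>\<infinity>i. \<sigma> i * (cmod (e i x))\<^sup>2) \<le> D"
    and dispersive: "cmod (\<Sum>\<^sub>\<infinity>i. of_real (\<sigma> i) * e i x * cnj (e i y))
          * cmod (1 - of_real s * \<eta> x * cnj (\<eta> y)) ^ N \<le> \<kappa>"
    and N_pos: "1 \<le> N"
begin

lemma e_measurable [measurable]: "e i \<in> borel_measurable M"
  using e_square_integrable by (rule square_integrable_measurable)

text \<open>Multiplication by the characters \<open>\<eta> x ^ k\<close> keeps the waves orthogonal,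
  so the frequency k becomes a second index on which the analytic family can act.\<close>

definition E :: "nat \<times> 'i \<Rightarrow> 'x \<Rightarrow> complex" where
  "E j x = \<eta> x ^ fst j * e (snd j) x"

lemma E_square_integrable: "square_integrable M (E j)"
  unfolding E_def
  by (rule square_integrable_bound[OF _ e_square_integrable[of "snd j"], of _ 1])
    (auto simp: norm_mult norm_power \<eta>_norm)

lemma E_measurable [measurable]: "E j \<in> borel_measurable M"
  using E_square_integrable by (rule square_integrable_measurable)

lemma E_orthogonal: "inner_L2 M (E j) (E j') = (if j = j' then of_real c else 0)"
  unfolding E_def using e_orthogonal[of "fst j" "snd j" "fst j'" "snd j'"] by simp

lemmas E_Bessel = Bessel[OF E_square_integrable c_pos E_orthogonal]

section \<open>The analytic family of forms and its integral kernel\<close>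

definition weight :: "complex \<Rightarrow> nat \<times> 'i \<Rightarrow> complex" where
  "weight \<zeta> j = (\<zeta> gchoose fst j) * (- of_real s) ^ fst j * of_real (\<sigma> (snd j))"

text \<open>The form is given through its diagonalisation in the system \<open>E\<close>, so it
  makes sense for every \<zeta> on all of L^2; its representation by a kernel follows in
  \<open>form_eq_integral\<close> for arguments that are also integrable.\<close>

definition form :: "complex \<Rightarrow> ('x \<Rightarrow> complex) \<Rightarrow> ('x \<Rightarrow> complex) \<Rightarrow> complex" where
  "form \<zeta> f h = (\<Sum>\<^sub>\<infinity>j. weight \<zeta> j * (inner_L2 M f (E j) * cnj (inner_L2 M h (E j))))"

lemma weight_le:
  assumes "\<And>k. cmod ((\<zeta> gchoose k) * of_real s ^ k) \<le> K"
  shows "cmod (weight \<zeta> j) \<le> K"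
proof -
  have "cmod (weight \<zeta> j) = cmod ((\<zeta> gchoose fst j) * of_real s ^ fst j) * \<sigma> (snd j)"
    using \<sigma>_nonneg by (simp add: weight_def norm_mult norm_power)
  also have "\<dots> \<le> K * 1"
    using assms[of 0] assms by (intro mult_mono \<sigma>_le_1 \<sigma>_nonneg) (auto intro: order_trans)
  finally show ?thesis by simp
qed

lemma form_bound:
  assumes "square_integrable M f" "square_integrable M h"
    and K: "\<And>k. cmod ((\<zeta> gchoose k) * of_real s ^ k) \<le> K"
  shows "(\<lambda>j. cmod (weight \<zeta> j * (inner_L2 M f (E j) * cnj (inner_L2 M h (E j))))) summable_on UNIV"
    and "cmod (form \<zeta> f h) \<le> K * (c * (sqnorm_L2 M f + sqnorm_L2 M h) / 2)"
proof -
  let ?a = "\<lambda>j. inner_L2 M f (E j)" and ?b = "\<lambda>j. cnj (inner_L2 M h (E j))"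
  have a: "(\<lambda>j. (cmod (?a j))\<^sup>2) summable_on UNIV" "(\<Sum>\<^sub>\<infinity>j. (cmod (?a j))\<^sup>2) \<le> c * sqnorm_L2 M f"
    using E_Bessel[OF assms(1)] by auto
  have b: "(\<lambda>j. (cmod (?b j))\<^sup>2) summable_on UNIV" "(\<Sum>\<^sub>\<infinity>j. (cmod (?b j))\<^sup>2) \<le> c * sqnorm_L2 M h"
    using E_Bessel[OF assms(2)] by auto
  note ab = square_summable_product[OF a(1) b(1)]
  have K0: "0 \<le> K" using K[of 0] norm_ge_zero order_trans by blast
  have le: "cmod (weight \<zeta> j * (?a j * ?b j)) \<le> K * cmod (?a j * ?b j)" for j
    unfolding norm_mult[of "weight \<zeta> j"] by (intro mult_right_mono weight_le K norm_ge_zero)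
  have sK: "(\<lambda>j. K * cmod (?a j * ?b j)) summable_on UNIV"
    by (rule summable_on_cmult_right[OF ab(1)])
  show sm: "(\<lambda>j. cmod (weight \<zeta> j * (?a j * ?b j))) summable_on UNIV"
    by (rule Infinite_Sum.abs_summable_on_comparison_test'[OF sK le])
  have "cmod (form \<zeta> f h) \<le> (\<Sum>\<^sub>\<infinity>j. cmod (weight \<zeta> j * (?a j * ?b j)))"
    unfolding form_def by (rule norm_infsum_bound[OF sm])
  also have "\<dots> \<le> (\<Sum>\<^sub>\<infinity>j. K * cmod (?a j * ?b j))"
    by (rule infsum_mono[OF sm sK le])
  also have "\<dots> = K * (\<Sum>\<^sub>\<infinity>j. cmod (?a j * ?b j))"
    by (rule infsum_cmult_right[OF ab(1)])
  also have "\<dots> \<le> K * ((c * sqnorm_L2 M f + c * sqnorm_L2 M h) / 2)"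
    by (rule mult_left_mono[OF _ K0]) (use ab(2) a(2) b(2) in argo)
  finally show "cmod (form \<zeta> f h) \<le> K * (c * (sqnorm_L2 M f + sqnorm_L2 M h) / 2)"
    by (simp add: distrib_left)
qed

text \<open>A single term is at most the sum of the whole series of moduli at w = 1. The bound
  degenerates as s tends to 1; it serves for the growth inside the strip and for local domination,
  not for the constants on the edges.\<close>

lemma coeff_le_powr: "cmod ((\<zeta> gchoose k) * of_real s ^ k) \<le> (1 - s) powr (- cmod \<zeta>)"
proof -
  have "cmod ((\<zeta> gchoose k) * (- of_real s) ^ k * 1 ^ k)
      \<le> (\<Sum>\<^sub>\<infinity>k. cmod ((\<zeta> gchoose k) * (- of_real s) ^ k * 1 ^ k))"
    by (rule finite_sum_le_infsum[of _ UNIV "{k}", simplified])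
      (use has_sum_binomial_series(1)[OF s_pos s_less_1, of 1 \<zeta>] in auto)
  also have "\<dots> \<le> (1 - s) powr (- cmod \<zeta>)"
    using has_sum_binomial_series(2)[OF s_pos s_less_1, of 1 \<zeta>] by simp
  finally show ?thesis by (simp add: norm_mult norm_power)
qed

definition kernel :: "'x \<times> 'x \<Rightarrow> complex" where
  "kernel p = (\<Sum>\<^sub>\<infinity>i. of_real (\<sigma> i) * e i (fst p) * cnj (e i (snd p)))"

text \<open>Splitting \<sigma> into two square roots reduces the off-diagonal series to the diagonal
  ones at x and at y, both of which are bounded by D.\<close>

lemma kernel_summable:
  "(\<lambda>i. cmod (of_real (\<sigma> i) * e i x * cnj (e i y))) summable_on UNIV"
  "(\<Sum>\<^sub>\<infinity>i. cmod (of_real (\<sigma> i) * e i x * cnj (e i y))) \<le> D"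
proof -
  let ?a = "\<lambda>z i. of_real (sqrt (\<sigma> i)) * e i z"
  have sq: "(cmod (?a z i))\<^sup>2 = \<sigma> i * (cmod (e i z))\<^sup>2" for z i
    using \<sigma>_nonneg[of i] by (simp add: norm_mult power_mult_distrib)
  have 1: "(\<lambda>i. (cmod (?a z i))\<^sup>2) summable_on UNIV" for z
    unfolding sq by (rule diagonal_summable)
  have 2: "(\<Sum>\<^sub>\<infinity>i. (cmod (?a z i))\<^sup>2) \<le> D" for z
    unfolding sq by (rule diagonal_le)
  have 3: "(cmod (cnj (?a z i)))\<^sup>2 = (cmod (?a z i))\<^sup>2" for z i by (simp only: complex_mod_cnj)
  have eq: "?a x i * cnj (?a y i) = of_real (\<sigma> i) * e i x * cnj (e i y)" for i
  proof -
    have "complex_of_real (sqrt (\<sigma> i)) * complex_of_real (sqrt (\<sigma> i)) = of_real (\<sigma> i)"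
      using \<sigma>_nonneg[of i] by (simp flip: of_real_mult)
    then show ?thesis by (simp add: algebra_simps)
  qed
  note * = square_summable_product[of "?a x" UNIV "\<lambda>i. cnj (?a y i)", unfolded 3, OF 1 1, unfolded eq]
  show "(\<lambda>i. cmod (of_real (\<sigma> i) * e i x * cnj (e i y))) summable_on UNIV"
    by (rule *(1))
  show "(\<Sum>\<^sub>\<infinity>i. cmod (of_real (\<sigma> i) * e i x * cnj (e i y))) \<le> D"
    using *(2) 2[of x] 2[of y] by argo
qed

text \<open>The double series is a product: the frequencies sum to the binomial series of (1 - s
  w)^\<zeta>, the wave indices to \<open>kernel\<close>.\<close>

lemma weighted_kernel_sum:
  shows "(\<lambda>j. cmod (weight \<zeta> j * (E j x * cnj (E j y)))) summable_on UNIV"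
    and "(\<Sum>\<^sub>\<infinity>j. cmod (weight \<zeta> j * (E j x * cnj (E j y)))) \<le> (1 - s) powr (- cmod \<zeta>) * D"
    and "(\<Sum>\<^sub>\<infinity>j. weight \<zeta> j * (E j x * cnj (E j y)))
      = (1 - of_real s * (\<eta> x * cnj (\<eta> y))) powr \<zeta> * kernel (x, y)"
proof -
  let ?w = "\<eta> x * cnj (\<eta> y)"
  have w: "cmod ?w = 1" by (simp add: norm_mult \<eta>_norm)
  let ?f = "\<lambda>k. (\<zeta> gchoose k) * (- of_real s) ^ k * ?w ^ k"
  let ?g = "\<lambda>i. of_real (\<sigma> i) * e i x * cnj (e i y)"
  note f = has_sum_binomial_series[OF s_pos s_less_1 w, of \<zeta>]
  have eq: "weight \<zeta> j * (E j x * cnj (E j y)) = (case j of (k, i) \<Rightarrow> ?f k * ?g i)" for j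
    by (simp add: weight_def E_def case_prod_unfold power_mult_distrib)
  have eqn: "cmod (weight \<zeta> j * (E j x * cnj (E j y))) = (case j of (k, i) \<Rightarrow> cmod (?f k * ?g i))" for j
    unfolding eq by (simp add: case_prod_unfold)
  note fg = infsum_product_complex[OF f(1) kernel_summable(1)[of x y]]
  show "(\<lambda>j. cmod (weight \<zeta> j * (E j x * cnj (E j y)))) summable_on UNIV"
    unfolding eqn by (rule fg(1))
  show "(\<Sum>\<^sub>\<infinity>j. cmod (weight \<zeta> j * (E j x * cnj (E j y)))) \<le> (1 - s) powr (- cmod \<zeta>) * D"
    unfolding eqn fg(2)
    by (intro mult_mono f(2) kernel_summable(2) infsum_nonneg norm_ge_zero powr_ge_zero)
  show "(\<Sum>\<^sub>\<infinity>j. weight \<zeta> j * (E j x * cnj (E j y))) = (1 - of_real s * ?w) powr \<zeta> * kernel (x, y)"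
    unfolding eq fg(3) f(3) by (simp add: kernel_def)
qed

definition weighted_kernel :: "complex \<Rightarrow> 'x \<times> 'x \<Rightarrow> complex" where
  "weighted_kernel \<zeta> p = (1 - of_real s * (\<eta> (fst p) * cnj (\<eta> (snd p)))) powr \<zeta> * kernel p"

lemma weighted_kernel_measurable [measurable]:
  "weighted_kernel \<zeta> \<in> borel_measurable (M \<Otimes>\<^sub>M M)"
proof -
  have "weighted_kernel \<zeta> = (\<lambda>p. \<Sum>\<^sub>\<infinity>j. weight \<zeta> j * (E j (fst p) * cnj (E j (snd p))))"
    unfolding weighted_kernel_def weighted_kernel_sum(3) by simp
  also have "\<dots> \<in> borel_measurable (M \<Otimes>\<^sub>M M)"
    by (intro borel_measurable_infsum_complex abs_summable_summable[OF weighted_kernel_sum(1)]) measurable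
  finally show ?thesis .
qed

lemma weighted_kernel_le:
  assumes "Re \<zeta> = N"
  shows "cmod (weighted_kernel \<zeta> p) \<le> \<kappa> * exp (1 + (Im \<zeta>)\<^sup>2)"
proof -
  let ?w = "\<eta> (fst p) * cnj (\<eta> (snd p))"
  have w: "cmod ?w = 1" by (simp add: norm_mult \<eta>_norm)
  have "0 < 1 - s" using s_less_1 by simp
  also have "1 - s \<le> cmod (1 - of_real s * ?w)"
    using norm_triangle_ineq2[of 1 "of_real s * ?w"] s_pos by (simp add: norm_mult \<eta>_norm)
  finally have nz: "cmod (1 - of_real s * ?w) > 0" .
  have "cmod (weighted_kernel \<zeta> p)
      \<le> cmod (1 - of_real s * ?w) powr Re \<zeta> * exp (1 + (Im \<zeta>)\<^sup>2) * cmod (kernel p)"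
    unfolding weighted_kernel_def norm_mult[of "_ powr \<zeta>"]
    by (intro mult_right_mono cmod_powr_le s_pos s_less_1 w norm_ge_zero)
  also have "\<dots> = (cmod (kernel p) * cmod (1 - of_real s * \<eta> (fst p) * cnj (\<eta> (snd p))) ^ N) * exp (1 + (Im \<zeta>)\<^sup>2)"
    using nz by (simp add: assms powr_realpow mult_ac)
  also have "\<dots> \<le> \<kappa> * exp (1 + (Im \<zeta>)\<^sup>2)"
    unfolding kernel_def by (intro mult_right_mono dispersive) auto
  finally show ?thesis .
qed

text \<open>Series and integral may be exchanged because the series of moduli is bounded uniformly
  in x and y, by (1 - s)^(-|\<zeta>|) D, and cnj(h(x)) f(y) is integrable on the product space. This
  is what integrability of the arguments in addition to square integrability is for.\<close>

lemma form_eq_integral: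
  assumes f: "square_integrable M f" "integrable M f" and h: "square_integrable M h" "integrable M h"
  shows "form \<zeta> f h = (LINT p|(M \<Otimes>\<^sub>M M). weighted_kernel \<zeta> p * (cnj (h (fst p)) * f (snd p)))"
proof -
  interpret pair_sigma_finite M M ..
  note [measurable] = borel_measurable_integrable[OF f(2)] borel_measurable_integrable[OF h(2)]
  let ?F = "\<lambda>j p. weight \<zeta> j * (E j (fst p) * cnj (E j (snd p))) * (cnj (h (fst p)) * f (snd p))"
  let ?R = "\<lambda>p. cnj (h (fst p)) * f (snd p)"
  have i1: "integrable M (\<lambda>x. cnj (h x) * E j x)" for j
    using integrable_inner_L2[OF E_square_integrable[of j] h(1)] by (simp add: mult.commute)
  have i2: "integrable M (\<lambda>x. f x * cnj (E j x))" for j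
    by (rule integrable_inner_L2[OF f(1) E_square_integrable])
  have Fint: "(LINT p|(M \<Otimes>\<^sub>M M). ?F j p) = weight \<zeta> j * (inner_L2 M f (E j) * cnj (inner_L2 M h (E j)))" for j
  proof -
    have "(LINT p|(M \<Otimes>\<^sub>M M). ?F j p)
        = (LINT p|(M \<Otimes>\<^sub>M M). weight \<zeta> j * ((cnj (h (fst p)) * E j (fst p)) * (f (snd p) * cnj (E j (snd p)))))"
      by (rule Bochner_Integration.integral_cong) (auto simp: mult_ac)
    also have "\<dots> = weight \<zeta> j * ((LINT x|M. cnj (h x) * E j x) * (LINT x|M. f x * cnj (E j x)))"
      using integral_product_mult(2)[OF i1[of j] i2[of j]] by simp
    also have "(LINT x|M. cnj (h x) * E j x) = cnj (inner_L2 M h (E j))"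
      unfolding inner_L2_def by (subst Bochner_Integration.integral_cnj[symmetric]) simp
    finally show ?thesis by (simp add: inner_L2_def mult_ac)
  qed
  have abs: "cmod (?F j p) = cmod (weight \<zeta> j * (E j (fst p) * cnj (E j (snd p)))) * cmod (?R p)" for j p
    by (rule norm_mult)
  have "((\<lambda>j. LINT p|(M \<Otimes>\<^sub>M M). ?F j p) has_sum (LINT p|(M \<Otimes>\<^sub>M M). (\<Sum>\<^sub>\<infinity>j. ?F j p))) UNIV"
  proof (rule has_sum_integral[where w="\<lambda>p. (1 - s) powr (- cmod \<zeta>) * D * cmod (?R p)"])
    show "?F j \<in> borel_measurable (M \<Otimes>\<^sub>M M)" for j by measurable
    show "(\<lambda>j. cmod (?F j p)) summable_on UNIV" for p
      unfolding abs by (rule summable_on_cmult_left[OF weighted_kernel_sum(1)])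
    show "(\<Sum>\<^sub>\<infinity>j. cmod (?F j p)) \<le> (1 - s) powr (- cmod \<zeta>) * D * cmod (?R p)" for p
      unfolding abs
      by (subst infsum_cmult_left[OF weighted_kernel_sum(1)])
        (rule mult_right_mono[OF weighted_kernel_sum(2) norm_ge_zero])
    show "integrable (M \<Otimes>\<^sub>M M) (\<lambda>p. (1 - s) powr (- cmod \<zeta>) * D * cmod (?R p))"
      using integral_product_mult(1)[of "\<lambda>x. cnj (h x)" f] f(2) h(2) by (intro integrable_mult_right integrable_norm) auto
  qed
  moreover have "(\<Sum>\<^sub>\<infinity>j. ?F j p) = weighted_kernel \<zeta> p * ?R p" for p
    unfolding weighted_kernel_def
    by (subst infsum_cmult_left[OF abs_summable_summable[OF weighted_kernel_sum(1)]])
      (simp add: weighted_kernel_sum(3))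
  ultimately show ?thesis
    unfolding form_def Fint by (simp add: infsumI)
qed

text \<open>
  The three lines theorem is applied to
  \<open>\<Sum>\<^sub>l b\<^sub>l\<^bsup>\<alpha>(1 - (\<zeta>+1)/(2(N+1)))\<^esup> form \<zeta> (V\<^bsup>(\<zeta>+1)/2\<^esup> g\<^sub>l) (V\<^bsup>(\<zeta>\<^sup>*+1)/2\<^esup> g\<^sub>l)\<close> on \<open>-1 \<le> Re \<zeta> \<le> N\<close>; it is
  evaluated at \<open>\<zeta> = 0\<close>, where only the frequency \<open>0\<close> survives in \<open>form\<close>.
\<close>

theorem weighted_coefficient_bound:
  fixes L :: "'l set" and g :: "'l \<Rightarrow> 'x \<Rightarrow> complex" and b :: "'l \<Rightarrow> real" and V :: "'x \<Rightarrow> real"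
  defines "\<alpha> \<equiv> 2 * (real N + 1) / (2 * real N + 1)"
  assumes L: "finite L"
    and g: "\<And>l. l \<in> L \<Longrightarrow> square_integrable M (g l)"
    and g_orth: "\<And>l m. l \<in> L \<Longrightarrow> m \<in> L \<Longrightarrow> inner_L2 M (g l) (g m) = (if l = m then 1 else 0)"
    and b: "\<And>l. l \<in> L \<Longrightarrow> 0 < b l" and b_sum: "(\<Sum>l\<in>L. b l powr \<alpha>) = 1"
    and V [measurable]: "V \<in> borel_measurable M" and V_nonneg: "\<And>x. 0 \<le> V x" and V_fin: "finite (range V)"
    and V_int: "integrable M (\<lambda>x. V x ^ (N + 1))" and V_norm: "(LINT x|M. V x ^ (N + 1)) = 1"
  shows "(\<Sum>l\<in>L. b l * (\<Sum>\<^sub>\<infinity>i. \<sigma> i * (cmod (inner_L2 M (\<lambda>x. of_real (sqrt (V x)) * g l x) (e i)))\<^sup>2))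
    \<le> (c + \<kappa> * exp 1) * exp (2 * (1 + (real N)\<^sup>2))"
proof -
  \<comment> \<open>\<open>W \<zeta>\<close> is V^((\<zeta>+1)/2), with the value 0 for every
    \<zeta> where V vanishes, so that \<zeta> enters through exponentials only.\<close>
  define W where "W \<zeta> x = (if V x = 0 then 0 else exp ((\<zeta> + 1) / 2 * of_real (ln (V x))))" for \<zeta> :: complex and x
  define vs where "vs = range V - {0}"
  define ex where "ex v \<zeta> = exp ((\<zeta> + 1) / 2 * of_real (ln v))" for v :: real and \<zeta> :: complex
  \<comment> \<open>\<open>T v l\<close> is \<open>g l\<close> cut off to a level set of V. Since V
    takes finitely many values, \<open>Wg l \<zeta>\<close> is a finite combination of these pieces
    with the entire coefficients \<open>ex v \<zeta>\<close>.\<close>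
  define T where "T v l x = (if V x = v then g l x else 0)" for v l x
  define Wg where "Wg l \<zeta> x = W \<zeta> x * g l x" for l \<zeta> x
  have g_meas [measurable]: "l \<in> L \<Longrightarrow> g l \<in> borel_measurable M" for l
    using g by (rule square_integrable_measurable)
  have W_meas [measurable]: "W \<zeta> \<in> borel_measurable M" for \<zeta>
    unfolding W_def by measurable
  have vs_fin: "finite vs" using V_fin by (simp add: vs_def)
  have Vpos: "V x \<noteq> 0 \<Longrightarrow> 0 < V x" for x using V_nonneg[of x] by simp
  have nW: "cmod (W \<zeta> x) = (if V x = 0 then 0 else V x powr ((Re \<zeta> + 1) / 2))" for \<zeta> x
    using Vpos[of x] by (simp add: W_def powr_def)
  have W_cnj: "W (cnj \<zeta>) x = cnj (W \<zeta> x)" for \<zeta> x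
    by (simp add: W_def exp_cnj)
  have T_sq: "square_integrable M (T v l)" if "l \<in> L" for v l
  proof (rule square_integrable_bound[OF _ g[OF that], of _ 1])
    have [measurable]: "g l \<in> borel_measurable M" by (rule g_meas[OF that])
    show "T v l \<in> borel_measurable M" unfolding T_def[abs_def] by measurable
  qed (simp add: T_def)
  have Wg_T: "Wg l \<zeta> = (\<lambda>x. \<Sum>v\<in>vs. ex v \<zeta> * T v l x)" for l \<zeta>
  proof
    fix x
    have "(\<Sum>v\<in>vs. ex v \<zeta> * T v l x) = (\<Sum>v\<in>vs. if V x = v then ex v \<zeta> * g l x else 0)"
      by (rule sum.cong) (auto simp: T_def)
    also have "\<dots> = (if V x \<in> vs then ex (V x) \<zeta> * g l x else 0)"
      using vs_fin by simp
    also have "\<dots> = Wg l \<zeta> x"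
      by (simp add: Wg_def W_def ex_def vs_def)
    finally show "Wg l \<zeta> x = (\<Sum>v\<in>vs. ex v \<zeta> * T v l x)" ..
  qed
  have Wg_sq: "square_integrable M (Wg l \<zeta>)" if "l \<in> L" for l \<zeta>
    unfolding Wg_T by (intro square_integrable_sum square_integrable_cmult T_sq that)
  define A where "A l \<zeta> j = inner_L2 M (Wg l \<zeta>) (E j)" for l \<zeta> j
  define a where "a l v j = inner_L2 M (T v l) (E j)" for l v j
  have A_a: "A l \<zeta> j = (\<Sum>v\<in>vs. ex v \<zeta> * a l v j)" if "l \<in> L" for l \<zeta> j
    unfolding A_def a_def Wg_T by (rule inner_L2_sum_left[OF T_sq E_square_integrable]) (rule that)
  \<comment> \<open>The form is conjugate linear in its second argument; evaluating that argument at
    cnj \<zeta> restores the holomorphic dependence on \<zeta>.\<close>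
  have cnj_A_a: "cnj (A l (cnj \<zeta>) j) = (\<Sum>v\<in>vs. ex v \<zeta> * cnj (a l v j))" if "l \<in> L" for l \<zeta> j
    unfolding A_a[OF that] by (simp add: ex_def exp_cnj)
  define H where "H l \<zeta> = form \<zeta> (Wg l \<zeta>) (Wg l (cnj \<zeta>))" for l \<zeta>
  have H_eq: "H l \<zeta> = (\<Sum>\<^sub>\<infinity>j. weight \<zeta> j * (A l \<zeta> j * cnj (A l (cnj \<zeta>) j)))" for l \<zeta>
    by (simp add: H_def form_def A_def)

  have H_hol: "H l holomorphic_on UNIV" if l: "l \<in> L" for l
  proof -
    have "H l holomorphic_on ball z 1" for z
    proof -
      \<comment> \<open>On the unit ball around z the summands have the summable majorant
        \<open>B\<close>: K bounds the weights, R the exponentials, and the coefficients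
        \<open>a\<close> are square summable by Bessel's inequality. Uniform convergence then makes
        the series holomorphic.\<close>
      define K where "K = (1 - s) powr (- (cmod z + 1))"
      define R where "R = (\<Sum>v\<in>vs. exp ((cmod z + 2) * \<bar>ln v\<bar>))"
      define B where "B j = K * (\<Sum>v\<in>vs. \<Sum>v'\<in>vs. R * R * cmod (a l v j * a l v' j))" for j
      have K: "cmod (weight \<zeta> j) \<le> K" if "\<zeta> \<in> cball z 1" for \<zeta> j
      proof (rule weight_le)
        fix k
        have "cmod \<zeta> \<le> cmod z + 1"
          using that norm_triangle_ineq4[of z "z - \<zeta>"] by (simp add: dist_norm)
        then have "(1 - s) powr (- cmod \<zeta>) \<le> K"
          unfolding K_def using s_pos s_less_1 by (intro powr_mono') auto
        then show "cmod ((\<zeta> gchoose k) * of_real s ^ k) \<le> K"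
          using coeff_le_powr[of \<zeta> k] by linarith
      qed
      have exR: "cmod (ex v \<zeta>) \<le> R" if "\<zeta> \<in> cball z 1" "v \<in> vs" for v \<zeta>
      proof -
        have "cmod \<zeta> \<le> cmod z + 1"
          using that norm_triangle_ineq4[of z "z - \<zeta>"] by (simp add: dist_norm)
        then have hr: "\<bar>(Re \<zeta> + 1) / 2\<bar> \<le> cmod z + 2"
          using abs_Re_le_cmod[of \<zeta>] norm_ge_zero[of z] by (simp add: abs_le_iff)
        then have "(Re \<zeta> + 1) / 2 * ln v \<le> (cmod z + 2) * \<bar>ln v\<bar>"
          using abs_ge_self[of "(Re \<zeta> + 1) / 2 * ln v"] mult_right_mono[OF hr, of "\<bar>ln v\<bar>"]
          unfolding abs_mult by linarith
        then have "cmod (ex v \<zeta>) \<le> exp ((cmod z + 2) * \<bar>ln v\<bar>)"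
          by (simp add: ex_def)
        also have "\<dots> \<le> R"
          unfolding R_def using vs_fin that by (intro member_le_sum) auto
        finally show ?thesis .
      qed
      have R0: "0 \<le> R" unfolding R_def by (intro sum_nonneg) simp
      have K0: "0 \<le> K" by (simp add: K_def)
      have AR: "cmod (A l \<zeta> j) \<le> (\<Sum>v\<in>vs. R * cmod (a l v j))" if "\<zeta> \<in> cball z 1" for \<zeta> j
        unfolding A_a[OF l]
        by (rule sum_norm_le) (use exR[OF that] in \<open>auto simp: norm_mult intro: mult_right_mono\<close>)
      have AR': "cmod (cnj (A l (cnj \<zeta>) j)) \<le> (\<Sum>v\<in>vs. R * cmod (a l v j))" if "\<zeta> \<in> cball z 1" for \<zeta> j
        unfolding cnj_A_a[OF l]
        by (rule sum_norm_le) (use exR[OF that] in \<open>auto simp: norm_mult intro: mult_right_mono\<close>)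
      have dom: "cmod (weight \<zeta> j * (A l \<zeta> j * cnj (A l (cnj \<zeta>) j))) \<le> B j" if "\<zeta> \<in> cball z 1" for \<zeta> j
      proof -
        have "cmod (weight \<zeta> j * (A l \<zeta> j * cnj (A l (cnj \<zeta>) j)))
            \<le> K * ((\<Sum>v\<in>vs. R * cmod (a l v j)) * (\<Sum>v\<in>vs. R * cmod (a l v j)))"
          unfolding norm_mult[of "weight \<zeta> j"] norm_mult[of "A l \<zeta> j"]
          by (intro mult_mono K AR AR' that K0 mult_nonneg_nonneg norm_ge_zero sum_nonneg R0)
        also have "\<dots> = B j"
          by (simp add: B_def sum_product norm_mult algebra_simps)
        finally show ?thesis .
      qed
      have "(\<lambda>j. cmod (a l v j * a l v' j)) summable_on UNIV" for v v'
        unfolding a_def by (intro square_summable_product(1) E_Bessel(1) T_sq l)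
      then have B_sum: "B summable_on UNIV"
        unfolding B_def by (intro summable_on_cmult_right summable_on_finite_sum) (use vs_fin in auto)
      have ul: "uniform_limit (cball z 1) (\<lambda>X \<zeta>. \<Sum>j\<in>X. weight \<zeta> j * (A l \<zeta> j * cnj (A l (cnj \<zeta>) j))) (H l)
          (finite_subsets_at_top UNIV)"
        unfolding H_eq[abs_def]
        by (rule Weierstrass_m_test_general[OF _ B_sum]) (rule dom)
      have hol: "(\<lambda>\<zeta>. \<Sum>j\<in>X. weight \<zeta> j * (A l \<zeta> j * cnj (A l (cnj \<zeta>) j))) holomorphic_on U" for X U
        unfolding cnj_A_a[OF l] unfolding A_a[OF l] weight_def gbinomial_prod_rev ex_def
        by (intro holomorphic_intros) auto
      show ?thesis
        by (rule holomorphic_uniform_limit[OF _ ul])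
          (use hol in \<open>auto intro!: always_eventually holomorphic_on_imp_continuous_on\<close>)
    qed
    then have "H l holomorphic_on (\<Union>z. ball z 1)"
      by (intro holomorphic_on_UN_open) auto
    moreover have "(\<Union>z::complex. ball z 1) = UNIV" by (auto intro: exI[of _ "_::complex"])
    ultimately show ?thesis by simp
  qed

  \<comment> \<open>Used with R = 1 on the left edge and with crude constants inside the
    strip.\<close>
  have H_bound: "cmod (H l \<zeta>) \<le> K * (c * R\<^sup>2)"
    if l: "l \<in> L" and K: "\<And>k. cmod ((\<zeta> gchoose k) * of_real s ^ k) \<le> K" and R: "\<And>x. cmod (W \<zeta> x) \<le> R" for l \<zeta> K R
  proof -
    have R': "cmod (W (cnj \<zeta>) x) \<le> R" for x using R[of x] by (simp add: W_cnj)
    have "sqnorm_L2 M (Wg l \<xi>) \<le> R\<^sup>2" if \<xi>: "\<And>x. cmod (W \<xi> x) \<le> R" for \<xi>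
    proof -
      have "sqnorm_L2 M (Wg l \<xi>) \<le> (LINT x|M. R\<^sup>2 * (cmod (g l x))\<^sup>2)"
        unfolding sqnorm_L2_def
      proof (rule integral_mono)
        show "integrable M (\<lambda>x. (cmod (Wg l \<xi> x))\<^sup>2)"
          using Wg_sq[OF l, of \<xi>] by (simp add: square_integrable_def)
        show "integrable M (\<lambda>x. R\<^sup>2 * (cmod (g l x))\<^sup>2)"
          using g[OF l] by (simp add: square_integrable_def)
        show "(cmod (Wg l \<xi> x))\<^sup>2 \<le> R\<^sup>2 * (cmod (g l x))\<^sup>2" for x
          unfolding Wg_def norm_mult power_mult_distrib by (intro mult_right_mono power_mono \<xi>) auto
      qed
      also have "\<dots> = R\<^sup>2 * sqnorm_L2 M (g l)" by (simp add: sqnorm_L2_def)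
      also have "sqnorm_L2 M (g l) = 1"
        using g_orth[OF l l] inner_L2_self[of M "g l"] by (metis of_real_eq_1_iff)
      finally show ?thesis by simp
    qed
    then have 1: "sqnorm_L2 M (Wg l \<zeta>) \<le> R\<^sup>2" "sqnorm_L2 M (Wg l (cnj \<zeta>)) \<le> R\<^sup>2"
      using R R' by auto
    have K0: "0 \<le> K" using K[of 0] norm_ge_zero order_trans by blast
    have "cmod (H l \<zeta>) \<le> K * (c * (sqnorm_L2 M (Wg l \<zeta>) + sqnorm_L2 M (Wg l (cnj \<zeta>))) / 2)"
      unfolding H_def by (rule form_bound(2)[OF Wg_sq Wg_sq K]) (use l in auto)
    also have "c * (sqnorm_L2 M (Wg l \<zeta>) + sqnorm_L2 M (Wg l (cnj \<zeta>))) / 2 \<le> c * R\<^sup>2"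
      using mult_left_mono[OF 1(1), of c] mult_left_mono[OF 1(2), of c] c_pos unfolding distrib_left by argo
    then have "K * (c * (sqnorm_L2 M (Wg l \<zeta>) + sqnorm_L2 M (Wg l (cnj \<zeta>))) / 2) \<le> K * (c * R\<^sup>2)"
      by (rule mult_left_mono[OF _ K0])
    finally show ?thesis .
  qed

  \<comment> \<open>The exponent of b is affine in \<zeta>: its real part is \<alpha> on the left
    edge and \<alpha>/2 on the right one, and it equals 1 at \<zeta> = 0.\<close>
  define \<beta> where "\<beta> \<zeta> = of_real \<alpha> * (1 - (\<zeta> + 1) / (2 * (of_nat N + 1)))" for \<zeta> :: complex
  define F where "F \<zeta> = (\<Sum>l\<in>L. exp (\<beta> \<zeta> * of_real (ln (b l))) * H l \<zeta>)" for \<zeta>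
  have \<alpha>_pos: "0 < \<alpha>" unfolding \<alpha>_def by (intro divide_pos_pos) auto
  have Re_\<beta>: "Re (\<beta> \<zeta>) = \<alpha> * (1 - (Re \<zeta> + 1) / (2 * (real N + 1)))" for \<zeta>
  proof -
    have "(\<zeta> + 1) / (2 * (of_nat N + 1)) = (\<zeta> + 1) / of_real (2 * (real N + 1))" by simp
    then have "Re ((\<zeta> + 1) / (2 * (of_nat N + 1))) = (Re \<zeta> + 1) / (2 * (real N + 1))"
      by (simp only: Re_divide_of_real plus_complex.sel one_complex.sel)
    then show ?thesis unfolding \<beta>_def by (simp add: Re_divide_of_real)
  qed
  have exp_\<beta>: "cmod (exp (\<beta> \<zeta> * of_real (ln (b l)))) = b l powr (Re (\<beta> \<zeta>))" if "l \<in> L" for \<zeta> l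
    using b[OF that] by (simp add: powr_def)
  have F_hol: "F holomorphic_on UNIV"
    unfolding F_def \<beta>_def by (intro holomorphic_intros H_hol) auto

  define B where "B = Max (insert 0 (range V))"
  \<comment> \<open>Inside the strip some exponential growth bound suffices, however large. The
    absolute value of the logarithm covers coefficients b on both sides of 1.\<close>
  define A0 where "A0 = (\<Sum>l\<in>L. exp (\<alpha> * \<bar>ln (b l)\<bar>)) * (c * ((1 + B) ^ (N + 1))\<^sup>2)"
  have B: "0 \<le> B" "\<And>x. V x \<le> B"
    unfolding B_def by (intro Max_ge finite.insertI V_fin; simp)+
  have "cmod (F 0) \<le> (c + \<kappa> * exp 1) * exp (2 * ((- 1)\<^sup>2 + (real N)\<^sup>2))"
  proof (rule three_lines[OF F_hol])
    show "- 1 < (0::real)" "0 < real N" using N_pos by auto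
    have \<kappa>: "0 \<le> \<kappa>" by (rule order_trans[OF _ dispersive]) simp
    then show M0: "0 < c + \<kappa> * exp 1" using c_pos by (simp add: add_pos_nonneg)
    fix y :: real
    show "cmod (F (Complex (- 1) y)) \<le> (c + \<kappa> * exp 1) * exp (y\<^sup>2)"
    proof -
      let ?\<zeta> = "Complex (- 1) y"
      \<comment> \<open>On this edge |W| \<le> 1 and the factor from b has modulus
        \<open>b l powr \<alpha>\<close>, so the normalisation of b finishes the estimate.\<close>
      have "cmod (F ?\<zeta>) \<le> (\<Sum>l\<in>L. b l powr \<alpha> * (exp (y\<^sup>2) * (c * 1\<^sup>2)))"
        unfolding F_def
      proof (rule sum_norm_le)
        fix l assume l: "l \<in> L"
        have "cmod (H l ?\<zeta>) \<le> exp (y\<^sup>2) * (c * 1\<^sup>2)"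
        proof (rule H_bound[OF l])
          fix k
          have "cmod (?\<zeta> gchoose k) * s ^ k \<le> exp (y\<^sup>2) * 1"
            using s_pos s_less_1 by (intro mult_mono norm_gbinomial_minus_one_le power_le_one) auto
          then show "cmod ((?\<zeta> gchoose k) * of_real s ^ k) \<le> exp (y\<^sup>2)"
            using s_pos by (simp add: norm_mult norm_power)
        qed (simp add: nW)
        moreover have "cmod (exp (\<beta> ?\<zeta> * of_real (ln (b l)))) = b l powr \<alpha>"
          unfolding exp_\<beta>[OF l] Re_\<beta> by simp
        ultimately show "cmod (exp (\<beta> ?\<zeta> * of_real (ln (b l))) * H l ?\<zeta>) \<le> b l powr \<alpha> * (exp (y\<^sup>2) * (c * 1\<^sup>2))"
          unfolding norm_mult by (intro mult_mono) auto
      qed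
      also have "\<dots> = c * exp (y\<^sup>2)"
        by (simp add: sum_distrib_right[symmetric] b_sum)
      also have "\<dots> \<le> (c + \<kappa> * exp 1) * exp (y\<^sup>2)" using \<kappa> by (intro mult_right_mono) auto
      finally show ?thesis .
    qed
    show "cmod (F (Complex (real N) y)) \<le> (c + \<kappa> * exp 1) * exp (y\<^sup>2)"
    proof -
      interpret P: pair_sigma_finite M M ..
      let ?\<zeta> = "Complex (real N) y"
      have nW2: "(cmod (W ?\<zeta> x))\<^sup>2 = V x ^ (N + 1)" for x
      proof (cases "V x = 0")
        case False
        have "(V x powr ((real N + 1) / 2))\<^sup>2 = V x powr ((real N + 1) / 2 + (real N + 1) / 2)"
          unfolding powr_add by (simp add: power2_eq_square)
        also have "\<dots> = V x powr real (N + 1)" by (rule arg_cong[where f="\<lambda>a. V x powr a"]) simp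
        finally show ?thesis using False Vpos[of x] by (simp add: nW powr_realpow del: of_nat_add of_nat_Suc)
      qed (simp add: nW)
      have W_sq: "square_integrable M (W ?\<zeta>)"
        unfolding square_integrable_def nW2 using V_int by simp
      have Wg_int: "integrable M (Wg l ?\<zeta>)" if "l \<in> L" for l
        using integrable_inner_L2[OF W_sq square_integrable_cnj[OF g[OF that]]] by (simp add: Wg_def[abs_def])
      have Wg_int': "integrable M (Wg l (cnj ?\<zeta>))" if "l \<in> L" for l
        using integrable_inner_L2[OF square_integrable_cnj[OF W_sq] square_integrable_cnj[OF g[OF that]]]
        by (simp add: Wg_def[abs_def] W_cnj)
      \<comment> \<open>The form at g_l is the pairing of one fixed function Q on the product space
        with the tensor \<open>G l\<close>. These tensors are orthonormal, so all values together
        are bounded in l^2 by the norm of Q, which is the Hilbert-Schmidt norm of the weighted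
        kernel.\<close>
      define G where "G l p = g l (fst p) * cnj (g l (snd p))" for l p
      define Q where "Q p = weighted_kernel ?\<zeta> p * (W ?\<zeta> (fst p) * W ?\<zeta> (snd p))" for p
      have int2: "integrable (M \<Otimes>\<^sub>M M) (\<lambda>p. complex_of_real ((cmod (f (fst p)))\<^sup>2) * complex_of_real ((cmod (h (snd p)))\<^sup>2))"
        "(LINT p|(M \<Otimes>\<^sub>M M). complex_of_real ((cmod (f (fst p)))\<^sup>2) * complex_of_real ((cmod (h (snd p)))\<^sup>2))
          = of_real (sqnorm_L2 M f * sqnorm_L2 M h)"
        if "square_integrable M f" "square_integrable M h" for f h
        using that P.integral_product_mult[of "\<lambda>x. complex_of_real ((cmod (f x))\<^sup>2)" "\<lambda>x. complex_of_real ((cmod (h x))\<^sup>2)"]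
        by (auto simp: square_integrable_def sqnorm_L2_def integral_complex_of_real simp del: of_real_power)
      have int2r: "integrable (M \<Otimes>\<^sub>M M) (\<lambda>p. (cmod (f (fst p)))\<^sup>2 * (cmod (h (snd p)))\<^sup>2)"
        "(LINT p|(M \<Otimes>\<^sub>M M). (cmod (f (fst p)))\<^sup>2 * (cmod (h (snd p)))\<^sup>2) = sqnorm_L2 M f * sqnorm_L2 M h"
        if "square_integrable M f" "square_integrable M h" for f h
      proof -
        have i: "integrable (M \<Otimes>\<^sub>M M) (\<lambda>p. complex_of_real ((cmod (f (fst p)))\<^sup>2 * (cmod (h (snd p)))\<^sup>2))"
          using int2(1)[OF that] by simp
        then show "integrable (M \<Otimes>\<^sub>M M) (\<lambda>p. (cmod (f (fst p)))\<^sup>2 * (cmod (h (snd p)))\<^sup>2)"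
          unfolding complex_of_real_integrable_eq .
        have "complex_of_real (LINT p|(M \<Otimes>\<^sub>M M). (cmod (f (fst p)))\<^sup>2 * (cmod (h (snd p)))\<^sup>2)
            = of_real (sqnorm_L2 M f * sqnorm_L2 M h)"
          using int2(2)[OF that] by (simp add: integral_complex_of_real[symmetric] del: integral_complex_of_real)
        then show "(LINT p|(M \<Otimes>\<^sub>M M). (cmod (f (fst p)))\<^sup>2 * (cmod (h (snd p)))\<^sup>2) = sqnorm_L2 M f * sqnorm_L2 M h"
          using of_real_eq_iff by blast
      qed
      have G_sq: "square_integrable (M \<Otimes>\<^sub>M M) (G l)" if "l \<in> L" for l
        unfolding square_integrable_def G_def using int2r(1)[OF g[OF that] g[OF that]] that
        by (auto simp: norm_mult power_mult_distrib)
      have G_orth: "inner_L2 (M \<Otimes>\<^sub>M M) (G l) (G m) = (if l = m then of_real 1 else 0)" if "l \<in> L" "m \<in> L" for l m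
      proof -
        have "inner_L2 (M \<Otimes>\<^sub>M M) (G l) (G m)
            = (LINT p|(M \<Otimes>\<^sub>M M). (g l (fst p) * cnj (g m (fst p))) * (cnj (g l (snd p)) * g m (snd p)))"
          unfolding inner_L2_def G_def by (rule Bochner_Integration.integral_cong) (auto simp: mult_ac)
        also have "\<dots> = inner_L2 M (g l) (g m) * (LINT x|M. cnj (g l x) * g m x)"
          unfolding inner_L2_def
          using integrable_inner_L2[OF g g, OF that] integrable_inner_L2[OF g g, OF that(2,1)]
          by (subst P.integral_product_mult(2)) (auto simp: mult.commute)
        also have "(LINT x|M. cnj (g l x) * g m x) = inner_L2 M (g m) (g l)"
          unfolding inner_L2_def by (simp add: mult.commute)
        finally show ?thesis using g_orth that by auto
      qed
      have Qle: "(cmod (Q p))\<^sup>2 \<le> (\<kappa> * exp (1 + y\<^sup>2))\<^sup>2 * ((cmod (W ?\<zeta> (fst p)))\<^sup>2 * (cmod (W ?\<zeta> (snd p)))\<^sup>2)" for p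
      proof -
        have "cmod (weighted_kernel ?\<zeta> p) \<le> \<kappa> * exp (1 + y\<^sup>2)"
          using weighted_kernel_le[of ?\<zeta> p] by simp
        then show ?thesis unfolding Q_def norm_mult power_mult_distrib[symmetric]
          by (intro power_mono mult_right_mono) auto
      qed
      have Q_sq: "square_integrable (M \<Otimes>\<^sub>M M) Q"
      proof -
        have [measurable]: "Q \<in> borel_measurable (M \<Otimes>\<^sub>M M)" unfolding Q_def by measurable
        have "integrable (M \<Otimes>\<^sub>M M) (\<lambda>p. (cmod (Q p))\<^sup>2)"
          by (rule Bochner_Integration.integrable_bound[OF integrable_mult_right[OF int2r(1)[OF W_sq W_sq], of "(\<kappa> * exp (1 + y\<^sup>2))\<^sup>2"]])
            (measurable, use Qle in auto)
        then show ?thesis by (simp add: square_integrable_def)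
      qed
      have W1: "sqnorm_L2 M (W ?\<zeta>) = 1" unfolding sqnorm_L2_def nW2 by (rule V_norm)
      have "sqnorm_L2 (M \<Otimes>\<^sub>M M) Q \<le> (LINT p|(M \<Otimes>\<^sub>M M). (\<kappa> * exp (1 + y\<^sup>2))\<^sup>2 * ((cmod (W ?\<zeta> (fst p)))\<^sup>2 * (cmod (W ?\<zeta> (snd p)))\<^sup>2))"
        unfolding sqnorm_L2_def
        using Q_sq by (intro integral_mono integrable_mult_right int2r(1) W_sq Qle) (auto simp: square_integrable_def)
      also have "\<dots> = (\<kappa> * exp (1 + y\<^sup>2))\<^sup>2"
        using int2r(2)[OF W_sq W_sq] by (simp add: W1)
      finally have Q1: "sqnorm_L2 (M \<Otimes>\<^sub>M M) Q \<le> (\<kappa> * exp (1 + y\<^sup>2))\<^sup>2" .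
      have HQ: "H l ?\<zeta> = inner_L2 (M \<Otimes>\<^sub>M M) Q (G l)" if "l \<in> L" for l
        unfolding H_def form_eq_integral[OF Wg_sq[OF that] Wg_int[OF that] Wg_sq[OF that] Wg_int'[OF that]] inner_L2_def
        by (rule Bochner_Integration.integral_cong) (auto simp: Wg_def Q_def G_def W_cnj[of ?\<zeta>] mult_ac)
      have HS: "(\<Sum>l\<in>L. (cmod (H l ?\<zeta>))\<^sup>2) \<le> (\<kappa> * exp (1 + y\<^sup>2))\<^sup>2"
      proof -
        have "(\<Sum>l\<in>L. (cmod (inner_L2 (M \<Otimes>\<^sub>M M) Q (G l)))\<^sup>2) \<le> 1 * sqnorm_L2 (M \<Otimes>\<^sub>M M) Q"
          by (rule Bessel_finite[OF L]) (use G_sq G_orth Q_sq in auto)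
        then show ?thesis using Q1 HQ by simp
      qed
      \<comment> \<open>On this edge the factors from b have moduli
        \<open>b l powr (\<alpha> / 2)\<close>, a unit vector in l^2, so Cauchy-Schwarz against the
        l^2 bound \<open>HS\<close> closes the estimate.\<close>
      have bh: "(\<Sum>l\<in>L. (b l powr (\<alpha> / 2))\<^sup>2) = 1"
        using b_sum b by (simp add: power2_eq_square flip: powr_add)
      have e: "cmod (exp (\<beta> ?\<zeta> * of_real (ln (b l)))) = b l powr (\<alpha> / 2)" if "l \<in> L" for l
      proof -
        have "Re (\<beta> ?\<zeta>) = \<alpha> / 2" unfolding Re_\<beta> by (simp add: field_simps)
        then show ?thesis unfolding exp_\<beta>[OF that] by (simp only:)
      qed
      have "cmod (F ?\<zeta>) \<le> (\<Sum>l\<in>L. b l powr (\<alpha> / 2) * cmod (H l ?\<zeta>))"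
        unfolding F_def by (rule sum_norm_le) (simp only: norm_mult e order_refl)
      also have "\<dots> \<le> L2_set (\<lambda>l. b l powr (\<alpha> / 2)) L * L2_set (\<lambda>l. cmod (H l ?\<zeta>)) L"
        using L2_set_mult_ineq[of "\<lambda>l. b l powr (\<alpha> / 2)" "\<lambda>l. cmod (H l ?\<zeta>)" L] by simp
      also have "\<dots> \<le> 1 * (\<kappa> * exp (1 + y\<^sup>2))"
        unfolding L2_set_def bh using HS \<kappa>
        by (intro mult_mono real_le_lsqrt) (auto intro: sum_nonneg)
      also have "\<dots> \<le> (c + \<kappa> * exp 1) * exp (y\<^sup>2)"
        using c_pos by (simp add: exp_add algebra_simps)
      finally show ?thesis .
    qed
  next
    show "0 \<le> A0" unfolding A0_def using c_pos by (intro mult_nonneg_nonneg sum_nonneg) auto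
    show "0 \<le> - ln (1 - s)" using s_pos s_less_1 by simp
    fix \<zeta> :: complex assume \<zeta>: "- 1 \<le> Re \<zeta>" "Re \<zeta> \<le> real N"
    \<comment> \<open>V may lie on either side of 1, so the base is enlarged to 1 + B before the
      exponent is enlarged.\<close>
    have R: "cmod (W \<zeta> x) \<le> (1 + B) ^ (N + 1)" for x
    proof -
      have "V x powr ((Re \<zeta> + 1) / 2) \<le> (1 + B) powr ((Re \<zeta> + 1) / 2)"
        using V_nonneg[of x] B(2)[of x] \<zeta> by (intro powr_mono2) auto
      also have "\<dots> \<le> (1 + B) powr (real (N + 1))"
        using B \<zeta> by (intro powr_mono) auto
      also have "\<dots> = (1 + B) ^ (N + 1)" using B by (subst powr_realpow) auto
      finally show ?thesis using B by (simp add: nW)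
    qed
    have "cmod (F \<zeta>) \<le> (\<Sum>l\<in>L. exp (\<alpha> * \<bar>ln (b l)\<bar>) * ((1 - s) powr (- cmod \<zeta>) * (c * ((1 + B) ^ (N + 1))\<^sup>2)))"
      unfolding F_def
    proof (rule sum_norm_le)
      fix l assume l: "l \<in> L"
      have "(Re \<zeta> + 1) / (2 * (real N + 1)) \<le> 1" "0 \<le> (Re \<zeta> + 1) / (2 * (real N + 1))"
        using \<zeta> by (auto simp: divide_le_eq)
      then have "\<bar>Re (\<beta> \<zeta>)\<bar> \<le> \<alpha>" unfolding Re_\<beta> using \<alpha>_pos by (simp add: abs_mult)
      then have "Re (\<beta> \<zeta>) * ln (b l) \<le> \<alpha> * \<bar>ln (b l)\<bar>"
        using abs_ge_self[of "Re (\<beta> \<zeta>) * ln (b l)"] mult_right_mono[of "\<bar>Re (\<beta> \<zeta>)\<bar>" \<alpha> "\<bar>ln (b l)\<bar>"]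
        unfolding abs_mult by linarith
      then have "cmod (exp (\<beta> \<zeta> * of_real (ln (b l)))) \<le> exp (\<alpha> * \<bar>ln (b l)\<bar>)"
        unfolding exp_\<beta>[OF l] using b[OF l] by (simp add: powr_def)
      then show "cmod (exp (\<beta> \<zeta> * of_real (ln (b l))) * H l \<zeta>)
          \<le> exp (\<alpha> * \<bar>ln (b l)\<bar>) * ((1 - s) powr (- cmod \<zeta>) * (c * ((1 + B) ^ (N + 1))\<^sup>2))"
        unfolding norm_mult by (intro mult_mono H_bound[OF l coeff_le_powr R]) auto
    qed
    also have "\<dots> = A0 * exp (- ln (1 - s) * cmod \<zeta>)"
      using s_less_1 by (simp add: A0_def sum_distrib_left sum_distrib_right powr_def mult_ac)
    finally show "cmod (F \<zeta>) \<le> A0 * exp (- ln (1 - s) * cmod \<zeta>)" .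
  qed

  moreover have "F 0 = of_real (\<Sum>l\<in>L. b l * (\<Sum>\<^sub>\<infinity>i. \<sigma> i * (cmod (inner_L2 M (\<lambda>x. of_real (sqrt (V x)) * g l x) (e i)))\<^sup>2))"
  proof -
    have "H l 0 = of_real (\<Sum>\<^sub>\<infinity>i. \<sigma> i * (cmod (inner_L2 M (\<lambda>x. of_real (sqrt (V x)) * g l x) (e i)))\<^sup>2)"
      if l: "l \<in> L" for l
    proof -
      have W0: "W 0 x = of_real (sqrt (V x))" for x
        using Vpos[of x] exp_of_real[where 'a=complex, of "ln (V x) / 2"]
        by (auto simp: W_def powr_half_sqrt[symmetric] powr_def)
      have A0: "A l 0 (0, i) = inner_L2 M (\<lambda>x. of_real (sqrt (V x)) * g l x) (e i)" for i
        unfolding A_def Wg_def[abs_def] W0 E_def by simp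
      \<comment> \<open>At \<zeta> = 0 the binomial coefficient vanishes except for k = 0, so only
        the original waves remain.\<close>
      have "H l 0 = (\<Sum>\<^sub>\<infinity>j\<in>Pair 0 ` UNIV. weight 0 j * (A l 0 j * cnj (A l 0 j)))"
        unfolding H_eq
      proof (rule infsum_cong_neutral)
        fix j :: "nat \<times> 'i" assume "j \<in> UNIV - Pair 0 ` UNIV"
        then have "fst j \<noteq> 0" by (cases j) auto
        then have "weight 0 j = 0" by (simp add: weight_def gbinomial_0_left)
        then show "weight 0 j * (A l 0 j * cnj (A l (cnj 0) j)) = 0" by simp
      qed auto
      also have "\<dots> = (\<Sum>\<^sub>\<infinity>i. weight 0 (0, i) * (A l 0 (0, i) * cnj (A l 0 (0, i))))"
        by (subst infsum_reindex) (auto intro: inj_onI simp: o_def)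
      also have "\<dots> = (\<Sum>\<^sub>\<infinity>i. of_real (\<sigma> i * (cmod (A l 0 (0, i)))\<^sup>2))"
        by (simp add: weight_def complex_norm_square del: of_real_power)
      also have "\<dots> = of_real (\<Sum>\<^sub>\<infinity>i. \<sigma> i * (cmod (A l 0 (0, i)))\<^sup>2)"
        unfolding infsum_of_real_complex ..
      finally show ?thesis unfolding A0 .
    qed
    moreover have "exp (\<beta> 0 * of_real (ln (b l))) = of_real (b l)" if "l \<in> L" for l
    proof -
      have "\<beta> 0 = of_real (\<alpha> * (1 - 1 / (2 * (real N + 1))))" by (simp add: \<beta>_def)
      also have "\<alpha> * (1 - 1 / (2 * (real N + 1))) = 1"
      proof -
        have "2 + (real N * 6 + real N * (real N * 4)) > 0" by (intro add_pos_nonneg) auto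
        then show ?thesis by (simp add: \<alpha>_def field_simps)
      qed
      finally show ?thesis using b[OF that] by (simp add: exp_of_real)
    qed
    ultimately show ?thesis unfolding F_def by simp
  qed
  ultimately have "\<bar>\<Sum>l\<in>L. b l * (\<Sum>\<^sub>\<infinity>i. \<sigma> i * (cmod (inner_L2 M (\<lambda>x. of_real (sqrt (V x)) * g l x) (e i)))\<^sup>2)\<bar>
      \<le> (c + \<kappa> * exp 1) * exp (2 * ((- 1)\<^sup>2 + (real N)\<^sup>2))"
    by (simp only: norm_of_real)
  then show ?thesis by simp
qed

end

subsection \<open>The weighted energy bound\<close>

lemma sqnorm_L2_combination:
  assumes "square_integrable M f" "square_integrable M h"
  shows "sqnorm_L2 M (\<lambda>x. a * f x + b * h x)
    = (cmod a)\<^sup>2 * sqnorm_L2 M f + (cmod b)\<^sup>2 * sqnorm_L2 M h + 2 * Re (a * cnj b * inner_L2 M f h)"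
proof -
  have "sqnorm_L2 M (\<lambda>x. a * f x + b * h x) = sqnorm_L2 M (\<lambda>x. a * f x - (- b) * h x)" by simp
  also have "\<dots> = sqnorm_L2 M (\<lambda>x. a * f x) - 2 * Re (inner_L2 M (\<lambda>x. a * f x) (\<lambda>x. (- b) * h x)) + sqnorm_L2 M (\<lambda>x. (- b) * h x)"
    by (rule sqnorm_L2_diff) (intro square_integrable_cmult assms)+
  also have "inner_L2 M (\<lambda>x. a * f x) (\<lambda>x. (- b) * h x) = - (a * cnj b * inner_L2 M f h)"
  proof -
    have "inner_L2 M (\<lambda>x. a * f x) (\<lambda>x. (- b) * h x) = (LINT x|M. - (a * cnj b) * (f x * cnj (h x)))"
      unfolding inner_L2_def by (rule Bochner_Integration.integral_cong) (auto simp: mult_ac)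
    then show ?thesis by (simp add: inner_L2_def)
  qed
  finally show ?thesis unfolding sqnorm_L2_cmult by simp
qed

text \<open>The maximiser of \<open>\<phi>\<close> over all orthonormal systems diagonalises the Gram matrix, because
  otherwise a small rotation in the plane of two non-orthogonal vectors would increase \<open>\<phi>\<close>.\<close>

lemma exists_diagonalising_rotation:
  fixes J :: "'j set" and T :: "'j \<Rightarrow> 'x \<Rightarrow> complex" and b :: "'j \<Rightarrow> real"
  assumes J: "finite J" and T: "\<And>j. j \<in> J \<Longrightarrow> square_integrable M (T j)" and b: "inj_on b J"
  obtains q :: "'j \<Rightarrow> 'j \<Rightarrow> complex" where
    "\<And>l m. l \<in> J \<Longrightarrow> m \<in> J \<Longrightarrow> (\<Sum>j\<in>J. q l j * cnj (q m j)) = (if l = m then 1 else 0)"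
    "\<And>l m. l \<in> J \<Longrightarrow> m \<in> J \<Longrightarrow> l \<noteq> m \<Longrightarrow>
       inner_L2 M (\<lambda>x. \<Sum>j\<in>J. q l j * T j x) (\<lambda>x. \<Sum>j\<in>J. q m j * T j x) = 0"
    "(\<Sum>j\<in>J. b j * sqnorm_L2 M (T j)) \<le> (\<Sum>l\<in>J. b l * sqnorm_L2 M (\<lambda>x. \<Sum>j\<in>J. q l j * T j x))"
proof -
  define rows where "rows q l m = (\<Sum>j\<in>J. q (l, j) * cnj (q (m, j)))" for q :: "'j \<times> 'j \<Rightarrow> complex" and l m
  \<comment> \<open>Matrices are functions on all pairs of indices. Fixing the entries outside J
    \<times> J to 0 and confining the others to the unit disc gives a product of compact sets, so a
    maximiser exists on the closed subset \<open>U\<close>.\<close>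
  define X where "X = PiE UNIV (\<lambda>p. if p \<in> J \<times> J then cball 0 1 else {0::complex})"
  define U where "U = X \<inter> {q. \<forall>l\<in>J. \<forall>m\<in>J. rows q l m = (if l = m then 1 else 0)}"
  define y where "y q l = (\<lambda>x. \<Sum>j\<in>J. q (l, j) * T j x)" for q :: "'j \<times> 'j \<Rightarrow> complex" and l
  define \<phi> where "\<phi> q = (\<Sum>l\<in>J. b l * sqnorm_L2 M (y q l))" for q
  have cont: "continuous_on A (\<lambda>q::'j \<times> 'j \<Rightarrow> complex. q p)" for A p
    by (rule continuous_on_subset[OF continuous_on_product_coordinates]) simp
  have y_sq: "square_integrable M (y q l)" for q l
    unfolding y_def by (intro square_integrable_sum square_integrable_cmult T)
  have "compact X"
  proof -
    have "compactin (product_topology (\<lambda>_. euclidean) UNIV) X"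
      unfolding X_def compactin_PiE by auto
    then show ?thesis by (simp add: euclidean_product_topology)
  qed
  moreover have "closed {q. \<forall>l\<in>J. \<forall>m\<in>J. rows q l m = (if l = m then 1 else 0)}"
  proof -
    have "closed {q. \<forall>p\<in>J \<times> J. rows q (fst p) (snd p) = (if fst p = snd p then 1 else 0)}"
      unfolding rows_def Collect_ball_eq
      by (intro closed_INT ballI closed_Collect_eq continuous_intros cont)
    then show ?thesis by (rule back_subst[of closed]) auto
  qed
  ultimately have "compact U" unfolding U_def by (rule compact_Int_closed)
  moreover have id_U: "(\<lambda>p. if p \<in> J \<times> J \<and> fst p = snd p then 1 else 0) \<in> U" (is "?id \<in> U")
  proof -
    have "rows ?id l m = (if l = m then 1 else 0)" if "l \<in> J" "m \<in> J" for l m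
    proof -
      have "rows ?id l m = (\<Sum>j\<in>J. if j = l then (if l = m then 1 else 0) else 0)"
        unfolding rows_def by (rule sum.cong) (use that in auto)
      then show ?thesis using that J by simp
    qed
    moreover have "?id \<in> X" unfolding X_def by auto
    ultimately show ?thesis unfolding U_def by blast
  qed
  moreover have "continuous_on U \<phi>"
  proof -
    have "sqnorm_L2 M (y q l) = Re (\<Sum>j\<in>J. q (l, j) * (\<Sum>k\<in>J. cnj (q (l, k)) * inner_L2 M (T j) (T k)))" for q l
    proof -
      have "complex_of_real (sqnorm_L2 M (y q l)) = (\<Sum>j\<in>J. q (l, j) * (\<Sum>k\<in>J. cnj (q (l, k)) * inner_L2 M (T j) (T k)))"
        unfolding inner_L2_self[symmetric] y_def using T
        by (simp add: inner_L2_sum_left inner_L2_sum_right square_integrable_sum square_integrable_cmult)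
      then show ?thesis by (metis Re_complex_of_real)
    qed
    then show ?thesis unfolding \<phi>_def
      by (simp only:) (intro continuous_intros cont)
  qed
  ultimately obtain q where q: "q \<in> U" and qmax: "\<And>q'. q' \<in> U \<Longrightarrow> \<phi> q' \<le> \<phi> q"
    using continuous_attains_sup[of U \<phi>] by blast
  have rows: "rows q l m = (if l = m then 1 else 0)" if "l \<in> J" "m \<in> J" for l m
    using q that by (auto simp: U_def)
  \<comment> \<open>Orthonormal rows have entries of modulus at most 1, so the confinement to the
    disc excludes no competitor.\<close>
  have entry_le_1: "r \<in> X" if r: "\<And>l m. l \<in> J \<Longrightarrow> m \<in> J \<Longrightarrow> rows r l m = (if l = m then 1 else 0)"
    "\<And>p. p \<notin> J \<times> J \<Longrightarrow> r p = 0" for r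
  proof -
    have "cmod (r (l, j)) \<le> 1" if "l \<in> J" "j \<in> J" for l j
    proof -
      have "complex_of_real (\<Sum>j\<in>J. (cmod (r (l, j)))\<^sup>2) = rows r l l"
        by (simp add: rows_def complex_norm_square del: of_real_power)
      then have "(\<Sum>j\<in>J. (cmod (r (l, j)))\<^sup>2) = 1"
        using r(1)[of l l] that by (metis of_real_eq_1_iff)
      moreover have "(cmod (r (l, j)))\<^sup>2 \<le> (\<Sum>j\<in>J. (cmod (r (l, j)))\<^sup>2)"
        using J that by (intro member_le_sum) auto
      ultimately have "(cmod (r (l, j)))\<^sup>2 \<le> 1" by simp
      then show ?thesis by (simp add: power2_le_iff_abs_le[of 1, simplified] power_le_one_iff)
    qed
    then show ?thesis using r(2) by (auto simp: X_def)
  qed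
  have orth: "inner_L2 M (y q l) (y q m) = 0" if l: "l \<in> J" and m: "m \<in> J" and lm: "l \<noteq> m" for l m
  proof (rule ccontr)
    define w where "w = inner_L2 M (y q l) (y q m)"
    assume "inner_L2 M (y q l) (y q m) \<noteq> 0"
    then have w: "cmod w > 0" by (simp add: w_def)
    \<comment> \<open>Rotating the rows l and m changes \<phi> by a multiple of d, so the
      distinctness of the coefficients is what makes a gain possible.\<close>
    define d where "d = b l - b m"
    have d: "d \<noteq> 0" using b l m lm by (auto simp: d_def inj_on_def)
    define A where "A = sqnorm_L2 M (y q l)"
    define B where "B = sqnorm_L2 M (y q m)"
    \<comment> \<open>The tangent of the rotation angle. The gain is of order t |d| |w|, the
      second-order loss at most of order t^2 |d| |A - B|, and this choice makes t |A - B| < |w|. The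
      factor \<open>C\<close> below normalises the rotated rows.\<close>
    define t where "t = cmod w / (1 + \<bar>A - B\<bar>)"
    have t: "t > 0" unfolding t_def using w by (intro divide_pos_pos) auto
    define C where "C = 1 / sqrt (1 + t\<^sup>2)"
    have C: "C\<^sup>2 * (1 + t\<^sup>2) = 1" "C > 0"
    proof -
      have "0 < 1 + t\<^sup>2" by (simp add: add_pos_nonneg)
      then show "C\<^sup>2 * (1 + t\<^sup>2) = 1" "C > 0" by (auto simp: C_def power_divide)
    qed
    \<comment> \<open>The phase aligns the two rows, and the sign of d turns the rotation towards
      the row with the larger coefficient.\<close>
    define u where "u = of_real (sgn d) * (w / of_real (cmod w))"
    have u: "cmod u = 1" using d w by (simp add: u_def norm_mult norm_divide sgn_if)
    have uu: "u * cnj u = 1" using u by (simp add: complex_norm_square[symmetric])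
    have Rr: "Re (complex_of_real r * z) = r * Re z" for r z by simp
    have uu2: "u * (cnj u * x) = x" "cnj u * (u * x) = x" for x
      using uu by (metis mult.assoc mult.commute mult_1)+
    have duw: "d * Re (cnj u * w) = \<bar>d\<bar> * cmod w"
    proof -
      have "cnj u * w = of_real (sgn d) * (cnj w * w / of_real (cmod w))" by (simp add: u_def)
      also have "cnj w * w = of_real (cmod w * cmod w)"
        by (simp add: complex_norm_square[symmetric] mult.commute power2_eq_square[symmetric])
      also have "of_real (cmod w * cmod w) / complex_of_real (cmod w) = of_real (cmod w)" using w by simp
      finally have "cnj u * w = of_real (sgn d * cmod w)" by simp
      then show ?thesis by (simp add: abs_sgn[of d] mult.assoc)
    qed
    define r where "r p = (if fst p = l then of_real C * q (l, snd p) + of_real (C * t) * u * q (m, snd p)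
        else if fst p = m then of_real C * q (m, snd p) - of_real (C * t) * cnj u * q (l, snd p)
        else q p)" for p
    have q0: "q p = 0" if "p \<notin> J \<times> J" for p
    proof -
      have "q p \<in> (if p \<in> J \<times> J then cball 0 1 else {0})" using q unfolding U_def X_def by blast
      then show ?thesis using that by simp
    qed
    have CC: "complex_of_real C * of_real C * (1 + of_real t * of_real t) = 1"
      using C(1) by (metis of_real_1 of_real_add of_real_mult power2_eq_square)
    have rows_expand:
      "(\<Sum>j\<in>J. (\<alpha> * q (i, j) + \<beta> * q (k, j)) * cnj (\<gamma> * q (i', j) + \<delta> * q (k', j)))
        = \<alpha> * cnj \<gamma> * rows q i i' + \<alpha> * cnj \<delta> * rows q i k' + \<beta> * cnj \<gamma> * rows q k i' + \<beta> * cnj \<delta> * rows q k k'"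
      for \<alpha> \<beta> \<gamma> \<delta> i k i' k'
      unfolding rows_def sum_distrib_left sum.distrib[symmetric]
      by (rule sum.cong) (auto simp: algebra_simps)
    \<comment> \<open>Every row of r is \<open>c1 i\<close> times the old row plus
      \<open>c2 i\<close> times the row of its partner \<open>k1 i\<close>, which is trivial outside
      {l, m}. One expansion then treats all pairs of rows.\<close>
    define c1 where "c1 i = (if i = l then of_real C else if i = m then of_real C else 1 :: complex)" for i
    define k1 where "k1 i = (if i = l then m else if i = m then l else i)" for i
    define c2 where "c2 i = (if i = l then of_real (C * t) * u else if i = m then - (of_real (C * t) * cnj u) else 0)" for i
    have r_c: "r (i, j) = c1 i * q (i, j) + c2 i * q (k1 i, j)" for i j
      using lm by (simp add: r_def c1_def c2_def k1_def)
    have k1J: "k1 i \<in> J" if "i \<in> J" for i using that l m by (simp add: k1_def)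
    have r_rows: "rows r i i' = (if i = i' then 1 else 0)" if "i \<in> J" "i' \<in> J" for i i'
    proof -
      have "rows r i i' = c1 i * cnj (c1 i') * rows q i i' + c1 i * cnj (c2 i') * rows q i (k1 i')
          + c2 i * cnj (c1 i') * rows q (k1 i) i' + c2 i * cnj (c2 i') * rows q (k1 i) (k1 i')"
        unfolding rows_def[of r] r_c rows_expand ..
      also have "\<dots> = (if i = i' then 1 else 0)"
        using that l m lm CC uu
        by (auto simp: rows k1J c1_def c2_def k1_def algebra_simps uu2)
      finally show ?thesis .
    qed
    have "r \<in> U"
      using entry_le_1[OF r_rows] r_rows q0 l m
      by (auto simp: U_def r_def)
    then have "\<phi> r \<le> \<phi> q" by (rule qmax)
    have y_r: "y r i = (\<lambda>x. c1 i * y q i x + c2 i * y q (k1 i) x)" for i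
      unfolding y_def r_c by (auto simp: fun_eq_iff algebra_simps sum.distrib sum_distrib_left)
    have nr: "sqnorm_L2 M (y r i) = (cmod (c1 i))\<^sup>2 * sqnorm_L2 M (y q i) + (cmod (c2 i))\<^sup>2 * sqnorm_L2 M (y q (k1 i))
        + 2 * Re (c1 i * cnj (c2 i) * inner_L2 M (y q i) (y q (k1 i)))" for i
      unfolding y_r by (rule sqnorm_L2_combination[OF y_sq y_sq])
    have "\<phi> r - \<phi> q = (\<Sum>i\<in>J. b i * (sqnorm_L2 M (y r i) - sqnorm_L2 M (y q i)))"
      by (simp add: \<phi>_def sum_subtractf[symmetric] algebra_simps)
    also have "\<dots> = (\<Sum>i\<in>{l, m}. b i * (sqnorm_L2 M (y r i) - sqnorm_L2 M (y q i)))"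
    proof (rule sum.mono_neutral_right[OF J])
      show "\<forall>i\<in>J - {l, m}. b i * (sqnorm_L2 M (y r i) - sqnorm_L2 M (y q i)) = 0"
        unfolding nr by (auto simp: c1_def c2_def)
    qed (use l m in auto)
    also have "\<dots> = b l * (sqnorm_L2 M (y r l) - A) + b m * (sqnorm_L2 M (y r m) - B)"
      using lm by (simp add: A_def B_def)
    also have "sqnorm_L2 M (y r l) = C\<^sup>2 * A + (C * t)\<^sup>2 * B + 2 * (C\<^sup>2 * t) * Re (cnj u * w)"
    proof -
      have e1: "c1 l * cnj (c2 l) * inner_L2 M (y q l) (y q (k1 l)) = of_real (C\<^sup>2 * t) * (cnj u * w)"
        by (simp add: c1_def c2_def k1_def w_def power2_eq_square)
      have R: "Re (c1 l * cnj (c2 l) * inner_L2 M (y q l) (y q (k1 l))) = C\<^sup>2 * t * Re (cnj u * w)"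
        unfolding e1 Rr by simp
      show ?thesis unfolding nr R using lm C(2) t u
        by (simp add: k1_def A_def B_def c1_def c2_def norm_mult power_mult_distrib)
    qed
    also have "sqnorm_L2 M (y r m) = C\<^sup>2 * B + (C * t)\<^sup>2 * A - 2 * (C\<^sup>2 * t) * Re (cnj u * w)"
    proof -
      have i: "inner_L2 M (y q m) (y q l) = cnj w" unfolding w_def by (rule inner_L2_commute)
      have e1: "c1 m * cnj (c2 m) * inner_L2 M (y q m) (y q (k1 m)) = of_real (- (C\<^sup>2 * t)) * cnj (cnj u * w)"
        using lm by (simp add: c1_def c2_def k1_def i power2_eq_square)
      have R: "Re (c1 m * cnj (c2 m) * inner_L2 M (y q m) (y q (k1 m))) = - (C\<^sup>2 * t * Re (cnj u * w))"
        unfolding e1 Rr by simp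
      show ?thesis unfolding nr R using lm C(2) t u
        by (simp add: k1_def A_def B_def c1_def c2_def norm_mult power_mult_distrib)
    qed
    also have "b l * (C\<^sup>2 * A + (C * t)\<^sup>2 * B + 2 * (C\<^sup>2 * t) * Re (cnj u * w) - A)
          + b m * (C\<^sup>2 * B + (C * t)\<^sup>2 * A - 2 * (C\<^sup>2 * t) * Re (cnj u * w) - B)
        = C\<^sup>2 * t * (2 * (d * Re (cnj u * w)) - t * (d * (A - B)))"
    proof -
      have "b l * (C\<^sup>2 * A + (C * t)\<^sup>2 * B + 2 * (C\<^sup>2 * t) * R - A) + b m * (C\<^sup>2 * B + (C * t)\<^sup>2 * A - 2 * (C\<^sup>2 * t) * R - B)
          - C\<^sup>2 * t * (2 * (d * R) - t * (d * (A - B))) = (b l * A + b m * B) * (C\<^sup>2 * (1 + t\<^sup>2) - 1)" for R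
        by (simp add: d_def algebra_simps power2_eq_square)
      then have "b l * (C\<^sup>2 * A + (C * t)\<^sup>2 * B + 2 * (C\<^sup>2 * t) * R - A) + b m * (C\<^sup>2 * B + (C * t)\<^sup>2 * A - 2 * (C\<^sup>2 * t) * R - B)
          = C\<^sup>2 * t * (2 * (d * R) - t * (d * (A - B)))" for R
        unfolding C(1) by (metis diff_self eq_iff_diff_eq_0 mult_zero_right)
      then show ?thesis .
    qed
    finally have eq: "\<phi> r - \<phi> q = C\<^sup>2 * t * (2 * (d * Re (cnj u * w)) - t * (d * (A - B)))" .
    have "0 < C\<^sup>2 * t * (2 * (d * Re (cnj u * w)) - t * (d * (A - B)))"
    proof -
      have "t * (d * (A - B)) \<le> t * (\<bar>d\<bar> * \<bar>A - B\<bar>)"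
        using t abs_ge_self[of "d * (A - B)"] by (intro mult_left_mono) (auto simp: abs_mult)
      also have "\<dots> = \<bar>d\<bar> * (cmod w * (\<bar>A - B\<bar> / (1 + \<bar>A - B\<bar>)))" by (simp add: t_def)
      also have "\<dots> \<le> \<bar>d\<bar> * (cmod w * 1)"
        by (intro mult_left_mono) (auto simp: divide_le_eq_1)
      also have "\<dots> < 2 * (\<bar>d\<bar> * cmod w)" using d w by simp
      finally show ?thesis unfolding duw using C(2) t by simp
    qed
    then have "\<phi> r > \<phi> q" using eq by linarith
    with \<open>\<phi> r \<le> \<phi> q\<close> show False by simp
  qed
  \<comment> \<open>The identity matrix is a competitor, so the maximum is at least the original
    weighted sum.\<close>
  have "\<phi> ?id = (\<Sum>j\<in>J. b j * sqnorm_L2 M (T j))"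
  proof -
    have "y ?id l = T l" if "l \<in> J" for l
    proof
      fix x
      have "y ?id l x = (\<Sum>j\<in>J. if j = l then T l x else 0)"
        unfolding y_def by (rule sum.cong) (use that in auto)
      then show "y ?id l x = T l x" using J that by simp
    qed
    then show ?thesis unfolding \<phi>_def by simp
  qed
  then have max: "(\<Sum>j\<in>J. b j * sqnorm_L2 M (T j)) \<le> \<phi> q" using qmax[OF id_U] by simp
  show thesis
    by (rule that[of "\<lambda>l j. q (l, j)"])
      (use rows orth max in \<open>auto simp: rows_def y_def \<phi>_def\<close>)
qed

lemma inner_L2_cmult_right: "inner_L2 M f (\<lambda>x. c * g x) = cnj c * inner_L2 M f g"
  by (subst inner_L2_commute, subst inner_L2_cmult_left) (simp add: inner_L2_commute[of M f g])

lemma infsum_finite_sum: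
  fixes f :: "'b \<Rightarrow> 'a \<Rightarrow> 'c::{topological_comm_monoid_add,t2_space}"
  assumes "finite S" "\<And>j. j \<in> S \<Longrightarrow> f j summable_on A"
  shows "(\<Sum>\<^sub>\<infinity>x\<in>A. \<Sum>j\<in>S. f j x) = (\<Sum>j\<in>S. infsum (f j) A)"
  using assms
proof (induction S rule: finite_induct)
  case (insert j S)
  then have "(\<Sum>\<^sub>\<infinity>x\<in>A. f j x + (\<Sum>j\<in>S. f j x)) = infsum (f j) A + (\<Sum>\<^sub>\<infinity>x\<in>A. \<Sum>j\<in>S. f j x)"
    by (intro infsum_add summable_on_finite_sum) auto
  then show ?case using insert by simp
qed simp

context dispersive_system
begin

text \<open>The three lines bound on the strip from -1 to N: c stems from the left edge,
  \<open>\<kappa> * exp 1\<close> from the right one, and the last factor is the price of the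
  Gaussian correction.\<close>

definition interpolation_constant :: real where
  "interpolation_constant = (c + \<kappa> * exp 1) * exp (2 * (1 + (real N)\<^sup>2))"

text \<open>Both sides are homogeneous of degree one in b and in V, which enters the left-hand side
  through the square of sqrt V; so the normalisations in \<open>weighted_coefficient_bound\<close>
  can be undone.\<close>

lemma weighted_coefficient_bound_scaled:
  fixes L :: "'l set" and g :: "'l \<Rightarrow> 'x \<Rightarrow> complex" and b :: "'l \<Rightarrow> real" and V :: "'x \<Rightarrow> real"
  defines "\<alpha> \<equiv> 2 * (real N + 1) / (2 * real N + 1)"
  assumes L: "finite L" "L \<noteq> {}"
    and g: "\<And>l. l \<in> L \<Longrightarrow> square_integrable M (g l)"
    and g_orth: "\<And>l m. l \<in> L \<Longrightarrow> m \<in> L \<Longrightarrow> inner_L2 M (g l) (g m) = (if l = m then 1 else 0)"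
    and b: "\<And>l. l \<in> L \<Longrightarrow> 0 < b l"
    and V [measurable]: "V \<in> borel_measurable M" and V_nonneg: "\<And>x. 0 \<le> V x" and V_fin: "finite (range V)"
    and V_int: "integrable M (\<lambda>x. V x ^ (N + 1))" and V_pos: "0 < (LINT x|M. V x ^ (N + 1))"
  shows "(\<Sum>l\<in>L. b l * (\<Sum>\<^sub>\<infinity>i. \<sigma> i * (cmod (inner_L2 M (\<lambda>x. of_real (sqrt (V x)) * g l x) (e i)))\<^sup>2))
    \<le> interpolation_constant * (\<Sum>l\<in>L. b l powr \<alpha>) powr (1 / \<alpha>) * (LINT x|M. V x ^ (N + 1)) powr (1 / (real N + 1))"
proof -
  define B where "B = (\<Sum>l\<in>L. b l powr \<alpha>)"
  define Q where "Q = (LINT x|M. V x ^ (N + 1))"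
  define r where "r = Q powr (1 / (real N + 1))"
  define X where "X l = (\<Sum>\<^sub>\<infinity>i. \<sigma> i * (cmod (inner_L2 M (\<lambda>x. of_real (sqrt (V x)) * g l x) (e i)))\<^sup>2)" for l
  have \<alpha>: "0 < \<alpha>" unfolding \<alpha>_def by (intro divide_pos_pos) auto
  have B: "0 < B" unfolding B_def
  proof (intro sum_pos L)
    show "0 < b l powr \<alpha>" if "l \<in> L" for l using b[OF that] by simp
  qed
  have Q: "0 < Q" using V_pos by (simp add: Q_def)
  have r: "0 < r" using Q by (simp add: r_def)
  have rN: "r ^ (N + 1) = Q"
  proof -
    have "r ^ (N + 1) = r powr real (N + 1)" using r by (subst powr_realpow) auto
    also have "\<dots> = Q" using Q by (simp add: r_def powr_powr add.commute)
    finally show ?thesis .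
  qed
  define b' where "b' l = b l / B powr (1 / \<alpha>)" for l
  define V' where "V' x = V x / r" for x
  have X': "(\<Sum>\<^sub>\<infinity>i. \<sigma> i * (cmod (inner_L2 M (\<lambda>x. of_real (sqrt (V' x)) * g l x) (e i)))\<^sup>2) = X l / r" for l
  proof -
    have "inner_L2 M (\<lambda>x. of_real (sqrt (V' x)) * g l x) (e i)
        = of_real (1 / sqrt r) * inner_L2 M (\<lambda>x. of_real (sqrt (V x)) * g l x) (e i)" for i
      unfolding inner_L2_cmult_left[symmetric] by (simp add: V'_def real_sqrt_divide)
    then have eq: "\<sigma> i * (cmod (inner_L2 M (\<lambda>x. of_real (sqrt (V' x)) * g l x) (e i)))\<^sup>2
        = \<sigma> i * (cmod (inner_L2 M (\<lambda>x. of_real (sqrt (V x)) * g l x) (e i)))\<^sup>2 * (1 / r)" for i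
      using r by (simp add: norm_mult power_mult_distrib power_divide norm_divide)
    show ?thesis unfolding X_def eq by (subst infsum_cmult_left') simp
  qed
  have "(\<Sum>l\<in>L. b' l * (\<Sum>\<^sub>\<infinity>i. \<sigma> i * (cmod (inner_L2 M (\<lambda>x. of_real (sqrt (V' x)) * g l x) (e i)))\<^sup>2))
      \<le> interpolation_constant"
    unfolding interpolation_constant_def
  proof (rule weighted_coefficient_bound[OF L(1) g g_orth])
    show "0 < b' l" if "l \<in> L" for l using b[OF that] B by (simp add: b'_def)
    have "(\<Sum>l\<in>L. b' l powr \<alpha>) = (\<Sum>l\<in>L. b l powr \<alpha> / B)"
      using b B \<alpha> by (intro sum.cong refl) (auto simp: b'_def powr_divide powr_powr less_imp_le)
    then show "(\<Sum>l\<in>L. b' l powr (2 * (real N + 1) / (2 * real N + 1))) = 1"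
      unfolding \<alpha>_def[symmetric] using B by (simp add: B_def flip: sum_divide_distrib)
    have eq: "V' x ^ (N + 1) = V x ^ (N + 1) / Q" for x
      unfolding V'_def power_divide rN ..
    show "integrable M (\<lambda>x. V' x ^ (N + 1))" unfolding eq using V_int by simp
    show "(LINT x|M. V' x ^ (N + 1)) = 1" unfolding eq using Q by (simp add: Q_def)
    show "V' \<in> borel_measurable M" unfolding V'_def by measurable
    show "0 \<le> V' x" for x using V_nonneg[of x] r by (simp add: V'_def)
    have "range V' = (\<lambda>v. v / r) ` range V" by (auto simp: V'_def)
    then show "finite (range V')" using V_fin by simp
  qed
  then have "(\<Sum>l\<in>L. b l * X l) / (B powr (1 / \<alpha>) * r) \<le> interpolation_constant"
    unfolding X' by (simp add: b'_def sum_divide_distrib)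
  then have "(\<Sum>l\<in>L. b l * X l) \<le> interpolation_constant * (B powr (1 / \<alpha>) * r)"
    using B r by (simp add: pos_divide_le_eq)
  then show ?thesis unfolding X_def B_def r_def Q_def by (simp add: mult.assoc)
qed

text \<open>The square root shares the damping between synthesis and analysis: pairing
  \<open>synth a\<close> with a function weighs each coefficient of that function with sqrt
  \<sigma>, and squaring produces the weight \<sigma> of the form at \<zeta> = 0.\<close>

definition synth :: "('i \<Rightarrow> complex) \<Rightarrow> 'x \<Rightarrow> complex" where
  "synth a x = (\<Sum>\<^sub>\<infinity>i. of_real (sqrt (\<sigma> i)) * a i * e i x)"

lemma synth_summable:
  assumes "(\<lambda>i. (cmod (a i))\<^sup>2) summable_on UNIV"
  shows "(\<lambda>i. cmod (of_real (sqrt (\<sigma> i)) * a i * e i x)) summable_on UNIV"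
    and "(\<Sum>\<^sub>\<infinity>i. cmod (of_real (sqrt (\<sigma> i)) * a i * e i x)) \<le> ((\<Sum>\<^sub>\<infinity>i. (cmod (a i))\<^sup>2) + D) / 2"
proof -
  have sq: "(cmod (of_real (sqrt (\<sigma> i)) * e i x))\<^sup>2 = \<sigma> i * (cmod (e i x))\<^sup>2" for i
    using \<sigma>_nonneg[of i] by (simp add: norm_mult power_mult_distrib)
  have eq: "of_real (sqrt (\<sigma> i)) * a i * e i x = a i * (of_real (sqrt (\<sigma> i)) * e i x)" for i by simp
  have s: "(\<lambda>i. (cmod (of_real (sqrt (\<sigma> i)) * e i x))\<^sup>2) summable_on UNIV"
    unfolding sq by (rule diagonal_summable)
  note * = square_summable_product[OF assms s]
  show "(\<lambda>i. cmod (of_real (sqrt (\<sigma> i)) * a i * e i x)) summable_on UNIV"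
    unfolding eq by (rule *(1))
  show "(\<Sum>\<^sub>\<infinity>i. cmod (of_real (sqrt (\<sigma> i)) * a i * e i x)) \<le> ((\<Sum>\<^sub>\<infinity>i. (cmod (a i))\<^sup>2) + D) / 2"
    unfolding eq using *(2) diagonal_le[of x] unfolding sq by argo
qed

lemma synth_measurable:
  assumes "(\<lambda>i. (cmod (a i))\<^sup>2) summable_on UNIV"
  shows "synth a \<in> borel_measurable M"
  unfolding synth_def
  by (intro borel_measurable_infsum_complex abs_summable_summable[OF synth_summable(1)[OF assms]]) measurable

lemma synth_le:
  assumes "(\<lambda>i. (cmod (a i))\<^sup>2) summable_on UNIV"
  shows "cmod (synth a x) \<le> ((\<Sum>\<^sub>\<infinity>i. (cmod (a i))\<^sup>2) + D) / 2"
  unfolding synth_def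
  using norm_infsum_bound[OF synth_summable(1)[OF assms, of x]] synth_summable(2)[OF assms, of x] by linarith

lemma synth_sum:
  assumes J: "finite J" and "\<And>j. j \<in> J \<Longrightarrow> (\<lambda>i. (cmod (a j i))\<^sup>2) summable_on UNIV"
  shows "synth (\<lambda>i. \<Sum>j\<in>J. q j * a j i) x = (\<Sum>j\<in>J. q j * synth (a j) x)"
proof -
  have "(\<Sum>j\<in>J. q j * synth (a j) x) = (\<Sum>j\<in>J. \<Sum>\<^sub>\<infinity>i. q j * (of_real (sqrt (\<sigma> i)) * a j i * e i x))"
    unfolding synth_def using assms
    by (intro sum.cong refl infsum_cmult_right[symmetric] abs_summable_summable[OF synth_summable(1)]) auto
  also have "\<dots> = (\<Sum>\<^sub>\<infinity>i. \<Sum>j\<in>J. q j * (of_real (sqrt (\<sigma> i)) * a j i * e i x))"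
    by (rule infsum_finite_sum[symmetric, OF J])
      (intro summable_on_cmult_right abs_summable_summable[OF synth_summable(1)] assms(2))
  also have "\<dots> = synth (\<lambda>i. \<Sum>j\<in>J. q j * a j i) x"
    unfolding synth_def by (simp add: sum_distrib_left sum_distrib_right mult_ac)
  finally show ?thesis ..
qed

text \<open>A nonnegative function with finite range is bounded away from 0 wherever it does not
  vanish, so V is at most a multiple of V^(N+1).\<close>

lemma simple_potential_integrable:
  fixes V :: "'x \<Rightarrow> real"
  assumes "V \<in> borel_measurable M" "\<And>x. 0 \<le> V x" "finite (range V)" "integrable M (\<lambda>x. V x ^ (N + 1))"
  shows "integrable M V"
proof -
  \<comment> \<open>The sum over the range dominates every single reciprocal; the value v = 0 adds
    nothing, because 1 / 0 = 0.\<close>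
  define K where "K = (\<Sum>v\<in>range V. 1 / v ^ N)"
  have "V x \<le> K * V x ^ (N + 1)" for x
  proof (cases "V x = 0")
    case False
    then have "0 < V x" using assms(2)[of x] by simp
    then have "V x = (1 / V x ^ N) * V x ^ (N + 1)" by simp
    also have "\<dots> \<le> K * V x ^ (N + 1)"
      unfolding K_def using assms by (intro mult_right_mono member_le_sum) auto
    finally show ?thesis .
  qed simp
  then show ?thesis
    by (intro Bochner_Integration.integrable_bound[OF integrable_mult_right[OF assms(4), of K] assms(1)] AE_I2)
      (use assms(2) in \<open>auto intro: order_trans[OF _ abs_ge_self]\<close>)
qed

text \<open>The rotated functions \<open>y l\<close> are orthogonal with squared norms
  \<open>lam l\<close>, and \<open>g l\<close> is \<open>y l\<close> normalised. The pairing of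
  \<open>y l\<close> with \<open>g l\<close> is the square root of \<open>lam l\<close>; expanding
  it in the waves shows that \<open>lam l\<close> is at most the coefficient sum \<open>X l\<close>,
  to which \<open>weighted_coefficient_bound_scaled\<close> applies. Orthonormality of the data
  enters as a Bessel bound for all their combinations, a form that passes to the rotated data at
  once.\<close>

lemma energy_bound_distinct:
  fixes J :: "'j set" and a :: "'j \<Rightarrow> 'i \<Rightarrow> complex" and b :: "'j \<Rightarrow> real" and V :: "'x \<Rightarrow> real"
  defines "\<alpha> \<equiv> 2 * (real N + 1) / (2 * real N + 1)"
  assumes J: "finite J" and b: "\<And>j. j \<in> J \<Longrightarrow> 0 < b j" "inj_on b J"
    and a: "\<And>q. (\<lambda>i. (cmod (\<Sum>j\<in>J. q j * a j i))\<^sup>2) summable_on UNIV"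
      "\<And>q. (\<Sum>\<^sub>\<infinity>i. (cmod (\<Sum>j\<in>J. q j * a j i))\<^sup>2) \<le> (\<Sum>j\<in>J. (cmod (q j))\<^sup>2)"
    and V [measurable]: "V \<in> borel_measurable M" and V_nonneg: "\<And>x. 0 \<le> V x" and V_fin: "finite (range V)"
    and V_int: "integrable M (\<lambda>x. V x ^ (N + 1))"
  shows "(LINT x|M. V x * (\<Sum>j\<in>J. b j * (cmod (synth (a j) x))\<^sup>2))
    \<le> interpolation_constant * (\<Sum>j\<in>J. b j powr \<alpha>) powr (1 / \<alpha>) * (LINT x|M. V x ^ (N + 1)) powr (1 / (real N + 1))"
proof (cases "(LINT x|M. V x ^ (N + 1)) = 0")
  case True
  then have "AE x in M. V x ^ (N + 1) = 0"
    using V_nonneg by (subst (asm) integral_nonneg_eq_0_iff_AE[OF V_int]) auto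
  then have "AE x in M. V x * (\<Sum>j\<in>J. b j * (cmod (synth (a j) x))\<^sup>2) = 0" by eventually_elim auto
  then have "(LINT x|M. V x * (\<Sum>j\<in>J. b j * (cmod (synth (a j) x))\<^sup>2)) = 0"
    by (rule integral_eq_zero_AE)
  then show ?thesis using True by simp
next
  case False
  have V_pos: "0 < (LINT x|M. V x ^ (N + 1))"
    using False V_nonneg by (simp add: order.not_eq_order_implies_strict integral_nonneg_AE)
  have V1: "integrable M V" by (rule simple_potential_integrable[OF V V_nonneg V_fin V_int])
  have a1: "(\<lambda>i. (cmod (a j i))\<^sup>2) summable_on UNIV" if "j \<in> J" for j
  proof -
    have "(\<Sum>k\<in>J. (if k = j then 1 else 0) * a k i) = a j i" for i
    proof -
      have "(\<Sum>k\<in>J. (if k = j then 1 else 0) * a k i) = (\<Sum>k\<in>J. if k = j then a j i else 0)"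
        by (rule sum.cong) auto
      then show ?thesis using J that by simp
    qed
    then show ?thesis using a(1)[of "\<lambda>k. if k = j then 1 else 0"] by simp
  qed
  define T where "T j x = of_real (sqrt (V x)) * synth (a j) x" for j x
  have sqrt_syn_sq: "square_integrable M (\<lambda>x. of_real (sqrt (V x)) * synth d x)"
    if d: "(\<lambda>i. (cmod (d i))\<^sup>2) summable_on UNIV" for d
  proof -
    note synth_measurable[OF d, measurable]
    define S where "S = ((\<Sum>\<^sub>\<infinity>i. (cmod (d i))\<^sup>2) + D) / 2"
    have "integrable M (\<lambda>x. (cmod (of_real (sqrt (V x)) * synth d x))\<^sup>2)"
    proof (rule Bochner_Integration.integrable_bound[OF integrable_mult_right[OF V1, of "S\<^sup>2"]])
      show "AE x in M. norm ((cmod (of_real (sqrt (V x)) * synth d x))\<^sup>2) \<le> norm (S\<^sup>2 * V x)"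
      proof (rule AE_I2)
        fix x
        have "(cmod (synth d x))\<^sup>2 \<le> S\<^sup>2"
          using synth_le[OF d, of x] by (intro power_mono) (auto simp: S_def)
        then have "V x * (cmod (synth d x))\<^sup>2 \<le> V x * S\<^sup>2" by (rule mult_left_mono[OF _ V_nonneg])
        then show "norm ((cmod (of_real (sqrt (V x)) * synth d x))\<^sup>2) \<le> norm (S\<^sup>2 * V x)"
          using V_nonneg[of x] by (simp add: norm_mult power_mult_distrib mult.commute)
      qed
    qed measurable
    then show ?thesis unfolding square_integrable_def by (intro conjI) measurable
  qed
  have T_sq: "square_integrable M (T j)" if "j \<in> J" for j
    unfolding T_def by (rule sqrt_syn_sq[OF a1[OF that]])
  obtain q where q: "\<And>l m. l \<in> J \<Longrightarrow> m \<in> J \<Longrightarrow> (\<Sum>j\<in>J. q l j * cnj (q m j)) = (if l = m then 1 else 0)"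
    and q_orth: "\<And>l m. l \<in> J \<Longrightarrow> m \<in> J \<Longrightarrow> l \<noteq> m \<Longrightarrow>
       inner_L2 M (\<lambda>x. \<Sum>j\<in>J. q l j * T j x) (\<lambda>x. \<Sum>j\<in>J. q m j * T j x) = 0"
    and q_max: "(\<Sum>j\<in>J. b j * sqnorm_L2 M (T j)) \<le> (\<Sum>l\<in>J. b l * sqnorm_L2 M (\<lambda>x. \<Sum>j\<in>J. q l j * T j x))"
    using exists_diagonalising_rotation[where T=T and M=M, OF J T_sq b(2)] by blast
  define y where "y l = (\<lambda>x. \<Sum>j\<in>J. q l j * T j x)" for l
  define d where "d l i = (\<Sum>j\<in>J. q l j * a j i)" for l i
  have y_sq: "square_integrable M (y l)" for l
    unfolding y_def by (intro square_integrable_sum square_integrable_cmult T_sq)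
  have d1: "(\<lambda>i. (cmod (d l i))\<^sup>2) summable_on UNIV" for l
    unfolding d_def by (rule a(1))
  have d2: "(\<Sum>\<^sub>\<infinity>i. (cmod (d l i))\<^sup>2) \<le> 1" if "l \<in> J" for l
  proof -
    have "complex_of_real (\<Sum>j\<in>J. (cmod (q l j))\<^sup>2) = (\<Sum>j\<in>J. q l j * cnj (q l j))"
      by (simp add: complex_norm_square del: of_real_power)
    then have "(\<Sum>j\<in>J. (cmod (q l j))\<^sup>2) = 1"
      using q[OF that that] by (metis (full_types) of_real_eq_1_iff)
    then show ?thesis unfolding d_def using a(2)[of "q l"] by simp
  qed
  have y_d: "y l x = of_real (sqrt (V x)) * synth (d l) x" for l x
    unfolding y_def T_def d_def using synth_sum[where a=a, OF J a1, of "q l" x]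
    by (simp add: sum_distrib_left mult_ac)
  define lam where "lam l = sqnorm_L2 M (y l)" for l
  \<comment> \<open>Functions that the rotation makes null cannot be normalised and contribute
    nothing.\<close>
  define L where "L = {l \<in> J. lam l \<noteq> 0}"
  define g where "g l x = of_real (1 / sqrt (lam l)) * y l x" for l x
  have lam_pos: "0 < lam l" if "l \<in> L" for l
  proof -
    have "lam l \<noteq> 0" using that by (simp add: L_def)
    then show ?thesis using sqnorm_L2_nonneg[of M "y l"] unfolding lam_def by linarith
  qed
  have g_sq: "square_integrable M (g l)" for l
    unfolding g_def by (rule square_integrable_cmult[OF y_sq])
  have g_orth: "inner_L2 M (g l) (g m) = (if l = m then 1 else 0)" if "l \<in> L" "m \<in> L" for l m
  proof -
    have "inner_L2 M (g l) (g m) = of_real (1 / sqrt (lam l)) * cnj (of_real (1 / sqrt (lam m))) * inner_L2 M (y l) (y m)"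
      unfolding g_def inner_L2_cmult_left inner_L2_cmult_right by simp
    also have "\<dots> = (if l = m then 1 else 0)"
    proof (cases "l = m")
      case True
      have "complex_of_real (1 / sqrt (lam l)) * of_real (1 / sqrt (lam l)) * of_real (lam l) = of_real (1 / sqrt (lam l) * (1 / sqrt (lam l)) * lam l)"
        by (simp only: of_real_mult)
      also have "1 / sqrt (lam l) * (1 / sqrt (lam l)) * lam l = 1"
        using lam_pos[OF that(1)] by simp
      finally show ?thesis using True by (simp add: inner_L2_self lam_def)
    qed (use q_orth that in \<open>simp add: L_def y_def\<close>)
    finally show ?thesis .
  qed
  define X where "X l = (\<Sum>\<^sub>\<infinity>i. \<sigma> i * (cmod (inner_L2 M (\<lambda>x. of_real (sqrt (V x)) * g l x) (e i)))\<^sup>2)" for l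
  have lam_le_X: "lam l \<le> X l" if l: "l \<in> L" for l
  proof -
    define Vg where "Vg x = of_real (sqrt (V x)) * g l x" for x
    define r where "r = sqrt (lam l)"
    have r: "0 < r" "r\<^sup>2 = lam l" using lam_pos[OF l] by (auto simp: r_def)
    have sqV: "square_integrable M (\<lambda>x. complex_of_real (sqrt (V x)))"
      using V1 V_nonneg by (simp add: square_integrable_def)
    have Vg_int: "integrable M Vg"
      using integrable_inner_L2[OF sqV square_integrable_cnj[OF g_sq]] by (simp add: Vg_def[abs_def])
    define vmax where "vmax = Max (range V)"
    have vmax: "V x \<le> vmax" for x using V_fin by (simp add: vmax_def)
    have Vg_sq: "square_integrable M Vg"
    proof (rule square_integrable_bound[OF _ g_sq[of l], of _ "sqrt vmax"])
      show "Vg \<in> borel_measurable M" using Vg_int by simp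
      show "cmod (Vg x) \<le> sqrt vmax * cmod (g l x)" for x
        using vmax[of x] V_nonneg[of x] by (auto simp: Vg_def norm_mult intro!: mult_right_mono)
    qed
    have g_y: "y l x = of_real r * g l x" for x
      using lam_pos[OF l] by (simp add: g_def r_def)
    let ?f = "\<lambda>i x. (of_real (sqrt (\<sigma> i)) * d l i * e i x) * cnj (Vg x)"
    define S where "S = ((\<Sum>\<^sub>\<infinity>i. (cmod (d l i))\<^sup>2) + D) / 2"
    have hs: "((\<lambda>i. LINT x|M. ?f i x) has_sum (LINT x|M. (\<Sum>\<^sub>\<infinity>i. ?f i x))) UNIV"
    proof (rule has_sum_integral[where w="\<lambda>x. S * cmod (Vg x)"])
      have [measurable]: "Vg \<in> borel_measurable M" using Vg_int by simp
      show "?f i \<in> borel_measurable M" for i by measurable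
      show "(\<lambda>i. cmod (?f i x)) summable_on UNIV" for x
        unfolding norm_mult[of _ "cnj (Vg x)"] by (rule summable_on_cmult_left[OF synth_summable(1)[OF d1]])
      show "(\<Sum>\<^sub>\<infinity>i. cmod (?f i x)) \<le> S * cmod (Vg x)" for x
        unfolding norm_mult[of _ "cnj (Vg x)"] S_def
        by (subst infsum_cmult_left') (use mult_right_mono[OF synth_summable(2)[OF d1], of "cmod (Vg x)"] in simp)
      show "integrable M (\<lambda>x. S * cmod (Vg x))" using Vg_int by simp
    qed
    have "(LINT x|M. (\<Sum>\<^sub>\<infinity>i. ?f i x)) = (LINT x|M. y l x * cnj (g l x))"
    proof (rule Bochner_Integration.integral_cong[OF refl])
      fix x
      have "(\<Sum>\<^sub>\<infinity>i. ?f i x) = synth (d l) x * cnj (Vg x)"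
        unfolding synth_def by (rule infsum_cmult_left[OF abs_summable_summable[OF synth_summable(1)[OF d1]]])
      then show "(\<Sum>\<^sub>\<infinity>i. ?f i x) = y l x * cnj (g l x)" by (simp add: y_d Vg_def)
    qed
    also have "\<dots> = of_real r"
    proof -
      have "(LINT x|M. y l x * cnj (g l x)) = of_real r * inner_L2 M (g l) (g l)"
        unfolding g_y inner_L2_def by (simp add: mult.assoc)
      then show ?thesis using g_orth[OF l l] by simp
    qed
    finally have hs': "((\<lambda>i. LINT x|M. ?f i x) has_sum of_real r) UNIV" using hs by simp
    have fi: "(LINT x|M. ?f i x) = d l i * (of_real (sqrt (\<sigma> i)) * inner_L2 M (e i) Vg)" for i
      unfolding inner_L2_def by (subst integral_mult_right_zero[symmetric], subst integral_mult_right_zero[symmetric])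
        (rule Bochner_Integration.integral_cong, auto simp: mult_ac)
    \<comment> \<open>The extra factor r puts the mean inequality into the form r^2 \<le> (r^2 +
      X)/2, which can be solved for r^2.\<close>
    have hs2: "((\<lambda>i. (of_real r * d l i) * (of_real (sqrt (\<sigma> i)) * inner_L2 M (e i) Vg)) has_sum of_real (r\<^sup>2)) UNIV"
      using has_sum_cmult_right[OF hs', of "of_real r"] unfolding fi by (simp add: mult.assoc power2_eq_square)
    have x2: "(cmod (of_real (sqrt (\<sigma> i)) * inner_L2 M (e i) Vg))\<^sup>2 = \<sigma> i * (cmod (inner_L2 M Vg (e i)))\<^sup>2" for i
      using \<sigma>_nonneg[of i] by (subst inner_L2_commute) (simp add: norm_mult power_mult_distrib)
    have XB: "(\<lambda>i. (cmod (inner_L2 M Vg (e i)))\<^sup>2) summable_on UNIV"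
      by (rule Bessel(1)[OF e_square_integrable c_pos _ Vg_sq]) (use e_orthogonal[of 0 _ 0] in simp)
    have xs: "(\<lambda>i. (cmod (of_real (sqrt (\<sigma> i)) * inner_L2 M (e i) Vg))\<^sup>2) summable_on UNIV"
      unfolding x2
      by (rule summable_on_comparison_test[OF XB]) (use \<sigma>_nonneg \<sigma>_le_1 in \<open>auto intro: mult_left_le_one_le\<close>)
    have rd: "(\<lambda>i. (cmod (of_real r * d l i))\<^sup>2) summable_on UNIV"
      unfolding norm_mult power_mult_distrib by (rule summable_on_cmult_right[OF d1])
    note ss = square_summable_product[OF rd xs]
    have "r\<^sup>2 = cmod (complex_of_real (r\<^sup>2))" by (simp del: of_real_power)
    also have "\<dots> \<le> (\<Sum>\<^sub>\<infinity>i. cmod ((of_real r * d l i) * (of_real (sqrt (\<sigma> i)) * inner_L2 M (e i) Vg)))"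
      unfolding infsumI[OF hs2, symmetric] by (rule norm_infsum_bound[OF ss(1)])
    also have "\<dots> \<le> ((\<Sum>\<^sub>\<infinity>i. (cmod (of_real r * d l i))\<^sup>2) + X l) / 2"
      using ss(2) unfolding x2 X_def Vg_def[symmetric] .
    also have "(\<Sum>\<^sub>\<infinity>i. (cmod (of_real r * d l i))\<^sup>2) = r\<^sup>2 * (\<Sum>\<^sub>\<infinity>i. (cmod (d l i))\<^sup>2)"
      unfolding norm_mult power_mult_distrib by (subst infsum_cmult_right[OF d1]) simp
    also have "\<dots> \<le> r\<^sup>2 * 1" using d2 l by (intro mult_left_mono) (auto simp: L_def)
    finally have "r\<^sup>2 \<le> X l" by simp
    then show ?thesis using r by simp
  qed
  have int_eq: "(LINT x|M. V x * (\<Sum>j\<in>J. b j * (cmod (synth (a j) x))\<^sup>2)) = (\<Sum>j\<in>J. b j * sqnorm_L2 M (T j))"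
  proof -
    have "(LINT x|M. V x * (\<Sum>j\<in>J. b j * (cmod (synth (a j) x))\<^sup>2)) = (LINT x|M. (\<Sum>j\<in>J. b j * (cmod (T j x))\<^sup>2))"
      using V_nonneg by (intro Bochner_Integration.integral_cong refl)
        (auto simp: T_def norm_mult power_mult_distrib sum_distrib_left mult_ac)
    also have "\<dots> = (\<Sum>j\<in>J. LINT x|M. b j * (cmod (T j x))\<^sup>2)"
      using T_sq by (intro Bochner_Integration.integral_sum) (auto simp: square_integrable_def)
    finally show ?thesis by (simp add: sqnorm_L2_def)
  qed
  have C_nonneg: "0 \<le> interpolation_constant"
  proof -
    have "0 \<le> \<kappa>" by (rule order_trans[OF _ dispersive]) simp
    then show ?thesis using c_pos by (simp add: interpolation_constant_def)
  qed
  have "(\<Sum>j\<in>J. b j * sqnorm_L2 M (T j)) \<le> (\<Sum>l\<in>J. b l * lam l)"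
    using q_max by (simp add: lam_def y_def)
  also have "\<dots> = (\<Sum>l\<in>L. b l * lam l)"
    using J by (intro sum.mono_neutral_right) (auto simp: L_def)
  also have "\<dots> \<le> (\<Sum>l\<in>L. b l * X l)"
    using b lam_le_X by (intro sum_mono mult_left_mono) (auto simp: L_def less_imp_le)
  also have "\<dots> \<le> interpolation_constant * (\<Sum>j\<in>J. b j powr \<alpha>) powr (1 / \<alpha>) * (LINT x|M. V x ^ (N + 1)) powr (1 / (real N + 1))"
  proof (cases "L = {}")
    case True
    then show ?thesis using C_nonneg by simp
  next
    case L: False
    have fL: "finite L" using J by (simp add: L_def)
    have bL: "0 < b l" if "l \<in> L" for l using that b by (simp add: L_def)
    have "(\<Sum>l\<in>L. b l * X l) \<le> interpolation_constant * (\<Sum>l\<in>L. b l powr \<alpha>) powr (1 / \<alpha>) * (LINT x|M. V x ^ (N + 1)) powr (1 / (real N + 1))"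
      unfolding X_def \<alpha>_def
      by (rule weighted_coefficient_bound_scaled[OF fL L g_sq g_orth bL V V_nonneg V_fin V_int V_pos])
    also have "\<dots> \<le> interpolation_constant * (\<Sum>j\<in>J. b j powr \<alpha>) powr (1 / \<alpha>) * (LINT x|M. V x ^ (N + 1)) powr (1 / (real N + 1))"
      using C_nonneg J
      by (intro mult_right_mono mult_left_mono powr_mono2 sum_mono2 sum_nonneg)
        (auto simp: L_def \<alpha>_def)
    finally show ?thesis .
  qed
  finally show ?thesis unfolding int_eq .
qed

text \<open>Equal or vanishing coefficients are reached as limits of distinct positive ones.\<close>

theorem energy_bound:
  fixes J :: "nat set" and a :: "nat \<Rightarrow> 'i \<Rightarrow> complex" and b :: "nat \<Rightarrow> real" and V :: "'x \<Rightarrow> real"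
  defines "\<alpha> \<equiv> 2 * (real N + 1) / (2 * real N + 1)"
  assumes J: "finite J" and b: "\<And>j. j \<in> J \<Longrightarrow> 0 \<le> b j"
    and a: "\<And>q. (\<lambda>i. (cmod (\<Sum>j\<in>J. q j * a j i))\<^sup>2) summable_on UNIV"
      "\<And>q. (\<Sum>\<^sub>\<infinity>i. (cmod (\<Sum>j\<in>J. q j * a j i))\<^sup>2) \<le> (\<Sum>j\<in>J. (cmod (q j))\<^sup>2)"
    and int: "\<And>j. j \<in> J \<Longrightarrow> integrable M (\<lambda>x. V x * (cmod (synth (a j) x))\<^sup>2)"
    and V [measurable]: "V \<in> borel_measurable M" and V_nonneg: "\<And>x. 0 \<le> V x" and V_fin: "finite (range V)"
    and V_int: "integrable M (\<lambda>x. V x ^ (N + 1))"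
  shows "(LINT x|M. V x * (\<Sum>j\<in>J. b j * (cmod (synth (a j) x))\<^sup>2))
    \<le> interpolation_constant * (\<Sum>j\<in>J. b j powr \<alpha>) powr (1 / \<alpha>) * (LINT x|M. V x ^ (N + 1)) powr (1 / (real N + 1))"
proof -
  \<comment> \<open>The shifts (j+1)/(n+1) are positive and differ from index to index, so equal
    coefficients separate for every n, and unequal ones are separated for all large n.\<close>
  define bn where "bn n j = b j + (real j + 1) / (real n + 1)" for n j
  define I where "I j = (LINT x|M. V x * (cmod (synth (a j) x))\<^sup>2)" for j
  have lin: "(LINT x|M. V x * (\<Sum>j\<in>J. \<beta> j * (cmod (synth (a j) x))\<^sup>2)) = (\<Sum>j\<in>J. \<beta> j * I j)" for \<beta>
  proof -
    have "(LINT x|M. V x * (\<Sum>j\<in>J. \<beta> j * (cmod (synth (a j) x))\<^sup>2)) = (LINT x|M. (\<Sum>j\<in>J. \<beta> j * (V x * (cmod (synth (a j) x))\<^sup>2)))"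
      by (intro Bochner_Integration.integral_cong refl) (auto simp: sum_distrib_left mult_ac)
    also have "\<dots> = (\<Sum>j\<in>J. LINT x|M. \<beta> j * (V x * (cmod (synth (a j) x))\<^sup>2))"
      using int by (intro Bochner_Integration.integral_sum) auto
    finally show ?thesis by (simp add: I_def)
  qed
  have \<alpha>: "0 < \<alpha>" unfolding \<alpha>_def by (intro divide_pos_pos) auto
  have bn_lim: "(\<lambda>n. bn n j) \<longlonglongrightarrow> b j" for j
  proof -
    have "(\<lambda>n. b j + (real j + 1) / (real n + 1)) \<longlonglongrightarrow> b j + 0"
      by (intro tendsto_add tendsto_const) real_asymp
    then show ?thesis by (simp add: bn_def)
  qed
  have "\<forall>\<^sub>F n in sequentially. inj_on (bn n) J"
  proof -
    have "\<forall>\<^sub>F n in sequentially. bn n i \<noteq> bn n j" if "i \<noteq> j" for i j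
    proof (cases "b i = b j")
      case True
      then show ?thesis using that by (intro always_eventually) (auto simp: bn_def divide_simps)
    next
      case False
      have "(\<lambda>n. bn n i - bn n j) \<longlonglongrightarrow> b i - b j" by (intro tendsto_diff bn_lim)
      then have "\<forall>\<^sub>F n in sequentially. bn n i - bn n j \<noteq> 0"
        using False by (intro tendsto_imp_eventually_ne) auto
      then show ?thesis by eventually_elim auto
    qed
    then have "\<forall>\<^sub>F n in sequentially. \<forall>p\<in>{p \<in> J \<times> J. fst p \<noteq> snd p}. bn n (fst p) \<noteq> bn n (snd p)"
      using J by (intro eventually_ball_finite) auto
    then show ?thesis by eventually_elim (auto simp: inj_on_def)
  qed
  then have ev: "\<forall>\<^sub>F n in sequentially. (\<Sum>j\<in>J. bn n j * I j) \<le> interpolation_constant * (\<Sum>j\<in>J. bn n j powr \<alpha>) powr (1 / \<alpha>)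
      * (LINT x|M. V x ^ (N + 1)) powr (1 / (real N + 1))"
  proof eventually_elim
    case (elim n)
    have pos: "0 < bn n j" if "j \<in> J" for j
      using b[OF that] by (simp add: bn_def add_nonneg_pos)
    show ?case
      unfolding lin[symmetric] \<alpha>_def
      by (rule energy_bound_distinct[OF J pos elim a V V_nonneg V_fin V_int])
  qed
  have "(\<Sum>j\<in>J. b j * I j) \<le> interpolation_constant * (\<Sum>j\<in>J. b j powr \<alpha>) powr (1 / \<alpha>)
      * (LINT x|M. V x ^ (N + 1)) powr (1 / (real N + 1))"
  proof (rule tendsto_le[OF sequentially_bot _ _ ev])
    have p: "(\<lambda>n. bn n j powr \<alpha>) \<longlonglongrightarrow> b j powr \<alpha>" if "j \<in> J" for j
      using b[OF that] \<alpha>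
      by (intro tendsto_powr' bn_lim tendsto_const) (auto simp: bn_def intro!: always_eventually add_nonneg_nonneg)
    have s: "(\<lambda>n. \<Sum>j\<in>J. bn n j powr \<alpha>) \<longlonglongrightarrow> (\<Sum>j\<in>J. b j powr \<alpha>)" by (intro tendsto_sum p)
    have "(\<lambda>n. (\<Sum>j\<in>J. bn n j powr \<alpha>) powr (1 / \<alpha>)) \<longlonglongrightarrow> (\<Sum>j\<in>J. b j powr \<alpha>) powr (1 / \<alpha>)"
      using \<alpha> by (intro tendsto_powr' s tendsto_const) (auto intro!: always_eventually sum_nonneg)
    then show "(\<lambda>n. interpolation_constant * (\<Sum>j\<in>J. bn n j powr \<alpha>) powr (1 / \<alpha>) * (LINT x|M. V x ^ (N + 1)) powr (1 / (real N + 1)))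
        \<longlonglongrightarrow> interpolation_constant * (\<Sum>j\<in>J. b j powr \<alpha>) powr (1 / \<alpha>) * (LINT x|M. V x ^ (N + 1)) powr (1 / (real N + 1))"
      by (intro tendsto_mult tendsto_const)
    show "(\<lambda>n. \<Sum>j\<in>J. bn n j * I j) \<longlonglongrightarrow> (\<Sum>j\<in>J. b j * I j)"
      by (intro tendsto_sum tendsto_mult bn_lim tendsto_const)
  qed
  then show ?thesis unfolding lin .
qed

end

subsection \<open>Hermite functions\<close>

fun hermite_poly :: "nat \<Rightarrow> real \<Rightarrow> real" where
  "hermite_poly 0 x = 1"
| "hermite_poly (Suc 0) x = 2 * x"
| "hermite_poly (Suc (Suc k)) x = 2 * x * hermite_poly (Suc k) x - 2 * (real k + 1) * hermite_poly k x"

lemma hermite_poly_Suc: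
  "hermite_poly (Suc k) x = 2 * x * hermite_poly k x - 2 * real k * hermite_poly (k - 1) x"
  by (cases k) auto

text \<open>The rule follows from the three-term recurrence by induction over two predecessors. At k
  = 0 the factor k covers the truncated difference k - 1.\<close>

lemma hermite_poly_has_derivative:
  "(hermite_poly k has_field_derivative 2 * real k * hermite_poly (k - 1) x) (at x)"
proof (induction k rule: less_induct)
  case (less k)
  have h01: "hermite_poly 0 = (\<lambda>x. 1)" "hermite_poly (Suc 0) = (\<lambda>x. 2 * x)" by auto
  consider "k = 0" | "k = 1" | j where "k = Suc (Suc j)" by (metis One_nat_def not0_implies_Suc)
  then show ?case
  proof cases
    case 3
    have "((\<lambda>x. 2 * x * hermite_poly (Suc j) x - 2 * (real j + 1) * hermite_poly j x) has_field_derivative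
       (2 * hermite_poly (Suc j) x + 2 * x * (2 * real (Suc j) * hermite_poly (Suc j - 1) x)
         - 2 * (real j + 1) * (2 * real j * hermite_poly (j - 1) x))) (at x)"
      by (auto intro!: derivative_eq_intros less.IH simp: 3)
    moreover have "(\<lambda>x. 2 * x * hermite_poly (Suc j) x - 2 * (real j + 1) * hermite_poly j x) = hermite_poly k"
      by (auto simp: 3)
    moreover have "2 * hermite_poly (Suc j) x + 2 * x * (2 * real (Suc j) * hermite_poly (Suc j - 1) x)
         - 2 * (real j + 1) * (2 * real j * hermite_poly (j - 1) x) = 2 * real k * hermite_poly (k - 1) x"
      using arg_cong[OF hermite_poly_Suc[of j x], of "\<lambda>t. 2 * (real j + 1) * t"] by (simp add: 3 algebra_simps)
    ultimately show ?thesis by simp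
  qed (auto intro!: derivative_eq_intros simp: h01)
qed

lemma hermite_H_eq: "hermite_H k x = hermite_poly k x"
proof -
  have "(deriv ^^ k) (\<lambda>y. exp (- y\<^sup>2)) = (\<lambda>x. (- 1) ^ k * hermite_poly k x * exp (- x\<^sup>2))"
  proof (induction k)
    case (Suc k)
    have "deriv (\<lambda>x. (- 1) ^ k * hermite_poly k x * exp (- x\<^sup>2)) x = (- 1) ^ Suc k * hermite_poly (Suc k) x * exp (- x\<^sup>2)" for x
    proof (rule DERIV_imp_deriv)
      show "((\<lambda>x. (- 1) ^ k * hermite_poly k x * exp (- x\<^sup>2)) has_field_derivative (- 1) ^ Suc k * hermite_poly (Suc k) x * exp (- x\<^sup>2)) (at x)"
        by (auto intro!: derivative_eq_intros hermite_poly_has_derivative simp: hermite_poly_Suc algebra_simps)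
    qed
    then show ?case unfolding funpow.simps o_apply Suc by (rule ext)
  qed simp
  moreover have "((- 1) ^ k * (- 1) ^ k :: real) = 1" by (simp add: power_mult_distrib[symmetric])
  ultimately show ?thesis
    by (simp add: hermite_H_def exp_minus field_simps)
qed

text \<open>The Hermite function without its normalisation, which keeps square roots out of the
  ladder relations.\<close>

definition hermite_gauss :: "nat \<Rightarrow> real \<Rightarrow> real" where
  "hermite_gauss k x = hermite_poly k x * exp (- x\<^sup>2 / 2)"

lemma hermite_fun_eq: "hermite_fun k x = hermite_gauss k x / sqrt (2 ^ k * sqrt pi * fact k)"
  by (simp add: hermite_fun_def hermite_H_eq hermite_gauss_def powr_minus powr_half_sqrt field_simps)

lemma hermite_gauss_has_derivative:
  "(hermite_gauss k has_field_derivative 2 * real k * hermite_gauss (k - 1) x - x * hermite_gauss k x) (at x)"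
  unfolding hermite_gauss_def
  by (auto intro!: derivative_eq_intros hermite_poly_has_derivative simp: algebra_simps)

text \<open>The preceding form of the derivative lowers the index, this one raises it. Choosing one
  form for each of two factors is what produces the ladder relations.\<close>

lemma hermite_gauss_has_derivative':
  "(hermite_gauss k has_field_derivative x * hermite_gauss k x - hermite_gauss (Suc k) x) (at x)"
proof -
  have "2 * real k * hermite_gauss (k - 1) x - x * hermite_gauss k x = x * hermite_gauss k x - hermite_gauss (Suc k) x"
    by (simp add: hermite_gauss_def hermite_poly_Suc algebra_simps)
  then show ?thesis using hermite_gauss_has_derivative[of k x] by simp
qed

section \<open>Functions of Gaussian decay\<close>

definition gaussian_decay :: "('a::real_normed_vector \<Rightarrow> complex) \<Rightarrow> bool" where
  "gaussian_decay f \<longleftrightarrow> (\<exists>C a. 0 < a \<and> (\<forall>x. cmod (f x) \<le> C * exp (- a * (norm x)\<^sup>2)))"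

lemma gaussian_decayI: "0 < a \<Longrightarrow> (\<And>x. cmod (f x) \<le> C * exp (- a * (norm x)\<^sup>2)) \<Longrightarrow> gaussian_decay f"
  unfolding gaussian_decay_def by blast

lemma gaussian_decay_nonneg:
  assumes "gaussian_decay f"
  obtains C a where "0 < a" "0 \<le> C" "\<And>x. cmod (f x) \<le> C * exp (- a * (norm x)\<^sup>2)"
proof -
  obtain C a where *: "0 < a" "\<And>x. cmod (f x) \<le> C * exp (- a * (norm x)\<^sup>2)"
    using assms unfolding gaussian_decay_def by blast
  have "0 \<le> C" using order_trans[OF norm_ge_zero *(2)[of 0]] by simp
  with * that show ?thesis by blast
qed

lemma gaussian_decay_add:
  assumes "gaussian_decay f" "gaussian_decay g"
  shows "gaussian_decay (\<lambda>x. f x + g x)"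
proof -
  obtain C a where f: "0 < a" "0 \<le> C" "\<And>x. cmod (f x) \<le> C * exp (- a * (norm x)\<^sup>2)"
    using gaussian_decay_nonneg[OF assms(1)] by blast
  obtain D b where g: "0 < b" "0 \<le> D" "\<And>x. cmod (g x) \<le> D * exp (- b * (norm x)\<^sup>2)"
    using gaussian_decay_nonneg[OF assms(2)] by blast
  have "cmod (f x + g x) \<le> (C + D) * exp (- min a b * (norm x)\<^sup>2)" for x
  proof -
    have "C * exp (- a * (norm x)\<^sup>2) \<le> C * exp (- min a b * (norm x)\<^sup>2)"
      using f by (intro mult_left_mono) (auto intro: mult_right_mono)
    moreover have "D * exp (- b * (norm x)\<^sup>2) \<le> D * exp (- min a b * (norm x)\<^sup>2)"
      using g by (intro mult_left_mono) (auto intro: mult_right_mono)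
    ultimately show ?thesis
      using norm_triangle_ineq[of "f x" "g x"] f(3)[of x] g(3)[of x] by (simp add: distrib_right)
  qed
  then show ?thesis using f g by (intro gaussian_decayI[of "min a b"]) auto
qed

lemma gaussian_decay_bounded_mult:
  assumes "gaussian_decay f" "\<And>x. cmod (g x) \<le> B"
  shows "gaussian_decay (\<lambda>x. g x * f x)"
proof -
  obtain C a where f: "0 < a" "0 \<le> C" "\<And>x. cmod (f x) \<le> C * exp (- a * (norm x)\<^sup>2)"
    using gaussian_decay_nonneg[OF assms(1)] by blast
  have "cmod (g x * f x) \<le> (B * C) * exp (- a * (norm x)\<^sup>2)" for x
    unfolding norm_mult mult.assoc
    by (intro mult_mono assms f order_trans[OF norm_ge_zero assms(2)]) auto
  then show ?thesis using f by (intro gaussian_decayI[of a])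
qed

text \<open>A linear factor is absorbed by half of the decay rate, which is why
  \<open>gaussian_decay\<close> leaves the rate open.\<close>

lemma gaussian_decay_linear_mult:
  assumes "gaussian_decay f" "\<And>x. cmod (g x) \<le> B * (1 + norm x)"
  shows "gaussian_decay (\<lambda>x. g x * f x)"
proof -
  obtain C a where f: "0 < a" "0 \<le> C" "\<And>x. cmod (f x) \<le> C * exp (- a * (norm x)\<^sup>2)"
    using gaussian_decay_nonneg[OF assms(1)] by blast
  define K where "K = 2 + 2 / a"
  have B: "0 \<le> B" using order_trans[OF norm_ge_zero assms(2)[of 0]] by simp
  have lin: "1 + r \<le> K * exp (a / 2 * r\<^sup>2)" for r :: real
  proof -
    have "r \<le> 1 + r\<^sup>2"
      using sum_squares_bound[of r 1] zero_le_power2[of r] by (simp, linarith)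
    have u: "a / 2 * r\<^sup>2 \<le> exp (a / 2 * r\<^sup>2)" using exp_ge_add_one_self[of "a / 2 * r\<^sup>2"] by linarith
    from \<open>r \<le> 1 + r\<^sup>2\<close> have "1 + r \<le> 2 * 1 + 2 / a * (a / 2 * r\<^sup>2)" using f(1) by simp
    also have "\<dots> \<le> 2 * exp (a / 2 * r\<^sup>2) + 2 / a * exp (a / 2 * r\<^sup>2)"
      using f(1) by (intro add_mono mult_left_mono u) auto
    finally show ?thesis by (simp add: K_def distrib_right)
  qed
  have "cmod (g x * f x) \<le> (B * K * C) * exp (- (a / 2) * (norm x)\<^sup>2)" for x
  proof -
    have "cmod (g x * f x) \<le> (B * (K * exp (a / 2 * (norm x)\<^sup>2))) * (C * exp (- a * (norm x)\<^sup>2))"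
      unfolding norm_mult
      by (intro mult_mono f order_trans[OF assms(2)] mult_left_mono lin B) (use f B in \<open>auto simp: K_def intro!: mult_nonneg_nonneg\<close>)
    also have "\<dots> = (B * K * C) * (exp (a / 2 * (norm x)\<^sup>2) * exp (- a * (norm x)\<^sup>2))" by simp
    also have "exp (a / 2 * (norm x)\<^sup>2) * exp (- a * (norm x)\<^sup>2) = exp (- (a / 2) * (norm x)\<^sup>2)"
      unfolding exp_add[symmetric] by (rule arg_cong[where f=exp]) (simp add: field_simps)
    finally show ?thesis .
  qed
  then show ?thesis using f by (intro gaussian_decayI[of "a / 2"]) auto
qed

lemma gaussian_decay_cmult: "gaussian_decay f \<Longrightarrow> gaussian_decay (\<lambda>x. c * f x)"
  by (rule gaussian_decay_bounded_mult[of f "\<lambda>_. c" "cmod c"]) auto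

lemma gaussian_decay_diff:
  "gaussian_decay f \<Longrightarrow> gaussian_decay g \<Longrightarrow> gaussian_decay (\<lambda>x. f x - g x)"
  using gaussian_decay_add[of f "\<lambda>x. - 1 * g x"] gaussian_decay_cmult[of g "- 1"] by simp

lemma gaussian_decay_shift:
  fixes f :: "'a::real_normed_vector \<Rightarrow> complex"
  assumes "gaussian_decay f"
  shows "gaussian_decay (\<lambda>x. f (x + h))"
proof -
  obtain C a where f: "0 < a" "0 \<le> C" "\<And>x. cmod (f x) \<le> C * exp (- a * (norm x)\<^sup>2)"
    using gaussian_decay_nonneg[OF assms(1)] by blast
  have "cmod (f (x + h)) \<le> (C * exp (a * (norm h)\<^sup>2)) * exp (- (a / 2) * (norm x)\<^sup>2)" for x
  proof -
    have "norm x \<le> norm (x + h) + norm h" using norm_triangle_ineq4[of "x + h" h] by simp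
    then have "(norm x)\<^sup>2 \<le> (norm (x + h) + norm h)\<^sup>2" by (intro power_mono) auto
    also have "\<dots> \<le> 2 * (norm (x + h))\<^sup>2 + 2 * (norm h)\<^sup>2"
      using sum_squares_bound[of "norm (x + h)" "norm h"] by (simp add: power2_sum)
    finally have "a / 2 * (norm x)\<^sup>2 \<le> a / 2 * (2 * (norm (x + h))\<^sup>2 + 2 * (norm h)\<^sup>2)"
      using f(1) by (intro mult_left_mono) auto
    then have "- a * (norm (x + h))\<^sup>2 \<le> a * (norm h)\<^sup>2 + - (a / 2) * (norm x)\<^sup>2"
      by (simp add: algebra_simps)
    then have "C * exp (- a * (norm (x + h))\<^sup>2) \<le> C * exp (a * (norm h)\<^sup>2 + - (a / 2) * (norm x)\<^sup>2)"
      using f(2) by (intro mult_left_mono) auto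
    then show ?thesis using f(3)[of "x + h"] unfolding exp_add by (simp add: mult.assoc)
  qed
  then show ?thesis using f by (intro gaussian_decayI[of "a / 2"]) auto
qed

lemma integrable_gauss: "0 < a \<Longrightarrow> integrable lborel (\<lambda>x::real. exp (- a * x\<^sup>2))"
proof -
  assume a: "0 < a"
  \<comment> \<open>The Gaussian is a multiple of the normal density with variance 1/(2a).\<close>
  have "integrable lborel (\<lambda>x. sqrt (2 * pi * (sqrt (1 / (2 * a)))\<^sup>2) * normal_density 0 (sqrt (1 / (2 * a))) x)"
    using a by (intro integrable_mult_right integrable_normal_density) auto
  moreover have "sqrt (2 * pi * (sqrt (1 / (2 * a)))\<^sup>2) * normal_density 0 (sqrt (1 / (2 * a))) x = exp (- a * x\<^sup>2)" for x
    using a by (simp add: normal_density_def)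
  ultimately show ?thesis by simp
qed

lemma gaussian_decay_integrable:
  fixes f :: "real \<Rightarrow> complex"
  assumes "gaussian_decay f" "f \<in> borel_measurable lborel"
  shows "integrable lborel f"
proof -
  obtain C a where f: "0 < a" "0 \<le> C" "\<And>x. cmod (f x) \<le> C * exp (- a * (norm x)\<^sup>2)"
    using gaussian_decay_nonneg[OF assms(1)] by blast
  show ?thesis
    by (rule Bochner_Integration.integrable_bound[OF integrable_mult_right[OF integrable_gauss[OF f(1)], of C] assms(2)])
      (use f in \<open>auto intro!: AE_I2\<close>)
qed

lemma gaussian_decay_tendsto:
  fixes f :: "real \<Rightarrow> complex"
  assumes "gaussian_decay f"
  shows "(f \<longlongrightarrow> 0) at_top" "(f \<longlongrightarrow> 0) at_bot"
proof -
  obtain C a where f: "0 < a" "0 \<le> C" "\<And>x. cmod (f x) \<le> C * exp (- a * (norm x)\<^sup>2)"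
    using gaussian_decay_nonneg[OF assms(1)] by blast
  have "filterlim (\<lambda>x::real. x\<^sup>2) at_top at_top" "filterlim (\<lambda>x::real. x\<^sup>2) at_top at_bot" by real_asymp+
  note q = this
  have lim: "((\<lambda>x::real. C * exp (- a * x\<^sup>2)) \<longlongrightarrow> 0) F" if "filterlim (\<lambda>x::real. x\<^sup>2) at_top F" for F
  proof -
    have "filterlim (\<lambda>x. - a * x\<^sup>2) at_bot F"
      using filterlim_tendsto_neg_mult_at_bot[OF tendsto_const[of "- a"] _ that] f(1) by simp
    then have "((\<lambda>x. exp (- a * x\<^sup>2)) \<longlongrightarrow> 0) F" by (rule filterlim_compose[OF exp_at_bot])
    then show ?thesis by (rule tendsto_mult_right_zero)
  qed
  show "(f \<longlongrightarrow> 0) at_top"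
    by (rule Lim_null_comparison[OF _ lim[OF q(1)]]) (use f(3) in \<open>auto intro!: always_eventually\<close>)
  show "(f \<longlongrightarrow> 0) at_bot"
    by (rule Lim_null_comparison[OF _ lim[OF q(2)]]) (use f(3) in \<open>auto intro!: always_eventually\<close>)
qed

lemma integral_derivative_eq_0:
  fixes f f' :: "real \<Rightarrow> complex"
  assumes "\<And>x. (f has_vector_derivative f' x) (at x)" "continuous_on UNIV f'"
    and "gaussian_decay f" "gaussian_decay f'"
  shows "(LINT x|lborel. f' x) = 0"
proof -
  have i: "integrable lborel f'"
    by (rule gaussian_decay_integrable[OF assms(4)]) (use assms(2) in \<open>auto intro: borel_measurable_continuous_onI\<close>)
  have "(LBINT x=-\<infinity>..\<infinity>. f' x) = 0 - 0"
  proof (rule interval_integral_FTC_integrable)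
    show "((f \<circ> real_of_ereal) \<longlongrightarrow> 0) (at_right (- \<infinity>))" "((f \<circ> real_of_ereal) \<longlongrightarrow> 0) (at_left \<infinity>)"
      using gaussian_decay_tendsto[OF assms(3)] by (simp_all add: ereal_tendsto_simps)
    show "set_integrable lborel (einterval (- \<infinity>) \<infinity>) f'"
      using i by (simp add: set_integrable_def)
    show "isCont f' x" for x using assms(2) by (simp add: continuous_on_eq_continuous_at)
  qed (use assms in auto)
  then show ?thesis by (simp add: interval_lebesgue_integral_def set_lebesgue_integral_def)
qed

subsection \<open>Special Hermite functions in one variable\<close>

lemma hermite_gauss_decay: "gaussian_decay (\<lambda>x. complex_of_real (hermite_gauss k x))"
proof -
  have base: "gaussian_decay (\<lambda>x. complex_of_real (exp (- x\<^sup>2 / 2)))"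
    by (rule gaussian_decayI[of "1/2" _ 1]) auto
  have lin: "gaussian_decay (\<lambda>x. complex_of_real x * f x)" if "gaussian_decay f" for f :: "real \<Rightarrow> complex"
    by (rule gaussian_decay_linear_mult[OF that, of _ 1]) simp
  show ?thesis
  proof (induction k rule: less_induct)
    case (less k)
    consider "k = 0" | j where "k = Suc j" by (cases k) auto
    then show ?case
    proof cases
      case 1
      then show ?thesis using base by (simp add: hermite_gauss_def)
    next
      case 2
      have "gaussian_decay (\<lambda>x. 2 * (complex_of_real x * complex_of_real (hermite_gauss j x))
          - (2 * of_nat j) * complex_of_real (hermite_gauss (j - 1) x))"
        by (intro gaussian_decay_diff gaussian_decay_cmult lin less.IH)
          (use 2 in auto)
      moreover have "hermite_gauss k x = 2 * (x * hermite_gauss j x) - 2 * real j * hermite_gauss (j - 1) x" for x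
        by (simp add: 2 hermite_gauss_def hermite_poly_Suc algebra_simps)
      ultimately show ?thesis by simp
    qed
  qed
qed

lemma continuous_on_hermite_gauss [continuous_intros]:
  "continuous_on A f \<Longrightarrow> continuous_on A (\<lambda>x. hermite_gauss k (f x))"
  by (rule continuous_on_compose2[of UNIV])
    (auto intro!: continuous_at_imp_continuous_on DERIV_isCont[OF hermite_gauss_has_derivative])

section \<open>The Fourier-Wigner transform of two Hermite functions\<close>

definition wigner_integrand :: "nat \<Rightarrow> nat \<Rightarrow> complex \<Rightarrow> real \<Rightarrow> complex" where
  "wigner_integrand m k z \<xi> = exp (\<i> * of_real (Re z * \<xi>))
     * of_real (hermite_gauss m (\<xi> + Im z / 2)) * of_real (hermite_gauss k (\<xi> - Im z / 2))"

definition wigner_integral :: "nat \<Rightarrow> nat \<Rightarrow> complex \<Rightarrow> complex" where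
  "wigner_integral m k z = (LINT \<xi>|lborel. wigner_integrand m k z \<xi>)"

lemma wigner_integrand_decay: "gaussian_decay (wigner_integrand m k z)"
proof -
  obtain C a where C: "0 < a" "0 \<le> C" "\<And>x. cmod (of_real (hermite_gauss m x)) \<le> C * exp (- a * (norm x)\<^sup>2)"
    using gaussian_decay_nonneg[OF hermite_gauss_decay[of m]] by blast
  have "C * exp (- a * (norm x)\<^sup>2) \<le> C * 1" for x :: real
    using C by (intro mult_left_mono) auto
  then have "cmod (exp (\<i> * of_real (Re z * \<xi>)) * of_real (hermite_gauss m (\<xi> + Im z / 2))) \<le> C" for \<xi>
    using C(3)[of "\<xi> + Im z / 2"] order_trans by (fastforce simp: norm_mult)
  then have "gaussian_decay (\<lambda>\<xi>. (exp (\<i> * of_real (Re z * \<xi>)) * of_real (hermite_gauss m (\<xi> + Im z / 2)))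
      * of_real (hermite_gauss k (\<xi> + - (Im z / 2))))"
    by (intro gaussian_decay_bounded_mult gaussian_decay_shift[OF hermite_gauss_decay])
  then show ?thesis by (simp add: wigner_integrand_def[abs_def])
qed

lemma wigner_integrand_continuous: "continuous_on A (wigner_integrand m k z)"
  unfolding wigner_integrand_def[abs_def] by (intro continuous_intros) auto

lemma wigner_integrand_integrable: "integrable lborel (wigner_integrand m k z)"
  by (rule gaussian_decay_integrable[OF wigner_integrand_decay])
    (simp add: borel_measurable_continuous_onI wigner_integrand_continuous)

text \<open>Integrating the derivative of \<open>wigner_integrand m k z\<close> in two ways gives the ladder relations.\<close>

lemma wigner_integral_rec:
  "wigner_integral (Suc m) k z = \<i> * cnj z * wigner_integral m k z + 2 * of_nat k * wigner_integral m (k - 1) z"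
  "wigner_integral m (Suc k) z = \<i> * z * wigner_integral m k z + 2 * of_nat m * wigner_integral (m - 1) k z"
proof -
  let ?w = "\<lambda>m k. wigner_integrand m k z"
  have shift: "((\<lambda>\<xi>. of_real (hermite_gauss j (\<xi> + h))) has_vector_derivative complex_of_real d) (at \<xi>)"
    if "(hermite_gauss j has_field_derivative d) (at (\<xi> + h))" for j h d \<xi>
  proof -
    have "((\<lambda>\<xi>. hermite_gauss j (\<xi> + h)) has_field_derivative d) (at \<xi>)"
      using that by (simp add: DERIV_shift)
    then show ?thesis
      by (simp add: has_real_derivative_iff_has_vector_derivative has_vector_derivative_of_real)
  qed
  have expd: "((\<lambda>\<xi>. exp (\<i> * of_real (Re z * \<xi>))) has_vector_derivative (\<i> * of_real (Re z) * exp (\<i> * of_real (Re z * \<xi>)))) (at \<xi>)" for \<xi>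
  proof -
    have "((\<lambda>w. exp (\<i> * (of_real (Re z) * w))) has_field_derivative (\<i> * of_real (Re z) * exp (\<i> * of_real (Re z * \<xi>)))) (at (of_real \<xi>))"
      by (auto intro!: derivative_eq_intros)
    then show ?thesis using has_vector_derivative_real_field by fastforce
  qed
  have zero: "(LINT \<xi>|lborel. F \<xi>) = 0"
    if F: "\<And>\<xi>. (?w m k has_vector_derivative F \<xi>) (at \<xi>)"
      and eq: "F = (\<lambda>\<xi>. a * ?w m k \<xi> + b * ?w m1 k1 \<xi> + d * ?w m2 k2 \<xi>)" for F a b d m1 k1 m2 k2
  proof (rule integral_derivative_eq_0[OF F])
    show "continuous_on UNIV F" unfolding eq by (intro continuous_intros wigner_integrand_continuous)
    show "gaussian_decay F" unfolding eq
      by (intro gaussian_decay_add gaussian_decay_cmult wigner_integrand_decay)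
  qed (rule wigner_integrand_decay)
  have lin: "(LINT \<xi>|lborel. a * ?w m k \<xi> + b * ?w m1 k1 \<xi> + d * ?w m2 k2 \<xi>)
      = a * wigner_integral m k z + b * wigner_integral m1 k1 z + d * wigner_integral m2 k2 z" for a b d m1 k1 m2 k2
    unfolding wigner_integral_def using wigner_integrand_integrable
    by (simp add: Bochner_Integration.integral_add)
  have deriv: "(?w m k has_vector_derivative
      (\<i> * of_real (Re z) * exp (\<i> * of_real (Re z * \<xi>)) * of_real (hermite_gauss m (\<xi> + Im z / 2)) * of_real (hermite_gauss k (\<xi> - Im z / 2))
       + exp (\<i> * of_real (Re z * \<xi>)) * of_real d1 * of_real (hermite_gauss k (\<xi> - Im z / 2))
       + exp (\<i> * of_real (Re z * \<xi>)) * of_real (hermite_gauss m (\<xi> + Im z / 2)) * of_real d2)) (at \<xi>)"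
    if "(hermite_gauss m has_field_derivative d1) (at (\<xi> + Im z / 2))"
      "(hermite_gauss k has_field_derivative d2) (at (\<xi> - Im z / 2))" for \<xi> d1 d2
  proof -
    have d2: "((\<lambda>\<xi>. of_real (hermite_gauss k (\<xi> - Im z / 2))) has_vector_derivative complex_of_real d2) (at \<xi>)"
      using shift[of k d2 \<xi> "- (Im z / 2)"] that(2) by simp
    show ?thesis
      unfolding wigner_integrand_def[abs_def]
      by (rule has_vector_derivative_eq_rhs[OF has_vector_derivative_mult[OF has_vector_derivative_mult[OF expd shift[OF that(1)]] d2]])
        (simp add: algebra_simps)
  qed
  have z: "z = of_real (Re z) + \<i> * of_real (Im z)" by (simp add: complex_eq)
  have zc: "cnj z = of_real (Re z) - \<i> * of_real (Im z)" by (simp add: complex_eq_iff)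
  \<comment> \<open>The raising form for the first factor and the lowering form for the second: the
    terms in \<xi> cancel, and the remainder i Re z + Im z is i cnj z. The other relation exchanges
    the two roles and leaves i z.\<close>
  have "(LINT \<xi>|lborel. \<i> * cnj z * ?w m k \<xi> + (- 1) * ?w (Suc m) k \<xi> + (2 * of_nat k) * ?w m (k - 1) \<xi>) = 0"
  proof (rule zero[OF _ refl])
    fix \<xi>
    show "(?w m k has_vector_derivative \<i> * cnj z * ?w m k \<xi> + (- 1) * ?w (Suc m) k \<xi> + (2 * of_nat k) * ?w m (k - 1) \<xi>) (at \<xi>)"
      by (rule has_vector_derivative_eq_rhs[OF deriv[OF hermite_gauss_has_derivative' hermite_gauss_has_derivative]])
        (simp add: wigner_integrand_def zc algebra_simps)
  qed
  then show "wigner_integral (Suc m) k z = \<i> * cnj z * wigner_integral m k z + 2 * of_nat k * wigner_integral m (k - 1) z"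
    unfolding lin by (simp add: algebra_simps)
  have "(LINT \<xi>|lborel. \<i> * z * ?w m k \<xi> + (- 1) * ?w m (Suc k) \<xi> + (2 * of_nat m) * ?w (m - 1) k \<xi>) = 0"
  proof (rule zero[OF _ refl])
    fix \<xi>
    show "(?w m k has_vector_derivative \<i> * z * ?w m k \<xi> + (- 1) * ?w m (Suc k) \<xi> + (2 * of_nat m) * ?w (m - 1) k \<xi>) (at \<xi>)"
      by (rule has_vector_derivative_eq_rhs[OF deriv[OF hermite_gauss_has_derivative hermite_gauss_has_derivative']], subst (9) z)
        (simp add: wigner_integrand_def algebra_simps)
  qed
  then show "wigner_integral m (Suc k) z = \<i> * z * wigner_integral m k z + 2 * of_nat m * wigner_integral (m - 1) k z"
    unfolding lin by (simp add: algebra_simps)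
qed

text \<open>The product of the two shifted Gaussians is exp(-\<xi>^2) times a constant, so after
  rescaling by sqrt 2 the integral is the characteristic function of the standard normal
  distribution at Re z / sqrt 2.\<close>

lemma wigner_integral_0_0: "wigner_integral 0 0 z = of_real (sqrt pi * exp (- (cmod z)\<^sup>2 / 4))"
proof -
  let ?t = "Re z / sqrt 2"
  have "complex_of_real (exp (- ?t\<^sup>2 / 2)) = (LINT u|std_normal_distribution. iexp (?t * u))"
    using fun_cong[OF char_std_normal_distribution, of ?t, symmetric] unfolding char_def .
  also have "\<dots> = (LINT u|lborel. std_normal_density u *\<^sub>R iexp (?t * u))"
    by (subst integral_density) auto
  also have "\<dots> = (LINT u|lborel. std_normal_density (0 + sqrt 2 * u) *\<^sub>R iexp (?t * (0 + sqrt 2 * u)) * of_real (sqrt 2))"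
    by (subst lborel_integral_real_affine[of "sqrt 2" _ 0]) (simp_all add: scaleR_conv_of_real mult_ac)
  also have "\<dots> = (LINT u|lborel. of_real (exp ((Im z)\<^sup>2 / 4) / sqrt pi) * wigner_integrand 0 0 z u)"
  proof (rule Bochner_Integration.integral_cong[OF refl])
    fix u
    have e: "exp (- (u + Im z / 2)\<^sup>2 / 2) * exp (- (u - Im z / 2)\<^sup>2 / 2) = exp (- u\<^sup>2) * exp (- (Im z)\<^sup>2 / 4)"
      by (simp add: exp_add[symmetric] power2_eq_square field_simps)
    have "sqrt (2 * pi) = sqrt 2 * sqrt pi" by (simp add: real_sqrt_mult)
    then have s: "std_normal_density (sqrt 2 * u) * sqrt 2 = exp (- u\<^sup>2) / sqrt pi"
      by (simp add: std_normal_density_def power_mult_distrib)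
    have "std_normal_density (0 + sqrt 2 * u) *\<^sub>R iexp (?t * (0 + sqrt 2 * u)) * of_real (sqrt 2)
        = of_real (std_normal_density (sqrt 2 * u) * sqrt 2) * iexp (Re z * u)"
      by (simp add: scaleR_conv_of_real)
    also have "\<dots> = of_real (exp ((Im z)\<^sup>2 / 4) / sqrt pi) * (of_real (exp (- u\<^sup>2) * exp (- (Im z)\<^sup>2 / 4)) * iexp (Re z * u))"
      unfolding s by (simp add: exp_minus field_simps)
    also have "of_real (exp (- u\<^sup>2) * exp (- (Im z)\<^sup>2 / 4)) * iexp (Re z * u) = wigner_integrand 0 0 z u"
      unfolding e[symmetric] by (simp add: wigner_integrand_def hermite_gauss_def mult_ac)
    finally show "std_normal_density (0 + sqrt 2 * u) *\<^sub>R iexp (?t * (0 + sqrt 2 * u)) * of_real (sqrt 2)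
        = of_real (exp ((Im z)\<^sup>2 / 4) / sqrt pi) * wigner_integrand 0 0 z u" .
  qed
  also have "\<dots> = of_real (exp ((Im z)\<^sup>2 / 4) / sqrt pi) * wigner_integral 0 0 z"
    by (simp add: wigner_integral_def)
  finally have eq: "of_real (exp (- ?t\<^sup>2 / 2)) = of_real (exp ((Im z)\<^sup>2 / 4) / sqrt pi) * wigner_integral 0 0 z" .
  have "wigner_integral 0 0 z = of_real (sqrt pi * exp (- (Im z)\<^sup>2 / 4)) * (of_real (exp ((Im z)\<^sup>2 / 4) / sqrt pi) * wigner_integral 0 0 z)"
  proof -
    have "sqrt pi * exp (- (Im z)\<^sup>2 / 4) * (exp ((Im z)\<^sup>2 / 4) / sqrt pi) = 1"
      by (simp add: exp_minus)
    then show ?thesis unfolding mult.assoc[symmetric] of_real_mult[symmetric] by simp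
  qed
  also have "\<dots> = of_real (sqrt pi * (exp (- (Im z)\<^sup>2 / 4) * exp (- ?t\<^sup>2 / 2)))"
    unfolding eq[symmetric] by simp
  also have "exp (- (Im z)\<^sup>2 / 4) * exp (- ?t\<^sup>2 / 2) = exp (- (cmod z)\<^sup>2 / 4)"
    by (simp add: exp_add[symmetric] cmod_power2 power_divide field_simps)
  finally show ?thesis .
qed

text \<open>\<open>ladder_poly m k \<alpha> \<beta>\<close> is \<open>m! k!\<close> times the coefficient of \<open>a\<^sup>m b\<^sup>k\<close> in \<open>exp (a b + a \<alpha> + b \<beta>)\<close>.\<close>

fun ladder_poly :: "nat \<Rightarrow> nat \<Rightarrow> complex \<Rightarrow> complex \<Rightarrow> complex" where
  "ladder_poly 0 k \<alpha> \<beta> = \<beta> ^ k"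
| "ladder_poly (Suc m) k \<alpha> \<beta> = \<alpha> * ladder_poly m k \<alpha> \<beta> + of_nat k * ladder_poly m (k - 1) \<alpha> \<beta>"

text \<open>The generating function is unchanged when a, \<alpha> are exchanged with b, \<beta>, so
  the recursion in the first index has a mirror image in the second.\<close>

lemma ladder_poly_Suc_right:
  "ladder_poly m (Suc k) \<alpha> \<beta> = \<beta> * ladder_poly m k \<alpha> \<beta> + of_nat m * ladder_poly (m - 1) k \<alpha> \<beta>"
proof (induction m arbitrary: k)
  case (Suc m)
  have 1: "of_nat m * ladder_poly m k \<alpha> \<beta> = of_nat m * (\<alpha> * ladder_poly (m - 1) k \<alpha> \<beta> + of_nat k * ladder_poly (m - 1) (k - 1) \<alpha> \<beta>)"
    by (cases m) auto
  have 2: "of_nat k * ladder_poly m k \<alpha> \<beta> = of_nat k * (\<beta> * ladder_poly m (k - 1) \<alpha> \<beta> + of_nat m * ladder_poly (m - 1) (k - 1) \<alpha> \<beta>)"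
    using Suc[of "k - 1"] by (cases k) auto
  show ?case using Suc[of k] 1 2 by (simp add: algebra_simps)
qed simp

lemma cnj_ladder_poly: "cnj (ladder_poly m k \<alpha> \<beta>) = ladder_poly m k (cnj \<alpha>) (cnj \<beta>)"
  by (induction m arbitrary: k) auto

lemma continuous_on_ladder_poly [continuous_intros]:
  "continuous_on S f \<Longrightarrow> continuous_on S g \<Longrightarrow> continuous_on S (\<lambda>x. ladder_poly m k (f x) (g x))"
  by (induction m arbitrary: k) (auto intro!: continuous_intros)

text \<open>Differentiating the generating function in \<alpha> multiplies it by a, which lowers the
  first index and brings down the factor m; likewise for \<beta> and k.\<close>

lemma ladder_poly_has_vector_derivative:
  assumes f: "(f has_vector_derivative f') (at t)" and g: "(g has_vector_derivative g') (at t)"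
  shows "((\<lambda>t. ladder_poly m k (f t) (g t)) has_vector_derivative
    (f' * of_nat m * ladder_poly (m - 1) k (f t) (g t) + g' * of_nat k * ladder_poly m (k - 1) (f t) (g t))) (at t)"
proof (induction m arbitrary: k)
  case 0
  show ?case
  proof (induction k)
    case (Suc k)
    show ?case
      using has_vector_derivative_mult[OF g Suc] by (cases k) (auto simp: algebra_simps)
  qed simp
next
  case (Suc m)
  have 1: "of_nat m * ladder_poly m k (f t) (g t)
      = of_nat m * (f t * ladder_poly (m - 1) k (f t) (g t) + of_nat k * ladder_poly (m - 1) (k - 1) (f t) (g t))"
    by (cases m) auto
  have d: "((\<lambda>t. f t * ladder_poly m k (f t) (g t) + of_nat k * ladder_poly m (k - 1) (f t) (g t)) has_vector_derivative
     (f t * (f' * of_nat m * ladder_poly (m - 1) k (f t) (g t) + g' * of_nat k * ladder_poly m (k - 1) (f t) (g t))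
       + f' * ladder_poly m k (f t) (g t)
       + of_nat k * (f' * of_nat m * ladder_poly (m - 1) (k - 1) (f t) (g t) + g' * of_nat (k - 1) * ladder_poly m (k - 1 - 1) (f t) (g t)))) (at t)"
    by (intro has_vector_derivative_add has_vector_derivative_mult f Suc has_vector_derivative_mult_right)
  have eq: "f t * (f' * of_nat m * ladder_poly (m - 1) k (f t) (g t) + g' * of_nat k * ladder_poly m (k - 1) (f t) (g t))
       + f' * ladder_poly m k (f t) (g t)
       + of_nat k * (f' * of_nat m * ladder_poly (m - 1) (k - 1) (f t) (g t) + g' * of_nat (k - 1) * ladder_poly m (k - 1 - 1) (f t) (g t))
     = f' * (ladder_poly m k (f t) (g t) + of_nat m * ladder_poly m k (f t) (g t))
       + g' * of_nat k * (f t * ladder_poly m (k - 1) (f t) (g t) + of_nat (k - 1) * ladder_poly m (k - 1 - 1) (f t) (g t))"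
    unfolding 1 by (simp add: algebra_simps)
  have eq': "f' * (ladder_poly m k (f t) (g t) + of_nat m * ladder_poly m k (f t) (g t))
       + g' * of_nat k * (f t * ladder_poly m (k - 1) (f t) (g t) + of_nat (k - 1) * ladder_poly m (k - 1 - 1) (f t) (g t))
     = f' * of_nat (Suc m) * ladder_poly (Suc m - 1) k (f t) (g t) + g' * of_nat k * ladder_poly (Suc m) (k - 1) (f t) (g t)"
    by (simp add: distrib_left distrib_right)
  show ?case using d unfolding eq eq' by simp
qed

lemma gaussian_decay_ladder_poly:
  assumes "gaussian_decay f" "\<And>z. cmod (a z) \<le> 1 + norm z" "\<And>z. cmod (b z) \<le> 1 + norm z"
  shows "gaussian_decay (\<lambda>z. ladder_poly m k (a z) (b z) * f z)"
proof -
  have lin: "gaussian_decay (\<lambda>z. c z * h z)" if "gaussian_decay h" "\<And>z. cmod (c z) \<le> 1 + norm z" for c h :: "'a \<Rightarrow> complex"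
    by (rule gaussian_decay_linear_mult[OF that(1), of _ 1]) (use that in simp)
  show ?thesis
  proof (induction m arbitrary: k)
    case 0
    show ?case
    proof (induction k)
      case (Suc k)
      show ?case using lin[OF Suc assms(3)] by (simp add: mult.assoc)
    qed (use assms in simp)
  next
    case (Suc m)
    have "gaussian_decay (\<lambda>z. a z * (ladder_poly m k (a z) (b z) * f z) + of_nat k * (ladder_poly m (k - 1) (a z) (b z) * f z))"
      by (intro gaussian_decay_add lin gaussian_decay_cmult Suc assms(2))
    then show ?case by (simp add: algebra_simps)
  qed
qed

abbreviation raising :: "complex \<Rightarrow> complex" where "raising z \<equiv> \<i> * cnj z / of_real (sqrt 2)"
abbreviation lowering :: "complex \<Rightarrow> complex" where "lowering z \<equiv> \<i> * z / of_real (sqrt 2)"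

lemma sqrt2_mult: "complex_of_real (sqrt 2) * complex_of_real (sqrt 2) = 2"
  by (simp flip: of_real_mult)

text \<open>Taking out sqrt 2 for each index turns the factors 2 k and 2 m of the ladder relations
  into k and m, that is, into the recursion of \<open>ladder_poly\<close>.\<close>

lemma wigner_integral_eq:
  "wigner_integral m k z = of_real (sqrt pi * exp (- (cmod z)\<^sup>2 / 4)) * of_real (sqrt 2) ^ (m + k)
     * ladder_poly m k (raising z) (lowering z)"
proof (induction m arbitrary: k)
  case 0
  show ?case
  proof (induction k)
    case (Suc k)
    show ?case unfolding wigner_integral_rec(2) Suc by simp
  qed (simp add: wigner_integral_0_0)
next
  case (Suc m)
  have B: "2 * of_nat k * (C * complex_of_real (sqrt 2) ^ (m + (k - 1)) * x)
      = C * complex_of_real (sqrt 2) ^ (Suc m + k) * (of_nat k * x)" for C x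
  proof (cases k)
    case (Suc j)
    have p: "complex_of_real (sqrt 2) ^ (Suc m + Suc j) = 2 * complex_of_real (sqrt 2) ^ (m + j)"
      by (simp add: mult.assoc[symmetric] sqrt2_mult)
    show ?thesis unfolding Suc p by simp
  qed simp
  show ?case unfolding wigner_integral_rec(1) Suc B by (simp add: algebra_simps)
qed

definition special_hermite_1 :: "nat \<Rightarrow> nat \<Rightarrow> complex \<Rightarrow> complex" where
  "special_hermite_1 m k z = of_real (exp (- (cmod z)\<^sup>2 / 4) / sqrt (2 * pi * fact m * fact k))
     * ladder_poly m k (raising z) (lowering z)"

text \<open>The powers of 2 in the normalisation of the Hermite functions cancel against those in
  \<open>wigner_integral_eq\<close>, and sqrt pi cancels as well; besides 1/sqrt(2 pi) only the
  factorials survive.\<close>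

lemma special_hermite_1_eq:
  "special_hermite_1 m k z = of_real (1 / sqrt (2 * pi)) *
    (LINT \<xi>|lborel. exp (\<i> * of_real (Re z * \<xi>)) * of_real (hermite_fun m (\<xi> + Im z / 2)) * of_real (hermite_fun k (\<xi> - Im z / 2)))"
proof -
  define c where "c j = sqrt (2 ^ j * sqrt pi * fact j)" for j
  have c: "c j > 0" for j by (simp add: c_def)
  have "(LINT \<xi>|lborel. exp (\<i> * of_real (Re z * \<xi>)) * of_real (hermite_fun m (\<xi> + Im z / 2)) * of_real (hermite_fun k (\<xi> - Im z / 2)))
      = (LINT \<xi>|lborel. of_real (1 / (c m * c k)) * wigner_integrand m k z \<xi>)"
    by (rule Bochner_Integration.integral_cong) (auto simp: wigner_integrand_def hermite_fun_eq c_def[symmetric])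
  also have "\<dots> = of_real (1 / (c m * c k)) * wigner_integral m k z"
    by (simp add: wigner_integral_def)
  also have "\<dots> = of_real (1 / (c m * c k) * (sqrt pi * exp (- (cmod z)\<^sup>2 / 4) * sqrt 2 ^ (m + k)))
      * ladder_poly m k (raising z) (lowering z)"
    unfolding wigner_integral_eq by simp
  also have "1 / (c m * c k) * (sqrt pi * exp (- (cmod z)\<^sup>2 / 4) * sqrt 2 ^ (m + k)) = exp (- (cmod z)\<^sup>2 / 4) / sqrt (fact m * fact k)"
  proof -
    have "c m * c k = sqrt 2 ^ (m + k) * sqrt pi * sqrt (fact m * fact k)"
      by (simp add: c_def real_sqrt_mult power_add real_sqrt_power)
    then show ?thesis by (simp add: field_simps)
  qed
  finally show ?thesis
    by (simp add: special_hermite_1_def real_sqrt_mult mult_ac)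
qed

section \<open>Integration by parts in the complex plane\<close>

lemma lborel_complex: "(lborel :: complex measure) = distr (lborel \<Otimes>\<^sub>M lborel) borel (\<lambda>p. Complex (fst p) (snd p))"
proof (rule lborel_eqI)
  fix l u :: complex
  assume le: "\<And>b. b \<in> Basis \<Longrightarrow> l \<bullet> b \<le> u \<bullet> b"
  have [measurable]: "(\<lambda>p::real \<times> real. Complex (fst p) (snd p)) \<in> borel_measurable (lborel \<Otimes>\<^sub>M lborel)"
    unfolding Complex_eq by measurable
  have re: "Re l \<le> Re u" "Im l \<le> Im u" using le[of 1] le[of \<i>] by (auto simp: Basis_complex_def)
  have "emeasure (distr (lborel \<Otimes>\<^sub>M lborel) borel (\<lambda>p. Complex (fst p) (snd p))) (box l u)
      = emeasure (lborel \<Otimes>\<^sub>M lborel) ({Re l<..<Re u} \<times> {Im l<..<Im u})"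
    by (subst emeasure_distr) (auto intro!: arg_cong2[where f=emeasure] simp: in_box_complex_iff space_pair_measure)
  also have "\<dots> = ennreal (Re u - Re l) * ennreal (Im u - Im l)"
    using re by (subst lborel.emeasure_pair_measure_Times) auto
  also have "\<dots> = (\<Prod>b\<in>Basis. (u - l) \<bullet> b)"
    using re by (simp add: Basis_complex_def ennreal_mult complex_i_not_one)
  finally show "emeasure (distr (lborel \<Otimes>\<^sub>M lborel) borel (\<lambda>p. Complex (fst p) (snd p))) (box l u) = (\<Prod>b\<in>Basis. (u - l) \<bullet> b)" .
qed simp

lemma measurable_Complex [measurable]: "(\<lambda>p. Complex (fst p) (snd p)) \<in> borel_measurable (lborel \<Otimes>\<^sub>M lborel)"
  unfolding Complex_eq by measurable

lemma gaussian_decay_integrable_complex: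
  fixes f :: "complex \<Rightarrow> complex"
  assumes "gaussian_decay f" and [measurable]: "f \<in> borel_measurable borel"
  shows "integrable (lborel \<Otimes>\<^sub>M lborel) (\<lambda>p. f (Complex (fst p) (snd p)))"
proof -
  obtain C a where f: "0 < a" "0 \<le> C" "\<And>x. cmod (f x) \<le> C * exp (- a * (norm x)\<^sup>2)"
    using gaussian_decay_nonneg[OF assms(1)] by blast
  have i: "integrable lborel (\<lambda>x. complex_of_real (exp (- a * x\<^sup>2)))"
    using integrable_gauss[OF f(1)] by simp
  have "integrable (lborel \<Otimes>\<^sub>M lborel) (\<lambda>p. of_real C * (complex_of_real (exp (- a * (fst p)\<^sup>2)) * of_real (exp (- a * (snd p)\<^sup>2))))"
    by (intro integrable_mult_right lborel_pair.integral_product_mult(1) i)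
  then show ?thesis
  proof (rule Bochner_Integration.integrable_bound)
    show "AE p in lborel \<Otimes>\<^sub>M lborel. cmod (f (Complex (fst p) (snd p)))
        \<le> cmod (of_real C * (complex_of_real (exp (- a * (fst p)\<^sup>2)) * of_real (exp (- a * (snd p)\<^sup>2))))"
    proof (rule AE_I2)
      fix p :: "real \<times> real"
      have "exp (- a * (fst p)\<^sup>2) * exp (- a * (snd p)\<^sup>2) = exp (- a * (cmod (Complex (fst p) (snd p)))\<^sup>2)"
        by (simp add: cmod_power2 exp_add[symmetric] algebra_simps)
      then show "cmod (f (Complex (fst p) (snd p)))
        \<le> cmod (of_real C * (complex_of_real (exp (- a * (fst p)\<^sup>2)) * of_real (exp (- a * (snd p)\<^sup>2))))"
        using f(2,3) by (simp add: norm_mult)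
    qed
  qed measurable
qed

lemma gaussian_decay_integrable_lborel_complex:
  fixes f :: "complex \<Rightarrow> complex"
  assumes "gaussian_decay f" and [measurable]: "f \<in> borel_measurable borel"
  shows "integrable lborel f"
  unfolding lborel_complex
  by (subst integrable_distr_eq) (auto intro: gaussian_decay_integrable_complex assms)

lemma gaussian_decay_line:
  fixes f :: "complex \<Rightarrow> complex"
  assumes "gaussian_decay f" "\<And>x. \<bar>x\<bar> \<le> cmod (l x)"
  shows "gaussian_decay (\<lambda>x::real. f (l x))"
proof -
  obtain C a where f: "0 < a" "0 \<le> C" "\<And>x. cmod (f x) \<le> C * exp (- a * (norm x)\<^sup>2)"
    using gaussian_decay_nonneg[OF assms(1)] by blast
  have "cmod (f (l x)) \<le> C * exp (- a * (norm x)\<^sup>2)" for x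
  proof -
    have "\<bar>x\<bar>\<^sup>2 \<le> (cmod (l x))\<^sup>2" by (intro power_mono assms) auto
    then have "C * exp (- a * (cmod (l x))\<^sup>2) \<le> C * exp (- a * (norm x)\<^sup>2)"
      using f by (intro mult_left_mono) (auto intro: mult_left_mono)
    then show ?thesis using f(3)[of "l x"] by linarith
  qed
  then show ?thesis using f by (intro gaussian_decayI[of a])
qed

text \<open>By Fubini it suffices that the integral of the derivative over each line vanishes;
  Gaussian decay in the plane restricts to Gaussian decay on the lines.\<close>

lemma integral_partial_derivative_eq_0:
  fixes G G' :: "complex \<Rightarrow> complex"
  assumes "continuous_on UNIV G'" "gaussian_decay G" "gaussian_decay G'"
  shows "(\<And>x y. ((\<lambda>x. G (Complex x y)) has_vector_derivative G' (Complex x y)) (at x)) \<Longrightarrow> (LINT z|lborel. G' z) = 0"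
    and "(\<And>x y. ((\<lambda>y. G (Complex x y)) has_vector_derivative G' (Complex x y)) (at y)) \<Longrightarrow> (LINT z|lborel. G' z) = 0"
proof -
  have [measurable]: "G' \<in> borel_measurable borel" using assms(1) by (rule borel_measurable_continuous_onI)
  have i: "integrable (lborel \<Otimes>\<^sub>M lborel) (\<lambda>p. G' (Complex (fst p) (snd p)))"
    by (rule gaussian_decay_integrable_complex[OF assms(3)]) measurable
  have eq: "(LINT z|lborel. G' z) = (LINT p|(lborel \<Otimes>\<^sub>M lborel). G' (Complex (fst p) (snd p)))"
    by (subst lborel_complex, subst integral_distr) auto
  have cont: "continuous_on UNIV (\<lambda>x. G' (Complex x y))" "continuous_on UNIV (\<lambda>x. G' (Complex y x))" for y
    unfolding Complex_eq by (intro continuous_on_compose2[OF assms(1)] continuous_intros; simp)+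
  have le: "\<bar>x\<bar> \<le> cmod (Complex x y)" "\<bar>x\<bar> \<le> cmod (Complex y x)" for x y
    using abs_Re_le_cmod[of "Complex x y"] abs_Im_le_cmod[of "Complex y x"] by auto
  show "(LINT z|lborel. G' z) = 0" if d: "\<And>x y. ((\<lambda>x. G (Complex x y)) has_vector_derivative G' (Complex x y)) (at x)"
  proof -
    have "(LINT x|lborel. G' (Complex x y)) = 0" for y
      by (rule integral_derivative_eq_0[OF d cont(1)])
        (intro gaussian_decay_line[OF assms(2)] gaussian_decay_line[OF assms(3)] le)+
    then show ?thesis
      unfolding eq lborel_pair.integral_snd[of "\<lambda>x y. G' (Complex x y)", symmetric, unfolded case_prod_unfold, OF i] by simp
  qed
  show "(LINT z|lborel. G' z) = 0" if d: "\<And>x y. ((\<lambda>y. G (Complex x y)) has_vector_derivative G' (Complex x y)) (at y)"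
  proof -
    have "(LINT y|lborel. G' (Complex x y)) = 0" for x
      by (rule integral_derivative_eq_0[OF d cont(2)])
        (intro gaussian_decay_line[OF assms(2)] gaussian_decay_line[OF assms(3)] le)+
    then show ?thesis
      unfolding eq lborel_pair.integral_fst'[OF i, symmetric] by simp
  qed
qed

section \<open>Orthogonality of the one-variable special Hermite functions\<close>

definition ladder_pairing :: "nat \<Rightarrow> nat \<Rightarrow> nat \<Rightarrow> nat \<Rightarrow> complex \<Rightarrow> complex" where
  "ladder_pairing m k m' k' z = ladder_poly m k (raising z) (lowering z)
     * (ladder_poly m' k' (cnj (raising z)) (cnj (lowering z)) * of_real (exp (- (cmod z)\<^sup>2 / 2)))"

lemma norm_raising_le: "cmod (raising z) \<le> 1 + cmod z" "cmod (lowering z) \<le> 1 + cmod z"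
  "cmod (cnj (raising z)) \<le> 1 + cmod z" "cmod (cnj (lowering z)) \<le> 1 + cmod z"
proof -
  have "cmod z / sqrt 2 \<le> cmod z / 1" by (intro divide_left_mono) auto
  then show "cmod (raising z) \<le> 1 + cmod z" "cmod (lowering z) \<le> 1 + cmod z"
    "cmod (cnj (raising z)) \<le> 1 + cmod z" "cmod (cnj (lowering z)) \<le> 1 + cmod z"
    by (simp_all add: norm_divide norm_mult)
qed

lemma ladder_pairing_decay: "gaussian_decay (ladder_pairing m k m' k')"
  unfolding ladder_pairing_def[abs_def]
  by (intro gaussian_decay_ladder_poly norm_raising_le gaussian_decayI[of "1/2" _ 1]) auto

lemma ladder_pairing_continuous: "continuous_on A (ladder_pairing m k m' k')"
  unfolding ladder_pairing_def[abs_def] by (intro continuous_intros) auto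

lemma ladder_pairing_integrable: "integrable lborel (ladder_pairing m k m' k')"
  by (rule gaussian_decay_integrable_lborel_complex[OF ladder_pairing_decay])
    (rule borel_measurable_continuous_onI[OF ladder_pairing_continuous])

lemma ladder_pairing_partial:
  shows "((\<lambda>x. ladder_pairing m k m' k' (Complex x y)) has_vector_derivative
      (\<i> / of_real (sqrt 2) * of_nat m * ladder_pairing (m - 1) k m' k' (Complex x y)
       + \<i> / of_real (sqrt 2) * of_nat k * ladder_pairing m (k - 1) m' k' (Complex x y)
       - \<i> / of_real (sqrt 2) * of_nat m' * ladder_pairing m k (m' - 1) k' (Complex x y)
       - \<i> / of_real (sqrt 2) * of_nat k' * ladder_pairing m k m' (k' - 1) (Complex x y)
       - of_real x * ladder_pairing m k m' k' (Complex x y))) (at x)"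
    and "((\<lambda>y. ladder_pairing m k m' k' (Complex x y)) has_vector_derivative
      (1 / of_real (sqrt 2) * of_nat m * ladder_pairing (m - 1) k m' k' (Complex x y)
       - 1 / of_real (sqrt 2) * of_nat k * ladder_pairing m (k - 1) m' k' (Complex x y)
       + 1 / of_real (sqrt 2) * of_nat m' * ladder_pairing m k (m' - 1) k' (Complex x y)
       - 1 / of_real (sqrt 2) * of_nat k' * ladder_pairing m k m' (k' - 1) (Complex x y)
       - of_real y * ladder_pairing m k m' k' (Complex x y))) (at y)"
proof -
  let ?r = "complex_of_real (sqrt 2)"
  have id: "((\<lambda>x. complex_of_real x) has_vector_derivative 1) (at x)" for x
    using has_vector_derivative_of_real[of "\<lambda>x. x" 1 "at x"] by (simp add: has_vector_derivative_id)
  have lin: "((\<lambda>x. c + d * complex_of_real x) has_vector_derivative d) (at x)" for c d x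
    using has_vector_derivative_add[OF has_vector_derivative_const has_vector_derivative_mult_right[OF id]] by simp
  have iz: "\<i> * cnj (Complex x y) = of_real y + \<i> * of_real x" "\<i> * Complex x y = - of_real y + \<i> * of_real x" for x y
    by (simp_all add: complex_eq_iff)
  have ax: "(\<lambda>x. raising (Complex x y)) = (\<lambda>x. of_real y / ?r + \<i> / ?r * of_real x)"
    "(\<lambda>x. lowering (Complex x y)) = (\<lambda>x. - of_real y / ?r + \<i> / ?r * of_real x)"
    "(\<lambda>x. cnj (raising (Complex x y))) = (\<lambda>x. of_real y / ?r + - \<i> / ?r * of_real x)"
    "(\<lambda>x. cnj (lowering (Complex x y))) = (\<lambda>x. - of_real y / ?r + - \<i> / ?r * of_real x)"
    by (auto simp: iz fun_eq_iff add_divide_distrib diff_divide_distrib)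
  have ay: "(\<lambda>y. raising (Complex x y)) = (\<lambda>y. \<i> * of_real x / ?r + 1 / ?r * of_real y)"
    "(\<lambda>y. lowering (Complex x y)) = (\<lambda>y. \<i> * of_real x / ?r + - 1 / ?r * of_real y)"
    "(\<lambda>y. cnj (raising (Complex x y))) = (\<lambda>y. - \<i> * of_real x / ?r + 1 / ?r * of_real y)"
    "(\<lambda>y. cnj (lowering (Complex x y))) = (\<lambda>y. - \<i> * of_real x / ?r + - 1 / ?r * of_real y)"
    by (auto simp: iz fun_eq_iff add_divide_distrib diff_divide_distrib)
  have exd: "((\<lambda>t. complex_of_real (exp (- (c + t\<^sup>2) / 2))) has_vector_derivative - of_real t * of_real (exp (- (c + t\<^sup>2) / 2))) (at t)" for c t :: real
  proof -
    have "((\<lambda>t. exp (- (c + t\<^sup>2) / 2)) has_real_derivative - t * exp (- (c + t\<^sup>2) / 2)) (at t)"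
      by (auto intro!: derivative_eq_intros)
    then show ?thesis
      using has_vector_derivative_of_real[of "\<lambda>t. exp (- (c + t\<^sup>2) / 2)" "- t * exp (- (c + t\<^sup>2) / 2)" "at t"]
      by (simp add: has_real_derivative_iff_has_vector_derivative)
  qed
  have ex: "(\<lambda>x. complex_of_real (exp (- (cmod (Complex x y))\<^sup>2 / 2))) = (\<lambda>x. of_real (exp (- (y\<^sup>2 + x\<^sup>2) / 2)))" for y
    by (simp add: cmod_power2 add.commute)
  have ey: "(\<lambda>y. complex_of_real (exp (- (cmod (Complex x y))\<^sup>2 / 2))) = (\<lambda>y. of_real (exp (- (x\<^sup>2 + y\<^sup>2) / 2)))" for x
    by (simp add: cmod_power2)
  have dx: "((\<lambda>x. raising (Complex x y)) has_vector_derivative \<i> / ?r) (at x)"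
    "((\<lambda>x. lowering (Complex x y)) has_vector_derivative \<i> / ?r) (at x)"
    "((\<lambda>x. cnj (raising (Complex x y))) has_vector_derivative - \<i> / ?r) (at x)"
    "((\<lambda>x. cnj (lowering (Complex x y))) has_vector_derivative - \<i> / ?r) (at x)"
    unfolding ax by (rule lin)+
  have dy: "((\<lambda>y. raising (Complex x y)) has_vector_derivative 1 / ?r) (at y)"
    "((\<lambda>y. lowering (Complex x y)) has_vector_derivative - 1 / ?r) (at y)"
    "((\<lambda>y. cnj (raising (Complex x y))) has_vector_derivative 1 / ?r) (at y)"
    "((\<lambda>y. cnj (lowering (Complex x y))) has_vector_derivative - 1 / ?r) (at y)"
    unfolding ay by (rule lin)+
  have dex: "((\<lambda>x. complex_of_real (exp (- (cmod (Complex x y))\<^sup>2 / 2))) has_vector_derivative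
      - of_real x * of_real (exp (- (cmod (Complex x y))\<^sup>2 / 2))) (at x)"
    using exd[of "y\<^sup>2" x] by (simp add: cmod_power2 add.commute)
  have dey: "((\<lambda>y. complex_of_real (exp (- (cmod (Complex x y))\<^sup>2 / 2))) has_vector_derivative
      - of_real y * of_real (exp (- (cmod (Complex x y))\<^sup>2 / 2))) (at y)"
    using exd[of "x\<^sup>2" y] by (simp add: cmod_power2)
  show "((\<lambda>x. ladder_pairing m k m' k' (Complex x y)) has_vector_derivative
      (\<i> / ?r * of_nat m * ladder_pairing (m - 1) k m' k' (Complex x y)
       + \<i> / ?r * of_nat k * ladder_pairing m (k - 1) m' k' (Complex x y)
       - \<i> / ?r * of_nat m' * ladder_pairing m k (m' - 1) k' (Complex x y)
       - \<i> / ?r * of_nat k' * ladder_pairing m k m' (k' - 1) (Complex x y)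
       - of_real x * ladder_pairing m k m' k' (Complex x y))) (at x)"
    unfolding ladder_pairing_def
    by (rule has_vector_derivative_eq_rhs[OF has_vector_derivative_mult[OF ladder_poly_has_vector_derivative[OF dx(1,2)]
      has_vector_derivative_mult[OF ladder_poly_has_vector_derivative[OF dx(3,4)] dex]]])
      (simp add: algebra_simps)
  show "((\<lambda>y. ladder_pairing m k m' k' (Complex x y)) has_vector_derivative
      (1 / ?r * of_nat m * ladder_pairing (m - 1) k m' k' (Complex x y)
       - 1 / ?r * of_nat k * ladder_pairing m (k - 1) m' k' (Complex x y)
       + 1 / ?r * of_nat m' * ladder_pairing m k (m' - 1) k' (Complex x y)
       - 1 / ?r * of_nat k' * ladder_pairing m k m' (k' - 1) (Complex x y)
       - of_real y * ladder_pairing m k m' k' (Complex x y))) (at y)"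
    unfolding ladder_pairing_def
    by (rule has_vector_derivative_eq_rhs[OF has_vector_derivative_mult[OF ladder_poly_has_vector_derivative[OF dy(1,2)]
      has_vector_derivative_mult[OF ladder_poly_has_vector_derivative[OF dy(3,4)] dey]]])
      (simp add: algebra_simps)
qed

definition ladder_product :: "nat \<Rightarrow> nat \<Rightarrow> nat \<Rightarrow> nat \<Rightarrow> complex" where
  "ladder_product m k m' k' = (LINT z|lborel. ladder_pairing m k m' k' z)"

text \<open>The combinations \<open>\<partial>\<^sub>x \<minusplus> \<i> \<partial>\<^sub>y\<close> of the previous derivatives shift one index of each factor.\<close>

lemma ladder_product_rec:
  "ladder_product (Suc m) k m' k' = of_nat m' * ladder_product m k (m' - 1) k'"
  "ladder_product m (Suc k) m' k' = of_nat k' * ladder_product m k m' (k' - 1)"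
proof -
  let ?r = "complex_of_real (sqrt 2)" and ?L = "ladder_pairing m k m' k'"
  define Lx where "Lx z = \<i> / ?r * of_nat m * ladder_pairing (m - 1) k m' k' z
       + \<i> / ?r * of_nat k * ladder_pairing m (k - 1) m' k' z
       - \<i> / ?r * of_nat m' * ladder_pairing m k (m' - 1) k' z
       - \<i> / ?r * of_nat k' * ladder_pairing m k m' (k' - 1) z
       - of_real (Re z) * ?L z" for z
  define Ly where "Ly z = 1 / ?r * of_nat m * ladder_pairing (m - 1) k m' k' z
       - 1 / ?r * of_nat k * ladder_pairing m (k - 1) m' k' z
       + 1 / ?r * of_nat m' * ladder_pairing m k (m' - 1) k' z
       - 1 / ?r * of_nat k' * ladder_pairing m k m' (k' - 1) z
       - of_real (Im z) * ?L z" for z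
  have decay_lin: "gaussian_decay (\<lambda>z. of_real (Re z) * ?L z)" "gaussian_decay (\<lambda>z. of_real (Im z) * ?L z)"
  proof -
    show "gaussian_decay (\<lambda>z. of_real (Re z) * ?L z)"
    proof (rule gaussian_decay_linear_mult[OF ladder_pairing_decay, of _ 1])
      show "cmod (of_real (Re z)) \<le> 1 * (1 + cmod z)" for z using abs_Re_le_cmod[of z] by simp
    qed
    show "gaussian_decay (\<lambda>z. of_real (Im z) * ?L z)"
    proof (rule gaussian_decay_linear_mult[OF ladder_pairing_decay, of _ 1])
      show "cmod (of_real (Im z)) \<le> 1 * (1 + cmod z)" for z using abs_Im_le_cmod[of z] by simp
    qed
  qed
  have decay: "gaussian_decay Lx" "gaussian_decay Ly"
    unfolding Lx_def[abs_def] Ly_def[abs_def]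
    by (intro gaussian_decay_add gaussian_decay_diff gaussian_decay_cmult ladder_pairing_decay decay_lin)+
  have cont: "continuous_on UNIV Lx" "continuous_on UNIV Ly"
    unfolding Lx_def[abs_def] Ly_def[abs_def]
    by (intro continuous_intros ladder_pairing_continuous)+
  have zero: "(LINT z|lborel. Lx z) = 0" "(LINT z|lborel. Ly z) = 0"
  proof -
    show "(LINT z|lborel. Lx z) = 0"
      by (rule integral_partial_derivative_eq_0(1)[OF cont(1) ladder_pairing_decay[of m k m' k'] decay(1)])
        (use ladder_pairing_partial(1) in \<open>simp add: Lx_def\<close>)
    show "(LINT z|lborel. Ly z) = 0"
      by (rule integral_partial_derivative_eq_0(2)[OF cont(2) ladder_pairing_decay[of m k m' k'] decay(2)])
        (use ladder_pairing_partial(2) in \<open>simp add: Ly_def\<close>)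
  qed
  have int: "integrable lborel Lx" "integrable lborel Ly"
    by (rule gaussian_decay_integrable_lborel_complex[OF decay(1) borel_measurable_continuous_onI[OF cont(1)]],
        rule gaussian_decay_integrable_lborel_complex[OF decay(2) borel_measurable_continuous_onI[OF cont(2)]])
  have r: "?r \<noteq> 0" "2 / ?r = ?r" "inverse ?r * 2 = ?r" using sqrt2_mult by (auto simp: field_simps)
  have up: "ladder_pairing (Suc m) k m' k' z = raising z * ?L z + of_nat k * ladder_pairing m (k - 1) m' k' z"
    "ladder_pairing m (Suc k) m' k' z = lowering z * ?L z + of_nat m * ladder_pairing (m - 1) k m' k' z" for z
    by (simp_all add: ladder_pairing_def ladder_poly_Suc_right algebra_simps)
  \<comment> \<open>In this combination the terms with m and k' cancel and those with k and m'
    double; together with the term in cnj z they form the recursion that raises m.\<close>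
  have "Lx z - \<i> * Ly z = \<i> * ?r * (ladder_pairing (Suc m) k m' k' z - of_nat m' * ladder_pairing m k (m' - 1) k' z)" for z
  proof -
    have "\<i> * ?r * raising z = - (of_real (Re z) - \<i> * of_real (Im z))"
      using r(1) by (simp add: complex_eq_iff)
    then have "\<i> * ?r * (raising z * ?L z) = - (of_real (Re z) - \<i> * of_real (Im z)) * ?L z"
      by (simp add: mult.assoc[symmetric])
    moreover have "Lx z - \<i> * Ly z = \<i> * (2 / ?r) * (of_nat k * ladder_pairing m (k - 1) m' k' z)
        - \<i> * (2 / ?r) * (of_nat m' * ladder_pairing m k (m' - 1) k' z) - (of_real (Re z) - \<i> * of_real (Im z)) * ?L z"
      using r(1) by (simp add: Lx_def Ly_def field_simps)
    ultimately show ?thesis unfolding r(2) up by (simp add: algebra_simps)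
  qed
  then have "(LINT z|lborel. Lx z - \<i> * Ly z)
      = \<i> * ?r * (ladder_product (Suc m) k m' k' - of_nat m' * ladder_product m k (m' - 1) k')"
    unfolding ladder_product_def using ladder_pairing_integrable by simp
  then show "ladder_product (Suc m) k m' k' = of_nat m' * ladder_product m k (m' - 1) k'"
    using int zero r(1) by simp
  have "Lx z + \<i> * Ly z = \<i> * ?r * (ladder_pairing m (Suc k) m' k' z - of_nat k' * ladder_pairing m k m' (k' - 1) z)" for z
  proof -
    have "\<i> * ?r * lowering z = - (of_real (Re z) + \<i> * of_real (Im z))"
      using r(1) by (simp add: complex_eq_iff)
    then have "\<i> * ?r * (lowering z * ?L z) = - (of_real (Re z) + \<i> * of_real (Im z)) * ?L z"
      by (simp add: mult.assoc[symmetric])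
    moreover have "Lx z + \<i> * Ly z = \<i> * (2 / ?r) * (of_nat m * ladder_pairing (m - 1) k m' k' z)
        - \<i> * (2 / ?r) * (of_nat k' * ladder_pairing m k m' (k' - 1) z) - (of_real (Re z) + \<i> * of_real (Im z)) * ?L z"
      using r(1) by (simp add: Lx_def Ly_def field_simps)
    ultimately show ?thesis unfolding r(2) up by (simp add: algebra_simps)
  qed
  then have "(LINT z|lborel. Lx z + \<i> * Ly z)
      = \<i> * ?r * (ladder_product m (Suc k) m' k' - of_nat k' * ladder_product m k m' (k' - 1))"
    unfolding ladder_product_def using ladder_pairing_integrable by simp
  then show "ladder_product m (Suc k) m' k' = of_nat k' * ladder_product m k m' (k' - 1)"
    using int zero r(1) by simp
qed

lemma ladder_product_commute: "ladder_product m' k' m k = cnj (ladder_product m k m' k')"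
proof -
  have eq: "ladder_pairing m' k' m k z = cnj (ladder_pairing m k m' k' z)" for z
    by (simp add: ladder_pairing_def cnj_ladder_poly mult_ac)
  have "ladder_product m' k' m k = (LINT z|lborel. cnj (ladder_pairing m k m' k' z))"
    unfolding ladder_product_def by (rule Bochner_Integration.integral_cong[OF refl eq])
  then show ?thesis by (simp add: ladder_product_def)
qed

lemma ladder_product_0: "ladder_product 0 0 0 0 = of_real (2 * pi)"
proof -
  have i: "integrable lborel (\<lambda>x. complex_of_real (exp (- (1/2) * x\<^sup>2)))"
    using integrable_gauss[of "1/2"] by simp
  have g: "(LINT x|lborel. complex_of_real (exp (- (1/2) * x\<^sup>2))) = of_real (sqrt (2 * pi))"
  proof -
    have "(LINT x|lborel. exp (- (1/2) * x\<^sup>2)) = (LINT x|lborel. sqrt (2 * pi) * std_normal_density x)"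
      by (rule Bochner_Integration.integral_cong) (auto simp: std_normal_density_def)
    also have "\<dots> = sqrt (2 * pi)" by simp
    finally show ?thesis by (simp only: integral_complex_of_real)
  qed
  have "ladder_product 0 0 0 0 = (LINT p|(lborel \<Otimes>\<^sub>M lborel). ladder_pairing 0 0 0 0 (Complex (fst p) (snd p)))"
    unfolding ladder_product_def
    by (subst lborel_complex, subst integral_distr)
      (auto intro: borel_measurable_continuous_onI ladder_pairing_continuous)
  also have "\<dots> = (LINT p|(lborel \<Otimes>\<^sub>M lborel). complex_of_real (exp (- (1/2) * (fst p)\<^sup>2)) * complex_of_real (exp (- (1/2) * (snd p)\<^sup>2)))"
    by (rule Bochner_Integration.integral_cong)
      (auto simp: ladder_pairing_def cmod_power2 exp_add[symmetric] add_divide_distrib simp flip: of_real_mult)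
  also have "\<dots> = of_real (sqrt (2 * pi)) * of_real (sqrt (2 * pi))"
    unfolding lborel_pair.integral_product_mult(2)[OF i i] g ..
  also have "\<dots> = of_real (2 * pi)"
    unfolding of_real_mult[symmetric] real_sqrt_mult_self by simp
  finally show ?thesis .
qed

text \<open>The recursion lowers m together with m' and k together with k'. If one index of a pair
  runs out first, conjugate symmetry moves the surplus to the left, where the recursion produces a
  zero factor.\<close>

lemma ladder_product_eq:
  "ladder_product m k m' k' = (if m = m' \<and> k = k' then of_real (2 * pi * fact m * fact k) else 0)"
proof -
  have zero_k: "ladder_product 0 k 0 k' = (if k = k' then of_real (2 * pi * fact k) else 0)" for k k'
  proof (induction k arbitrary: k')
    case 0
    show ?case
    proof (cases k')
      case (Suc j)
      have "ladder_product 0 (Suc j) 0 0 = 0" by (simp add: ladder_product_rec)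
      then show ?thesis using ladder_product_commute[of 0 0 0 "Suc j"] Suc by simp
    qed (use ladder_product_0 in simp)
  next
    case (Suc k)
    then show ?case unfolding ladder_product_rec(2) by (cases k') auto
  qed
  show ?thesis
  proof (induction m arbitrary: m')
    case 0
    show ?case
    proof (cases m')
      case (Suc j)
      have "ladder_product (Suc j) k' 0 k = 0" by (simp add: ladder_product_rec)
      then show ?thesis using ladder_product_commute[of 0 k "Suc j" k'] Suc by simp
    qed (use zero_k in simp)
  next
    case (Suc m)
    then show ?case unfolding ladder_product_rec(1) by (cases m') auto
  qed
qed

lemma special_hermite_1_mult:
  "special_hermite_1 m k z * cnj (special_hermite_1 m' k' z)
    = of_real (1 / (2 * pi * sqrt (fact m * fact k * (fact m' * fact k')))) * ladder_pairing m k m' k' z"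
proof -
  have "exp (- (cmod z)\<^sup>2 / 4) * exp (- (cmod z)\<^sup>2 / 4) = exp (- (cmod z)\<^sup>2 / 2)"
    by (simp add: exp_add[symmetric])
  then have "complex_of_real (exp (- (cmod z)\<^sup>2 / 2)) = of_real (exp (- (cmod z)\<^sup>2 / 4)) * of_real (exp (- (cmod z)\<^sup>2 / 4))"
    by (simp flip: of_real_mult)
  moreover have "sqrt (2 * pi * fact m * fact k) * sqrt (2 * pi * fact m' * fact k') = 2 * pi * sqrt (fact m * fact k * (fact m' * fact k'))"
  proof -
    have "sqrt 2 * (sqrt pi * (sqrt 2 * sqrt pi)) = (sqrt 2 * sqrt 2) * (sqrt pi * sqrt pi)"
      by (simp only: mult_ac)
    also have "\<dots> = 2 * pi" unfolding real_sqrt_mult_self by simp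
    finally show ?thesis by (simp add: real_sqrt_mult)
  qed
  ultimately show ?thesis
    by (simp add: special_hermite_1_def ladder_pairing_def cnj_ladder_poly field_simps flip: of_real_mult)
qed

lemma special_hermite_1_integrable:
  "integrable lborel (\<lambda>z. special_hermite_1 m k z * cnj (special_hermite_1 m' k' z))"
  unfolding special_hermite_1_mult using ladder_pairing_integrable by simp

lemma special_hermite_1_orthonormal:
  "(LINT z|lborel. special_hermite_1 m k z * cnj (special_hermite_1 m' k' z)) = (if m = m' \<and> k = k' then 1 else 0)"
proof -
  have "(LINT z|lborel. special_hermite_1 m k z * cnj (special_hermite_1 m' k' z))
      = of_real (1 / (2 * pi * sqrt (fact m * fact k * (fact m' * fact k')))) * ladder_product m k m' k'"
    unfolding special_hermite_1_mult ladder_product_def by simp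
  then show ?thesis unfolding ladder_product_eq by simp
qed

lemma special_hermite_1_continuous: "continuous_on A (special_hermite_1 m k)"
  unfolding special_hermite_1_def[abs_def] by (intro continuous_intros) auto

section \<open>Mehler's formula for the damped one-variable kernel\<close>

fun contracted_poly :: "complex \<Rightarrow> nat \<Rightarrow> nat \<Rightarrow> complex \<Rightarrow> complex \<Rightarrow> complex" where
  "contracted_poly s 0 k' B B' = B' ^ k'"
| "contracted_poly s (Suc k) k' B B' = B * contracted_poly s k k' B B' + s * of_nat k' * contracted_poly s k (k' - 1) B B'"

lemma contracted_poly_0_Suc: "contracted_poly s 0 (Suc k') B B' = B' * contracted_poly s 0 k' B B'"
  by simp

lemma ladder_poly_0_right: "ladder_poly m 0 \<alpha> \<beta> = \<alpha> ^ m"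
  by (induction m) auto

text \<open>The factor m cancels against m! and shifts the summation by one, at the price of a
  factor s.\<close>

lemma sums_shifted_weight:
  fixes F :: "nat \<Rightarrow> complex"
  assumes "(\<lambda>m. s ^ m / fact m * F (Suc m)) sums S"
  shows "(\<lambda>m. s ^ m / fact m * (of_nat m * F m)) sums (s * S)"
proof -
  have "(\<lambda>m. s * (s ^ m / fact m * F (Suc m))) sums (s * S)"
    by (rule sums_mult[OF assms])
  moreover have "s * (s ^ m / fact m * F (Suc m)) = s ^ Suc m / fact (Suc m) * (of_nat (Suc m) * F (Suc m))" for m
    by (simp add: field_simps del: of_nat_Suc)
  ultimately have "(\<lambda>m. s ^ Suc m / fact (Suc m) * (of_nat (Suc m) * F (Suc m))) sums (s * S)" by simp
  then show ?thesis by (subst (asm) sums_Suc_iff) simp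
qed

text \<open>Summing over the first index contracts the two copies of \<open>a\<close> in
  \<open>exp (a b + a \<alpha> + b \<beta>) exp (a' b' + a' \<alpha>' + b' \<beta>')\<close>.\<close>

lemma ladder_poly_contraction:
  "(\<lambda>m. s ^ m / fact m * (ladder_poly m k \<alpha> \<beta> * ladder_poly m k' \<alpha>' \<beta>'))
     sums (exp (s * \<alpha> * \<alpha>') * contracted_poly s k k' (\<beta> + s * \<alpha>') (\<beta>' + s * \<alpha>))"
proof (induction k arbitrary: k')
  case 0
  show ?case
  proof (induction k')
    case 0
    have "(\<lambda>m. (s * \<alpha> * \<alpha>') ^ m /\<^sub>R fact m) sums exp (s * \<alpha> * \<alpha>')" by (rule exp_converges)
    then show ?case
      by (simp add: ladder_poly_0_right power_mult_distrib scaleR_conv_of_real field_simps)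
  next
    case (Suc k')
    let ?S = "exp (s * \<alpha> * \<alpha>') * contracted_poly s 0 k' (\<beta> + s * \<alpha>') (\<beta>' + s * \<alpha>)"
    have 1: "(\<lambda>m. \<beta>' * (s ^ m / fact m * (ladder_poly m 0 \<alpha> \<beta> * ladder_poly m k' \<alpha>' \<beta>'))) sums (\<beta>' * ?S)"
      by (rule sums_mult[OF Suc])
    have "(\<lambda>m. \<alpha> * (s ^ m / fact m * (ladder_poly m 0 \<alpha> \<beta> * ladder_poly m k' \<alpha>' \<beta>'))) sums (\<alpha> * ?S)"
      by (rule sums_mult[OF Suc])
    \<comment> \<open>Writing \<open>Suc m - 1\<close> for m puts the summand into the shape
      \<open>F (Suc m)\<close>.\<close>
    then have "(\<lambda>m. s ^ m / fact m * (ladder_poly (Suc m) 0 \<alpha> \<beta> * ladder_poly (Suc m - 1) k' \<alpha>' \<beta>')) sums (\<alpha> * ?S)"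
      by (simp add: mult_ac)
    note 2 = sums_shifted_weight[OF this]
    have eq: "s ^ m / fact m * (ladder_poly m 0 \<alpha> \<beta> * ladder_poly m (Suc k') \<alpha>' \<beta>')
       = \<beta>' * (s ^ m / fact m * (ladder_poly m 0 \<alpha> \<beta> * ladder_poly m k' \<alpha>' \<beta>'))
         + s ^ m / fact m * (of_nat m * (ladder_poly m 0 \<alpha> \<beta> * ladder_poly (m - 1) k' \<alpha>' \<beta>'))" for m
      unfolding ladder_poly_Suc_right by (simp add: algebra_simps)
    show ?case unfolding eq contracted_poly_0_Suc using sums_add[OF 1 2] by (simp add: algebra_simps)
  qed
next
  case (Suc k)
  let ?S = "\<lambda>k'. exp (s * \<alpha> * \<alpha>') * contracted_poly s k k' (\<beta> + s * \<alpha>') (\<beta>' + s * \<alpha>)"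
  have 1: "(\<lambda>m. \<beta> * (s ^ m / fact m * (ladder_poly m k \<alpha> \<beta> * ladder_poly m k' \<alpha>' \<beta>'))) sums (\<beta> * ?S k')"
    by (rule sums_mult[OF Suc])
  have "(\<lambda>m. \<alpha>' * (s ^ m / fact m * (ladder_poly m k \<alpha> \<beta> * ladder_poly m k' \<alpha>' \<beta>'))
      + of_nat k' * (s ^ m / fact m * (ladder_poly m k \<alpha> \<beta> * ladder_poly m (k' - 1) \<alpha>' \<beta>')))
      sums (\<alpha>' * ?S k' + of_nat k' * ?S (k' - 1))"
    by (intro sums_add sums_mult Suc)
  then have "(\<lambda>m. s ^ m / fact m * (ladder_poly (Suc m - 1) k \<alpha> \<beta> * ladder_poly (Suc m) k' \<alpha>' \<beta>'))
      sums (\<alpha>' * ?S k' + of_nat k' * ?S (k' - 1))"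
    by (simp add: algebra_simps)
  note 2 = sums_shifted_weight[OF this]
  have eq: "s ^ m / fact m * (ladder_poly m (Suc k) \<alpha> \<beta> * ladder_poly m k' \<alpha>' \<beta>')
     = \<beta> * (s ^ m / fact m * (ladder_poly m k \<alpha> \<beta> * ladder_poly m k' \<alpha>' \<beta>'))
       + s ^ m / fact m * (of_nat m * (ladder_poly (m - 1) k \<alpha> \<beta> * ladder_poly m k' \<alpha>' \<beta>'))" for m
    unfolding ladder_poly_Suc_right by (simp add: algebra_simps)
  show ?case unfolding eq using sums_add[OF 1 2] by (simp add: algebra_simps)
qed

text \<open>\<open>contracted_poly\<close> has the generating function exp(s b b' + b B + b' B').
  The index j counts the contracted pairs, and \<open>fact j * (k choose j) * (k' choose j)\<close>
  is the number of ways to choose them.\<close>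

lemma contracted_poly_eq:
  "contracted_poly s k k' B B' = (\<Sum>j\<le>k. of_nat (fact j * (k choose j) * (k' choose j)) * s ^ j * B ^ (k - j) * B' ^ (k' - j))"
proof (induction k arbitrary: k')
  case (Suc k)
  let ?t = "\<lambda>k k' j. of_nat (fact j * (k choose j) * (k' choose j)) * s ^ j * B ^ (k - j) * B' ^ (k' - j)"
  have 1: "B * contracted_poly s k k' B B' = (\<Sum>j\<le>Suc k. of_nat (fact j * (k choose j) * (k' choose j)) * s ^ j * B ^ (Suc k - j) * B' ^ (k' - j))"
    unfolding Suc by (simp add: sum_distrib_left Suc_diff_le mult_ac)
  have 2: "s * of_nat k' * contracted_poly s k (k' - 1) B B'
      = (\<Sum>j\<le>Suc k. of_nat (fact j * (if j = 0 then 0 else k choose (j - 1)) * (k' choose j)) * s ^ j * B ^ (Suc k - j) * B' ^ (k' - j))"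
  proof -
    have t: "s * of_nat k' * ?t k (k' - 1) j
        = of_nat (fact (Suc j) * (k choose j) * (k' choose Suc j)) * s ^ Suc j * B ^ (Suc k - Suc j) * B' ^ (k' - Suc j)" for j
    proof -
      have c: "k' * (k' - 1 choose j) = Suc j * (k' choose Suc j)"
        by (cases k') (simp, simp only: diff_Suc_1 Suc_times_binomial)
      have "of_nat k' * complex_of_nat (fact j * (k choose j) * (k' - 1 choose j)) = of_nat (fact j * (k choose j) * (k' * (k' - 1 choose j)))"
        by simp
      also have "\<dots> = complex_of_nat (fact (Suc j) * (k choose j) * (k' choose Suc j))"
        unfolding c by (simp add: algebra_simps)
      finally have "of_nat k' * complex_of_nat (fact j * (k choose j) * (k' - 1 choose j)) = complex_of_nat (fact (Suc j) * (k choose j) * (k' choose Suc j))" .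
      then have "s * of_nat k' * ?t k (k' - 1) j
        = s * complex_of_nat (fact (Suc j) * (k choose j) * (k' choose Suc j)) * s ^ j * B ^ (k - j) * B' ^ (k' - 1 - j)"
        by (metis (no_types, lifting) mult.assoc)
      then show ?thesis by (simp add: mult_ac)
    qed
    show ?thesis unfolding Suc sum_distrib_left t sum.atMost_Suc_shift by simp
  qed
  have "of_nat (fact j * (Suc k choose j) * (k' choose j))
      = of_nat (fact j * (k choose j) * (k' choose j)) + complex_of_nat (fact j * (if j = 0 then 0 else k choose (j - 1)) * (k' choose j))" for j
    by (cases j) (auto simp: algebra_simps)
  then show ?case
    unfolding contracted_poly.simps 1 2 sum.distrib[symmetric]
    by (intro sum.cong refl) (simp add: algebra_simps)
qed simp

lemma has_sum_negative_binomial: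
  fixes u :: complex
  assumes "cmod u < 1"
  shows "((\<lambda>j. of_nat (j + l choose j) * u ^ j) has_sum (1 / (1 - u) ^ Suc l)) UNIV"
    and "(\<lambda>j. cmod (of_nat (j + l choose j) * u ^ j)) summable_on UNIV"
proof -
  have gen: "(\<lambda>j. of_nat (j + l choose j) * v ^ j) sums (1 / (1 - v) ^ Suc l)" if v: "cmod v < 1" for v :: complex
  proof -
    have "(\<lambda>j. ((- of_nat (Suc l)) gchoose j) * (- v) ^ j) sums (1 + - v) powr (- of_nat (Suc l))"
      by (rule gen_binomial_complex) (use v in simp)
    moreover have "((- of_nat (Suc l)) gchoose j) * (- v) ^ j = of_nat (j + l choose j) * v ^ j" for j
    proof -
      have "((- complex_of_nat (Suc l)) gchoose j) = (- 1) ^ j * (of_nat (l + j) gchoose j)"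
        by (subst gbinomial_minus) (simp add: algebra_simps)
      moreover have "(- 1 :: complex) ^ j * (- 1) ^ j = 1" by (simp add: power_mult_distrib[symmetric])
      ultimately show ?thesis unfolding power_minus[of v]
        by (simp add: binomial_gbinomial add.commute algebra_simps)
    qed
    moreover have "(1 + - v) powr (- of_nat (Suc l)) = 1 / (1 - v) ^ Suc l"
    proof -
      have "1 - v \<noteq> 0" using v by auto
      then show ?thesis by (simp add: powr_minus powr_nat' inverse_eq_divide del: of_nat_Suc power_Suc)
    qed
    ultimately show ?thesis by simp
  qed
  have "(\<lambda>j. complex_of_real (real (j + l choose j) * cmod u ^ j)) sums (1 / (1 - complex_of_real (cmod u)) ^ Suc l)"
    using gen[of "complex_of_real (cmod u)"] assms by simp
  then have "summable (\<lambda>j. real (j + l choose j) * cmod u ^ j)"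
    using summable_complex_of_real sums_summable by blast
  then have s: "summable (\<lambda>j. cmod (of_nat (j + l choose j) * u ^ j))" by (simp add: norm_mult norm_power)
  show "((\<lambda>j. of_nat (j + l choose j) * u ^ j) has_sum (1 / (1 - u) ^ Suc l)) UNIV"
    by (rule norm_summable_imp_has_sum[OF s gen[OF assms]])
  show "(\<lambda>j. cmod (of_nat (j + l choose j) * u ^ j)) summable_on UNIV"
    using s by (subst summable_on_UNIV_nonneg_real_iff) auto
qed

text \<open>With v = -x u this is the generating function of the Laguerre polynomials in x. Putting
  k = j + l, the sum over j is a negative binomial series with value 1/(1-u)^(l+1), and the sum over
  l is then an exponential series.\<close>

lemma has_sum_laguerre:
  fixes u v :: complex
  assumes "cmod u < 1"
  shows "((\<lambda>k. \<Sum>j\<le>k. of_nat (k choose j) * u ^ j * v ^ (k - j) / fact (k - j)) has_sum (1 / (1 - u) * exp (v / (1 - u)))) UNIV"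
proof -
  let ?f = "\<lambda>(l, j). of_nat (j + l choose j) * u ^ j * (v ^ l / fact l) :: complex"
  have u1: "1 - u \<noteq> 0" using assms by auto
  have expo: "(\<lambda>l. w ^ l / fact l) sums exp w" for w :: complex
    using exp_converges[of w] by (simp add: scaleR_conv_of_real field_simps)
  have inner: "((\<lambda>j. ?f (l, j)) has_sum (1 / (1 - u) ^ Suc l * (v ^ l / fact l))) UNIV" for l
    using has_sum_cmult_left[OF has_sum_negative_binomial(1)[OF assms], where c="v ^ l / fact l"] by (simp only: split_conv)
  have outer_sums: "(\<lambda>l. 1 / (1 - w) ^ Suc l * (x ^ l / fact l)) sums (1 / (1 - w) * exp (x / (1 - w)))" if "1 - w \<noteq> 0" for w x :: complex
  proof -
    have "(\<lambda>l. 1 / (1 - w) * ((x / (1 - w)) ^ l / fact l)) sums (1 / (1 - w) * exp (x / (1 - w)))"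
      by (intro sums_mult expo)
    then show ?thesis by (simp add: power_divide field_simps)
  qed
  have ar: "((\<lambda>j. cmod (?f (l, j))) has_sum (1 / (1 - cmod u) ^ Suc l * (cmod v ^ l / fact l))) UNIV" for l
  proof -
    have "((\<lambda>j. complex_of_real (real (j + l choose j) * cmod u ^ j)) has_sum complex_of_real (1 / (1 - cmod u) ^ Suc l)) UNIV"
      using has_sum_negative_binomial(1)[of "complex_of_real (cmod u)" l] assms by simp
    then have "((\<lambda>j. real (j + l choose j) * cmod u ^ j) has_sum (1 / (1 - cmod u) ^ Suc l)) UNIV"
      unfolding has_sum_of_real_iff .
    from has_sum_cmult_left[OF this, where c="cmod v ^ l / fact l"] show ?thesis
      by (simp add: norm_mult norm_divide norm_power)
  qed
  have "(\<lambda>l. 1 / (1 - cmod u) ^ Suc l * (cmod v ^ l / fact l)) summable_on UNIV"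
  proof (subst summable_on_UNIV_nonneg_real_iff)
    have "(\<lambda>l. 1 / (1 - complex_of_real (cmod u)) ^ Suc l * (complex_of_real (cmod v) ^ l / fact l)) sums
        (1 / (1 - complex_of_real (cmod u)) * exp (complex_of_real (cmod v) / (1 - complex_of_real (cmod u))))"
      by (rule outer_sums) (use assms in \<open>simp add: complex_eq_iff\<close>)
    then have "summable (\<lambda>l. complex_of_real (1 / (1 - cmod u) ^ Suc l * (cmod v ^ l / fact l)))"
      by (simp add: sums_iff)
    then show "summable (\<lambda>l. 1 / (1 - cmod u) ^ Suc l * (cmod v ^ l / fact l))"
      by (rule summable_complex_of_real[THEN iffD1])
  qed (use assms in auto)
  then have "(\<lambda>x. cmod (?f x)) summable_on Sigma UNIV (\<lambda>_. UNIV)"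
    by (intro summable_on_SigmaI[where g="\<lambda>l. 1 / (1 - cmod u) ^ Suc l * (cmod v ^ l / fact l)"] ar) auto
  then have sm: "?f summable_on Sigma UNIV (\<lambda>_. UNIV)" by (rule abs_summable_summable)
  have "(\<lambda>l. cmod (1 / (1 - u) ^ Suc l * (v ^ l / fact l))) summable_on UNIV"
  proof -
    have "summable (\<lambda>l. cmod (1 / (1 - u) * ((v / (1 - u)) ^ l / fact l)))"
    proof -
      have "summable (\<lambda>l. cmod (1 / (1 - u)) * (cmod (v / (1 - u)) ^ l / fact l))"
        using summable_exp[of "cmod (v / (1 - u))"] by (intro summable_mult) (simp add: field_simps)
      then show ?thesis by (simp add: norm_mult norm_divide norm_power)
    qed
    then have "summable (\<lambda>l. cmod (1 / (1 - u) ^ Suc l * (v ^ l / fact l)))"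
      by (simp add: power_divide field_simps)
    then show ?thesis by (subst summable_on_UNIV_nonneg_real_iff) auto
  qed
  then have outer: "((\<lambda>l. 1 / (1 - u) ^ Suc l * (v ^ l / fact l)) has_sum (1 / (1 - u) * exp (v / (1 - u)))) UNIV"
    by (intro norm_summable_imp_has_sum outer_sums u1) (simp add: summable_on_UNIV_nonneg_real_iff)
  have "(?f has_sum (1 / (1 - u) * exp (v / (1 - u)))) (Sigma UNIV (\<lambda>_. UNIV))"
    by (rule has_sum_SigmaI[OF inner outer sm])
  moreover have "(?f has_sum X) (Sigma UNIV (\<lambda>_. UNIV))
      \<longleftrightarrow> ((\<lambda>(k, j). of_nat (k choose j) * u ^ j * v ^ (k - j) / fact (k - j)) has_sum X) (Sigma UNIV (\<lambda>k. {..k}))" for X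
    by (rule has_sum_reindex_bij_witness[of _ "\<lambda>(k, j). (k - j, j)" "\<lambda>(l, j). (j + l, j)"]) auto
  ultimately have "((\<lambda>(k, j). of_nat (k choose j) * u ^ j * v ^ (k - j) / fact (k - j)) has_sum (1 / (1 - u) * exp (v / (1 - u)))) (Sigma UNIV (\<lambda>k. {..k}))"
    by blast
  then show ?thesis
    by (rule has_sum_SigmaD[where f="\<lambda>(k, j). of_nat (k choose j) * u ^ j * v ^ (k - j) / fact (k - j)"]) simp
qed

text \<open>For k = k' one of the two binomial coefficients cancels against the factorials, which
  leaves the Laguerre series with u = s \<omega> and v = \<omega> B B'.\<close>

lemma contracted_poly_diagonal_has_sum:
  assumes "cmod (s * \<omega>) < 1"
  shows "((\<lambda>k. \<omega> ^ k / fact k * contracted_poly s k k B B') has_sum (1 / (1 - s * \<omega>) * exp (\<omega> * (B * B') / (1 - s * \<omega>)))) UNIV"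
proof -
  have "\<omega> ^ k / fact k * contracted_poly s k k B B'
      = (\<Sum>j\<le>k. of_nat (k choose j) * (s * \<omega>) ^ j * (\<omega> * (B * B')) ^ (k - j) / fact (k - j))" for k
    unfolding contracted_poly_eq sum_distrib_left
  proof (rule sum.cong[OF refl])
    fix j assume "j \<in> {..k}"
    then obtain l where k: "k = j + l" by (auto simp: le_iff_add)
    have "complex_of_nat (fact j * fact l * (j + l choose j)) = fact (j + l)"
      using binomial_fact_lemma[of j "j + l"] by (metis add_diff_cancel_left' le_add1 of_nat_fact)
    then have c: "complex_of_nat (j + l choose j) = fact (j + l) / (fact j * fact l)"
      by (simp add: field_simps)
    show "\<omega> ^ k / fact k * (of_nat (fact j * (k choose j) * (k choose j)) * s ^ j * B ^ (k - j) * B' ^ (k - j))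
        = of_nat (k choose j) * (s * \<omega>) ^ j * (\<omega> * (B * B')) ^ (k - j) / fact (k - j)"
      unfolding k by (simp add: c power_mult_distrib power_add field_simps)
  qed
  then show ?thesis using has_sum_laguerre[OF assms, of "\<omega> * (B * B')"] by simp
qed

text \<open>The first index carries the damping, the second the unimodular factor that comes from
  the time evolution.\<close>

definition ladder_term :: "real \<Rightarrow> complex \<Rightarrow> complex \<Rightarrow> complex \<Rightarrow> complex \<Rightarrow> complex \<Rightarrow> nat \<times> nat \<Rightarrow> complex" where
  "ladder_term s \<omega> \<alpha> \<beta> \<alpha>' \<beta>' p = of_real s ^ fst p * \<omega> ^ snd p / (fact (fst p) * fact (snd p))
     * (ladder_poly (fst p) (snd p) \<alpha> \<beta> * ladder_poly (fst p) (snd p) \<alpha>' \<beta>')"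

lemma ladder_term_row:
  "(\<lambda>m. ladder_term s \<omega> \<alpha> \<beta> \<alpha>' \<beta>' (m, k)) sums
     (exp (of_real s * \<alpha> * \<alpha>') * (\<omega> ^ k / fact k * contracted_poly (of_real s) k k (\<beta> + of_real s * \<alpha>') (\<beta>' + of_real s * \<alpha>)))"
  using sums_mult[OF ladder_poly_contraction[of "of_real s" k \<alpha> \<beta> k \<alpha>' \<beta>'], of "\<omega> ^ k / fact k"]
  by (simp add: ladder_term_def field_simps)

text \<open>With \<omega> = 1 and conjugate arguments all terms are nonnegative, so convergence of
  the iterated sum gives that of the double sum. Absolute summability in general follows from this
  case by \<open>square_summable_product\<close>.\<close>

lemma ladder_term_diagonal_summable:
  assumes s: "0 < s" "s < 1"
  shows "(\<lambda>p. s ^ fst p / (fact (fst p) * fact (snd p)) * (cmod (ladder_poly (fst p) (snd p) \<alpha> \<beta>))\<^sup>2) summable_on UNIV"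
proof -
  let ?g = "\<lambda>p. s ^ fst p / (fact (fst p) * fact (snd p)) * (cmod (ladder_poly (fst p) (snd p) \<alpha> \<beta>))\<^sup>2"
  have eq: "ladder_term s 1 \<alpha> \<beta> (cnj \<alpha>) (cnj \<beta>) p = of_real (?g p)" for p
    unfolding ladder_term_def cnj_ladder_poly[symmetric] complex_norm_square[symmetric] by simp
  let ?h = "\<lambda>k. exp (of_real s * \<alpha> * cnj \<alpha>) * (1 ^ k / fact k * contracted_poly (of_real s) k k (\<beta> + of_real s * cnj \<alpha>) (cnj \<beta> + of_real s * \<alpha>))"
  have row: "((\<lambda>m. ?g (m, k)) has_sum Re (?h k)) UNIV" for k
  proof (rule sums_nonneg_imp_has_sum)
    show "(\<lambda>m. ?g (m, k)) sums Re (?h k)"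
      using sums_Re[OF ladder_term_row[of s 1 \<alpha> \<beta> "cnj \<alpha>" "cnj \<beta>" k]] unfolding eq Re_complex_of_real .
  qed (use s in simp)
  have "(\<lambda>k. ?h k) summable_on UNIV"
    using contracted_poly_diagonal_has_sum[of "of_real s" 1 "\<beta> + of_real s * cnj \<alpha>" "cnj \<beta> + of_real s * \<alpha>"] s
    by (intro summable_on_cmult_right) (auto simp: summable_on_def)
  then have h: "(\<lambda>k. Re (?h k)) summable_on UNIV" by (rule summable_on_Re)
  have "(\<lambda>(k, m). ?g (m, k)) summable_on Sigma UNIV (\<lambda>_. UNIV)"
    by (rule summable_on_SigmaI[OF _ h]) (use row s in auto)
  then have "(\<lambda>p. ?g (prod.swap p)) summable_on UNIV" by (simp add: case_prod_unfold prod.swap_def)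
  then show ?thesis
    using summable_on_reindex_bij_betw[OF bij_swap, of ?g] by simp
qed

lemma ladder_term_has_sum:
  assumes s: "0 < s" "s < 1" and \<omega>: "cmod \<omega> = 1"
  shows "(\<lambda>p. cmod (ladder_term s \<omega> \<alpha> \<beta> \<alpha>' \<beta>' p)) summable_on UNIV"
    and "(ladder_term s \<omega> \<alpha> \<beta> \<alpha>' \<beta>' has_sum
      (exp (of_real s * \<alpha> * \<alpha>') * (1 / (1 - of_real s * \<omega>) * exp (\<omega> * ((\<beta> + of_real s * \<alpha>') * (\<beta>' + of_real s * \<alpha>)) / (1 - of_real s * \<omega>))))) UNIV"
proof -
  define c where "c p = sqrt (s ^ fst p / (fact (fst p) * fact (snd p)))" for p :: "nat \<times> nat"
  have c2: "c p * c p = s ^ fst p / (fact (fst p) * fact (snd p))" for p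
    using s by (simp add: c_def)
  have sq: "(\<lambda>p. (cmod (of_real (c p) * ladder_poly (fst p) (snd p) a b))\<^sup>2) summable_on UNIV" for a b
    using ladder_term_diagonal_summable[OF s, of a b] by (simp add: norm_mult power_mult_distrib power2_eq_square[of "c _"] c2)
  have "cmod (ladder_term s \<omega> \<alpha> \<beta> \<alpha>' \<beta>' p)
      = cmod (of_real (c p) * ladder_poly (fst p) (snd p) \<alpha> \<beta> * (of_real (c p) * ladder_poly (fst p) (snd p) \<alpha>' \<beta>'))" for p
  proof -
    have "cmod (ladder_term s \<omega> \<alpha> \<beta> \<alpha>' \<beta>' p) = (c p * c p) * (cmod (ladder_poly (fst p) (snd p) \<alpha> \<beta>) * cmod (ladder_poly (fst p) (snd p) \<alpha>' \<beta>'))"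
      unfolding c2 using s \<omega> by (simp add: ladder_term_def norm_mult norm_divide norm_power)
    moreover have "0 \<le> c p" using s by (simp add: c_def)
    ultimately show ?thesis by (simp only: norm_mult norm_of_real abs_of_nonneg mult_ac)
  qed
  then show sm: "(\<lambda>p. cmod (ladder_term s \<omega> \<alpha> \<beta> \<alpha>' \<beta>' p)) summable_on UNIV"
    using square_summable_product(1)[OF sq sq] by simp
  let ?T = "\<lambda>(k, m). ladder_term s \<omega> \<alpha> \<beta> \<alpha>' \<beta>' (m, k)"
  have swap: "(?T has_sum S) UNIV \<longleftrightarrow> (ladder_term s \<omega> \<alpha> \<beta> \<alpha>' \<beta>' has_sum S) UNIV" for S
    using has_sum_reindex_bij_betw[OF bij_swap, of "ladder_term s \<omega> \<alpha> \<beta> \<alpha>' \<beta>'" S]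
    by (simp add: case_prod_unfold prod.swap_def)
  have sm': "(\<lambda>p. cmod (?T p)) summable_on UNIV"
    using summable_on_reindex_bij_betw[OF bij_swap, of "\<lambda>p. cmod (ladder_term s \<omega> \<alpha> \<beta> \<alpha>' \<beta>' p)"] sm
    by (simp add: case_prod_unfold prod.swap_def)
  have "(?T has_sum (exp (of_real s * \<alpha> * \<alpha>') * (1 / (1 - of_real s * \<omega>) * exp (\<omega> * ((\<beta> + of_real s * \<alpha>') * (\<beta>' + of_real s * \<alpha>)) / (1 - of_real s * \<omega>))))) (Sigma UNIV (\<lambda>_. UNIV))"
  proof (rule has_sum_SigmaI)
    show "((\<lambda>m. ?T (k, m)) has_sum (exp (of_real s * \<alpha> * \<alpha>') * (\<omega> ^ k / fact k * contracted_poly (of_real s) k k (\<beta> + of_real s * \<alpha>') (\<beta>' + of_real s * \<alpha>)))) UNIV" for k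
    proof -
      have "(\<lambda>m. cmod (?T (k, m))) summable_on UNIV"
        using summable_on_SigmaD1[of "\<lambda>k m. cmod (?T (k, m))" UNIV "\<lambda>_. UNIV" k] sm' by (simp add: case_prod_unfold)
      then have "(\<lambda>m. ?T (k, m)) summable_on UNIV" by (rule abs_summable_summable)
      moreover have "(\<lambda>m. ?T (k, m)) sums (exp (of_real s * \<alpha> * \<alpha>') * (\<omega> ^ k / fact k * contracted_poly (of_real s) k k (\<beta> + of_real s * \<alpha>') (\<beta>' + of_real s * \<alpha>)))"
        using ladder_term_row by simp
      ultimately show ?thesis by (metis has_sum_imp_sums has_sum_infsum sums_unique2)
    qed
    show "((\<lambda>k. exp (of_real s * \<alpha> * \<alpha>') * (\<omega> ^ k / fact k * contracted_poly (of_real s) k k (\<beta> + of_real s * \<alpha>') (\<beta>' + of_real s * \<alpha>))) has_sum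
      (exp (of_real s * \<alpha> * \<alpha>') * (1 / (1 - of_real s * \<omega>) * exp (\<omega> * ((\<beta> + of_real s * \<alpha>') * (\<beta>' + of_real s * \<alpha>)) / (1 - of_real s * \<omega>))))) UNIV"
      by (intro has_sum_cmult_right contracted_poly_diagonal_has_sum) (use s \<omega> in \<open>simp add: norm_mult\<close>)
    show "?T summable_on Sigma UNIV (\<lambda>_. UNIV)"
      using sm' by (intro abs_summable_summable[of ?T]) simp
  qed
  then show "(ladder_term s \<omega> \<alpha> \<beta> \<alpha>' \<beta>' has_sum
      (exp (of_real s * \<alpha> * \<alpha>') * (1 / (1 - of_real s * \<omega>) * exp (\<omega> * ((\<beta> + of_real s * \<alpha>') * (\<beta>' + of_real s * \<alpha>)) / (1 - of_real s * \<omega>))))) UNIV"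
    using swap by simp
qed

text \<open>Over the common denominator w the exponent is (s \<gamma> + \<omega> cnj \<gamma> - s
  \<omega> R)/(2 w) with R = |z|^2 + |z'|^2. After multiplication of numerator and denominator by
  cnj w, the real part of the numerator is largest if Re(cnj \<omega> \<gamma>) attains its bound
  R/2, and then it equals R |w|^2 / 2, because |w|^2 = 1 - 2 s Re \<omega> + s^2.\<close>

lemma mehler_exponent_le:
  fixes z z' \<omega> :: complex
  assumes s: "0 < s" "s < 1" and \<omega>: "cmod \<omega> = 1"
  defines "w \<equiv> 1 - of_real s * \<omega>"
  shows "Re (of_real s * raising z * cnj (raising z')
      + \<omega> * ((lowering z + of_real s * cnj (raising z')) * (cnj (lowering z') + of_real s * raising z)) / w)
    \<le> ((cmod z)\<^sup>2 + (cmod z')\<^sup>2) / 4"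
proof -
  define \<gamma> where "\<gamma> = cnj z * z'"
  define R where "R = (cmod z)\<^sup>2 + (cmod z')\<^sup>2"
  have w0: "w \<noteq> 0"
  proof
    assume "w = 0"
    then have "cmod (of_real s * \<omega>) = 1" by (simp add: w_def)
    then show False using s \<omega> by (simp add: norm_mult)
  qed
  have \<omega>\<omega>: "\<omega> * cnj \<omega> = 1" using \<omega> by (simp add: complex_norm_square[symmetric])
  have r: "complex_of_real (sqrt 2) \<noteq> 0" by simp
  have half: "a / of_real (sqrt 2) * (b / of_real (sqrt 2)) = a * b / 2" for a b :: complex
    using sqrt2_mult by simp
  have p: "raising z * cnj (raising z') = \<gamma> / 2" "lowering z * cnj (lowering z') = cnj \<gamma> / 2"
    "lowering z * raising z = - of_real ((cmod z)\<^sup>2) / 2"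
    "cnj (raising z') * cnj (lowering z') = - of_real ((cmod z')\<^sup>2) / 2"
    by (simp_all only: complex_cnj_divide complex_cnj_complex_of_real half)
      (simp_all add: \<gamma>_def complex_norm_square mult_ac del: of_real_power)
  have "w * (of_real s * a * a') + \<omega> * ((b + of_real s * a') * (b' + of_real s * a))
      = of_real s * (a * a') + \<omega> * (b * b') + of_real s * \<omega> * (b * a + a' * b')" for a a' b b'
    unfolding w_def by (simp add: algebra_simps)
  then have "w * (of_real s * raising z * cnj (raising z')) + \<omega> * ((lowering z + of_real s * cnj (raising z')) * (cnj (lowering z') + of_real s * raising z))
      = of_real s * (raising z * cnj (raising z')) + \<omega> * (lowering z * cnj (lowering z'))
        + of_real s * \<omega> * (lowering z * raising z + cnj (raising z') * cnj (lowering z'))" .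
  also have "\<dots> = (of_real s * \<gamma> + \<omega> * cnj \<gamma> - of_real s * \<omega> * of_real R) / 2"
    unfolding p R_def by (simp add: field_simps)
  moreover have div: "x + y / w = (w * x + y) / w" for x y using w0 by (simp add: add_divide_distrib)
  ultimately have num: "of_real s * raising z * cnj (raising z')
      + \<omega> * ((lowering z + of_real s * cnj (raising z')) * (cnj (lowering z') + of_real s * raising z)) / w
    = (of_real s * \<gamma> + \<omega> * cnj \<gamma> - of_real s * \<omega> * of_real R) / 2 / w"
    unfolding div by (simp only:)
  have "Re ((of_real s * \<gamma> + \<omega> * cnj \<gamma> - of_real s * \<omega> * of_real R) / 2 / w)
      = Re ((of_real s * \<gamma> + \<omega> * cnj \<gamma> - of_real s * \<omega> * of_real R) * cnj w) / (2 * (cmod w)\<^sup>2)"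
    by (subst complex_div_cnj) (simp add: Re_divide_of_real[symmetric] flip: of_real_power)
  also have "Re ((of_real s * \<gamma> + \<omega> * cnj \<gamma> - of_real s * \<omega> * of_real R) * cnj w)
      = (1 - s\<^sup>2) * Re (cnj \<omega> * \<gamma>) - R * (s * Re \<omega> - s\<^sup>2)"
  proof -
    have e: "(of_real s * \<gamma> + \<omega> * cnj \<gamma> - of_real s * \<omega> * of_real R) * cnj w
        = of_real s * \<gamma> - of_real s * (\<omega> * cnj \<omega>) * cnj \<gamma> + \<omega> * cnj \<gamma> - of_real (s\<^sup>2) * (cnj \<omega> * \<gamma>)
          - of_real (s * R) * \<omega> + of_real (s\<^sup>2 * R) * (\<omega> * cnj \<omega>)"
      by (simp add: w_def algebra_simps power2_eq_square)
    show ?thesis unfolding e \<omega>\<omega> by (simp add: algebra_simps)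
  qed
  also have "\<dots> \<le> R / 2 * (cmod w)\<^sup>2"
  proof -
    define c where "c = Re (cnj \<omega> * \<gamma>)"
    have "c \<le> R / 2"
    proof -
      have "c \<le> cmod (cnj \<omega> * \<gamma>)" unfolding c_def by (rule complex_Re_le_cmod)
      also have "\<dots> = cmod z * cmod z'" using \<omega> by (simp add: \<gamma>_def norm_mult)
      also have "\<dots> \<le> R / 2" using sum_squares_bound[of "cmod z" "cmod z'"] by (simp add: R_def)
      finally show ?thesis .
    qed
    moreover have "0 \<le> 1 - s\<^sup>2" using s by (simp add: power_le_one)
    ultimately have le: "(1 - s\<^sup>2) * c \<le> (1 - s\<^sup>2) * (R / 2)" by (intro mult_left_mono)
    have w2: "(cmod w)\<^sup>2 = 1 - 2 * s * Re \<omega> + s\<^sup>2"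
    proof -
      have "(Re \<omega>)\<^sup>2 + (Im \<omega>)\<^sup>2 = 1" using \<omega> by (metis cmod_power2 one_power2)
      then have "s\<^sup>2 * (Re \<omega>)\<^sup>2 + s\<^sup>2 * (Im \<omega>)\<^sup>2 = s\<^sup>2" by (metis distrib_left mult.right_neutral)
      then show ?thesis by (simp add: w_def cmod_power2 power2_diff power_mult_distrib)
    qed
    show ?thesis unfolding c_def[symmetric] w2 using le by (simp add: algebra_simps)
  qed
  then have "((1 - s\<^sup>2) * Re (cnj \<omega> * \<gamma>) - R * (s * Re \<omega> - s\<^sup>2)) / (2 * (cmod w)\<^sup>2) \<le> R / 2 * (cmod w)\<^sup>2 / (2 * (cmod w)\<^sup>2)"
    by (rule divide_right_mono) simp
  also have "\<dots> = R / 4" using w0 by simp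
  finally show ?thesis unfolding num R_def .
qed

text \<open>The Gaussian factors of the two functions and the exponential in Mehler's formula have a
  product of modulus at most 1, so only the prefactor remains.\<close>

lemma special_hermite_1_kernel:
  assumes s: "0 < s" "s < 1" and \<omega>: "cmod \<omega> = 1"
  shows "(\<lambda>p. cmod (of_real s ^ fst p * \<omega> ^ snd p * (special_hermite_1 (fst p) (snd p) z * cnj (special_hermite_1 (fst p) (snd p) z')))) summable_on UNIV"
    and "cmod (\<Sum>\<^sub>\<infinity>p. of_real s ^ fst p * \<omega> ^ snd p * (special_hermite_1 (fst p) (snd p) z * cnj (special_hermite_1 (fst p) (snd p) z')))
      \<le> 1 / (2 * pi * cmod (1 - of_real s * \<omega>))"
proof -
  let ?c = "complex_of_real (exp (- ((cmod z)\<^sup>2 + (cmod z')\<^sup>2) / 4) / (2 * pi))"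
  let ?L = "ladder_term s \<omega> (raising z) (lowering z) (cnj (raising z')) (cnj (lowering z'))"
  have eq: "of_real s ^ fst p * \<omega> ^ snd p * (special_hermite_1 (fst p) (snd p) z * cnj (special_hermite_1 (fst p) (snd p) z')) = ?c * ?L p" for p
  proof -
    let ?q = "2 * pi * fact (fst p) * fact (snd p) :: real"
    have "exp (- (cmod z)\<^sup>2 / 4) / sqrt ?q * (exp (- (cmod z')\<^sup>2 / 4) / sqrt ?q)
        = exp (- ((cmod z)\<^sup>2 + (cmod z')\<^sup>2) / 4) / ?q"
    proof -
      have "exp (- (cmod z)\<^sup>2 / 4) * exp (- (cmod z')\<^sup>2 / 4) = exp (- ((cmod z)\<^sup>2 + (cmod z')\<^sup>2) / 4)"
        by (simp add: exp_add[symmetric] add_divide_distrib diff_divide_distrib)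
      moreover have "sqrt ?q * sqrt ?q = ?q" unfolding real_sqrt_mult_self by simp
      ultimately show ?thesis by (simp only: times_divide_times_eq)
    qed
    then have e1: "complex_of_real (exp (- (cmod z)\<^sup>2 / 4) / sqrt ?q) * complex_of_real (exp (- (cmod z')\<^sup>2 / 4) / sqrt ?q)
        = of_real (exp (- ((cmod z)\<^sup>2 + (cmod z')\<^sup>2) / 4) / ?q)"
      unfolding of_real_mult[symmetric] by (simp only:)
    have e2: "special_hermite_1 (fst p) (snd p) z * cnj (special_hermite_1 (fst p) (snd p) z')
        = (complex_of_real (exp (- (cmod z)\<^sup>2 / 4) / sqrt ?q) * complex_of_real (exp (- (cmod z')\<^sup>2 / 4) / sqrt ?q))
          * (ladder_poly (fst p) (snd p) (raising z) (lowering z) * ladder_poly (fst p) (snd p) (cnj (raising z')) (cnj (lowering z')))"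
      unfolding special_hermite_1_def by (simp only: complex_cnj_mult complex_cnj_complex_of_real cnj_ladder_poly mult_ac)
    show ?thesis unfolding e2 e1 ladder_term_def by (simp add: field_simps)
  qed
  note hs = ladder_term_has_sum[OF s \<omega>, of "raising z" "lowering z" "cnj (raising z')" "cnj (lowering z')"]
  show "(\<lambda>p. cmod (of_real s ^ fst p * \<omega> ^ snd p * (special_hermite_1 (fst p) (snd p) z * cnj (special_hermite_1 (fst p) (snd p) z')))) summable_on UNIV"
    unfolding eq norm_mult[of ?c] by (rule summable_on_cmult_right[OF hs(1)])
  define w where "w = 1 - of_real s * \<omega>"
  define X where "X = of_real s * raising z * cnj (raising z')
      + \<omega> * ((lowering z + of_real s * cnj (raising z')) * (cnj (lowering z') + of_real s * raising z)) / w"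
  have "(\<Sum>\<^sub>\<infinity>p. ?c * ?L p) = ?c * (1 / w * exp X)"
    using infsumI[OF has_sum_cmult_right[OF hs(2), of ?c]] by (simp add: w_def X_def exp_add mult_ac)
  then have "cmod (\<Sum>\<^sub>\<infinity>p. ?c * ?L p) = exp (- ((cmod z)\<^sup>2 + (cmod z')\<^sup>2) / 4) / (2 * pi) * (1 / cmod w * exp (Re X))"
    by (simp add: norm_mult norm_divide)
  also have "\<dots> = (exp (- ((cmod z)\<^sup>2 + (cmod z')\<^sup>2) / 4) * exp (Re X)) * (1 / (2 * pi * cmod w))"
    by simp
  also have "\<dots> \<le> 1 * (1 / (2 * pi * cmod w))"
  proof (rule mult_right_mono)
    have "Re X \<le> ((cmod z)\<^sup>2 + (cmod z')\<^sup>2) / 4"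
      unfolding X_def w_def by (rule mehler_exponent_le[OF s \<omega>])
    then have "- ((cmod z)\<^sup>2 + (cmod z')\<^sup>2) / 4 + Re X \<le> 0" by linarith
    then show "exp (- ((cmod z)\<^sup>2 + (cmod z')\<^sup>2) / 4) * exp (Re X) \<le> 1"
      unfolding exp_add[symmetric] exp_le_one_iff .
  qed simp
  finally show "cmod (\<Sum>\<^sub>\<infinity>p. of_real s ^ fst p * \<omega> ^ snd p * (special_hermite_1 (fst p) (snd p) z * cnj (special_hermite_1 (fst p) (snd p) z')))
      \<le> 1 / (2 * pi * cmod (1 - of_real s * \<omega>))"
    unfolding eq w_def by simp
qed

subsection \<open>Special Hermite functions in several variables\<close>

lemma measurable_vec_lambda [measurable]:
  "(\<lambda>f. \<chi> i. f i) \<in> borel_measurable (\<Pi>\<^sub>M i\<in>UNIV. (lborel :: 'a::euclidean_space measure))"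
proof (subst borel_measurable_euclidean_space, rule ballI)
  fix b :: "'a ^ 'n" assume "b \<in> Basis"
  then obtain i u where b: "b = axis i u" by (auto simp: Basis_vec_def)
  show "(\<lambda>f. (\<chi> i. f i) \<bullet> b) \<in> borel_measurable (\<Pi>\<^sub>M i\<in>UNIV. lborel)"
    unfolding b inner_axis by simp measurable
qed

lemma lborel_vec:
  "(lborel :: ('a::euclidean_space ^ 'n) measure) = distr (\<Pi>\<^sub>M i\<in>UNIV. lborel) borel (\<lambda>f. \<chi> i. f i)"
proof (rule lborel_eqI)
  fix l u :: "'a ^ 'n"
  assume le: "\<And>b. b \<in> Basis \<Longrightarrow> l \<bullet> b \<le> u \<bullet> b"
  interpret product_sigma_finite "\<lambda>_::'n. lborel :: 'a measure" ..
  have le': "l $ i \<bullet> b \<le> u $ i \<bullet> b" if "b \<in> Basis" for i b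
    using le[of "axis i b"] that by (auto simp: inner_axis Basis_vec_def)
  have "(\<lambda>f. \<chi> i. f i) -` box l u \<inter> space (\<Pi>\<^sub>M i\<in>UNIV. lborel) = PiE UNIV (\<lambda>i. box (l $ i) (u $ i))"
    by (auto simp: mem_box Basis_vec_def inner_axis space_PiM PiE_iff)
  then have "emeasure (distr (\<Pi>\<^sub>M i\<in>UNIV. lborel) borel (\<lambda>f. \<chi> i. f i)) (box l u)
      = emeasure (\<Pi>\<^sub>M i\<in>UNIV. (lborel :: 'a measure)) (PiE UNIV (\<lambda>i. box (l $ i) (u $ i)))"
    by (subst emeasure_distr) auto
  also have "\<dots> = (\<Prod>i\<in>UNIV. emeasure (lborel :: 'a measure) (box (l $ i) (u $ i)))"
    by (rule emeasure_PiM) auto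
  also have "\<dots> = (\<Prod>i\<in>UNIV. ennreal (\<Prod>b\<in>Basis. (u $ i - l $ i) \<bullet> b))"
    using le' by (intro prod.cong refl emeasure_lborel_box) auto
  also have "\<dots> = ennreal (\<Prod>i\<in>UNIV. \<Prod>b\<in>Basis. (u $ i - l $ i) \<bullet> b)"
    using le' by (intro prod_ennreal prod_nonneg) (auto simp: inner_diff_left)
  also have "(\<Prod>i\<in>UNIV. \<Prod>b\<in>Basis. (u $ i - l $ i) \<bullet> b) = (\<Prod>b\<in>Basis. (u - l) \<bullet> b)"
  proof -
    have "(\<Prod>b\<in>Basis. (u - l) \<bullet> b) = (\<Prod>b\<in>(\<Union>i\<in>UNIV. axis i ` Basis). (u - l) \<bullet> b)"
      by (rule prod.cong) (auto simp: Basis_vec_def)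
    also have "\<dots> = (\<Prod>i\<in>UNIV. \<Prod>b\<in>axis i ` Basis. (u - l) \<bullet> b)"
      by (rule prod.UNION_disjoint) (auto simp: axis_eq_axis)
    also have "\<dots> = (\<Prod>i\<in>UNIV. \<Prod>b\<in>Basis. (u $ i - l $ i) \<bullet> b)"
      by (intro prod.cong refl, subst prod.reindex) (auto simp: inj_on_def axis_eq_axis inner_axis)
    finally show ?thesis ..
  qed
  finally show "emeasure (distr (\<Pi>\<^sub>M i\<in>UNIV. lborel) borel (\<lambda>f. \<chi> i. f i)) (box l u) = (\<Prod>b\<in>Basis. (u - l) \<bullet> b)" .
qed simp

lemma integral_lborel_vec_prod:
  fixes f :: "'n::finite \<Rightarrow> 'a::euclidean_space \<Rightarrow> complex"
  assumes f: "\<And>i. integrable lborel (f i)"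
  shows "integrable lborel (\<lambda>x::'a ^ 'n. \<Prod>i\<in>UNIV. f i (x $ i))"
    and "(LINT x|lborel. (\<Prod>i\<in>UNIV. f i ((x :: 'a ^ 'n) $ i))) = (\<Prod>i\<in>UNIV. LINT x|lborel. f i x)"
proof -
  interpret product_sigma_finite "\<lambda>_::'n. lborel :: 'a measure" ..
  have fm [measurable]: "f i \<in> borel_measurable borel" for i using f[of i] by simp
  have [measurable]: "(\<lambda>x::'a ^ 'n. \<Prod>i\<in>UNIV. f i (x $ i)) \<in> borel_measurable borel"
    by (intro borel_measurable_prod measurable_compose[OF _ fm]) (auto intro!: borel_measurable_continuous_onI continuous_intros)
  show "integrable lborel (\<lambda>x::'a ^ 'n. \<Prod>i\<in>UNIV. f i (x $ i))"
    unfolding lborel_vec using product_integrable_prod[OF finite f]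
    by (subst integrable_distr_eq) auto
  show "(LINT x|lborel. (\<Prod>i\<in>UNIV. f i ((x :: 'a ^ 'n) $ i))) = (\<Prod>i\<in>UNIV. LINT x|lborel. f i x)"
    unfolding lborel_vec[where 'n='n] using product_integral_prod[OF finite f]
    by (subst integral_distr) auto
qed

lemma special_hermite_eq_prod:
  fixes \<mu> \<nu> :: "nat ^ 'n"
  shows "special_hermite \<mu> \<nu> \<zeta> = (\<Prod>j\<in>UNIV. special_hermite_1 (\<mu> $ j) (\<nu> $ j) (\<zeta> $ j))"
proof -
  define h where "h j \<xi> = exp (\<i> * of_real (Re (\<zeta> $ j) * \<xi>)) * of_real (hermite_fun (\<mu> $ j) (\<xi> + Im (\<zeta> $ j) / 2))
      * of_real (hermite_fun (\<nu> $ j) (\<xi> - Im (\<zeta> $ j) / 2))" for j \<xi>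
  have h_int: "integrable lborel (h j)" for j
  proof -
    have "h j = (\<lambda>\<xi>. of_real (1 / (sqrt (2 ^ (\<mu> $ j) * sqrt pi * fact (\<mu> $ j)) * sqrt (2 ^ (\<nu> $ j) * sqrt pi * fact (\<nu> $ j))))
        * wigner_integrand (\<mu> $ j) (\<nu> $ j) (\<zeta> $ j) \<xi>)"
      by (auto simp: h_def wigner_integrand_def hermite_fun_eq)
    then show ?thesis using wigner_integrand_integrable by simp
  qed
  have "exp (\<i> * complex_of_real (Re_vec \<zeta> \<bullet> \<xi>)) * complex_of_real (Hermite_Phi \<mu> (\<xi> + (1/2) *\<^sub>R Im_vec \<zeta>)) *
        complex_of_real (Hermite_Phi \<nu> (\<xi> - (1/2) *\<^sub>R Im_vec \<zeta>)) = (\<Prod>j\<in>UNIV. h j (\<xi> $ j))" for \<xi>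
    by (simp add: h_def Hermite_Phi_def Re_vec_def Im_vec_def inner_vec_def sum_distrib_left exp_sum prod.distrib)
  then have "special_hermite \<mu> \<nu> \<zeta> = of_real ((2 * pi) powr (- real CARD('n) / 2)) * (LINT \<xi>|lebesgue. (\<Prod>j\<in>UNIV. h j ((\<xi> :: real ^ 'n) $ j)))"
    unfolding special_hermite_def by simp
  also have "(LINT \<xi>|lebesgue. (\<Prod>j\<in>UNIV. h j ((\<xi> :: real ^ 'n) $ j))) = (LINT \<xi>|lborel. (\<Prod>j\<in>UNIV. h j ((\<xi> :: real ^ 'n) $ j)))"
    by (rule integral_completion[OF borel_measurable_integrable[OF integral_lborel_vec_prod(1)[OF h_int]]])
  also have "\<dots> = (\<Prod>j\<in>UNIV. LINT \<xi>|lborel. h j \<xi>)" by (rule integral_lborel_vec_prod(2)[OF h_int])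
  also have "(2 * pi) powr (- real CARD('n) / 2) = (\<Prod>j\<in>(UNIV::'n set). 1 / sqrt (2 * pi))"
  proof -
    have "(2 * pi) powr (- real CARD('n) / 2) = ((2 * pi) powr (- (1 / 2))) powr real CARD('n)"
      by (simp add: powr_powr)
    also have "(2 * pi) powr (- (1 / 2)) = 1 / sqrt (2 * pi)"
      by (simp only: powr_minus powr_half_sqrt inverse_eq_divide) (simp add: powr_half_sqrt)
    also have "(1 / sqrt (2 * pi)) powr real CARD('n) = (1 / sqrt (2 * pi)) ^ CARD('n)"
      by (rule powr_realpow) simp
    finally show ?thesis by simp
  qed
  also have "complex_of_real (\<Prod>j\<in>(UNIV::'n set). 1 / sqrt (2 * pi)) * (\<Prod>j\<in>UNIV. LINT \<xi>|lborel. h j \<xi>)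
      = (\<Prod>j\<in>UNIV. special_hermite_1 (\<mu> $ j) (\<nu> $ j) (\<zeta> $ j))"
    unfolding of_real_prod prod.distrib[symmetric] special_hermite_1_eq h_def ..
  finally show ?thesis .
qed

lemma special_hermite_continuous: "continuous_on A (special_hermite \<mu> \<nu>)"
  unfolding special_hermite_eq_prod[abs_def]
  by (intro continuous_intros continuous_on_compose2[OF special_hermite_1_continuous[of UNIV]]) auto

lemma special_hermite_measurable [measurable]: "special_hermite \<mu> \<nu> \<in> borel_measurable borel"
  by (rule borel_measurable_continuous_onI[OF special_hermite_continuous])

lemma special_hermite_orthonormal_lborel:
  fixes \<mu> \<nu> \<mu>' \<nu>' :: "nat ^ 'n"
  shows "integrable lborel (\<lambda>z. special_hermite \<mu> \<nu> z * cnj (special_hermite \<mu>' \<nu>' z))"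
    and "(LINT z|lborel. special_hermite \<mu> \<nu> z * cnj (special_hermite \<mu>' \<nu>' z)) = (if \<mu> = \<mu>' \<and> \<nu> = \<nu>' then 1 else 0)"
proof -
  have eq: "special_hermite \<mu> \<nu> z * cnj (special_hermite \<mu>' \<nu>' z)
      = (\<Prod>j\<in>UNIV. special_hermite_1 (\<mu> $ j) (\<nu> $ j) (z $ j) * cnj (special_hermite_1 (\<mu>' $ j) (\<nu>' $ j) (z $ j)))" for z
    unfolding special_hermite_eq_prod by (simp add: prod.distrib)
  show "integrable lborel (\<lambda>z. special_hermite \<mu> \<nu> z * cnj (special_hermite \<mu>' \<nu>' z))"
    unfolding eq by (rule integral_lborel_vec_prod(1)) (rule special_hermite_1_integrable)
  have "(LINT z|lborel. special_hermite \<mu> \<nu> z * cnj (special_hermite \<mu>' \<nu>' z))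
      = (\<Prod>j\<in>UNIV. if \<mu> $ j = \<mu>' $ j \<and> \<nu> $ j = \<nu>' $ j then 1 else 0)"
    unfolding eq
    by (subst integral_lborel_vec_prod(2)[OF special_hermite_1_integrable]) (simp add: special_hermite_1_orthonormal)
  also have "\<dots> = (if \<mu> = \<mu>' \<and> \<nu> = \<nu>' then 1 else 0)"
    by (auto simp: vec_eq_iff prod_eq_1_iff intro!: prod_zero)
  finally show "(LINT z|lborel. special_hermite \<mu> \<nu> z * cnj (special_hermite \<mu>' \<nu>' z)) = (if \<mu> = \<mu>' \<and> \<nu> = \<nu>' then 1 else 0)" .
qed

lemma special_hermite_square_integrable: "square_integrable lborel (special_hermite \<mu> \<nu>)"
proof -
  have "integrable lborel (\<lambda>z. complex_of_real ((cmod (special_hermite \<mu> \<nu> z))\<^sup>2))"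
    using special_hermite_orthonormal_lborel(1)[of \<mu> \<nu> \<mu> \<nu>] by (simp add: complex_norm_square del: of_real_power)
  then show ?thesis unfolding square_integrable_def complex_of_real_integrable_eq by simp
qed

lemma abs_summable_prod:
  fixes f :: "'n::finite \<Rightarrow> 'b \<Rightarrow> complex"
  assumes f: "\<And>j. (\<lambda>b. cmod (f j b)) summable_on UNIV"
  shows "(\<lambda>g. cmod (\<Prod>j\<in>UNIV. f j (g j))) summable_on UNIV"
    and "(\<Sum>\<^sub>\<infinity>g. \<Prod>j\<in>UNIV. f j (g j)) = (\<Prod>j\<in>UNIV. \<Sum>\<^sub>\<infinity>b. f j b)"
proof -
  have bound: "(\<Sum>g\<in>F. cmod (\<Prod>j\<in>UNIV. f j (g j))) \<le> (\<Prod>j\<in>UNIV. \<Sum>\<^sub>\<infinity>b. cmod (f j b))" if "finite F" for F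
  proof -
    \<comment> \<open>A finite set of index functions lies in the product of its projections, on
      which the sum of the products factorises.\<close>
    define B where "B j = (\<lambda>g. g j) ` F" for j
    have "(\<Sum>g\<in>F. cmod (\<Prod>j\<in>UNIV. f j (g j))) \<le> (\<Sum>g\<in>PiE UNIV B. cmod (\<Prod>j\<in>UNIV. f j (g j)))"
      using that by (intro sum_mono2 finite_PiE) (auto simp: B_def)
    also have "\<dots> = (\<Prod>j\<in>UNIV. \<Sum>b\<in>B j. cmod (f j b))"
      unfolding prod_norm[symmetric] by (rule prod_sum_PiE[symmetric]) (use that in \<open>auto simp: B_def\<close>)
    also have "\<dots> \<le> (\<Prod>j\<in>UNIV. \<Sum>\<^sub>\<infinity>b. cmod (f j b))"
      using that by (intro prod_mono conjI sum_nonneg finite_sum_le_infsum f) (auto simp: B_def)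
    finally show ?thesis .
  qed
  then show "(\<lambda>g. cmod (\<Prod>j\<in>UNIV. f j (g j))) summable_on UNIV"
    by (intro nonneg_bounded_partial_sums_imp_summable_on[of _ _ "\<Prod>j\<in>UNIV. \<Sum>\<^sub>\<infinity>b. cmod (f j b)"])
      (auto simp: eventually_finite_subsets_at_top intro!: exI[of _ "{}"])
  show "(\<Sum>\<^sub>\<infinity>g. \<Prod>j\<in>UNIV. f j (g j)) = (\<Prod>j\<in>UNIV. \<Sum>\<^sub>\<infinity>b. f j b)"
    using infsum_prod_PiE_abs[of UNIV f "\<lambda>_. UNIV"] f by (simp add: PiE_def)
qed

lemma bij_multiindex: "bij_betw (\<lambda>g. (\<chi> j. fst (g j), \<chi> j. snd (g j))) UNIV (UNIV :: ((nat ^ 'n) \<times> (nat ^ 'n)) set)"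
  by (rule bij_betw_byWitness[where f'="\<lambda>p j. (vec_nth (fst p) j, vec_nth (snd p) j)"]) auto

abbreviation multi_degree :: "nat ^ 'n \<Rightarrow> nat" where "multi_degree \<mu> \<equiv> \<Sum>j\<in>UNIV. \<mu> $ j"

text \<open>The kernel factorises over the coordinates, so the one-variable bound enters once for
  each of them; this is where the exponent N of the dispersive bound comes from.\<close>

lemma special_hermite_kernel:
  fixes z z' :: "complex ^ 'n"
  assumes s: "0 < s" "s < 1" and \<omega>: "cmod \<omega> = 1"
  defines "term \<equiv> \<lambda>p. of_real s ^ multi_degree (fst p) * \<omega> ^ multi_degree (snd p)
      * (special_hermite (fst p) (snd p) z * cnj (special_hermite (fst p) (snd p) z'))"
  shows "(\<lambda>p. cmod (term p)) summable_on UNIV"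
    and "cmod (\<Sum>\<^sub>\<infinity>p. term p) \<le> (1 / (2 * pi)) ^ CARD('n) / cmod (1 - of_real s * \<omega>) ^ CARD('n)"
proof -
  let ?t = "\<lambda>j p. of_real s ^ fst p * \<omega> ^ snd p * (special_hermite_1 (fst p) (snd p) (z $ j) * cnj (special_hermite_1 (fst p) (snd p) (z' $ j)))"
  have eq: "term (\<chi> j. fst (g j), \<chi> j. snd (g j)) = (\<Prod>j\<in>UNIV. ?t j (g j))" for g
    unfolding term_def special_hermite_eq_prod by (simp add: prod.distrib power_sum)
  note ap = abs_summable_prod[of ?t, OF special_hermite_1_kernel(1)[OF s \<omega>]]
  show "(\<lambda>p. cmod (term p)) summable_on UNIV"
    using summable_on_reindex_bij_betw[OF bij_multiindex, of "\<lambda>p. cmod (term p)"] ap(1) unfolding eq by simp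
  have "(\<Sum>\<^sub>\<infinity>p. term p) = (\<Sum>\<^sub>\<infinity>g. \<Prod>j\<in>UNIV. ?t j (g j))"
    using infsum_reindex_bij_betw[OF bij_multiindex, of "term"] unfolding eq by simp
  also have "\<dots> = (\<Prod>j\<in>UNIV. \<Sum>\<^sub>\<infinity>p. ?t j p)" by (rule ap(2))
  finally have "cmod (\<Sum>\<^sub>\<infinity>p. term p) = (\<Prod>j\<in>UNIV. cmod (\<Sum>\<^sub>\<infinity>p. ?t j p))" by (simp only: prod_norm)
  also have "\<dots> \<le> (\<Prod>j\<in>(UNIV::'n set). 1 / (2 * pi * cmod (1 - of_real s * \<omega>)))"
    by (intro prod_mono conjI norm_ge_zero special_hermite_1_kernel(2) s \<omega>)
  also have "\<dots> = (1 / (2 * pi)) ^ CARD('n) / cmod (1 - of_real s * \<omega>) ^ CARD('n)"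
    by (simp add: power_divide power_mult_distrib)
  finally show "cmod (\<Sum>\<^sub>\<infinity>p. term p) \<le> (1 / (2 * pi)) ^ CARD('n) / cmod (1 - of_real s * \<omega>) ^ CARD('n)" .
qed

section \<open>Waves on space-time\<close>

definition circle_measure :: "real measure" where
  "circle_measure = restrict_space lborel {-pi..pi}"

lemma space_circle_measure [simp]: "space circle_measure = {-pi..pi}"
  by (simp add: circle_measure_def space_restrict_space)

lemma finite_measure_circle: "finite_measure circle_measure"
  unfolding circle_measure_def
  by (rule finite_measureI) (simp add: emeasure_restrict_space space_restrict_space)

lemma measurable_circle: "f \<in> borel_measurable borel \<Longrightarrow> f \<in> borel_measurable circle_measure"
  unfolding circle_measure_def by (rule measurable_restrict_space1) simp

lemma circle_orthogonal:
  fixes m :: int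
  shows "integrable circle_measure (\<lambda>t. exp (\<i> * of_real (of_int m * t)))"
    and "(LINT t|circle_measure. exp (\<i> * of_real (of_int m * t))) = (if m = 0 then of_real (2 * pi) else 0)"
proof -
  interpret finite_measure circle_measure by (rule finite_measure_circle)
  have meas: "(\<lambda>t. exp (\<i> * of_real (of_int m * t))) \<in> borel_measurable circle_measure"
    by (intro measurable_circle borel_measurable_continuous_onI continuous_intros)
  show "integrable circle_measure (\<lambda>t. exp (\<i> * of_real (of_int m * t)))"
    by (rule integrable_const_bound[of _ 1]) (use meas in auto)
  have set: "(LINT t|circle_measure. exp (\<i> * of_real (of_int m * t))) = (LINT t:{-pi..pi}|lborel. exp (\<i> * of_real (of_int m * t)))"
    unfolding circle_measure_def by (simp add: integral_restrict_space set_lebesgue_integral_def)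
  show "(LINT t|circle_measure. exp (\<i> * of_real (of_int m * t))) = (if m = 0 then of_real (2 * pi) else 0)"
  proof (cases "m = 0")
    case True
    then show ?thesis unfolding set by (simp add: set_lebesgue_integral_def scaleR_conv_of_real)
  next
    case False
    let ?F = "\<lambda>t. exp (\<i> * of_real (of_int m * t)) / (\<i> * of_int m)"
    have d: "(?F has_vector_derivative exp (\<i> * of_real (of_int m * t))) (at t within {-pi..pi})" for t
    proof -
      have "((\<lambda>w. exp (c * w) / c) has_field_derivative exp (c * of_real t)) (at (of_real t))" if "c \<noteq> 0" for c
        using that by (auto intro!: derivative_eq_intros)
      from has_vector_derivative_real_field[OF this[of "\<i> * of_int m"]] False
      show ?thesis by (auto intro: has_vector_derivative_at_within simp: mult.assoc)
    qed
    have "(LINT t:{-pi..pi}|lborel. exp (\<i> * of_real (of_int m * t))) = ?F pi - ?F (- pi)"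
      unfolding set_lebesgue_integral_def
      by (rule integral_FTC_atLeastAtMost) (use d in \<open>auto intro!: continuous_intros\<close>)
    also have "exp (\<i> * of_real (of_int m * pi)) = exp (\<i> * of_real (of_int m * (- pi)))"
    proof -
      have "exp (\<i> * of_real (of_int m * pi)) = exp (\<i> * of_real (of_int m * (- pi)) + of_int (2 * m) * (of_real pi * \<i>))"
        by (rule arg_cong[where f=exp]) (simp add: algebra_simps)
      also have "\<dots> = exp (\<i> * of_real (of_int m * (- pi)))"
        unfolding exp_eq by (rule exI[of _ m]) simp
      finally show ?thesis .
    qed
    finally show ?thesis unfolding set using False by simp
  qed
qed

text \<open>Borel measures on both factors fit the theorems of Tonelli and Fubini; the passage to
  the completed measures of the theorem is made separately in each variable.\<close>

definition space_time :: "(real \<times> (complex ^ 'n)) measure" where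
  "space_time = circle_measure \<Otimes>\<^sub>M lborel"

definition wave :: "(nat ^ 'n) \<times> (nat ^ 'n) \<Rightarrow> real \<times> (complex ^ 'n) \<Rightarrow> complex" where
  "wave p x = exp (- \<i> * of_real (fst x * special_hermite_eigenvalue (snd p))) * special_hermite (fst p) (snd p) (snd x)"

text \<open>The factor 2 is the gap between consecutive eigenvalues: multiplication by this function
  moves a wave one step up in the time spectrum.\<close>

definition modulation :: "real \<times> (complex ^ 'n) \<Rightarrow> complex" where
  "modulation x = exp (\<i> * of_real (- 2 * fst x))"

lemma wave_measurable: "wave p \<in> borel_measurable borel"
  unfolding wave_def[abs_def]
  by (intro borel_measurable_continuous_onI continuous_intros continuous_on_compose2[OF special_hermite_continuous[of UNIV]]) auto

lemma measurable_space_time: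
  assumes "f \<in> borel_measurable (borel :: (real \<times> (complex ^ 'n)) measure)"
  shows "f \<in> borel_measurable space_time"
proof -
  have c: "(\<lambda>t. t) \<in> circle_measure \<rightarrow>\<^sub>M borel"
    unfolding circle_measure_def by (rule measurable_restrict_space1) simp
  have l: "(\<lambda>z. z) \<in> (lborel :: (complex ^ 'n) measure) \<rightarrow>\<^sub>M borel" by simp
  have "(\<lambda>p. (fst p, snd p)) \<in> (circle_measure \<Otimes>\<^sub>M (lborel :: (complex ^ 'n) measure)) \<rightarrow>\<^sub>M (borel \<Otimes>\<^sub>M borel)"
    by (rule measurable_Pair[OF measurable_compose[OF measurable_fst c] measurable_compose[OF measurable_snd l]])
  then have "(\<lambda>p. p) \<in> space_time \<rightarrow>\<^sub>M (borel :: (real \<times> (complex ^ 'n)) measure)"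
    unfolding space_time_def borel_prod by simp
  from measurable_compose[OF this assms] show ?thesis .
qed

interpretation circle: finite_measure circle_measure by (rule finite_measure_circle)

interpretation space_time: pair_sigma_finite circle_measure "lborel :: (complex ^ 'n) measure" ..

text \<open>Different index pairs are orthogonal already in space. For equal pairs the eigenvalues
  cancel, and different k are orthogonal on the circle.\<close>

lemma wave_modulation_product:
  fixes p p' :: "(nat ^ 'n) \<times> (nat ^ 'n)"
  shows "integrable space_time (\<lambda>x. (modulation x ^ k * wave p x) * cnj (modulation x ^ k' * wave p' x))"
    and "inner_L2 space_time (\<lambda>x. modulation x ^ k * wave p x) (\<lambda>x. modulation x ^ k' * wave p' x)
      = (if (k, p) = (k', p') then of_real (2 * pi) else 0)"
proof -
  define m where "m = - 2 * int k - 2 * int (multi_degree (snd p)) + 2 * int k' + 2 * int (multi_degree (snd p'))"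
  have eq: "(modulation x ^ k * wave p x) * cnj (modulation x ^ k' * wave p' x)
      = exp (\<i> * of_real (of_int m * fst x)) * (special_hermite (fst p) (snd p) (snd x) * cnj (special_hermite (fst p') (snd p') (snd x)))" for x
  proof -
    have "modulation x ^ k * exp (- \<i> * of_real (fst x * special_hermite_eigenvalue (snd p)))
        * cnj (modulation x ^ k' * exp (- \<i> * of_real (fst x * special_hermite_eigenvalue (snd p'))))
        = exp (\<i> * of_real (of_int m * fst x))"
      unfolding modulation_def exp_of_nat_mult[symmetric] complex_cnj_mult exp_cnj exp_add[symmetric]
      by (rule arg_cong[where f=exp]) (simp add: m_def special_hermite_eigenvalue_def algebra_simps)
    then show ?thesis unfolding wave_def by (simp add: mult_ac)
  qed
  note ip = space_time.integral_product_mult[OF circle_orthogonal(1)[of m] special_hermite_orthonormal_lborel(1)[of "fst p" "snd p" "fst p'" "snd p'"]]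
  show "integrable space_time (\<lambda>x. (modulation x ^ k * wave p x) * cnj (modulation x ^ k' * wave p' x))"
    unfolding eq space_time_def by (rule ip(1))
  have "inner_L2 space_time (\<lambda>x. modulation x ^ k * wave p x) (\<lambda>x. modulation x ^ k' * wave p' x)
      = (if m = 0 then of_real (2 * pi) else 0) * (if fst p = fst p' \<and> snd p = snd p' then 1 else 0)"
    unfolding inner_L2_def eq unfolding space_time_def ip(2) circle_orthogonal(2) special_hermite_orthonormal_lborel(2) ..
  also have "\<dots> = (if (k, p) = (k', p') then of_real (2 * pi) else 0)"
    by (auto simp: m_def prod_eq_iff)
  finally show "inner_L2 space_time (\<lambda>x. modulation x ^ k * wave p x) (\<lambda>x. modulation x ^ k' * wave p' x)
      = (if (k, p) = (k', p') then of_real (2 * pi) else 0)" .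
qed

text \<open>The eigenvalue depends on \<open>\<nu>\<close> only, so the sum over \<open>\<mu>\<close> has to be regularised.\<close>

definition damping :: "real \<Rightarrow> (nat ^ 'n) \<times> (nat ^ 'n) \<Rightarrow> real" where
  "damping s p = s ^ multi_degree (fst p)"

text \<open>The constant n in the eigenvalue contributes a mere phase, and what remains is the
  damped kernel at \<omega> = \<open>modulation x * cnj (modulation y)\<close>. The diagonal bound
  is the case \<omega> = 1 and blows up as s tends to 1, whereas the dispersive constant does not
  depend on s.\<close>

theorem special_hermite_dispersive_system:
  assumes s: "0 < s" "s < 1"
  shows "dispersive_system space_time (wave :: (nat ^ 'n) \<times> (nat ^ 'n) \<Rightarrow> real \<times> (complex ^ 'n) \<Rightarrow> complex) modulation (damping s) s
    ((1 / (2 * pi)) ^ CARD('n)) ((1 / (2 * pi)) ^ CARD('n) / (1 - s) ^ CARD('n)) (2 * pi) CARD('n)"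
proof -
  interpret sigma_finite_measure "space_time :: (real \<times> (complex ^ 'n)) measure"
    unfolding space_time_def by (rule space_time.sigma_finite_measure_axioms)
  have mod: "cmod (modulation x) = 1" for x :: "real \<times> (complex ^ 'n)" by (simp add: modulation_def)
  have kern: "of_real (damping s p) * wave p x * cnj (wave p y)
      = exp (\<i> * of_real ((fst y - fst x) * real CARD('n))) * (of_real s ^ multi_degree (fst p) * (modulation x * cnj (modulation y)) ^ multi_degree (snd p)
          * (special_hermite (fst p) (snd p) (snd x) * cnj (special_hermite (fst p) (snd p) (snd y))))"
    for p :: "(nat ^ 'n) \<times> (nat ^ 'n)" and x y
  proof -
    have "exp (- \<i> * of_real (fst x * special_hermite_eigenvalue (snd p))) * cnj (exp (- \<i> * of_real (fst y * special_hermite_eigenvalue (snd p))))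
        = exp (\<i> * of_real ((fst y - fst x) * real CARD('n))) * (modulation x * cnj (modulation y)) ^ multi_degree (snd p)"
      unfolding modulation_def complex_cnj_mult exp_cnj exp_add[symmetric] exp_of_nat_mult[symmetric]
      by (rule arg_cong[where f=exp]) (simp add: special_hermite_eigenvalue_def algebra_simps)
    then show ?thesis unfolding wave_def damping_def by (simp add: mult_ac)
  qed
  have cmod_wave: "cmod (wave p x) = cmod (special_hermite (fst p) (snd p) (snd x))" for p and x :: "real \<times> (complex ^ 'n)"
    by (simp add: wave_def norm_mult)
  have diag: "complex_of_real (damping s p * (cmod (wave p x))\<^sup>2)
      = of_real s ^ multi_degree (fst p) * 1 ^ multi_degree (snd p) * (special_hermite (fst p) (snd p) (snd x) * cnj (special_hermite (fst p) (snd p) (snd x)))"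
    for p and x :: "real \<times> (complex ^ 'n)"
    unfolding cmod_wave complex_norm_square[symmetric] by (simp add: damping_def)
  have diag': "damping s p * (cmod (wave p x))\<^sup>2 = cmod (of_real s ^ multi_degree (fst p) * 1 ^ multi_degree (snd p)
      * (special_hermite (fst p) (snd p) (snd x) * cnj (special_hermite (fst p) (snd p) (snd x))))"
    for p and x :: "real \<times> (complex ^ 'n)"
  proof -
    have "0 \<le> damping s p * (cmod (wave p x))\<^sup>2" using s by (simp add: damping_def)
    then have "damping s p * (cmod (wave p x))\<^sup>2 = cmod (complex_of_real (damping s p * (cmod (wave p x))\<^sup>2))"
      by (simp only: norm_of_real abs_of_nonneg)
    then show ?thesis unfolding diag .
  qed
  show ?thesis
  proof
    fix p p' :: "(nat ^ 'n) \<times> (nat ^ 'n)" and x y :: "real \<times> (complex ^ 'n)" and k k' :: nat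
    have "integrable space_time (\<lambda>x. complex_of_real ((cmod (wave p x))\<^sup>2))"
      using wave_modulation_product(1)[of 0 p 0 p] by (simp add: complex_norm_square del: of_real_power)
    then show "square_integrable space_time (wave p)"
      unfolding square_integrable_def complex_of_real_integrable_eq
      using measurable_space_time[OF wave_measurable] by simp
    show "modulation \<in> borel_measurable (space_time :: (real \<times> (complex ^ 'n)) measure)"
      unfolding modulation_def[abs_def]
      by (intro measurable_space_time borel_measurable_continuous_onI continuous_intros)
    show "cmod (modulation x) = 1" by (rule mod)
    show "inner_L2 space_time (\<lambda>x. modulation x ^ k * wave p x) (\<lambda>x. modulation x ^ k' * wave p' x)
      = (if (k, p) = (k', p') then of_real (2 * pi) else 0)"
      by (rule wave_modulation_product(2))
    show "0 < 2 * pi" by simp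
    show "0 \<le> damping s p" "damping s p \<le> 1" using s by (auto simp: damping_def power_le_one)
    show "0 < s" "s < 1" by fact+
    show "1 \<le> CARD('n)" using zero_less_card_finite[where 'a='n] by linarith
    have one: "cmod (1::complex) = 1" by simp
    note K = special_hermite_kernel[OF s one, of "snd x" "snd x"]
    show sm: "(\<lambda>i. damping s i * (cmod (wave i x))\<^sup>2) summable_on UNIV"
      unfolding diag' by (rule K(1))
    have "complex_of_real (\<Sum>\<^sub>\<infinity>i. damping s i * (cmod (wave i x))\<^sup>2)
        = (\<Sum>\<^sub>\<infinity>p. of_real s ^ multi_degree (fst p) * 1 ^ multi_degree (snd p) * (special_hermite (fst p) (snd p) (snd x) * cnj (special_hermite (fst p) (snd p) (snd x))))"
      unfolding infsum_of_real_complex[symmetric] diag ..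
    then have "cmod (complex_of_real (\<Sum>\<^sub>\<infinity>i. damping s i * (cmod (wave i x))\<^sup>2)) \<le> (1 / (2 * pi)) ^ CARD('n) / cmod (1 - of_real s * 1) ^ CARD('n)"
      using K(2) by simp
    moreover have "cmod (1 - complex_of_real s * 1) = 1 - s"
    proof -
      have "1 - complex_of_real s * 1 = of_real (1 - s)" by simp
      then show ?thesis using s by (simp only: norm_of_real)
    qed
    ultimately show "(\<Sum>\<^sub>\<infinity>i. damping s i * (cmod (wave i x))\<^sup>2) \<le> (1 / (2 * pi)) ^ CARD('n) / (1 - s) ^ CARD('n)"
      by simp
    have \<omega>: "cmod (modulation x * cnj (modulation y)) = 1" by (simp add: norm_mult mod)
    note K2 = special_hermite_kernel[OF s \<omega>, of "snd x" "snd y"]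
    have "cmod (1 - of_real s * (modulation x * cnj (modulation y))) > 0"
    proof -
      have "0 < 1 - cmod (of_real s * (modulation x * cnj (modulation y)))" using s by (simp add: norm_mult mod)
      also have "\<dots> \<le> cmod (1 - of_real s * (modulation x * cnj (modulation y)))"
        using norm_triangle_ineq2[of 1 "of_real s * (modulation x * cnj (modulation y))"] by simp
      finally show ?thesis .
    qed
    then have pos: "cmod (1 - of_real s * modulation x * cnj (modulation y)) ^ CARD('n) > 0" by (simp add: mult.assoc)
    have "cmod (\<Sum>\<^sub>\<infinity>i. of_real (damping s i) * wave i x * cnj (wave i y)) \<le> (1 / (2 * pi)) ^ CARD('n) / cmod (1 - of_real s * modulation x * cnj (modulation y)) ^ CARD('n)"
      unfolding kern infsum_cmult_right' norm_mult[of "exp _"]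
      using K2(2) by (simp add: mult.assoc)
    then show "cmod (\<Sum>\<^sub>\<infinity>i. of_real (damping s i) * wave i x * cnj (wave i y))
        * cmod (1 - of_real s * modulation x * cnj (modulation y)) ^ CARD('n) \<le> (1 / (2 * pi)) ^ CARD('n)"
      using pos by (simp only: pos_le_divide_eq)
  qed
qed

subsection \<open>The propagator as a limit of damped solutions\<close>

lemma L2_space_iff: "f \<in> L2_space \<longleftrightarrow> square_integrable lebesgue f"
  by (simp add: L2_space_def square_integrable_def)

lemma L2_inner_eq: "L2_inner f g = inner_L2 lebesgue f g"
  by (simp add: L2_inner_def inner_L2_def)

abbreviation Phi :: "(nat ^ 'n) \<times> (nat ^ 'n) \<Rightarrow> complex ^ 'n \<Rightarrow> complex" where
  "Phi p \<equiv> special_hermite (fst p) (snd p)"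

lemma Phi_lebesgue: "square_integrable lebesgue (Phi p)"
  "inner_L2 lebesgue (Phi p) (Phi p') = (if p = p' then of_real 1 else 0)"
proof -
  have "(\<lambda>z. (cmod (Phi p z))\<^sup>2) \<in> borel_measurable lborel" by measurable
  then show "square_integrable lebesgue (Phi p)"
    using special_hermite_square_integrable[of "fst p" "snd p"]
    by (simp add: square_integrable_def integrable_completion measurable_completion)
  have "inner_L2 lebesgue (Phi p) (Phi p') = inner_L2 lborel (Phi p) (Phi p')"
    unfolding inner_L2_def by (rule integral_completion) measurable
  then show "inner_L2 lebesgue (Phi p) (Phi p') = (if p = p' then of_real 1 else 0)"
    unfolding inner_L2_def special_hermite_orthonormal_lborel(2) by (auto simp: prod_eq_iff)
qed

definition coeff :: "(complex ^ 'n \<Rightarrow> complex) \<Rightarrow> (nat ^ 'n) \<times> (nat ^ 'n) \<Rightarrow> complex" where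
  "coeff u p = L2_inner u (Phi p)"

lemma coeff_Bessel:
  assumes "u \<in> L2_space"
  shows "(\<lambda>p. (cmod (coeff u p))\<^sup>2) summable_on UNIV"
    and "(\<Sum>\<^sub>\<infinity>p. (cmod (coeff u p))\<^sup>2) \<le> sqnorm_L2 lebesgue u"
  using Bessel[OF Phi_lebesgue(1) zero_less_one Phi_lebesgue(2)] assms
  unfolding coeff_def L2_inner_eq L2_space_iff by auto

text \<open>Transfers the orthonormality of a system to its coefficient families, in the form that
  \<open>energy_bound\<close> takes.\<close>

lemma coeff_orthonormal_Bessel:
  assumes J: "finite J" and u: "L2_orthonormal J u"
  shows "(\<lambda>p. (cmod (\<Sum>j\<in>J. q j * coeff (u j) p))\<^sup>2) summable_on UNIV"
    and "(\<Sum>\<^sub>\<infinity>p. (cmod (\<Sum>j\<in>J. q j * coeff (u j) p))\<^sup>2) \<le> (\<Sum>j\<in>J. (cmod (q j))\<^sup>2)"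
proof -
  have sq: "square_integrable lebesgue (u j)" if "j \<in> J" for j
    using u that by (simp add: L2_orthonormal_def L2_space_iff)
  have orth: "inner_L2 lebesgue (u j) (u k) = (if j = k then of_real 1 else 0)" if "j \<in> J" "k \<in> J" for j k
    using u that by (simp add: L2_orthonormal_def L2_inner_eq)
  let ?v = "\<lambda>z. \<Sum>j\<in>J. q j * u j z"
  have v: "?v \<in> L2_space"
    unfolding L2_space_iff by (intro square_integrable_sum square_integrable_cmult sq)
  have c: "coeff ?v p = (\<Sum>j\<in>J. q j * coeff (u j) p)" for p
    unfolding coeff_def L2_inner_eq by (rule inner_L2_sum_left[OF sq Phi_lebesgue(1)])
  have "sqnorm_L2 lebesgue ?v = 1 * (\<Sum>j\<in>J. (cmod (q j))\<^sup>2)"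
    by (rule sqnorm_L2_orthogonal_sum[OF J sq orth])
  then show "(\<lambda>p. (cmod (\<Sum>j\<in>J. q j * coeff (u j) p))\<^sup>2) summable_on UNIV"
    "(\<Sum>\<^sub>\<infinity>p. (cmod (\<Sum>j\<in>J. q j * coeff (u j) p))\<^sup>2) \<le> (\<Sum>j\<in>J. (cmod (q j))\<^sup>2)"
    using coeff_Bessel[OF v] unfolding c by auto
qed

text \<open>For finite partial sums orthonormality computes the norm exactly; Fatou's lemma along
  the enumeration carries this over to a pointwise sum as an inequality.\<close>

lemma nn_integral_series_le:
  fixes c :: "(nat ^ 'n) \<times> (nat ^ 'n) \<Rightarrow> complex"
  assumes c: "(\<lambda>p. (cmod (c p))\<^sup>2) summable_on UNIV"
    and f: "\<And>z. ((\<lambda>p. c p * Phi p z) has_sum f z) UNIV"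
  shows "(\<integral>\<^sup>+z. ennreal ((cmod (f z))\<^sup>2) \<partial>lborel) \<le> ennreal (\<Sum>\<^sub>\<infinity>p. (cmod (c p))\<^sup>2)"
proof -
  define S where "S m z = (\<Sum>p | to_nat p < m. c p * Phi p z)" for m z
  have S_meas [measurable]: "S m \<in> borel_measurable borel" for m
    unfolding S_def by measurable
  have lim: "(\<lambda>m. ennreal ((cmod (S m z))\<^sup>2)) \<longlonglongrightarrow> ennreal ((cmod (f z))\<^sup>2)" for z
    using has_sum_imp_tendsto_to_nat[OF f[of z]] unfolding S_def[symmetric]
    by (intro tendsto_ennrealI tendsto_power tendsto_norm)
  have S_le: "(\<integral>\<^sup>+z. ennreal ((cmod (S m z))\<^sup>2) \<partial>lborel) \<le> ennreal (\<Sum>\<^sub>\<infinity>p. (cmod (c p))\<^sup>2)" for m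
  proof -
    let ?F = "{p :: (nat ^ 'n) \<times> (nat ^ 'n). to_nat p < m}"
    have sq: "square_integrable lborel (S m)"
      unfolding S_def by (intro square_integrable_sum square_integrable_cmult special_hermite_square_integrable)
    have "(\<integral>\<^sup>+z. ennreal ((cmod (S m z))\<^sup>2) \<partial>lborel) = ennreal (sqnorm_L2 lborel (S m))"
      unfolding sqnorm_L2_def using sq by (intro nn_integral_eq_integral) (auto simp: square_integrable_def)
    also have "sqnorm_L2 lborel (S m) = 1 * (\<Sum>p\<in>?F. (cmod (c p))\<^sup>2)"
      unfolding S_def
      by (rule sqnorm_L2_orthogonal_sum[OF finite_to_nat_less special_hermite_square_integrable])
        (auto simp: inner_L2_def special_hermite_orthonormal_lborel(2) prod_eq_iff)
    also have "\<dots> \<le> (\<Sum>\<^sub>\<infinity>p. (cmod (c p))\<^sup>2)"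
      using finite_sum_le_infsum[OF c finite_to_nat_less] by simp
    finally show ?thesis by (simp add: ennreal_leI)
  qed
  have "(\<integral>\<^sup>+z. ennreal ((cmod (f z))\<^sup>2) \<partial>lborel) = (\<integral>\<^sup>+z. liminf (\<lambda>m. ennreal ((cmod (S m z))\<^sup>2)) \<partial>lborel)"
    by (intro nn_integral_cong lim_imp_Liminf[symmetric, OF sequentially_bot lim])
  also have "\<dots> \<le> liminf (\<lambda>m. \<integral>\<^sup>+z. ennreal ((cmod (S m z))\<^sup>2) \<partial>lborel)"
    by (rule nn_integral_liminf) measurable
  also have "\<dots> \<le> ennreal (\<Sum>\<^sub>\<infinity>p. (cmod (c p))\<^sup>2)"
    using S_le by (intro Liminf_le) auto
  finally show ?thesis .
qed

lemma has_sum_diff: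
  fixes f g :: "'a \<Rightarrow> 'b::real_normed_vector"
  assumes "(f has_sum a) A" "(g has_sum b) A"
  shows "((\<lambda>x. f x - g x) has_sum (a - b)) A"
  using has_sum_add[OF assms(1), of "\<lambda>x. - g x" "- b"] assms(2) by (simp add: has_sum_uminus)

text \<open>The damping makes the series converge absolutely at every point for square summable
  coefficients, so this is a genuine function of t and z rather than a class. The half power makes
  it agree with \<open>synth\<close>.\<close>

definition damped :: "real \<Rightarrow> ((nat ^ 'n) \<times> (nat ^ 'n) \<Rightarrow> complex) \<Rightarrow> real \<times> (complex ^ 'n) \<Rightarrow> complex" where
  "damped s a x = (\<Sum>\<^sub>\<infinity>p. of_real (sqrt (damping s p)) * a p * wave p x)"

lemma damped_has_sum:
  assumes s: "0 < s" "s < 1" and a: "(\<lambda>p. (cmod (a p))\<^sup>2) summable_on UNIV"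
  shows "((\<lambda>p. (of_real (sqrt (damping s p)) * a p * exp (- \<i> * of_real (t * special_hermite_eigenvalue (snd p)))) * Phi p z) has_sum damped s a (t, z)) UNIV"
proof -
  note D = special_hermite_dispersive_system[OF s]
  have "(\<lambda>p. of_real (sqrt (damping s p)) * a p * wave p (t, z)) summable_on UNIV"
    by (rule abs_summable_summable[OF dispersive_system.synth_summable(1)[OF D a]])
  then show ?thesis unfolding damped_def using has_sum_infsum by (simp add: wave_def mult.assoc)
qed

lemma damped_measurable:
  assumes s: "0 < s" "s < 1" and a: "(\<lambda>p. (cmod (a p))\<^sup>2) summable_on UNIV"
  shows "damped s a \<in> borel_measurable borel"
  unfolding damped_def
proof (rule borel_measurable_infsum_complex)
  show "(\<lambda>p. of_real (sqrt (damping s p)) * a p * wave p x) summable_on UNIV" for x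
    by (rule abs_summable_summable[OF dispersive_system.synth_summable(1)[OF special_hermite_dispersive_system[OF s] a]])
  show "(\<lambda>x. of_real (sqrt (damping s p)) * a p * wave p x) \<in> borel_measurable borel" for p
    using wave_measurable[of p] by measurable
qed

text \<open>The squared l^2 error caused by the damping. The time phases have modulus 1, so one
  number controls the error at all times.\<close>

definition damping_defect :: "real \<Rightarrow> ((nat ^ 'n) \<times> (nat ^ 'n) \<Rightarrow> complex) \<Rightarrow> real" where
  "damping_defect s a = (\<Sum>\<^sub>\<infinity>p. (1 - sqrt (damping s p))\<^sup>2 * (cmod (a p))\<^sup>2)"

lemma sqrt_damping: "0 < s \<Longrightarrow> s < 1 \<Longrightarrow> 0 \<le> sqrt (damping s p) \<and> sqrt (damping s p) \<le> 1"
  by (simp add: damping_def power_le_one)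

lemma damping_defect_summable:
  fixes a :: "(nat ^ 'n) \<times> (nat ^ 'n) \<Rightarrow> complex"
  assumes "0 < s" "s < 1" "(\<lambda>p. (cmod (a p))\<^sup>2) summable_on UNIV"
  shows "(\<lambda>p. (1 - sqrt (damping s p))\<^sup>2 * (cmod (a p))\<^sup>2) summable_on UNIV"
proof (rule summable_on_comparison_test[OF assms(3)])
  fix p :: "(nat ^ 'n) \<times> (nat ^ 'n)"
  have "(1 - sqrt (damping s p))\<^sup>2 \<le> 1"
    using sqrt_damping[OF assms(1,2), of p] by (intro power_le_one) auto
  then show "(1 - sqrt (damping s p))\<^sup>2 * (cmod (a p))\<^sup>2 \<le> (cmod (a p))\<^sup>2"
    by (intro mult_left_le_one_le) auto
qed auto

text \<open>Dominated convergence by hand: a finite set carries all but \<epsilon>/2 of the mass, on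
  it the factors tend to 0, and off it they are at most 1.\<close>

lemma damping_defect_tendsto:
  fixes a :: "(nat ^ 'n) \<times> (nat ^ 'n) \<Rightarrow> complex"
  assumes a: "(\<lambda>p. (cmod (a p))\<^sup>2) summable_on UNIV"
  shows "((\<lambda>s. damping_defect s a) \<longlongrightarrow> 0) (at_left 1)"
proof -
  have ev: "\<forall>\<^sub>F s in at_left (1::real). 0 < s \<and> s < 1"
    by (rule eventually_at_leftI[of 0]) auto
  have "\<forall>\<^sub>F s in at_left 1. damping_defect s a < \<epsilon>" if \<epsilon>: "\<epsilon> > 0" for \<epsilon>
  proof -
    define A where "A = (\<Sum>\<^sub>\<infinity>p. (cmod (a p))\<^sup>2)"
    have "((\<lambda>F. \<Sum>p\<in>F. (cmod (a p))\<^sup>2) \<longlongrightarrow> A) (finite_subsets_at_top UNIV)"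
      using has_sum_infsum[OF a] unfolding A_def has_sum_def .
    then have "\<forall>\<^sub>F F in finite_subsets_at_top UNIV. A - \<epsilon> / 2 < (\<Sum>p\<in>F. (cmod (a p))\<^sup>2)"
      by (rule order_tendstoD(1)) (use \<epsilon> in simp)
    then obtain F where F: "finite F" "A - \<epsilon> / 2 < (\<Sum>p\<in>F. (cmod (a p))\<^sup>2)"
      unfolding eventually_finite_subsets_at_top by auto
    have "((\<lambda>s. \<Sum>p\<in>F. (1 - sqrt (damping s p))\<^sup>2 * (cmod (a p))\<^sup>2) \<longlongrightarrow> (\<Sum>p\<in>F. (1 - sqrt (1 ^ multi_degree (fst p)))\<^sup>2 * (cmod (a p))\<^sup>2)) (at_left 1)"
      unfolding damping_def by (intro tendsto_intros)
    then have "((\<lambda>s. \<Sum>p\<in>F. (1 - sqrt (damping s p))\<^sup>2 * (cmod (a p))\<^sup>2) \<longlongrightarrow> 0) (at_left 1)" by simp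
    then have "\<forall>\<^sub>F s in at_left 1. (\<Sum>p\<in>F. (1 - sqrt (damping s p))\<^sup>2 * (cmod (a p))\<^sup>2) < \<epsilon> / 2"
      by (rule order_tendstoD(2)) (use \<epsilon> in simp)
    then show ?thesis using ev
    proof eventually_elim
      case (elim s)
      then have s: "0 < s" "s < 1" by auto
      let ?d = "\<lambda>p. (1 - sqrt (damping s p))\<^sup>2 * (cmod (a p))\<^sup>2"
      have d: "?d summable_on UNIV" by (rule damping_defect_summable[OF s a])
      have split: "infsum f UNIV = sum f F + infsum f (- F)" if "f summable_on UNIV" for f :: "_ \<Rightarrow> real"
      proof -
        have "infsum f (F \<union> - F) = infsum f F + infsum f (- F)"
          using that by (intro infsum_Un_disjoint) (auto intro: summable_on_subset_banach)
        then show ?thesis using F(1) by simp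
      qed
      have "infsum ?d (- F) \<le> infsum (\<lambda>p. (cmod (a p))\<^sup>2) (- F)"
      proof (rule infsum_mono)
        show "?d summable_on - F" "(\<lambda>p. (cmod (a p))\<^sup>2) summable_on - F"
          using d a by (auto intro: summable_on_subset_banach)
        fix p :: "(nat ^ 'n) \<times> (nat ^ 'n)"
        have "(1 - sqrt (damping s p))\<^sup>2 \<le> 1"
          using sqrt_damping[OF s, of p] by (intro power_le_one) auto
        then show "?d p \<le> (cmod (a p))\<^sup>2" by (intro mult_left_le_one_le) auto
      qed
      also have "\<dots> < \<epsilon> / 2" using split[OF a] F(2) by (simp add: A_def)
      finally show ?case unfolding damping_defect_def split[OF d] using elim by simp
    qed
  qed
  moreover have "\<forall>\<^sub>F s in at_left 1. 0 \<le> damping_defect s a"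
    by (intro always_eventually allI) (auto simp: damping_defect_def intro!: infsum_nonneg)
  ultimately show ?thesis
    by (intro order_tendstoI) (auto elim!: eventually_mono)
qed

lemma damped_diff_le:
  fixes a :: "(nat ^ 'n) \<times> (nat ^ 'n) \<Rightarrow> complex"
  assumes s: "0 < s" "s < 1" "0 < r" "r < 1" and a: "(\<lambda>p. (cmod (a p))\<^sup>2) summable_on UNIV"
  shows "(\<integral>\<^sup>+z. ennreal ((cmod (damped s a (t, z) - damped r a (t, z)))\<^sup>2) \<partial>lborel)
    \<le> ennreal (2 * (damping_defect s a + damping_defect r a))"
proof -
  let ?e = "\<lambda>p. exp (- \<i> * of_real (t * special_hermite_eigenvalue (snd p)))"
  let ?c = "\<lambda>p. of_real (sqrt (damping s p) - sqrt (damping r p)) * a p * ?e p"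
  let ?ds = "\<lambda>s p. (1 - sqrt (damping s p))\<^sup>2 * (cmod (a p))\<^sup>2"
  have sm: "(\<lambda>p. 2 * (?ds s p + ?ds r p)) summable_on UNIV"
    using assms by (intro summable_on_cmult_right summable_on_add damping_defect_summable)
  have le: "(cmod (?c p))\<^sup>2 \<le> 2 * (?ds s p + ?ds r p)" for p
  proof -
    have "(sqrt (damping s p) - sqrt (damping r p))\<^sup>2 \<le> 2 * ((1 - sqrt (damping s p))\<^sup>2 + (1 - sqrt (damping r p))\<^sup>2)"
      using sum_squares_bound[of "1 - sqrt (damping s p)" "- (1 - sqrt (damping r p))"]
      by (simp add: power2_eq_square algebra_simps)
    then have "(sqrt (damping s p) - sqrt (damping r p))\<^sup>2 * (cmod (a p))\<^sup>2
        \<le> 2 * ((1 - sqrt (damping s p))\<^sup>2 + (1 - sqrt (damping r p))\<^sup>2) * (cmod (a p))\<^sup>2"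
      by (rule mult_right_mono) simp
    moreover have "(cmod (?c p))\<^sup>2 = (sqrt (damping s p) - sqrt (damping r p))\<^sup>2 * (cmod (a p))\<^sup>2"
    proof -
      have "cmod (?e p) = 1" by simp
      then show ?thesis by (simp only: norm_mult power_mult_distrib norm_of_real power2_abs power_one mult_1_right)
    qed
    ultimately show ?thesis by (simp add: algebra_simps)
  qed
  have c: "(\<lambda>p. (cmod (?c p))\<^sup>2) summable_on UNIV"
    by (rule summable_on_comparison_test[OF sm le]) simp
  have "((\<lambda>p. ?c p * Phi p z) has_sum (damped s a (t, z) - damped r a (t, z))) UNIV" for z
    using has_sum_diff[OF damped_has_sum[OF s(1,2) a, of t z] damped_has_sum[OF s(3,4) a, of t z]]
    by (simp add: algebra_simps)
  from nn_integral_series_le[OF c this]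
  have "(\<integral>\<^sup>+z. ennreal ((cmod (damped s a (t, z) - damped r a (t, z)))\<^sup>2) \<partial>lborel) \<le> ennreal (\<Sum>\<^sub>\<infinity>p. (cmod (?c p))\<^sup>2)" .
  also have "\<dots> \<le> ennreal (\<Sum>\<^sub>\<infinity>p. 2 * (?ds s p + ?ds r p))"
    by (intro ennreal_leI infsum_mono c sm le)
  also have "(\<Sum>\<^sub>\<infinity>p. 2 * (?ds s p + ?ds r p)) = 2 * (damping_defect s a + damping_defect r a)"
    unfolding damping_defect_def using assms
    by (subst infsum_cmult_right') (simp add: infsum_add damping_defect_summable)
  finally show ?thesis .
qed

lemma damped_energy_le:
  assumes s: "0 < s" "s < 1" and a: "(\<lambda>p. (cmod (a p))\<^sup>2) summable_on UNIV"
  shows "(\<integral>\<^sup>+z. ennreal ((cmod (damped s a (t, z)))\<^sup>2) \<partial>lborel) \<le> ennreal (\<Sum>\<^sub>\<infinity>p. (cmod (a p))\<^sup>2)"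
proof -
  let ?c = "\<lambda>p. of_real (sqrt (damping s p)) * a p * exp (- \<i> * of_real (t * special_hermite_eigenvalue (snd p)))"
  have le: "(cmod (?c p))\<^sup>2 \<le> (cmod (a p))\<^sup>2" for p
    using sqrt_damping[OF s, of p]
    by (intro power_mono) (auto simp: norm_mult intro!: mult_left_le_one_le)
  have c: "(\<lambda>p. (cmod (?c p))\<^sup>2) summable_on UNIV"
    by (rule summable_on_comparison_test[OF a le]) simp
  show ?thesis
    using nn_integral_series_le[OF c damped_has_sum[OF s a, of t]] ennreal_leI[OF infsum_mono[OF c a le]]
    by (rule order_trans)
qed

text \<open>A quantitative Riesz--Fischer argument: the chosen rate makes the damped solutions
  converge almost everywhere and not only in \<open>L\<^sup>2\<close>.\<close>

lemma damped_AE_convergent: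
  fixes a :: "(nat ^ 'n) \<times> (nat ^ 'n) \<Rightarrow> complex"
  assumes s: "\<And>m. 0 < s m" "\<And>m. s m < 1" and a: "(\<lambda>p. (cmod (a p))\<^sup>2) summable_on UNIV"
    and rate: "\<And>m. m \<ge> m0 \<Longrightarrow> damping_defect (s m) a \<le> (1 / 4) ^ m"
  shows "AE z in lborel. convergent (\<lambda>m. damped (s m) a (t, z))"
proof -
  define d where "d m z = damped (s (m0 + Suc m)) a (t, z) - damped (s (m0 + m)) a (t, z)" for m z
  have meas [measurable]: "(\<lambda>z. damped (s m) a (t, z)) \<in> borel_measurable borel" for m
    by (rule measurable_compose[OF _ damped_measurable[OF s a]]) simp
  have d_meas [measurable]: "d m \<in> borel_measurable borel" for m
    unfolding d_def by measurable
  have d_le: "(\<integral>\<^sup>+z. ennreal ((cmod (d m z))\<^sup>2) \<partial>lborel) \<le> ennreal (4 * (1 / 4) ^ m)" for m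
  proof -
    have "damping_defect (s (m0 + Suc m)) a \<le> (1 / 4) ^ m" "damping_defect (s (m0 + m)) a \<le> (1 / 4) ^ m"
      by (rule order_trans[OF rate], simp, rule power_decreasing, simp_all)+
    then have "2 * (damping_defect (s (m0 + Suc m)) a + damping_defect (s (m0 + m)) a) \<le> 4 * (1 / 4) ^ m" by simp
    then show ?thesis
      unfolding d_def using damped_diff_le[OF s s a] ennreal_leI order_trans by blast
  qed
  \<comment> \<open>The increments have squared norms of order 4^(-m). The weight 2^m keeps the sum
    of the integrals finite and yields almost everywhere a pointwise decay of order 2^(-m/2), which
    is summable.\<close>
  have "(\<integral>\<^sup>+z. (\<Sum>m. ennreal (2 ^ m * (cmod (d m z))\<^sup>2)) \<partial>lborel) = (\<Sum>m. \<integral>\<^sup>+z. ennreal (2 ^ m * (cmod (d m z))\<^sup>2) \<partial>lborel)"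
    by (rule nn_integral_suminf) measurable
  also have "\<dots> \<le> (\<Sum>m. ennreal (4 * (1 / 2) ^ m))"
  proof (intro suminf_le summableI)
    fix m
    have "(\<integral>\<^sup>+z. ennreal (2 ^ m * (cmod (d m z))\<^sup>2) \<partial>lborel) = ennreal (2 ^ m) * (\<integral>\<^sup>+z. ennreal ((cmod (d m z))\<^sup>2) \<partial>lborel)"
      by (subst nn_integral_cmult[symmetric]) (auto simp: ennreal_mult)
    also have "\<dots> \<le> ennreal (2 ^ m) * ennreal (4 * (1 / 4) ^ m)" by (rule mult_left_mono[OF d_le]) simp
    also have "\<dots> = ennreal (4 * (2 ^ m * (1 / 4) ^ m))" by (simp add: ennreal_mult[symmetric] mult_ac)
    also have "2 ^ m * (1 / 4) ^ m = (1 / 2 :: real) ^ m" by (simp add: power_mult_distrib[symmetric])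
    finally show "(\<integral>\<^sup>+z. ennreal (2 ^ m * (cmod (d m z))\<^sup>2) \<partial>lborel) \<le> ennreal (4 * (1 / 2) ^ m)" .
  qed
  also have "\<dots> < \<infinity>"
  proof -
    have "summable (\<lambda>m. 4 * (1 / 2 :: real) ^ m)" by (intro summable_mult summable_geometric) simp
    then show ?thesis by (subst suminf_ennreal2) auto
  qed
  finally have "AE z in lborel. (\<Sum>m. ennreal (2 ^ m * (cmod (d m z))\<^sup>2)) \<noteq> \<infinity>"
    by (intro nn_integral_PInf_AE) auto
  then show ?thesis
  proof eventually_elim
    case (elim z)
    have "summable (\<lambda>m. 2 ^ m * (cmod (d m z))\<^sup>2)"
      using elim by (intro summable_suminf_not_top) (auto simp: infinity_ennreal_def)
    then have "(\<lambda>m. 2 ^ m * (cmod (d m z))\<^sup>2) \<longlonglongrightarrow> 0" by (rule summable_LIMSEQ_zero)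
    then have "Bseq (\<lambda>m. 2 ^ m * (cmod (d m z))\<^sup>2)" by (intro convergent_imp_Bseq convergentI)
    then obtain K where K: "K > 0" "\<And>m. norm (2 ^ m * (cmod (d m z))\<^sup>2) \<le> K" by (elim BseqE) blast
    have "cmod (d m z) \<le> sqrt K * sqrt (1 / 2) ^ m" for m
    proof -
      have "(cmod (d m z))\<^sup>2 \<le> K * (1 / 2) ^ m"
        using K(2)[of m] by (simp add: power_divide field_simps)
      then have "cmod (d m z) \<le> sqrt (K * (1 / 2) ^ m)" by (rule real_le_rsqrt)
      then show ?thesis by (simp add: real_sqrt_mult real_sqrt_power)
    qed
    moreover have "summable (\<lambda>m. sqrt K * sqrt (1 / 2) ^ m)"
      by (intro summable_mult summable_geometric) (simp add: real_sqrt_divide)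
    ultimately have "summable (\<lambda>m. d m z)"
      by (rule summable_comparison_test'[where N = 0, rotated])
    then have "convergent (\<lambda>n. \<Sum>m<n. d m z)" by (simp add: summable_iff_convergent)
    moreover have "(\<Sum>m<n. d m z) = damped (s (m0 + n)) a (t, z) - damped (s m0) a (t, z)" for n
      unfolding d_def using sum_lessThan_telescope[of "\<lambda>m. damped (s (m0 + m)) a (t, z)" n] by simp
    ultimately have "convergent (\<lambda>n. (damped (s (m0 + n)) a (t, z) - damped (s m0) a (t, z)) + damped (s m0) a (t, z))"
      by (intro convergent_add convergent_const) simp
    then have "convergent (\<lambda>n. damped (s (n + m0)) a (t, z))" by (simp add: add.commute)
    then show "convergent (\<lambda>m. damped (s m) a (t, z))" using convergent_ignore_initial_segment[of "\<lambda>m. damped (s m) a (t, z)" m0] by simp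
  qed
qed

text \<open>The damped solution is compared directly with the partial sums that define the
  propagator: on F the error is part of the damping defect, and off F it is at most the tail of the
  coefficients, as the damping factors do not exceed 1.\<close>

lemma damped_partial_sum_le:
  fixes a :: "(nat ^ 'n) \<times> (nat ^ 'n) \<Rightarrow> complex"
  assumes s: "0 < s" "s < 1" and a: "(\<lambda>p. (cmod (a p))\<^sup>2) summable_on UNIV" and F: "finite F"
  shows "(\<integral>\<^sup>+z. ennreal ((cmod (damped s a (t, z) - (\<Sum>p\<in>F. exp (- \<i> * of_real (t * special_hermite_eigenvalue (snd p))) * a p * Phi p z)))\<^sup>2) \<partial>lborel)
    \<le> ennreal (damping_defect s a + ((\<Sum>\<^sub>\<infinity>p. (cmod (a p))\<^sup>2) - (\<Sum>p\<in>F. (cmod (a p))\<^sup>2)))"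
proof -
  let ?e = "\<lambda>p. exp (- \<i> * of_real (t * special_hermite_eigenvalue (snd p)))"
  let ?r = "\<lambda>p. sqrt (damping s p) - (if p \<in> F then 1 else 0)"
  let ?c = "\<lambda>p. of_real (?r p) * a p * ?e p"
  let ?d = "\<lambda>p. (1 - sqrt (damping s p))\<^sup>2 * (cmod (a p))\<^sup>2"
  have d: "?d summable_on UNIV" by (rule damping_defect_summable[OF s a])
  have aF: "((\<lambda>p. if p \<in> F then (cmod (a p))\<^sup>2 else 0) has_sum (\<Sum>p\<in>F. (cmod (a p))\<^sup>2)) UNIV"
    using has_sum_finite[OF F, of "\<lambda>p. (cmod (a p))\<^sup>2"]
    by (rule has_sum_cong_neutral[THEN iffD1, rotated -1]) auto
  have bnd: "((\<lambda>p. ?d p + ((cmod (a p))\<^sup>2 - (if p \<in> F then (cmod (a p))\<^sup>2 else 0))) has_sum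
     (damping_defect s a + ((\<Sum>\<^sub>\<infinity>p. (cmod (a p))\<^sup>2) - (\<Sum>p\<in>F. (cmod (a p))\<^sup>2)))) UNIV"
    unfolding damping_defect_def
    by (intro has_sum_add has_sum_diff has_sum_infsum d a aF)
  have le: "(cmod (?c p))\<^sup>2 \<le> ?d p + ((cmod (a p))\<^sup>2 - (if p \<in> F then (cmod (a p))\<^sup>2 else 0))" for p
  proof -
    have "cmod (?e p) = 1" by simp
    then have eq: "(cmod (?c p))\<^sup>2 = (?r p)\<^sup>2 * (cmod (a p))\<^sup>2"
      by (simp only: norm_mult power_mult_distrib norm_of_real power2_abs power_one mult_1_right)
    show ?thesis
    proof (cases "p \<in> F")
      case True
      then show ?thesis unfolding eq by (simp add: power2_commute)
    next
      case False
      have "(sqrt (damping s p))\<^sup>2 * (cmod (a p))\<^sup>2 \<le> 1 * (cmod (a p))\<^sup>2"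
        using sqrt_damping[OF s, of p] by (intro mult_right_mono power_le_one) auto
      moreover have "0 \<le> ?d p" by (intro mult_nonneg_nonneg zero_le_power2)
      moreover have "(?r p)\<^sup>2 * (cmod (a p))\<^sup>2 = (sqrt (damping s p))\<^sup>2 * (cmod (a p))\<^sup>2" "(if p \<in> F then (cmod (a p))\<^sup>2 else 0) = 0"
        using False by simp_all
      ultimately show ?thesis unfolding eq by linarith
    qed
  qed
  have c: "(\<lambda>p. (cmod (?c p))\<^sup>2) summable_on UNIV"
    by (rule summable_on_comparison_test[OF has_sum_imp_summable[OF bnd] le]) simp
  have "((\<lambda>p. ?c p * Phi p z) has_sum (damped s a (t, z) - (\<Sum>p\<in>F. ?e p * a p * Phi p z))) UNIV" for z
  proof -
    have "((\<lambda>p. if p \<in> F then ?e p * a p * Phi p z else 0) has_sum (\<Sum>p\<in>F. ?e p * a p * Phi p z)) UNIV"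
      using has_sum_finite[OF F, of "\<lambda>p. ?e p * a p * Phi p z"]
      by (rule has_sum_cong_neutral[THEN iffD1, rotated -1]) auto
    from has_sum_diff[OF damped_has_sum[OF s a, of t z] this] show ?thesis
      by (rule has_sum_cong[THEN iffD1, rotated]) (simp add: algebra_simps)
  qed
  from nn_integral_series_le[OF c this] show ?thesis
    by (rule order_trans) (intro ennreal_leI has_sum_mono[OF has_sum_infsum[OF c] bnd le])
qed

text \<open>The pointwise limit of the damped solutions is also an L^2 limit of the partial sums,
  and two such limits agree almost everywhere; this identifies whatever representative the choice
  operator returns. The exceptional null set may depend on t.\<close>

lemma special_hermite_propagator_AE_eq:
  fixes u :: "complex ^ 'n \<Rightarrow> complex"
  assumes u: "u \<in> L2_space" and s: "\<And>m. 0 < s m" "\<And>m. s m < 1"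
    and rate: "\<And>m. m \<ge> m0 \<Longrightarrow> damping_defect (s m) (coeff u) \<le> (1 / 4) ^ m"
  shows "AE z in lebesgue. (\<lambda>m. damped (s m) (coeff u) (t, z)) \<longlonglongrightarrow> special_hermite_propagator t u z"
proof -
  define a where "a = coeff u"
  have a: "(\<lambda>p. (cmod (a p))\<^sup>2) summable_on UNIV" unfolding a_def by (rule coeff_Bessel(1)[OF u])
  define P where "P F z = (\<Sum>p\<in>F. exp (- \<i> * of_real (t * special_hermite_eigenvalue (snd p))) * a p * Phi p z)" for F z
  have P_eq: "(\<Sum>(\<mu>, \<nu>)\<in>F. exp (- \<i> * of_real (t * special_hermite_eigenvalue \<nu>)) * L2_inner u (special_hermite \<mu> \<nu>) * special_hermite \<mu> \<nu> z) = P F z" for F z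
    unfolding P_def a_def coeff_def by (simp add: case_prod_unfold)
  define T where "T F = (\<Sum>\<^sub>\<infinity>p. (cmod (a p))\<^sup>2) - (\<Sum>p\<in>F. (cmod (a p))\<^sup>2)" for F
  have T0: "0 \<le> T F" if "finite F" for F unfolding T_def using finite_sum_le_infsum[OF a that] by simp
  define g where "g z = lim (\<lambda>m. damped (s m) a (t, z))" for z
  have meas [measurable]: "(\<lambda>z. damped (s m) a (t, z)) \<in> borel_measurable borel" for m
    by (rule measurable_compose[OF _ damped_measurable[OF s a]]) simp
  have g_meas [measurable]: "g \<in> borel_measurable borel"
    unfolding g_def by (rule borel_measurable_lim_metric) measurable
  have P_meas [measurable]: "P F \<in> borel_measurable borel" for F unfolding P_def by measurable
  have conv: "AE z in lborel. (\<lambda>m. damped (s m) a (t, z)) \<longlonglongrightarrow> g z"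
  proof -
    have "AE z in lborel. convergent (\<lambda>m. damped (s m) a (t, z))"
      by (rule damped_AE_convergent[of s a m0, OF s a]) (use rate in \<open>simp add: a_def\<close>)
    then show ?thesis by eventually_elim (simp add: g_def convergent_LIMSEQ_iff)
  qed
  \<comment> \<open>By Fatou's lemma; the damping defect disappears as m grows, and only the tail
    outside F is left.\<close>
  have gP: "(\<integral>\<^sup>+z. ennreal ((cmod (g z - P F z))\<^sup>2) \<partial>lborel) \<le> ennreal (T F)" if F: "finite F" for F
  proof -
    have "(\<integral>\<^sup>+z. ennreal ((cmod (g z - P F z))\<^sup>2) \<partial>lborel)
        = (\<integral>\<^sup>+z. liminf (\<lambda>m. ennreal ((cmod (damped (s m) a (t, z) - P F z))\<^sup>2)) \<partial>lborel)"
    proof (rule nn_integral_cong_AE)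
      show "AE z in lborel. ennreal ((cmod (g z - P F z))\<^sup>2) = liminf (\<lambda>m. ennreal ((cmod (damped (s m) a (t, z) - P F z))\<^sup>2))"
        using conv
      proof eventually_elim
        case (elim z)
        then have "(\<lambda>m. ennreal ((cmod (damped (s m) a (t, z) - P F z))\<^sup>2)) \<longlonglongrightarrow> ennreal ((cmod (g z - P F z))\<^sup>2)"
          by (intro tendsto_ennrealI tendsto_power tendsto_norm tendsto_diff tendsto_const)
        then show ?case by (rule lim_imp_Liminf[symmetric, OF sequentially_bot])
      qed
    qed
    also have "\<dots> \<le> liminf (\<lambda>m. \<integral>\<^sup>+z. ennreal ((cmod (damped (s m) a (t, z) - P F z))\<^sup>2) \<partial>lborel)"
      by (rule nn_integral_liminf) measurable
    also have "\<dots> \<le> liminf (\<lambda>m. ennreal ((1 / 4) ^ m + T F))"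
    proof (rule Liminf_mono)
      have "(\<integral>\<^sup>+z. ennreal ((cmod (damped (s m) a (t, z) - P F z))\<^sup>2) \<partial>lborel) \<le> ennreal ((1 / 4) ^ m + T F)" if "m \<ge> m0" for m
      proof -
        have "damping_defect (s m) a + T F \<le> (1 / 4) ^ m + T F"
          using rate[OF that] by (simp add: a_def)
        then show ?thesis
          using damped_partial_sum_le[OF s a F, of m t] ennreal_leI order_trans unfolding P_def T_def by blast
      qed
      then show "\<forall>\<^sub>F m in sequentially. (\<integral>\<^sup>+z. ennreal ((cmod (damped (s m) a (t, z) - P F z))\<^sup>2) \<partial>lborel) \<le> ennreal ((1 / 4) ^ m + T F)"
        by (auto simp: eventually_sequentially)
    qed
    also have "\<dots> = ennreal (T F)"
    proof (rule lim_imp_Liminf)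
      have "(\<lambda>m. (1 / 4 :: real) ^ m + T F) \<longlonglongrightarrow> 0 + T F"
        by (intro tendsto_add tendsto_const LIMSEQ_power_zero) simp
      then show "(\<lambda>m. ennreal ((1 / 4) ^ m + T F)) \<longlonglongrightarrow> ennreal (T F)"
        using tendsto_ennrealI by fastforce
    qed simp
    finally show ?thesis .
  qed
  have T_lim: "((\<lambda>F. ennreal (T F)) \<longlongrightarrow> 0) (finite_subsets_at_top UNIV)"
  proof -
    have "(T \<longlongrightarrow> (\<Sum>\<^sub>\<infinity>p. (cmod (a p))\<^sup>2) - (\<Sum>\<^sub>\<infinity>p. (cmod (a p))\<^sup>2)) (finite_subsets_at_top UNIV)"
      unfolding T_def using has_sum_infsum[OF a] unfolding has_sum_def by (intro tendsto_diff tendsto_const)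
    then show ?thesis using tendsto_ennrealI[of T 0] by simp
  qed
  have fin: "\<forall>\<^sub>F F in finite_subsets_at_top UNIV. finite F"
    by (rule eventually_finite_subsets_at_top_weakI) simp
  have leb: "(\<integral>\<^sup>+z. ennreal ((cmod (h z - P F z))\<^sup>2) \<partial>lebesgue) = (\<integral>\<^sup>+z. ennreal ((cmod (h z - P F z))\<^sup>2) \<partial>lborel)"
    if "h \<in> borel_measurable borel" for h F
    using that by (intro nn_integral_completion) measurable
  have g_lim: "((\<lambda>F. \<integral>\<^sup>+z. ennreal ((cmod (g z - P F z))\<^sup>2) \<partial>lebesgue) \<longlongrightarrow> 0) (finite_subsets_at_top UNIV)"
    unfolding leb[OF g_meas]
    by (rule tendsto_sandwich[OF _ _ tendsto_const T_lim]) (use fin gP in \<open>auto elim!: eventually_mono\<close>)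
  have g_L2: "g \<in> L2_space"
  proof -
    have "(\<integral>\<^sup>+z. ennreal ((cmod (g z))\<^sup>2) \<partial>lborel) \<le> ennreal (T {})"
      using gP[of "{}"] by (simp add: P_def)
    also have "\<dots> < \<infinity>" by simp
    finally have "(\<integral>\<^sup>+z. ennreal (norm ((cmod (g z))\<^sup>2)) \<partial>lborel) < \<infinity>" by simp
    then have "integrable lborel (\<lambda>z. (cmod (g z))\<^sup>2)"
      by (rule integrableI_bounded[rotated]) measurable
    then have "integrable lebesgue (\<lambda>z. (cmod (g z))\<^sup>2)"
      by (subst integrable_completion) measurable
    moreover have "g \<in> borel_measurable lebesgue" by (rule measurable_completion) measurable
    ultimately show ?thesis unfolding L2_space_def by blast
  qed
  define G where "G = special_hermite_propagator t u"
  \<comment> \<open>The limit g witnesses the property in the definition of the propagator, so the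
    chosen function has this property too.\<close>
  have "\<exists>g. g \<in> L2_space \<and> ((\<lambda>F. \<integral>\<^sup>+z. ennreal ((cmod (g z - P F z))\<^sup>2) \<partial>lebesgue) \<longlongrightarrow> 0) (finite_subsets_at_top UNIV)"
    using g_L2 g_lim by blast
  from someI_ex[OF this] have G: "G \<in> L2_space" "((\<lambda>F. \<integral>\<^sup>+z. ennreal ((cmod (G z - P F z))\<^sup>2) \<partial>lebesgue) \<longlongrightarrow> 0) (finite_subsets_at_top UNIV)"
    unfolding G_def special_hermite_propagator_def P_eq by auto
  have [measurable]: "G \<in> borel_measurable lebesgue" using G(1) by (simp add: L2_space_def)
  have [measurable]: "g \<in> borel_measurable lebesgue" "P F \<in> borel_measurable lebesgue" for F
    by (auto intro: measurable_completion)
  have upper: "(\<integral>\<^sup>+z. ennreal ((cmod (G z - g z))\<^sup>2) \<partial>lebesgue)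
      \<le> 2 * (\<integral>\<^sup>+z. ennreal ((cmod (G z - P F z))\<^sup>2) \<partial>lebesgue) + 2 * (\<integral>\<^sup>+z. ennreal ((cmod (g z - P F z))\<^sup>2) \<partial>lebesgue)" for F
  proof -
    have "(\<integral>\<^sup>+z. ennreal ((cmod (G z - g z))\<^sup>2) \<partial>lebesgue)
        \<le> (\<integral>\<^sup>+z. 2 * ennreal ((cmod (G z - P F z))\<^sup>2) + 2 * ennreal ((cmod (g z - P F z))\<^sup>2) \<partial>lebesgue)"
    proof (rule nn_integral_mono)
      fix z
      have "(cmod (G z - g z))\<^sup>2 \<le> 2 * (cmod (G z - P F z))\<^sup>2 + 2 * (cmod (g z - P F z))\<^sup>2"
        using cmod_add_squared_le[of "G z - P F z" "P F z - g z"] by (simp add: norm_minus_commute)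
      then have "ennreal ((cmod (G z - g z))\<^sup>2) \<le> ennreal (2 * (cmod (G z - P F z))\<^sup>2 + 2 * (cmod (g z - P F z))\<^sup>2)"
        by (rule ennreal_leI)
      then show "ennreal ((cmod (G z - g z))\<^sup>2) \<le> 2 * ennreal ((cmod (G z - P F z))\<^sup>2) + 2 * ennreal ((cmod (g z - P F z))\<^sup>2)"
        by (simp add: ennreal_plus ennreal_mult)
    qed
    also have "\<dots> = 2 * (\<integral>\<^sup>+z. ennreal ((cmod (G z - P F z))\<^sup>2) \<partial>lebesgue) + 2 * (\<integral>\<^sup>+z. ennreal ((cmod (g z - P F z))\<^sup>2) \<partial>lebesgue)"
      by (subst nn_integral_add) (auto simp: nn_integral_cmult)
    finally show ?thesis .
  qed
  have "((\<lambda>F. 2 * (\<integral>\<^sup>+z. ennreal ((cmod (G z - P F z))\<^sup>2) \<partial>lebesgue) + 2 * (\<integral>\<^sup>+z. ennreal ((cmod (g z - P F z))\<^sup>2) \<partial>lebesgue)) \<longlongrightarrow> 2 * 0 + 2 * 0) (finite_subsets_at_top UNIV)"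
    by (intro tendsto_add ennreal_tendsto_cmult G(2) g_lim) auto
  then have "(\<integral>\<^sup>+z. ennreal ((cmod (G z - g z))\<^sup>2) \<partial>lebesgue) \<le> 2 * 0 + 2 * 0"
    using always_eventually[OF allI[OF upper]] finite_subsets_at_top_neq_bot by (rule tendsto_lowerbound)
  then have "(\<integral>\<^sup>+z. ennreal ((cmod (G z - g z))\<^sup>2) \<partial>lebesgue) = 0" by simp
  then have "AE z in lebesgue. ennreal ((cmod (G z - g z))\<^sup>2) = 0"
    by (rule nn_integral_0_iff_AE[THEN iffD1, rotated]) measurable
  moreover have "AE z in lebesgue. (\<lambda>m. damped (s m) a (t, z)) \<longlonglongrightarrow> g z"
    by (rule AE_completion[OF conv])
  ultimately show ?thesis
    unfolding G_def[symmetric] a_def[symmetric] by eventually_elim (simp add: ennreal_eq_0_iff)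
qed

subsection \<open>Mixed norm estimates\<close>

lemma ennreal_powr_ennreal: "0 \<le> x \<Longrightarrow> ennreal_powr (ennreal x) a = ennreal (x powr a)"
  by (simp add: ennreal_powr_def)

lemma ennreal_powr_top: "ennreal_powr \<infinity> a = \<infinity>"
  by (simp add: ennreal_powr_def)

lemma ennreal_powr_0: "ennreal_powr 0 a = 0"
  by (simp add: ennreal_powr_def)

lemma ennreal_powr_1: "ennreal_powr x 1 = x"
  by (cases x) (simp_all add: ennreal_powr_def)

lemma ennreal_powr_mono:
  assumes "x \<le> y" "0 \<le> a"
  shows "ennreal_powr x a \<le> ennreal_powr y a"
proof (cases y)
  case (real r)
  then obtain r' where r': "x = ennreal r'" "0 \<le> r'"
    using assms(1) by (cases x) (auto simp: top_unique)
  then have "r' \<le> r" using assms(1) real by simp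
  then show ?thesis
    unfolding r'(1) real(2) ennreal_powr_ennreal[OF r'(2)] ennreal_powr_ennreal[OF real(1)]
    by (intro ennreal_leI powr_mono2 assms r')
next
  case top
  then show ?thesis by (simp add: ennreal_powr_def)
qed

lemma ennreal_powr_powr:
  shows "ennreal_powr (ennreal_powr x a) b = ennreal_powr x (a * b)"
  by (cases x) (simp_all add: ennreal_powr_ennreal powr_powr ennreal_powr_top[unfolded infinity_ennreal_def])

lemma ennreal_powr_le_iff:
  assumes "0 < a"
  shows "ennreal_powr x a \<le> y \<longleftrightarrow> x \<le> ennreal_powr y (1 / a)"
proof
  assume "ennreal_powr x a \<le> y"
  then have "ennreal_powr (ennreal_powr x a) (1 / a) \<le> ennreal_powr y (1 / a)"
    using assms by (intro ennreal_powr_mono) auto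
  then show "x \<le> ennreal_powr y (1 / a)" using assms by (simp add: ennreal_powr_powr ennreal_powr_1)
next
  assume "x \<le> ennreal_powr y (1 / a)"
  then have "ennreal_powr x a \<le> ennreal_powr (ennreal_powr y (1 / a)) a"
    using assms by (intro ennreal_powr_mono) auto
  then show "ennreal_powr x a \<le> y" using assms by (simp add: ennreal_powr_powr ennreal_powr_1)
qed

text \<open>For a > 0 the power is an order isomorphism whose inverse is the power 1/a, hence it
  commutes with suprema.\<close>

lemma ennreal_powr_SUP:
  assumes "0 < a" "I \<noteq> {}"
  shows "ennreal_powr (SUP i\<in>I. f i) a = (SUP i\<in>I. ennreal_powr (f i) a)"
proof (rule antisym)
  show "ennreal_powr (SUP i\<in>I. f i) a \<le> (SUP i\<in>I. ennreal_powr (f i) a)"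
    unfolding ennreal_powr_le_iff[OF assms(1)]
  proof (rule SUP_least)
    fix i assume "i \<in> I"
    then show "f i \<le> ennreal_powr (SUP i\<in>I. ennreal_powr (f i) a) (1 / a)"
      unfolding ennreal_powr_le_iff[OF assms(1), symmetric] by (rule SUP_upper)
  qed
  show "(SUP i\<in>I. ennreal_powr (f i) a) \<le> ennreal_powr (SUP i\<in>I. f i) a"
    using assms by (intro SUP_least ennreal_powr_mono SUP_upper) auto
qed

lemma borel_measurable_ennreal_powr [measurable (raw)]:
  assumes [measurable]: "f \<in> borel_measurable M"
  shows "(\<lambda>x. ennreal_powr (f x) a) \<in> borel_measurable M"
  unfolding ennreal_powr_def by measurable

text \<open>Young's inequality for f/A and h/B, integrated. Numerical bounds A and B avoid dividing
  by the integrals themselves; if one of them is 0, the product vanishes almost everywhere.\<close>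

lemma nn_integral_Hoelder:
  fixes f h :: "'a \<Rightarrow> real"
  assumes a: "0 < a" "a < 1"
    and [measurable]: "f \<in> borel_measurable M" "h \<in> borel_measurable M"
    and nonneg: "\<And>x. 0 \<le> f x" "\<And>x. 0 \<le> h x" "0 \<le> A" "0 \<le> B"
    and A: "(\<integral>\<^sup>+x. ennreal (f x) \<partial>M) \<le> ennreal A" and B: "(\<integral>\<^sup>+x. ennreal (h x) \<partial>M) \<le> ennreal B"
  shows "(\<integral>\<^sup>+x. ennreal (f x powr a * h x powr (1 - a)) \<partial>M) \<le> ennreal (A powr a * B powr (1 - a))"
proof (cases "A = 0 \<or> B = 0")
  case True
  have "AE x in M. f x = 0 \<or> h x = 0"
  proof (cases "A = 0")
    case True
    then have "(\<integral>\<^sup>+x. ennreal (f x) \<partial>M) = 0" using A by simp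
    then have "AE x in M. ennreal (f x) = 0" by (subst (asm) nn_integral_0_iff_AE) auto
    then show ?thesis by eventually_elim (use nonneg in \<open>simp add: antisym\<close>)
  next
    case False
    then have "(\<integral>\<^sup>+x. ennreal (h x) \<partial>M) = 0" using \<open>A = 0 \<or> B = 0\<close> B by simp
    then have "AE x in M. ennreal (h x) = 0" by (subst (asm) nn_integral_0_iff_AE) auto
    then show ?thesis by eventually_elim (use nonneg in \<open>simp add: antisym\<close>)
  qed
  then have "AE x in M. ennreal (f x powr a * h x powr (1 - a)) = 0" by eventually_elim auto
  then have "(\<integral>\<^sup>+x. ennreal (f x powr a * h x powr (1 - a)) \<partial>M) = 0"
    by (subst nn_integral_0_iff_AE) auto
  then show ?thesis by simp
next
  case False
  then have pos: "0 < A" "0 < B" using nonneg(3,4) by auto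
  define K where "K = A powr a * B powr (1 - a)"
  have K: "0 < K" using pos by (simp add: K_def)
  \<comment> \<open>The weights of the pointwise Young inequality, for which
    \<open>k\<^sub>1 * A + k\<^sub>2 * B\<close> is exactly K.\<close>
  define k\<^sub>1 k\<^sub>2 where "k\<^sub>1 = K * (a / A)" and "k\<^sub>2 = K * ((1 - a) / B)"
  have c: "0 \<le> k\<^sub>1" "0 \<le> k\<^sub>2" using K a pos by (auto simp: k\<^sub>1_def k\<^sub>2_def)
  have le: "f x powr a * h x powr (1 - a) \<le> k\<^sub>1 * f x + k\<^sub>2 * h x" for x
  proof (cases "f x = 0 \<or> h x = 0")
    case True
    then have "f x powr a * h x powr (1 - a) = 0" by auto
    then show ?thesis using c nonneg(1)[of x] nonneg(2)[of x] by (simp only: add_nonneg_nonneg mult_nonneg_nonneg)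
  next
    case False
    then have fh: "0 < f x" "0 < h x" using nonneg(1)[of x] nonneg(2)[of x] by auto
    have "(f x / A) powr a * (h x / B) powr (1 - a) \<le> a * (f x / A) + (1 - a) * (h x / B)"
      using a pos fh by (intro Youngs_inequality_0) auto
    then have "K * ((f x / A) powr a * (h x / B) powr (1 - a)) \<le> K * (a * (f x / A) + (1 - a) * (h x / B))"
      using K by (intro mult_left_mono) auto
    moreover have "K * ((f x / A) powr a * (h x / B) powr (1 - a)) = f x powr a * h x powr (1 - a)"
      unfolding K_def using pos fh by (simp add: powr_divide)
    ultimately show ?thesis by (simp add: k\<^sub>1_def k\<^sub>2_def algebra_simps)
  qed
  have "(\<integral>\<^sup>+x. ennreal (f x powr a * h x powr (1 - a)) \<partial>M)
      \<le> (\<integral>\<^sup>+x. ennreal (k\<^sub>1) * ennreal (f x) + ennreal (k\<^sub>2) * ennreal (h x) \<partial>M)"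
  proof (rule nn_integral_mono)
    fix x
    have "ennreal (f x powr a * h x powr (1 - a)) \<le> ennreal (k\<^sub>1 * f x + k\<^sub>2 * h x)"
      by (rule ennreal_leI[OF le])
    also have "\<dots> = ennreal (k\<^sub>1) * ennreal (f x) + ennreal (k\<^sub>2) * ennreal (h x)"
      using c nonneg(1)[of x] nonneg(2)[of x] by (subst ennreal_plus) (auto simp: ennreal_mult)
    finally show "ennreal (f x powr a * h x powr (1 - a)) \<le> \<dots>" .
  qed
  also have "\<dots> = ennreal (k\<^sub>1) * (\<integral>\<^sup>+x. ennreal (f x) \<partial>M) + ennreal (k\<^sub>2) * (\<integral>\<^sup>+x. ennreal (h x) \<partial>M)"
    by (subst nn_integral_add) (auto simp: nn_integral_cmult)
  also have "\<dots> \<le> ennreal (k\<^sub>1) * ennreal A + ennreal (k\<^sub>2) * ennreal B"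
    by (intro add_mono mult_left_mono A B) auto
  also have "\<dots> = ennreal (k\<^sub>1 * A + k\<^sub>2 * B)"
    using c nonneg by (subst ennreal_plus) (auto simp: ennreal_mult)
  also have "k\<^sub>1 * A + k\<^sub>2 * B = K"
    using pos by (simp add: k\<^sub>1_def k\<^sub>2_def field_simps)
  finally show ?thesis by (simp add: K_def)
qed

lemma sum_Hoelder:
  fixes f h :: "'a \<Rightarrow> real"
  assumes a: "0 < a" "a < 1" and F: "finite F" and nonneg: "\<And>x. 0 \<le> f x" "\<And>x. 0 \<le> h x"
  shows "(\<Sum>x\<in>F. f x powr a * h x powr (1 - a)) \<le> (\<Sum>x\<in>F. f x) powr a * (\<Sum>x\<in>F. h x) powr (1 - a)"
proof -
  have "(\<integral>\<^sup>+x. ennreal (f x powr a * h x powr (1 - a)) \<partial>count_space F)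
      \<le> ennreal ((\<Sum>x\<in>F. f x) powr a * (\<Sum>x\<in>F. h x) powr (1 - a))"
    by (rule nn_integral_Hoelder[OF a])
       (use nonneg F in \<open>auto simp: nn_integral_count_space_finite sum_nonneg\<close>)
  then show ?thesis
    using nonneg F by (simp add: nn_integral_count_space_finite sum_nonneg)
qed

text \<open>
  Testing against simple functions suffices: they approximate the extremal weight
  \<open>\<rho>\<^sup>1\<^sup>/\<^sup>N\<close> from below.
\<close>

lemma nn_integral_powr_le_by_duality:
  fixes \<rho> :: "'a \<Rightarrow> real" and N :: nat
  assumes int: "integrable M \<rho>" and nonneg: "\<And>x. 0 \<le> \<rho> x" "0 \<le> K" and N: "1 \<le> N"
    and dual: "\<And>V :: 'a \<Rightarrow> real. V \<in> borel_measurable M \<Longrightarrow> (\<And>x. 0 \<le> V x) \<Longrightarrow> finite (range V) \<Longrightarrow>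
      integrable M (\<lambda>x. V x * \<rho> x) \<Longrightarrow> integrable M (\<lambda>x. V x ^ (N + 1)) \<Longrightarrow>
      (LINT x|M. V x * \<rho> x) \<le> K * (LINT x|M. V x ^ (N + 1)) powr (1 / (real N + 1))"
  shows "(\<integral>\<^sup>+x. ennreal (\<rho> x powr ((real N + 1) / real N)) \<partial>M) \<le> ennreal (K powr ((real N + 1) / real N))"
proof -
  have [measurable]: "\<rho> \<in> borel_measurable M" using int by auto
  define f where "f x = \<rho> x powr (1 / real N)" for x
  have f_meas: "f \<in> borel_measurable M" unfolding f_def[abs_def] by measurable
  have f0: "0 \<le> f x" for x by (simp add: f_def)
  obtain g where g: "incseq g" "\<And>i. simple_function M (g i)" "\<And>x. bdd_above (range (\<lambda>i. g i x))"
      "\<And>i x. 0 \<le> g i x" "f = (SUP i. g i)"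
    using borel_measurable_implies_simple_function_sequence_real[OF f_meas f0] by metis
  have f_eq: "f x = (SUP i. g i x)" for x unfolding g(5) by (simp add: image_comp)
  have g_le: "g i x \<le> f x" for i x unfolding f_eq by (rule cSUP_upper[OF UNIV_I g(3)])
  have g_lim: "(\<lambda>i. g i x) \<longlonglongrightarrow> f x" for x
    unfolding f_eq by (rule LIMSEQ_incseq_SUP[OF g(3)]) (use g(1) in \<open>auto simp: incseq_def le_fun_def\<close>)
  have fN: "f x ^ N = \<rho> x" for x
    using nonneg(1)[of x] N by (cases "\<rho> x = 0") (simp_all add: f_def powr_realpow[symmetric] powr_powr)
  have fN1: "f x ^ (N + 1) = \<rho> x powr ((real N + 1) / real N)" for x
  proof (cases "\<rho> x = 0")
    case False
    then have "0 < f x" using nonneg(1)[of x] by (simp add: f_def)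
    then have "f x ^ (N + 1) = f x powr (real N + 1)" using powr_realpow[of "f x" "N + 1"] by (simp add: add.commute)
    then show ?thesis using N by (simp add: f_def powr_powr)
  qed (use N in \<open>simp add: f_def\<close>)
  \<comment> \<open>The range of a simple function is finite only over the space of M; the value 0
    elsewhere makes the whole range finite.\<close>
  define V where "V i x = (if x \<in> space M then g i x else 0)" for i x
  have V_meas [measurable]: "V i \<in> borel_measurable M" for i
    using borel_measurable_simple_function[OF g(2)[of i]]
    by (rule measurable_cong[THEN iffD1, rotated]) (simp add: V_def)
  have V0: "0 \<le> V i x" for i x by (simp add: V_def g(4))
  have V_fin: "finite (range (V i))" for i
  proof (rule finite_subset)
    show "range (V i) \<subseteq> insert 0 (g i ` space M)" by (auto simp: V_def)
    show "finite (insert 0 (g i ` space M))" using simple_functionD(1)[OF g(2)[of i]] by simp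
  qed
  have V_le: "V i x \<le> f x" for i x using g_le[of i x] f0[of x] by (simp add: V_def)
  have bound: "(\<integral>\<^sup>+x. ennreal (V i x ^ (N + 1)) \<partial>M) \<le> ennreal (K powr ((real N + 1) / real N))" for i
  proof -
    obtain B where B: "\<And>x. V i x \<le> B"
      using V_fin[of i] by (meson bdd_above_finite bdd_above.unfold rangeI)
    have B0: "0 \<le> B" using V0 B order_trans by blast
    have Vr: "integrable M (\<lambda>x. V i x * \<rho> x)"
    proof (rule Bochner_Integration.integrable_bound)
      show "integrable M (\<lambda>x. B * \<rho> x)" using int by simp
      show "AE x in M. norm (V i x * \<rho> x) \<le> norm (B * \<rho> x)"
        using V0 B B0 nonneg by (intro AE_I2) (auto simp: abs_mult intro!: mult_right_mono)
    qed measurable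
    \<comment> \<open>V lies below f, and f^N = \<rho>. Testing with V therefore gives A \<le> K
      A^(1/(N+1)) for the integral A of V^(N+1); since A is finite, its power can be divided
      out.\<close>
    have le: "V i x ^ (N + 1) \<le> V i x * \<rho> x" for x
      using V0 V_le unfolding fN[symmetric] by (auto intro!: mult_left_mono power_mono)
    have VN: "integrable M (\<lambda>x. V i x ^ (N + 1))"
    proof (rule Bochner_Integration.integrable_bound[OF Vr])
      show "AE x in M. norm (V i x ^ (N + 1)) \<le> norm (V i x * \<rho> x)"
      proof (rule AE_I2)
        fix x
        show "norm (V i x ^ (N + 1)) \<le> norm (V i x * \<rho> x)"
          using le[of x] V0[of i x] nonneg(1)[of x] by (simp add: abs_mult)
      qed
    qed measurable
    define A where "A = (LINT x|M. V i x ^ (N + 1))"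
    have A0: "0 \<le> A" unfolding A_def using V0 by (intro integral_nonneg_AE AE_I2) simp
    have "A \<le> (LINT x|M. V i x * \<rho> x)" unfolding A_def by (rule integral_mono[OF VN Vr le])
    also have "\<dots> \<le> K * A powr (1 / (real N + 1))"
      unfolding A_def by (rule dual[OF V_meas V0 V_fin Vr VN])
    finally have AK: "A \<le> K * A powr (1 / (real N + 1))" .
    have "A \<le> K powr ((real N + 1) / real N)"
    proof (cases "A = 0")
      case False
      then have A: "0 < A" using A0 by simp
      define \<beta> where "\<beta> = 1 / (real N + 1)"
      have "A powr (1 - \<beta>) * A powr \<beta> \<le> K * A powr \<beta>"
        unfolding powr_add[symmetric] using AK A by (simp add: \<beta>_def)
      then have "A powr (1 - \<beta>) \<le> K" using A by simp
      then have "(A powr (1 - \<beta>)) powr ((real N + 1) / real N) \<le> K powr ((real N + 1) / real N)"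
        by (intro powr_mono2) auto
      moreover have "(1 - \<beta>) * ((real N + 1) / real N) = 1"
      proof -
        have "1 - \<beta> = real N / (real N + 1)" by (simp add: \<beta>_def field_simps)
        then show ?thesis using N by simp
      qed
      ultimately show ?thesis using A by (simp only: powr_powr powr_one)
    qed simp
    then show ?thesis
      unfolding A_def by (subst nn_integral_eq_integral[OF VN]) (use V0 in \<open>auto intro: ennreal_leI\<close>)
  qed
  have "(\<integral>\<^sup>+x. ennreal (\<rho> x powr ((real N + 1) / real N)) \<partial>M) = (\<integral>\<^sup>+x. liminf (\<lambda>i. ennreal (V i x ^ (N + 1))) \<partial>M)"
  proof (rule nn_integral_cong)
    fix x assume x: "x \<in> space M"
    have "(\<lambda>i. V i x) \<longlonglongrightarrow> f x" using g_lim[of x] x by (simp add: V_def)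
    then have "(\<lambda>i. ennreal (V i x ^ (N + 1))) \<longlonglongrightarrow> ennreal (f x ^ (N + 1))"
      by (intro tendsto_ennrealI tendsto_power)
    then show "ennreal (\<rho> x powr ((real N + 1) / real N)) = liminf (\<lambda>i. ennreal (V i x ^ (N + 1)))"
      unfolding fN1[symmetric] by (rule lim_imp_Liminf[symmetric, OF sequentially_bot])
  qed
  also have "\<dots> \<le> liminf (\<lambda>i. \<integral>\<^sup>+x. ennreal (V i x ^ (N + 1)) \<partial>M)"
    by (rule nn_integral_liminf) measurable
  also have "\<dots> \<le> liminf (\<lambda>i. ennreal (K powr ((real N + 1) / real N)))"
    using bound by (intro Liminf_mono always_eventually) simp
  also have "\<dots> = ennreal (K powr ((real N + 1) / real N))"
    by (rule lim_imp_Liminf) (simp_all)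
  finally show ?thesis .
qed

text \<open>The constant of the locale at c = 2 pi and \<kappa> = (2 pi)^(-n). As s does not occur
  in it, it survives the limit s to 1.\<close>

definition strichartz_constant :: "'n itself \<Rightarrow> real" where
  "strichartz_constant _ = dispersive_system.interpolation_constant ((1 / (2 * pi)) ^ CARD('n)) (2 * pi) CARD('n)"

lemma damped_integrable:
  fixes a :: "(nat ^ 'n) \<times> (nat ^ 'n) \<Rightarrow> complex"
  assumes s: "0 < s" "s < 1" and a: "(\<lambda>p. (cmod (a p))\<^sup>2) summable_on UNIV"
  shows "integrable space_time (\<lambda>x. (cmod (damped s a x))\<^sup>2)"
proof (rule integrableI_bounded)
  have m [measurable]: "damped s a \<in> borel_measurable space_time"
    by (rule measurable_space_time[OF damped_measurable[OF s a]])
  show "(\<lambda>x. (cmod (damped s a x))\<^sup>2) \<in> borel_measurable space_time" by measurable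
  have meas: "(\<lambda>x. ennreal ((cmod (damped s a x))\<^sup>2)) \<in> borel_measurable (circle_measure \<Otimes>\<^sub>M lborel)"
    unfolding space_time_def[symmetric] by measurable
  have "(\<integral>\<^sup>+x. ennreal ((cmod (damped s a x))\<^sup>2) \<partial>space_time)
      = (\<integral>\<^sup>+t. (\<integral>\<^sup>+z. ennreal ((cmod (damped s a (t, z)))\<^sup>2) \<partial>lborel) \<partial>circle_measure)"
    unfolding space_time_def by (rule lborel.nn_integral_fst[symmetric, OF meas])
  also have "\<dots> \<le> (\<integral>\<^sup>+t. ennreal (\<Sum>\<^sub>\<infinity>p. (cmod (a p))\<^sup>2) \<partial>circle_measure)"
    by (intro nn_integral_mono damped_energy_le[OF s a])
  also have "\<dots> < \<infinity>"
    using circle.emeasure_finite[of "space circle_measure"]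
    by (simp add: less_top[symmetric] ennreal_mult_eq_top_iff del: space_circle_measure)
  finally show "(\<integral>\<^sup>+x. ennreal (norm ((cmod (damped s a x))\<^sup>2)) \<partial>space_time) < \<infinity>" by simp
qed

text \<open>For the density of a damped system, \<open>energy_bound\<close> is the hypothesis of
  \<open>nn_integral_powr_le_by_duality\<close>.\<close>

lemma damped_endpoint_bound:
  fixes u :: "nat \<Rightarrow> complex ^ 'n \<Rightarrow> complex"
  defines "N \<equiv> real CARD('n)"
  defines "\<alpha> \<equiv> 2 * (N + 1) / (2 * N + 1)"
  assumes s: "0 < s" "s < 1" and J: "finite J" and u: "L2_orthonormal J u" and b: "\<And>j. j \<in> J \<Longrightarrow> 0 \<le> b j"
  shows "(\<integral>\<^sup>+x. ennreal ((\<Sum>j\<in>J. b j * (cmod (damped s (coeff (u j)) x))\<^sup>2) powr ((N + 1) / N)) \<partial>space_time)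
    \<le> ennreal ((strichartz_constant TYPE('n) * (\<Sum>j\<in>J. b j powr \<alpha>) powr (1 / \<alpha>)) powr ((N + 1) / N))"
proof -
  interpret D: dispersive_system "space_time :: (real \<times> (complex ^ 'n)) measure" wave modulation "damping s" s
      "(1 / (2 * pi)) ^ CARD('n)" "(1 / (2 * pi)) ^ CARD('n) / (1 - s) ^ CARD('n)" "2 * pi" "CARD('n)"
    by (rule special_hermite_dispersive_system[OF s])
  have synth: "D.synth a = damped s a" for a by (simp add: D.synth_def[abs_def] damped_def[abs_def])
  have C: "D.interpolation_constant = strichartz_constant TYPE('n)" by (simp add: strichartz_constant_def)
  have C0: "0 \<le> strichartz_constant TYPE('n)"
    unfolding C[symmetric] D.interpolation_constant_def by (simp add: add_nonneg_nonneg)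
  let ?b = "\<lambda>j. if j \<in> J then b j else 0"
  have int: "integrable space_time (\<lambda>x. (cmod (damped s (coeff (u j)) x))\<^sup>2)" if "j \<in> J" for j
    using u that by (intro damped_integrable[OF s] coeff_Bessel(1)) (auto simp: L2_orthonormal_def)
  have "(\<integral>\<^sup>+x. ennreal ((\<Sum>j\<in>J. ?b j * (cmod (damped s (coeff (u j)) x))\<^sup>2) powr ((real CARD('n) + 1) / real CARD('n))) \<partial>space_time)
    \<le> ennreal ((strichartz_constant TYPE('n) * (\<Sum>j\<in>J. ?b j powr \<alpha>) powr (1 / \<alpha>)) powr ((real CARD('n) + 1) / real CARD('n)))"
  proof (rule nn_integral_powr_le_by_duality)
    show "integrable space_time (\<lambda>x. \<Sum>j\<in>J. ?b j * (cmod (damped s (coeff (u j)) x))\<^sup>2)"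
      using int by (intro Bochner_Integration.integrable_sum integrable_mult_right) auto
    show "0 \<le> (\<Sum>j\<in>J. ?b j * (cmod (damped s (coeff (u j)) x))\<^sup>2)" for x
      using b by (intro sum_nonneg mult_nonneg_nonneg) auto
    show "0 \<le> strichartz_constant TYPE('n) * (\<Sum>j\<in>J. ?b j powr \<alpha>) powr (1 / \<alpha>)" using C0 by simp
    show "1 \<le> CARD('n)" by (rule D.N_pos)
    fix V :: "real \<times> (complex ^ 'n) \<Rightarrow> real"
    assume V: "V \<in> borel_measurable space_time" "\<And>x. 0 \<le> V x" "finite (range V)" "integrable space_time (\<lambda>x. V x ^ (CARD('n) + 1))"
    obtain B where B: "\<And>x. V x \<le> B"
      using V(3) by (meson bdd_above_finite bdd_above.unfold rangeI)
    have Vint: "integrable space_time (\<lambda>x. V x * (cmod (damped s (coeff (u j)) x))\<^sup>2)" if "j \<in> J" for j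
    proof (rule Bochner_Integration.integrable_bound)
      show "integrable space_time (\<lambda>x. B * (cmod (damped s (coeff (u j)) x))\<^sup>2)" using int[OF that] by simp
      have "0 \<le> B" using V(2) B order_trans by blast
      then show "AE x in space_time. norm (V x * (cmod (damped s (coeff (u j)) x))\<^sup>2) \<le> norm (B * (cmod (damped s (coeff (u j)) x))\<^sup>2)"
        using V(2) B by (intro AE_I2) (auto simp: abs_mult intro!: mult_right_mono)
      show "(\<lambda>x. V x * (cmod (damped s (coeff (u j)) x))\<^sup>2) \<in> borel_measurable space_time"
        by (intro borel_measurable_times V(1) borel_measurable_integrable[OF int[OF that]])
    qed
    have "(LINT x|space_time. V x * (\<Sum>j\<in>J. ?b j * (cmod (D.synth (coeff (u j)) x))\<^sup>2))
      \<le> D.interpolation_constant * (\<Sum>j\<in>J. ?b j powr (2 * (real CARD('n) + 1) / (2 * real CARD('n) + 1))) powr (1 / (2 * (real CARD('n) + 1) / (2 * real CARD('n) + 1)))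
         * (LINT x|space_time. V x ^ (CARD('n) + 1)) powr (1 / (real CARD('n) + 1))"
    proof (rule D.energy_bound[OF J])
      show "(\<lambda>p. (cmod (\<Sum>j\<in>J. q j * coeff (u j) p))\<^sup>2) summable_on UNIV"
        "(\<Sum>\<^sub>\<infinity>p. (cmod (\<Sum>j\<in>J. q j * coeff (u j) p))\<^sup>2) \<le> (\<Sum>j\<in>J. (cmod (q j))\<^sup>2)" for q
        by (rule coeff_orthonormal_Bessel[OF J u])+
    qed (use b V Vint in \<open>auto simp: synth\<close>)
    then show "(LINT x|space_time. V x * (\<Sum>j\<in>J. ?b j * (cmod (damped s (coeff (u j)) x))\<^sup>2))
      \<le> strichartz_constant TYPE('n) * (\<Sum>j\<in>J. ?b j powr \<alpha>) powr (1 / \<alpha>)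
         * (LINT x|space_time. V x ^ (CARD('n) + 1)) powr (1 / (real CARD('n) + 1))"
      unfolding synth C \<alpha>_def N_def .
  qed
  moreover have "(\<Sum>j\<in>J. ?b j * (cmod (damped s (coeff (u j)) x))\<^sup>2) = (\<Sum>j\<in>J. b j * (cmod (damped s (coeff (u j)) x))\<^sup>2)" for x
    by (rule sum.cong) auto
  moreover have "(\<Sum>j\<in>J. ?b j powr \<alpha>) = (\<Sum>j\<in>J. b j powr \<alpha>)" by (rule sum.cong) auto
  ultimately show ?thesis unfolding N_def by simp
qed

text \<open>At stage m only the finitely many indices below m have to obey the rate, so one damping
  parameter close to 1 serves them all; the index j is then controlled from stage j + 1 on.\<close>

lemma exists_damping_sequence:
  fixes a :: "nat \<Rightarrow> (nat ^ 'n) \<times> (nat ^ 'n) \<Rightarrow> complex"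
  assumes a: "\<And>j. j \<in> J \<Longrightarrow> (\<lambda>p. (cmod (a j p))\<^sup>2) summable_on UNIV"
  obtains s :: "nat \<Rightarrow> real" where "\<And>m. 0 < s m" "\<And>m. s m < 1"
    "\<And>j m. j \<in> J \<Longrightarrow> j < m \<Longrightarrow> damping_defect (s m) (a j) \<le> (1 / 4) ^ m"
proof -
  have "\<exists>r::real. 0 < r \<and> r < 1 \<and> (\<forall>j\<in>J \<inter> {..<m}. damping_defect r (a j) \<le> (1 / 4) ^ m)" for m :: nat
  proof -
    have "\<forall>\<^sub>F r in at_left (1::real). 0 < r \<and> r < 1"
      using eventually_at_left_real[of 0 1] by (simp add: greaterThanLessThan_def conj_commute)
    moreover have "\<forall>\<^sub>F r in at_left (1::real). \<forall>j\<in>J \<inter> {..<m}. damping_defect r (a j) \<le> (1 / 4) ^ m"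
    proof (intro eventually_ball_finite ballI)
      fix j assume "j \<in> J \<inter> {..<m}"
      then have "((\<lambda>r. damping_defect r (a j)) \<longlongrightarrow> 0) (at_left 1)"
        by (intro damping_defect_tendsto a) simp
      then have "\<forall>\<^sub>F r in at_left (1::real). damping_defect r (a j) < (1 / 4) ^ m"
        by (rule order_tendstoD) simp
      then show "\<forall>\<^sub>F r in at_left (1::real). damping_defect r (a j) \<le> (1 / 4) ^ m"
        by (rule eventually_mono) simp
    qed simp
    ultimately have "\<forall>\<^sub>F r in at_left (1::real). 0 < r \<and> r < 1 \<and> (\<forall>j\<in>J \<inter> {..<m}. damping_defect r (a j) \<le> (1 / 4) ^ m)"
      by eventually_elim simp
    then show ?thesis by (rule eventually_happens'[rotated]) simp
  qed
  then obtain s where "\<And>m. 0 < s m \<and> s m < 1 \<and> (\<forall>j\<in>J \<inter> {..<m}. damping_defect (s m) (a j) \<le> (1 / 4) ^ m)"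
    by metis
  then show thesis by (intro that[of s]) auto
qed

text \<open>The propagator is chosen for each t separately and thus carries no measurability in t. G
  is a jointly Borel measurable version, the limit of damped solutions along one sequence of
  parameters for all j, and it inherits both estimates through Fatou's lemma.\<close>

lemma propagator_representative:
  fixes u :: "nat \<Rightarrow> complex ^ 'n \<Rightarrow> complex"
  defines "N \<equiv> real CARD('n)"
  defines "\<alpha> \<equiv> 2 * (N + 1) / (2 * N + 1)"
  assumes u: "L2_orthonormal J u"
  obtains G :: "nat \<Rightarrow> real \<times> (complex ^ 'n) \<Rightarrow> complex"
  where "\<And>j. j \<in> J \<Longrightarrow> G j \<in> borel_measurable borel"
    and "\<And>j t. j \<in> J \<Longrightarrow> AE z in lebesgue. special_hermite_propagator t (u j) z = G j (t, z)"
    and "\<And>F b t. finite F \<Longrightarrow> F \<subseteq> J \<Longrightarrow> (\<And>j. 0 \<le> b j) \<Longrightarrow>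
      (\<integral>\<^sup>+z. ennreal (\<Sum>j\<in>F. b j * (cmod (G j (t, z)))\<^sup>2) \<partial>lborel) \<le> ennreal (\<Sum>j\<in>F. b j)"
    and "\<And>F b. finite F \<Longrightarrow> F \<subseteq> J \<Longrightarrow> (\<And>j. 0 \<le> b j) \<Longrightarrow>
      (\<integral>\<^sup>+t. (\<integral>\<^sup>+z. ennreal ((\<Sum>j\<in>F. b j * (cmod (G j (t, z)))\<^sup>2) powr ((N + 1) / N)) \<partial>lborel) \<partial>circle_measure)
        \<le> ennreal ((strichartz_constant TYPE('n) * (\<Sum>j\<in>F. b j powr \<alpha>) powr (1 / \<alpha>)) powr ((N + 1) / N))"
proof -
  have uL2: "u j \<in> L2_space" if "j \<in> J" for j using u that by (auto simp: L2_orthonormal_def)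
  have a: "(\<lambda>p. (cmod (coeff (u j) p))\<^sup>2) summable_on UNIV" if "j \<in> J" for j
    by (rule coeff_Bessel(1)[OF uL2[OF that]])
  have a1: "(\<Sum>\<^sub>\<infinity>p. (cmod (coeff (u j) p))\<^sup>2) \<le> 1" if "j \<in> J" for j
  proof -
    have "of_real (sqnorm_L2 lebesgue (u j)) = (1 :: complex)"
      using u that by (simp add: inner_L2_self[symmetric] L2_inner_eq[symmetric] L2_orthonormal_def)
    then show ?thesis using coeff_Bessel(2)[OF uL2[OF that]] by simp
  qed
  obtain s where s: "\<And>m. 0 < s m" "\<And>m. s m < 1"
    and rate: "\<And>j m. j \<in> J \<Longrightarrow> j < m \<Longrightarrow> damping_defect (s m) (coeff (u j)) \<le> (1 / 4) ^ m"
    using exists_damping_sequence[of J "\<lambda>j. coeff (u j)"] a by blast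
  define d where "d m j x = damped (s m) (coeff (u j)) x" for m j x
  \<comment> \<open>Where the sequence diverges, \<open>lim\<close> is an unspecified value; on
    every time slice this happens on a null set only.\<close>
  define G where "G j x = lim (\<lambda>m. d m j x)" for j x
  have d_meas: "d m j \<in> borel_measurable borel" if "j \<in> J" for m j
    unfolding d_def[abs_def] by (rule damped_measurable[OF s a[OF that]])
  have G_meas: "G j \<in> borel_measurable borel" if "j \<in> J" for j
    unfolding G_def[abs_def] by (rule borel_measurable_lim_metric) (rule d_meas[OF that])
  have d_sec: "(\<lambda>z. d m j (t, z)) \<in> borel_measurable borel" if "j \<in> J" for m j t
    by (rule measurable_compose[OF _ d_meas[OF that]]) simp
  have G_sec: "(\<lambda>z. G j (t, z)) \<in> borel_measurable borel" if "j \<in> J" for j t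
    by (rule measurable_compose[OF _ G_meas[OF that]]) simp
  have conv: "AE z in lborel. (\<lambda>m. d m j (t, z)) \<longlonglongrightarrow> G j (t, z)" if "j \<in> J" for j t
  proof -
    have "AE z in lborel. convergent (\<lambda>m. d m j (t, z))"
      unfolding d_def
      by (rule damped_AE_convergent[of s _ "Suc j", OF s a[OF that]]) (use rate[OF that] in simp)
    then show ?thesis by eventually_elim (simp add: G_def convergent_LIMSEQ_iff)
  qed
  have eq: "AE z in lebesgue. special_hermite_propagator t (u j) z = G j (t, z)" if "j \<in> J" for j t
  proof -
    have "AE z in lebesgue. (\<lambda>m. d m j (t, z)) \<longlonglongrightarrow> special_hermite_propagator t (u j) z"
      unfolding d_def
      by (rule special_hermite_propagator_AE_eq[of _ s "Suc j", OF uL2[OF that] s]) (use rate[OF that] in simp)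
    then show ?thesis using AE_completion[OF conv[OF that, of t]]
      by eventually_elim (rule LIMSEQ_unique)
  qed
  have fatou: "(\<integral>\<^sup>+z. ennreal ((\<Sum>j\<in>F. b j * (cmod (G j (t, z)))\<^sup>2) powr r) \<partial>lborel)
      \<le> liminf (\<lambda>m. \<integral>\<^sup>+z. ennreal ((\<Sum>j\<in>F. b j * (cmod (d m j (t, z)))\<^sup>2) powr r) \<partial>lborel)"
    if F: "finite F" "F \<subseteq> J" and b: "\<And>j. 0 \<le> b j" and r: "0 < r" for F b t r
  proof -
    have "AE z in lborel. \<forall>j\<in>F. (\<lambda>m. d m j (t, z)) \<longlonglongrightarrow> G j (t, z)"
      using F conv by (intro AE_finite_allI) auto
    then have "AE z in lborel. ennreal ((\<Sum>j\<in>F. b j * (cmod (G j (t, z)))\<^sup>2) powr r)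
        = liminf (\<lambda>m. ennreal ((\<Sum>j\<in>F. b j * (cmod (d m j (t, z)))\<^sup>2) powr r))"
    proof eventually_elim
      case (elim z)
      have "(\<lambda>m. (\<Sum>j\<in>F. b j * (cmod (d m j (t, z)))\<^sup>2) powr r) \<longlonglongrightarrow> (\<Sum>j\<in>F. b j * (cmod (G j (t, z)))\<^sup>2) powr r"
        using elim r b
        by (intro tendsto_powr' tendsto_sum tendsto_mult tendsto_const tendsto_power tendsto_norm)
           (auto intro!: always_eventually sum_nonneg mult_nonneg_nonneg)
      then show ?case by (intro lim_imp_Liminf[symmetric, OF sequentially_bot] tendsto_ennrealI)
    qed
    then have "(\<integral>\<^sup>+z. ennreal ((\<Sum>j\<in>F. b j * (cmod (G j (t, z)))\<^sup>2) powr r) \<partial>lborel)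
      = (\<integral>\<^sup>+z. liminf (\<lambda>m. ennreal ((\<Sum>j\<in>F. b j * (cmod (d m j (t, z)))\<^sup>2) powr r)) \<partial>lborel)"
      by (rule nn_integral_cong_AE)
    also have "\<dots> \<le> liminf (\<lambda>m. \<integral>\<^sup>+z. ennreal ((\<Sum>j\<in>F. b j * (cmod (d m j (t, z)))\<^sup>2) powr r) \<partial>lborel)"
    proof (rule nn_integral_liminf)
      show "(\<lambda>z. ennreal ((\<Sum>j\<in>F. b j * (cmod (d m j (t, z)))\<^sup>2) powr r)) \<in> borel_measurable lborel" for m
        using F(2) d_sec
        by (intro measurable_compose[OF _ measurable_ennreal] powr_real_measurable borel_measurable_sum borel_measurable_times
            borel_measurable_power borel_measurable_norm borel_measurable_const) auto
    qed
    finally show ?thesis .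
  qed
  have energy: "(\<integral>\<^sup>+z. ennreal (\<Sum>j\<in>F. b j * (cmod (G j (t, z)))\<^sup>2) \<partial>lborel) \<le> ennreal (\<Sum>j\<in>F. b j)"
    if F: "finite F" "F \<subseteq> J" and b: "\<And>j. 0 \<le> b j" for F b t
  proof -
    have "(\<integral>\<^sup>+z. ennreal (\<Sum>j\<in>F. b j * (cmod (d m j (t, z)))\<^sup>2) \<partial>lborel) \<le> ennreal (\<Sum>j\<in>F. b j)" for m
    proof -
      have "(\<integral>\<^sup>+z. ennreal (\<Sum>j\<in>F. b j * (cmod (d m j (t, z)))\<^sup>2) \<partial>lborel)
          = (\<integral>\<^sup>+z. (\<Sum>j\<in>F. ennreal (b j) * ennreal ((cmod (d m j (t, z)))\<^sup>2)) \<partial>lborel)"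
        by (intro nn_integral_cong) (simp add: sum_ennreal[symmetric] b ennreal_mult)
      also have "\<dots> = (\<Sum>j\<in>F. \<integral>\<^sup>+z. ennreal (b j) * ennreal ((cmod (d m j (t, z)))\<^sup>2) \<partial>lborel)"
      proof (rule nn_integral_sum)
        fix j assume "j \<in> F"
        then have [measurable]: "(\<lambda>z. d m j (t, z)) \<in> borel_measurable borel" using F(2) d_sec by auto
        show "(\<lambda>z. ennreal (b j) * ennreal ((cmod (d m j (t, z)))\<^sup>2)) \<in> borel_measurable lborel" by measurable
      qed
      also have "\<dots> \<le> (\<Sum>j\<in>F. ennreal (b j))"
      proof (rule sum_mono)
        fix j assume "j \<in> F"
        then have j: "j \<in> J" using F(2) by auto
        have [measurable]: "(\<lambda>z. d m j (t, z)) \<in> borel_measurable borel" by (rule d_sec[OF j])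
        have "(\<integral>\<^sup>+z. ennreal ((cmod (d m j (t, z)))\<^sup>2) \<partial>lborel) \<le> ennreal 1"
          using damped_energy_le[OF s a[OF j]] a1[OF j] ennreal_leI order_trans unfolding d_def by blast
        then have "ennreal (b j) * (\<integral>\<^sup>+z. ennreal ((cmod (d m j (t, z)))\<^sup>2) \<partial>lborel) \<le> ennreal (b j) * ennreal 1"
          by (intro mult_left_mono) auto
        then show "(\<integral>\<^sup>+z. ennreal (b j) * ennreal ((cmod (d m j (t, z)))\<^sup>2) \<partial>lborel) \<le> ennreal (b j)"
          by (subst nn_integral_cmult) auto
      qed
      also have "\<dots> = ennreal (\<Sum>j\<in>F. b j)" using b by (simp add: sum_ennreal)
      finally show ?thesis .
    qed
    then have "liminf (\<lambda>m. \<integral>\<^sup>+z. ennreal (\<Sum>j\<in>F. b j * (cmod (d m j (t, z)))\<^sup>2) \<partial>lborel) \<le> liminf (\<lambda>m::nat. ennreal (\<Sum>j\<in>F. b j))"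
      by (intro Liminf_mono always_eventually) simp
    moreover have "liminf (\<lambda>m::nat. ennreal (\<Sum>j\<in>F. b j)) = ennreal (\<Sum>j\<in>F. b j)"
      by (rule lim_imp_Liminf) simp_all
    moreover have "x powr 1 = x" if "x = (\<Sum>j\<in>F. b j * (cmod (y j))\<^sup>2)" for x and y :: "nat \<Rightarrow> complex"
      using that b by (simp add: sum_nonneg)
    ultimately show ?thesis using fatou[where F=F and b=b and t=t and r=1, OF F b zero_less_one] by (simp add: sum_nonneg b)
  qed
  have endpoint: "(\<integral>\<^sup>+t. (\<integral>\<^sup>+z. ennreal ((\<Sum>j\<in>F. b j * (cmod (G j (t, z)))\<^sup>2) powr ((N + 1) / N)) \<partial>lborel) \<partial>circle_measure)
        \<le> ennreal ((strichartz_constant TYPE('n) * (\<Sum>j\<in>F. b j powr \<alpha>) powr (1 / \<alpha>)) powr ((N + 1) / N))" (is "_ \<le> ?R")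
    if F: "finite F" "F \<subseteq> J" and b: "\<And>j. 0 \<le> b j" for F b
  proof -
    let ?f = "\<lambda>m x. ennreal ((\<Sum>j\<in>F. b j * (cmod (d m j x))\<^sup>2) powr ((N + 1) / N))"
    have f: "?f m \<in> borel_measurable (circle_measure \<Otimes>\<^sub>M lborel)" for m
      unfolding space_time_def[symmetric] using F(2) d_meas
      by (intro measurable_space_time measurable_compose[OF _ measurable_ennreal] powr_real_measurable borel_measurable_sum borel_measurable_times
            borel_measurable_power borel_measurable_norm borel_measurable_const) auto
    have orth: "L2_orthonormal F u" using u F(2) by (auto simp: L2_orthonormal_def subset_iff)
    have "0 < (N + 1) / N" by (simp add: N_def add_pos_pos)
    then have "(\<integral>\<^sup>+t. (\<integral>\<^sup>+z. ennreal ((\<Sum>j\<in>F. b j * (cmod (G j (t, z)))\<^sup>2) powr ((N + 1) / N)) \<partial>lborel) \<partial>circle_measure)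
      \<le> (\<integral>\<^sup>+t. liminf (\<lambda>m. \<integral>\<^sup>+z. ?f m (t, z) \<partial>lborel) \<partial>circle_measure)"
      by (intro nn_integral_mono fatou[OF F b])
    also have "\<dots> \<le> liminf (\<lambda>m. \<integral>\<^sup>+t. (\<integral>\<^sup>+z. ?f m (t, z) \<partial>lborel) \<partial>circle_measure)"
      by (rule nn_integral_liminf) (rule lborel.borel_measurable_nn_integral_fst[OF f])
    also have "\<dots> = liminf (\<lambda>m. \<integral>\<^sup>+x. ?f m x \<partial>space_time)"
      unfolding space_time_def by (simp only: lborel.nn_integral_fst[OF f])
    also have "\<dots> \<le> liminf (\<lambda>m::nat. ?R)"
      unfolding d_def N_def \<alpha>_def
      by (intro Liminf_mono always_eventually allI damped_endpoint_bound s orth F(1) b)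
    also have "\<dots> = ?R" by (rule lim_imp_Liminf) simp_all
    finally show ?thesis .
  qed
  show thesis by (rule that[OF G_meas eq energy endpoint])
qed

text \<open>The number \<theta> is determined by 1/q = (1 - \<theta>) + \<theta> N/(N+1). At each
  time Hoelder's inequality interpolates between the energy bound, which is uniform in t, and the
  endpoint integral. The exponent p is the one for which the endpoint integral of the slice appears
  to the power 1, so integrating in time reproduces the endpoint estimate.\<close>

lemma mixed_interpolation:
  fixes g :: "'j \<Rightarrow> 'a \<times> 'b \<Rightarrow> real" and q N C :: real
  defines "\<theta> \<equiv> (N + 1) * (1 - 1 / q)" and "p \<equiv> 1 / (N - N / q)" and "\<alpha> \<equiv> 2 * q / (q + 1)"
    and "\<alpha>\<^sub>1 \<equiv> 2 * (N + 1) / (2 * N + 1)" and "q\<^sub>1 \<equiv> (N + 1) / N"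
  assumes Z: "sigma_finite_measure Z" and F: "finite F" and N: "1 \<le> N" and q: "1 < q" "q \<le> 1 + 1 / N" and C: "0 < C"
    and g: "\<And>j. j \<in> F \<Longrightarrow> g j \<in> borel_measurable (T \<Otimes>\<^sub>M Z)" "\<And>j x. 0 \<le> g j x"
    and energy: "\<And>b t. (\<And>j. 0 \<le> b j) \<Longrightarrow> t \<in> space T \<Longrightarrow>
      (\<integral>\<^sup>+z. ennreal (\<Sum>j\<in>F. b j * g j (t, z)) \<partial>Z) \<le> ennreal (\<Sum>j\<in>F. b j)"
    and endpoint: "\<And>b. (\<And>j. 0 \<le> b j) \<Longrightarrow>
      (\<integral>\<^sup>+t. (\<integral>\<^sup>+z. ennreal ((\<Sum>j\<in>F. b j * g j (t, z)) powr q\<^sub>1) \<partial>Z) \<partial>T)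
        \<le> ennreal ((C * (\<Sum>j\<in>F. b j powr \<alpha>\<^sub>1) powr (1 / \<alpha>\<^sub>1)) powr q\<^sub>1)"
    and b: "\<And>j. 0 \<le> b j"
  shows "(\<integral>\<^sup>+t. ennreal_powr (\<integral>\<^sup>+z. ennreal ((\<Sum>j\<in>F. b j * g j (t, z)) powr q) \<partial>Z) (p / q) \<partial>T)
    \<le> ennreal ((C powr \<theta> * (\<Sum>j\<in>F. b j powr \<alpha>) powr (1 / \<alpha>)) powr p)"
proof -
  interpret Z: sigma_finite_measure Z by (rule Z)
  have q_le: "N * (q - 1) \<le> 1" using q N by (simp add: field_simps)
  have \<theta>: "0 < \<theta>" "\<theta> \<le> 1"
  proof -
    show "0 < \<theta>" using q N by (simp add: \<theta>_def)
    have "(N + 1) * (q - 1) \<le> 1 * q" using q_le by (simp add: algebra_simps)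
    moreover have "\<theta> = (N + 1) * (q - 1) / q" using q by (simp add: \<theta>_def field_simps)
    ultimately show "\<theta> \<le> 1" using q by (simp add: pos_divide_le_eq)
  qed
  have p0: "0 < p" using q N by (simp add: p_def field_simps)
  have \<alpha>0: "0 < \<alpha>" "0 < \<alpha>\<^sub>1" "0 < q\<^sub>1" using q N by (auto simp: \<alpha>_def \<alpha>\<^sub>1_def q\<^sub>1_def intro!: divide_pos_pos)
  have \<theta>p: "\<theta> * p = q\<^sub>1" using q N unfolding \<theta>_def p_def q\<^sub>1_def by (simp add: divide_simps) (simp add: algebra_simps)
  have inv: "1 / \<alpha> = (1 - \<theta>) + \<theta> / \<alpha>\<^sub>1"
    using q N unfolding \<theta>_def \<alpha>_def \<alpha>\<^sub>1_def by (simp add: divide_simps) (simp add: algebra_simps)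
  define B where "B = (\<Sum>j\<in>F. b j powr \<alpha>)"
  have B0: "0 \<le> B" unfolding B_def by (intro sum_nonneg) simp
  show ?thesis
  proof (cases "\<theta> = 1")
    case True
    have pq: "p = q\<^sub>1" using \<theta>p True by simp
    have "1 - 1 / q = 1 / (N + 1)" using True N by (simp add: \<theta>_def field_simps)
    then have "1 / q = N / (N + 1)" using N by (simp add: field_simps)
    then have qq: "q = q\<^sub>1" using q N by (simp add: q\<^sub>1_def field_simps)
    have \<alpha>\<alpha>: "\<alpha> = \<alpha>\<^sub>1" using inv True \<alpha>0 by (simp add: field_simps)
    have "p / q = 1" using pq qq q by simp
    then show ?thesis
      unfolding ennreal_powr_1 \<open>p / q = 1\<close> \<alpha>\<alpha> True
      using endpoint[of b, OF b] C unfolding qq[symmetric] pq by (simp add: qq[symmetric] )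
  next
    case False
    then have \<theta>1: "0 < 1 - \<theta>" "1 - \<theta> < 1" using \<theta> by auto
    show ?thesis
    proof (cases "B = 0")
      case True
      then have "b j = 0" if "j \<in> F" for j
        using that F by (auto simp: B_def sum_nonneg_eq_0_iff)
      then have "(\<Sum>j\<in>F. b j * g j (t, z)) powr q = 0" for t z by simp
      then show ?thesis by (simp add: ennreal_powr_0)
    next
      case False
      then have B: "0 < B" using B0 by simp
      \<comment> \<open>The share of the energy density in R^q. After raising to the power p/q, the
        complementary share 1 - a becomes 1.\<close>
      define a where "a = (1 - \<theta>) * q"
      have a1: "1 - a = N * (q - 1)" using q unfolding a_def \<theta>_def by (simp add: field_simps)
      have a: "0 < a" "a < 1"
      proof -
        show "0 < a" using \<theta>1 q by (simp add: a_def)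
        have "0 < N * (q - 1)" using q N by simp
        then show "a < 1" using a1 by linarith
      qed
      have a\<theta>: "q\<^sub>1 * (1 - a) = \<theta> * q"
        using q N unfolding a1 q\<^sub>1_def \<theta>_def by (simp add: field_simps)
      have ap: "(1 - a) * (p / q) = 1" using q N unfolding a1 p_def by (simp add: field_simps)
      have ap': "a * (p / q) = (1 - \<theta>) * p" using q by (simp add: a_def)
      \<comment> \<open>The split b = b0^(1-\<theta>) b1^\<theta> for which the sum of b0 and the
        sum of \<open>b1 j powr \<alpha>\<^sub>1\<close> are both equal to B, so that each of the
        two estimates is fed with its own norm.\<close>
      define b0 b1 where "b0 j = b j powr \<alpha>" and "b1 j = b j powr (\<alpha> / \<alpha>\<^sub>1)" for j
      define R R0 R1 where "R x = (\<Sum>j\<in>F. b j * g j x)" and "R0 x = (\<Sum>j\<in>F. b0 j * g j x)"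
        and "R1 x = (\<Sum>j\<in>F. b1 j * g j x)" for x
      have nonneg: "0 \<le> R x" "0 \<le> R0 x" "0 \<le> R1 x" for x
        unfolding R_def R0_def R1_def b0_def b1_def by (intro sum_nonneg mult_nonneg_nonneg b g(2) powr_ge_zero)+
      have meas [measurable]: "R0 \<in> borel_measurable (T \<Otimes>\<^sub>M Z)" "R1 \<in> borel_measurable (T \<Otimes>\<^sub>M Z)"
        unfolding R0_def[abs_def] R1_def[abs_def]
        by (intro borel_measurable_sum borel_measurable_times borel_measurable_const g(1); assumption)+
      have split: "b j * y = (b0 j * y) powr (1 - \<theta>) * (b1 j * y) powr \<theta>" if "0 \<le> y" for j y
      proof -
        have "b j powr (\<alpha> * (1 - \<theta>)) * b j powr (\<alpha> / \<alpha>\<^sub>1 * \<theta>) = b j powr (\<alpha> * ((1 - \<theta>) + \<theta> / \<alpha>\<^sub>1))"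
          by (simp add: powr_add[symmetric] algebra_simps)
        also have "\<dots> = b j" unfolding inv[symmetric] using \<alpha>0 b by simp
        finally have "b0 j powr (1 - \<theta>) * b1 j powr \<theta> = b j" by (simp add: b0_def b1_def powr_powr)
        moreover have "y powr (1 - \<theta>) * y powr \<theta> = y" using that by (simp add: powr_add[symmetric])
        moreover have "0 \<le> b0 j" "0 \<le> b1 j" by (auto simp: b0_def b1_def)
        ultimately show ?thesis using that by (simp add: powr_mult) (metis mult.assoc mult.left_commute)
      qed
      have R_le: "R x powr q \<le> R0 x powr a * (R1 x powr q\<^sub>1) powr (1 - a)" for x
      proof -
        have "R x = (\<Sum>j\<in>F. (b0 j * g j x) powr (1 - \<theta>) * (b1 j * g j x) powr (1 - (1 - \<theta>)))"
          unfolding R_def by (intro sum.cong refl) (use split[OF g(2)] in simp)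
        also have "\<dots> \<le> R0 x powr (1 - \<theta>) * R1 x powr (1 - (1 - \<theta>))"
          unfolding R0_def R1_def
          by (rule sum_Hoelder[OF \<theta>1 F]) (use g(2) in \<open>auto simp: b0_def b1_def\<close>)
        finally have "R x powr q \<le> (R0 x powr (1 - \<theta>) * R1 x powr \<theta>) powr q"
          using nonneg q by (intro powr_mono2) auto
        also have "\<dots> = R0 x powr a * R1 x powr (\<theta> * q)" by (simp add: powr_mult powr_powr a_def)
        also have "\<dots> = R0 x powr a * (R1 x powr q\<^sub>1) powr (1 - a)" by (simp add: powr_powr a\<theta>)
        finally show ?thesis .
      qed
      define Y where "Y t = (\<integral>\<^sup>+z. ennreal (R1 (t, z) powr q\<^sub>1) \<partial>Z)" for t
      have Y_meas [measurable]: "Y \<in> borel_measurable T"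
        unfolding Y_def[abs_def] by (rule Z.borel_measurable_nn_integral_fst) measurable
      have slice: "ennreal_powr (\<integral>\<^sup>+z. ennreal (R (t, z) powr q) \<partial>Z) (p / q) \<le> ennreal (B powr ((1 - \<theta>) * p)) * Y t"
        if t: "t \<in> space T" for t
      proof (cases "Y t")
        case top
        then show ?thesis using B by (simp add: ennreal_mult_top)
      next
        case (real y)
        have sec [measurable]: "(\<lambda>z. R0 (t, z)) \<in> borel_measurable Z" "(\<lambda>z. R1 (t, z)) \<in> borel_measurable Z"
          using meas t by measurable
        have "(\<integral>\<^sup>+z. ennreal (R (t, z) powr q) \<partial>Z) \<le> (\<integral>\<^sup>+z. ennreal (R0 (t, z) powr a * (R1 (t, z) powr q\<^sub>1) powr (1 - a)) \<partial>Z)"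
          by (intro nn_integral_mono ennreal_leI R_le)
        also have "\<dots> \<le> ennreal (B powr a * y powr (1 - a))"
        proof (rule nn_integral_Hoelder[OF a])
          show "(\<integral>\<^sup>+z. ennreal (R0 (t, z)) \<partial>Z) \<le> ennreal B"
            unfolding R0_def B_def b0_def by (rule energy[OF _ t]) simp
          show "(\<integral>\<^sup>+z. ennreal (R1 (t, z) powr q\<^sub>1) \<partial>Z) \<le> ennreal y"
            unfolding real(2)[symmetric] Y_def ..
        qed (use B0 real nonneg in \<open>auto\<close>)
        finally have "ennreal_powr (\<integral>\<^sup>+z. ennreal (R (t, z) powr q) \<partial>Z) (p / q) \<le> ennreal_powr (ennreal (B powr a * y powr (1 - a))) (p / q)"
          using p0 q by (intro ennreal_powr_mono) auto
        also have "\<dots> = ennreal ((B powr a * y powr (1 - a)) powr (p / q))" by (simp add: ennreal_powr_ennreal)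
        also have "(B powr a * y powr (1 - a)) powr (p / q) = B powr (a * (p / q)) * y powr ((1 - a) * (p / q))"
          by (simp only: powr_mult powr_powr)
        also have "\<dots> = B powr ((1 - \<theta>) * p) * y"
          unfolding ap ap' using real(1) by simp
        finally show ?thesis using real by (simp add: ennreal_mult)
      qed
      have "(\<integral>\<^sup>+t. ennreal_powr (\<integral>\<^sup>+z. ennreal (R (t, z) powr q) \<partial>Z) (p / q) \<partial>T)
          \<le> (\<integral>\<^sup>+t. ennreal (B powr ((1 - \<theta>) * p)) * Y t \<partial>T)"
        by (intro nn_integral_mono slice)
      also have "\<dots> = ennreal (B powr ((1 - \<theta>) * p)) * (\<integral>\<^sup>+t. Y t \<partial>T)"
        by (rule nn_integral_cmult) measurable
      also have "\<dots> \<le> ennreal (B powr ((1 - \<theta>) * p)) * ennreal ((C * (\<Sum>j\<in>F. b1 j powr \<alpha>\<^sub>1) powr (1 / \<alpha>\<^sub>1)) powr q\<^sub>1)"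
        unfolding Y_def R1_def by (intro mult_left_mono endpoint) (auto simp: b1_def)
      also have "(\<Sum>j\<in>F. b1 j powr \<alpha>\<^sub>1) = B"
        unfolding B_def b1_def using \<alpha>0 by (simp add: powr_powr)
      also have "ennreal (B powr ((1 - \<theta>) * p)) * ennreal ((C * B powr (1 / \<alpha>\<^sub>1)) powr q\<^sub>1)
          = ennreal (B powr ((1 - \<theta>) * p) * (C * B powr (1 / \<alpha>\<^sub>1)) powr q\<^sub>1)"
        by (simp add: ennreal_mult)
      also have "B powr ((1 - \<theta>) * p) * (C * B powr (1 / \<alpha>\<^sub>1)) powr q\<^sub>1 = (C powr \<theta> * B powr (1 / \<alpha>)) powr p"
      proof -
        have "(C * B powr (1 / \<alpha>\<^sub>1)) powr q\<^sub>1 = C powr (\<theta> * p) * B powr (1 / \<alpha>\<^sub>1 * (\<theta> * p))"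
          unfolding \<theta>p[symmetric] using C by (simp add: powr_mult powr_powr)
        moreover have "B powr ((1 - \<theta>) * p) * B powr (1 / \<alpha>\<^sub>1 * (\<theta> * p)) = B powr (1 / \<alpha> * p)"
          unfolding inv powr_add[symmetric] by (rule arg_cong[where f="\<lambda>x. B powr x"]) (simp add: algebra_simps)
        moreover have "(C powr \<theta> * B powr (1 / \<alpha>)) powr p = C powr (\<theta> * p) * B powr (1 / \<alpha> * p)"
          by (simp only: powr_mult powr_powr)
        ultimately show ?thesis by (metis mult.left_commute)
      qed
      finally show ?thesis unfolding R_def B_def .
    qed
  qed
qed

section \<open>Passage to infinite systems\<close>

lemma abs_summable_of_bounded_partial_sums:
  fixes c :: "nat \<Rightarrow> complex" and g :: "nat \<Rightarrow> real"
  assumes g: "\<And>j. 0 \<le> g j" and K: "\<And>m. (\<Sum>j\<in>J \<inter> {..<m}. cmod (c j) * g j) \<le> K"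
  shows "(\<lambda>j. c j * of_real (g j)) summable_on J" and "cmod (\<Sum>\<^sub>\<infinity>j\<in>J. c j * of_real (g j)) \<le> K"
proof -
  have n: "norm (c j * of_real (g j)) = cmod (c j) * g j" for j using g by (simp add: norm_mult)
  have fin: "(\<Sum>j\<in>F. cmod (c j) * g j) \<le> K" if F: "finite F" "F \<subseteq> J" for F
  proof -
    obtain m where "F \<subseteq> {..<m}" using finite_nat_bounded[OF F(1)] by auto
    then have "(\<Sum>j\<in>F. cmod (c j) * g j) \<le> (\<Sum>j\<in>J \<inter> {..<m}. cmod (c j) * g j)"
      using F g by (intro sum_mono2) auto
    then show ?thesis using K[of m] by linarith
  qed
  have s: "(\<lambda>j. norm (c j * of_real (g j))) summable_on J"
    unfolding n by (rule nonneg_bdd_above_summable_on) (use g fin in \<open>auto intro!: bdd_aboveI[of _ K]\<close>)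
  show "(\<lambda>j. c j * of_real (g j)) summable_on J" by (rule abs_summable_summable[OF s])
  have "cmod (\<Sum>\<^sub>\<infinity>j\<in>J. c j * of_real (g j)) \<le> (\<Sum>\<^sub>\<infinity>j\<in>J. norm (c j * of_real (g j)))"
    by (rule norm_infsum_bound[OF s])
  also have "\<dots> \<le> K" using s fin unfolding n by (rule infsum_le_finite_sums)
  finally show "cmod (\<Sum>\<^sub>\<infinity>j\<in>J. c j * of_real (g j)) \<le> K" .
qed

definition partial_density :: "nat set \<Rightarrow> (nat \<Rightarrow> real) \<Rightarrow> (nat \<Rightarrow> 'a \<Rightarrow> complex) \<Rightarrow> nat \<Rightarrow> 'a \<Rightarrow> real" where
  "partial_density J b G m x = (\<Sum>j\<in>J \<inter> {..<m}. b j * (cmod (G j x))\<^sup>2)"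

text \<open>Values in \<open>ennreal\<close> leave room for divergence: with b the moduli of the
  coefficients, this is the q-th power of the series of moduli, and its finiteness at a point
  certifies absolute convergence of the density there.\<close>

definition maximal_density :: "real \<Rightarrow> nat set \<Rightarrow> (nat \<Rightarrow> real) \<Rightarrow> (nat \<Rightarrow> 'a \<Rightarrow> complex) \<Rightarrow> 'a \<Rightarrow> ennreal" where
  "maximal_density q J b G x = (SUP m. ennreal (partial_density J b G m x powr q))"

lemma partial_density_mono:
  assumes "\<And>j. 0 \<le> b j" "m \<le> m'"
  shows "0 \<le> partial_density J b G m x" "partial_density J b G m x \<le> partial_density J b G m' x"
  unfolding partial_density_def using assms by (auto intro!: sum_nonneg sum_mono2)

lemma partial_density_measurable:
  assumes "\<And>j. j \<in> J \<Longrightarrow> G j \<in> borel_measurable M"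
  shows "partial_density J b G m \<in> borel_measurable M"
  unfolding partial_density_def[abs_def] using assms
  by (intro borel_measurable_sum borel_measurable_times borel_measurable_power borel_measurable_norm borel_measurable_const) auto

lemma maximal_density_measurable:
  assumes "\<And>j. j \<in> J \<Longrightarrow> G j \<in> borel_measurable M"
  shows "maximal_density q J b G \<in> borel_measurable M"
proof -
  have [measurable]: "partial_density J b G m \<in> borel_measurable M" for m
    by (rule partial_density_measurable[OF assms])
  show ?thesis unfolding maximal_density_def[abs_def] by measurable
qed

lemma maximal_density_finite:
  assumes q: "0 < q" and fin: "maximal_density q J (\<lambda>j. cmod (c j)) G x < \<infinity>"
  shows "(\<lambda>j. c j * of_real ((cmod (G j x))\<^sup>2)) summable_on J"
    and "ennreal (cmod (\<Sum>\<^sub>\<infinity>j\<in>J. c j * of_real ((cmod (G j x))\<^sup>2)) powr q) \<le> maximal_density q J (\<lambda>j. cmod (c j)) G x"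
proof -
  let ?b = "\<lambda>j. cmod (c j)"
  obtain r where r: "0 \<le> r" "maximal_density q J ?b G x = ennreal r"
    using fin by (cases "maximal_density q J ?b G x") auto
  have "partial_density J ?b G m x \<le> r powr (1 / q)" for m
  proof -
    have "ennreal (partial_density J ?b G m x powr q) \<le> ennreal r"
      unfolding r(2)[symmetric] maximal_density_def by (rule SUP_upper) simp
    then have "partial_density J ?b G m x powr q \<le> r" using r(1) by simp
    then have "(partial_density J ?b G m x powr q) powr (1 / q) \<le> r powr (1 / q)"
      using q by (intro powr_mono2) auto
    moreover have "0 \<le> partial_density J ?b G m x" by (rule partial_density_mono(1)[OF _ order_refl]) simp
    ultimately show ?thesis using q by (simp add: powr_powr)
  qed
  then have K: "(\<Sum>j\<in>J \<inter> {..<m}. cmod (c j) * (cmod (G j x))\<^sup>2) \<le> r powr (1 / q)" for m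
    unfolding partial_density_def .
  note s = abs_summable_of_bounded_partial_sums[OF zero_le_power2 K]
  show "(\<lambda>j. c j * of_real ((cmod (G j x))\<^sup>2)) summable_on J" by (rule s(1))
  have "cmod (\<Sum>\<^sub>\<infinity>j\<in>J. c j * of_real ((cmod (G j x))\<^sup>2)) powr q \<le> (r powr (1 / q)) powr q"
    using q s(2) by (intro powr_mono2) auto
  also have "\<dots> = r" using q r(1) by (simp add: powr_powr)
  finally show "ennreal (cmod (\<Sum>\<^sub>\<infinity>j\<in>J. c j * of_real ((cmod (G j x))\<^sup>2)) powr q) \<le> maximal_density q J ?b G x"
    unfolding r(2) by (rule ennreal_leI)
qed

lemma nn_integral_maximal_density:
  assumes b: "\<And>j. 0 \<le> b j" and q: "0 < q" and G: "\<And>j. j \<in> J \<Longrightarrow> (\<lambda>z. G j (h z)) \<in> borel_measurable M"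
  shows "(\<integral>\<^sup>+z. maximal_density q J b G (h z) \<partial>M) = (SUP m. \<integral>\<^sup>+z. ennreal (partial_density J b G m (h z) powr q) \<partial>M)"
  unfolding maximal_density_def
proof (rule nn_integral_monotone_convergence_SUP)
  show "incseq (\<lambda>m z. ennreal (partial_density J b G m (h z) powr q))"
    using q by (auto simp: incseq_def le_fun_def intro!: ennreal_leI powr_mono2 partial_density_mono[OF b])
  have "partial_density J b (\<lambda>j z. G j (h z)) m \<in> borel_measurable M" for m
    by (rule partial_density_measurable[OF G])
  then have [measurable]: "(\<lambda>z. partial_density J b G m (h z)) \<in> borel_measurable M" for m
    unfolding partial_density_def[abs_def] .
  show "(\<lambda>z. ennreal (partial_density J b G m (h z) powr q)) \<in> borel_measurable M" for m by measurable
qed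

text \<open>Connects the completed measure of the mixed norm with the Borel measure on which
  Tonelli's theorem was used.\<close>

lemma nn_integral_circle:
  assumes f: "f \<in> borel_measurable borel"
  shows "(\<integral>\<^sup>+t. f t \<partial>lebesgue_on {-pi..pi}) = (\<integral>\<^sup>+t. f t \<partial>circle_measure)"
proof -
  have "(\<integral>\<^sup>+t. f t \<partial>lebesgue_on {-pi..pi}) = (\<integral>\<^sup>+t. f t * indicator {-pi..pi} t \<partial>lebesgue)"
    by (subst nn_integral_restrict_space) auto
  also have "\<dots> = (\<integral>\<^sup>+t. f t * indicator {-pi..pi} t \<partial>lborel)"
    using f by (intro nn_integral_completion) measurable
  also have "\<dots> = (\<integral>\<^sup>+t. f t \<partial>circle_measure)"
    unfolding circle_measure_def by (subst nn_integral_restrict_space) auto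
  finally show ?thesis .
qed

lemma borel_measurable_slice_integral:
  fixes f :: "real \<times> (complex ^ 'n) \<Rightarrow> ennreal"
  assumes "f \<in> borel_measurable borel"
  shows "(\<lambda>t. \<integral>\<^sup>+z. f (t, z) \<partial>lborel) \<in> borel_measurable borel"
proof (rule lborel.borel_measurable_nn_integral_fst)
  have "sets ((borel :: real measure) \<Otimes>\<^sub>M (lborel :: (complex ^ 'n) measure)) = sets (borel \<Otimes>\<^sub>M borel)"
    by (rule sets_pair_measure_cong) simp_all
  then show "f \<in> borel_measurable ((borel :: real measure) \<Otimes>\<^sub>M lborel)"
    using assms unfolding borel_prod by (simp cong: measurable_cong_sets)
qed

lemma sum_le_infsum_ennreal:
  fixes f :: "'a \<Rightarrow> real"
  assumes f: "\<And>x. 0 \<le> f x" and S: "(\<Sum>\<^sub>\<infinity>x\<in>A. ennreal (f x)) \<le> ennreal S" "0 \<le> S" and F: "finite F" "F \<subseteq> A"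
  shows "(\<Sum>x\<in>F. f x) \<le> S"
proof -
  have "ennreal (\<Sum>x\<in>F. f x) = (\<Sum>x\<in>F. ennreal (f x))" using f by (simp add: sum_ennreal)
  also have "\<dots> \<le> (\<Sum>\<^sub>\<infinity>x\<in>A. ennreal (f x))"
    using F by (subst nonneg_infsum_complete) (auto intro: SUP_upper)
  finally have "ennreal (\<Sum>x\<in>F. f x) \<le> ennreal S" using S(1) by simp
  then show ?thesis using S(2) by simp
qed

lemma infsum_ennreal_finite:
  fixes f :: "'a \<Rightarrow> real"
  assumes f: "\<And>x. 0 \<le> f x" and s: "f summable_on A"
  shows "(\<Sum>\<^sub>\<infinity>x\<in>A. ennreal (f x)) \<noteq> \<infinity>"
proof -
  have "(\<Sum>\<^sub>\<infinity>x\<in>A. ennreal (f x)) = (SUP F\<in>{F. finite F \<and> F \<subseteq> A}. \<Sum>x\<in>F. ennreal (f x))"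
    by (rule nonneg_infsum_complete) simp
  also have "\<dots> \<le> ennreal (\<Sum>\<^sub>\<infinity>x\<in>A. f x)"
    using f by (intro SUP_least) (auto simp: sum_ennreal intro!: ennreal_leI finite_sum_le_infsum[OF s])
  also have "\<dots> < \<infinity>" by simp
  finally show ?thesis by simp
qed

lemma propagator_series:
  fixes u :: "nat \<Rightarrow> complex ^ 'n \<Rightarrow> complex" and G :: "nat \<Rightarrow> real \<times> (complex ^ 'n) \<Rightarrow> complex" and c :: "nat \<Rightarrow> complex"
  assumes q: "0 < q" and G: "\<And>j. j \<in> J \<Longrightarrow> G j \<in> borel_measurable borel"
    and eq: "\<And>j. j \<in> J \<Longrightarrow> AE z in lebesgue. special_hermite_propagator t (u j) z = G j (t, z)"
  defines "W \<equiv> \<integral>\<^sup>+z. maximal_density q J (\<lambda>j. cmod (c j)) G (t, z) \<partial>lborel"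
  assumes W: "W < \<infinity>"
  shows "AE z in lebesgue. (\<lambda>j. c j * complex_of_real ((cmod (special_hermite_propagator t (u j) z))\<^sup>2)) summable_on J"
    and "AE z in lebesgue. (\<lambda>m. \<Sum>j\<in>J \<inter> {..<m}. c j * complex_of_real ((cmod (G j (t, z)))\<^sup>2))
      \<longlonglongrightarrow> (\<Sum>\<^sub>\<infinity>j\<in>J. c j * complex_of_real ((cmod (special_hermite_propagator t (u j) z))\<^sup>2))"
    and "Lq_norm q (\<lambda>z. \<Sum>\<^sub>\<infinity>j\<in>J. c j * complex_of_real ((cmod (special_hermite_propagator t (u j) z))\<^sup>2)) \<le> ennreal_powr W (1 / q)"
proof -
  let ?D = "\<lambda>z. maximal_density q J (\<lambda>j. cmod (c j)) G (t, z)"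
  have D [measurable]: "?D \<in> borel_measurable borel"
    by (rule measurable_compose[OF _ maximal_density_measurable[OF G]]) simp_all
  \<comment> \<open>J is countable, so the exceptional null sets of all j combine into one.\<close>
  have all: "AE z in lebesgue. \<forall>j\<in>J. special_hermite_propagator t (u j) z = G j (t, z)"
    by (rule AE_ball_countable[THEN iffD2]) (use eq in auto)
  have "AE z in lborel. ?D z \<noteq> \<infinity>"
    using W unfolding W_def by (intro nn_integral_PInf_AE) auto
  then have fin: "AE z in lebesgue. ?D z < \<infinity>"
    by (intro AE_completion) (simp add: less_top)
  show "AE z in lebesgue. (\<lambda>j. c j * complex_of_real ((cmod (special_hermite_propagator t (u j) z))\<^sup>2)) summable_on J"
    using all fin
  proof eventually_elim
    case (elim z)
    show ?case using maximal_density_finite(1)[OF q elim(2)] elim(1)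
      by (subst summable_on_cong[where g="\<lambda>j. c j * of_real ((cmod (G j (t, z)))\<^sup>2)"]) auto
  qed
  show "AE z in lebesgue. (\<lambda>m. \<Sum>j\<in>J \<inter> {..<m}. c j * complex_of_real ((cmod (G j (t, z)))\<^sup>2))
      \<longlonglongrightarrow> (\<Sum>\<^sub>\<infinity>j\<in>J. c j * complex_of_real ((cmod (special_hermite_propagator t (u j) z))\<^sup>2))"
    using all fin
  proof eventually_elim
    case (elim z)
    have "filterlim (\<lambda>m. J \<inter> {..<m}) (finite_subsets_at_top J) sequentially"
      unfolding filterlim_finite_subsets_at_top
    proof (intro allI impI)
      fix X assume X: "finite X \<and> X \<subseteq> J"
      then obtain k where "X \<subseteq> {..<k}" using finite_nat_bounded[of X] by blast
      then show "\<forall>\<^sub>F m in sequentially. finite (J \<inter> {..<m}) \<and> X \<subseteq> J \<inter> {..<m} \<and> J \<inter> {..<m} \<subseteq> J"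
        using X by (intro eventually_sequentiallyI[of k]) auto
    qed
    moreover have "((\<lambda>F. \<Sum>j\<in>F. c j * of_real ((cmod (G j (t, z)))\<^sup>2)) \<longlongrightarrow> (\<Sum>\<^sub>\<infinity>j\<in>J. c j * of_real ((cmod (G j (t, z)))\<^sup>2))) (finite_subsets_at_top J)"
      using has_sum_infsum[OF maximal_density_finite(1)[OF q elim(2)]] unfolding has_sum_def .
    ultimately have "(\<lambda>m. \<Sum>j\<in>J \<inter> {..<m}. c j * of_real ((cmod (G j (t, z)))\<^sup>2)) \<longlonglongrightarrow> (\<Sum>\<^sub>\<infinity>j\<in>J. c j * of_real ((cmod (G j (t, z)))\<^sup>2))"
      by (rule filterlim_compose[rotated])
    then show ?case using elim(1) by (simp cong: infsum_cong)
  qed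
  have "(\<integral>\<^sup>+z. ennreal (cmod (\<Sum>\<^sub>\<infinity>j\<in>J. c j * complex_of_real ((cmod (special_hermite_propagator t (u j) z))\<^sup>2)) powr q) \<partial>lebesgue)
      \<le> (\<integral>\<^sup>+z. ?D z \<partial>lebesgue)"
  proof (rule nn_integral_mono_AE)
    show "AE z in lebesgue. ennreal (cmod (\<Sum>\<^sub>\<infinity>j\<in>J. c j * complex_of_real ((cmod (special_hermite_propagator t (u j) z))\<^sup>2)) powr q) \<le> ?D z"
      using all fin
    proof eventually_elim
      case (elim z)
      show ?case using maximal_density_finite(2)[OF q elim(2)] elim(1) by (simp cong: infsum_cong)
    qed
  qed
  also have "\<dots> = W" unfolding W_def by (rule nn_integral_completion)
  finally show "Lq_norm q (\<lambda>z. \<Sum>\<^sub>\<infinity>j\<in>J. c j * complex_of_real ((cmod (special_hermite_propagator t (u j) z))\<^sup>2)) \<le> ennreal_powr W (1 / q)"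
    unfolding Lq_norm_def using q by (intro ennreal_powr_mono) auto
qed

lemma strichartz_constant_pos: "0 < strichartz_constant TYPE('n::finite)"
proof -
  \<comment> \<open>Some admissible s opens the locale; the constant is the same for all of
    them.\<close>
  interpret D: dispersive_system "space_time :: (real \<times> (complex ^ 'n)) measure" wave modulation "damping (1 / 2)" "1 / 2"
      "(1 / (2 * pi)) ^ CARD('n)" "(1 / (2 * pi)) ^ CARD('n) / (1 - 1 / 2) ^ CARD('n)" "2 * pi" "CARD('n)"
    by (rule special_hermite_dispersive_system) simp_all
  show ?thesis
    unfolding strichartz_constant_def D.interpolation_constant_def by (simp add: add_pos_pos)
qed

text \<open>\<open>mixed_interpolation\<close> is applied to the first m members with the
  coefficients |c_j|. These densities increase with m, so monotone convergence, in space and then in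
  time, gives the bound for the whole system.\<close>

lemma strichartz_finite_exponent:
  fixes u :: "nat \<Rightarrow> complex ^ 'n \<Rightarrow> complex" and q :: real
  defines "N \<equiv> real CARD('n)"
  defines "p \<equiv> 1 / (N - N / q)" and "\<alpha> \<equiv> 2 * q / (q + 1)"
  assumes q: "1 < q" "q \<le> 1 + 1 / N" and u: "L2_orthonormal J u"
    and S: "(\<Sum>\<^sub>\<infinity>j\<in>J. ennreal (cmod (c j) powr \<alpha>)) \<le> ennreal S" "0 \<le> S"
  shows "AE t in lebesgue_on {-pi..pi}. AE z in lebesgue.
      (\<lambda>j. c j * complex_of_real ((cmod (special_hermite_propagator t (u j) z))\<^sup>2)) summable_on J"
    and "(\<integral>\<^sup>+t. ennreal_powr (Lq_norm q (\<lambda>z. \<Sum>\<^sub>\<infinity>j\<in>J. c j * complex_of_real ((cmod (special_hermite_propagator t (u j) z))\<^sup>2))) p \<partial>lebesgue_on {-pi..pi})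
      \<le> ennreal ((strichartz_constant TYPE('n) powr ((N + 1) * (1 - 1 / q)) * S powr (1 / \<alpha>)) powr p)"
proof -
  let ?C = "strichartz_constant TYPE('n) powr ((N + 1) * (1 - 1 / q))"
  have N: "1 \<le> N" unfolding N_def using zero_less_card_finite[where 'a='n] by linarith
  have p0: "0 < p" using q N by (simp add: p_def field_simps)
  have \<alpha>0: "0 < \<alpha>" using q by (simp add: \<alpha>_def)
  let ?b = "\<lambda>j. cmod (c j)"
  obtain G where G: "\<And>j. j \<in> J \<Longrightarrow> G j \<in> borel_measurable borel"
      "\<And>j t. j \<in> J \<Longrightarrow> AE z in lebesgue. special_hermite_propagator t (u j) z = G j (t, z)"
    and energy: "\<And>F b t. finite F \<Longrightarrow> F \<subseteq> J \<Longrightarrow> (\<And>j. 0 \<le> b j) \<Longrightarrow>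
      (\<integral>\<^sup>+z. ennreal (\<Sum>j\<in>F. b j * (cmod (G j (t, z)))\<^sup>2) \<partial>lborel) \<le> ennreal (\<Sum>j\<in>F. b j)"
    and endpoint: "\<And>F b. finite F \<Longrightarrow> F \<subseteq> J \<Longrightarrow> (\<And>j. 0 \<le> b j) \<Longrightarrow>
      (\<integral>\<^sup>+t. (\<integral>\<^sup>+z. ennreal ((\<Sum>j\<in>F. b j * (cmod (G j (t, z)))\<^sup>2) powr ((N + 1) / N)) \<partial>lborel) \<partial>circle_measure)
        \<le> ennreal ((strichartz_constant TYPE('n) * (\<Sum>j\<in>F. b j powr (2 * (N + 1) / (2 * N + 1))) powr (1 / (2 * (N + 1) / (2 * N + 1)))) powr ((N + 1) / N))"
  proof (rule propagator_representative[OF u, folded N_def], goal_cases)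
    case (1 G)
    show thesis by (rule that[of G]) (rule 1; assumption)+
  qed
  define W where "W t = (\<integral>\<^sup>+z. maximal_density q J ?b G (t, z) \<partial>lborel)" for t
  define w where "w m t = (\<integral>\<^sup>+z. ennreal (partial_density J ?b G m (t, z) powr q) \<partial>lborel)" for m t
  have W_meas [measurable]: "W \<in> borel_measurable borel"
    unfolding W_def[abs_def] by (intro borel_measurable_slice_integral maximal_density_measurable G)
  have w_meas [measurable]: "w m \<in> borel_measurable borel" for m
    unfolding w_def[abs_def]
    by (intro borel_measurable_slice_integral measurable_compose[OF _ measurable_ennreal] powr_real_measurable
        partial_density_measurable G borel_measurable_const)
  have q0: "0 < q" using q by simp
  have Ww: "W t = (SUP m. w m t)" for t
    unfolding W_def w_def
    by (rule nn_integral_maximal_density[OF _ q0]) (auto intro: measurable_compose[OF _ G(1)])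
  have w_mono: "w m t \<le> w m' t" if "m \<le> m'" for m m' t
    unfolding w_def using q that
    by (intro nn_integral_mono ennreal_leI powr_mono2 partial_density_mono) auto
  have w_le: "(\<integral>\<^sup>+t. ennreal_powr (w m t) (p / q) \<partial>circle_measure) \<le> ennreal ((?C * S powr (1 / \<alpha>)) powr p)" for m
  proof -
    let ?F = "J \<inter> {..<m}"
    have "(\<integral>\<^sup>+t. ennreal_powr (w m t) (p / q) \<partial>circle_measure) \<le> ennreal ((?C * (\<Sum>j\<in>?F. ?b j powr \<alpha>) powr (1 / \<alpha>)) powr p)"
      unfolding w_def partial_density_def p_def \<alpha>_def
    proof (rule mixed_interpolation[OF lborel.sigma_finite_measure_axioms _ N q strichartz_constant_pos])
      show "(\<lambda>x. (cmod (G j x))\<^sup>2) \<in> borel_measurable (circle_measure \<Otimes>\<^sub>M lborel)" if "j \<in> ?F" for j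
      proof -
        have [measurable]: "G j \<in> borel_measurable borel" using that by (intro G(1)) simp
        show ?thesis unfolding space_time_def[symmetric] by (rule measurable_space_time) measurable
      qed
      show "(\<integral>\<^sup>+t. (\<integral>\<^sup>+z. ennreal ((\<Sum>j\<in>?F. b j * (cmod (G j (t, z)))\<^sup>2) powr ((N + 1) / N)) \<partial>lborel) \<partial>circle_measure)
        \<le> ennreal ((strichartz_constant TYPE('n) * (\<Sum>j\<in>?F. b j powr (2 * (N + 1) / (2 * N + 1))) powr (1 / (2 * (N + 1) / (2 * N + 1)))) powr ((N + 1) / N))"
        if "\<And>j. 0 \<le> b j" for b
        by (rule endpoint[OF _ _ that]) auto
    qed (auto intro: energy)
    also have "\<dots> \<le> ennreal ((?C * S powr (1 / \<alpha>)) powr p)"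
    proof -
      have "(\<Sum>j\<in>?F. ?b j powr \<alpha>) \<le> S" by (rule sum_le_infsum_ennreal[OF _ S]) auto
      then show ?thesis
        using p0 \<alpha>0 by (intro ennreal_leI powr_mono2 mult_left_mono) (auto intro!: sum_nonneg)
    qed
    finally show ?thesis .
  qed
  have W_le: "(\<integral>\<^sup>+t. ennreal_powr (W t) (p / q) \<partial>lebesgue_on {-pi..pi}) \<le> ennreal ((?C * S powr (1 / \<alpha>)) powr p)"
  proof -
    have "(\<integral>\<^sup>+t. ennreal_powr (W t) (p / q) \<partial>lebesgue_on {-pi..pi}) = (\<integral>\<^sup>+t. ennreal_powr (W t) (p / q) \<partial>circle_measure)"
      by (rule nn_integral_circle) measurable
    also have "\<dots> = (\<integral>\<^sup>+t. (SUP m. ennreal_powr (w m t) (p / q)) \<partial>circle_measure)"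
      unfolding Ww using p0 q0 by (subst ennreal_powr_SUP) auto
    also have "\<dots> = (SUP m. \<integral>\<^sup>+t. ennreal_powr (w m t) (p / q) \<partial>circle_measure)"
    proof (rule nn_integral_monotone_convergence_SUP)
      show "incseq (\<lambda>m t. ennreal_powr (w m t) (p / q))"
        using w_mono p0 q0 by (auto simp: incseq_def le_fun_def intro!: ennreal_powr_mono)
      show "(\<lambda>t. ennreal_powr (w m t) (p / q)) \<in> borel_measurable circle_measure" for m
        by (rule measurable_circle) measurable
    qed
    also have "\<dots> \<le> ennreal ((?C * S powr (1 / \<alpha>)) powr p)" by (intro SUP_least w_le)
    finally show ?thesis .
  qed
  \<comment> \<open>A finite time integral forces W to be finite at almost every time, and at those
    times the series converges almost everywhere in z.\<close>
  have fin: "AE t in lebesgue_on {-pi..pi}. W t < \<infinity>"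
  proof -
    have "(\<lambda>t. ennreal_powr (W t) (p / q)) \<in> borel_measurable lebesgue"
      by (rule measurable_completion) measurable
    then have "(\<lambda>t. ennreal_powr (W t) (p / q)) \<in> borel_measurable (lebesgue_on {-pi..pi})"
      by (rule measurable_restrict_space1)
    moreover have "(\<integral>\<^sup>+t. ennreal_powr (W t) (p / q) \<partial>lebesgue_on {-pi..pi}) \<noteq> \<infinity>"
      using W_le by (auto simp: top_unique)
    ultimately have "AE t in lebesgue_on {-pi..pi}. ennreal_powr (W t) (p / q) \<noteq> \<infinity>"
      by (rule nn_integral_PInf_AE)
    then show ?thesis by eventually_elim (auto simp: ennreal_powr_def less_top split: if_splits)
  qed
  note series = propagator_series[OF q0, of J G _ u c, OF G, folded W_def]
  show "AE t in lebesgue_on {-pi..pi}. AE z in lebesgue.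
      (\<lambda>j. c j * complex_of_real ((cmod (special_hermite_propagator t (u j) z))\<^sup>2)) summable_on J"
    using fin by eventually_elim (rule series(1))
  have "(\<integral>\<^sup>+t. ennreal_powr (Lq_norm q (\<lambda>z. \<Sum>\<^sub>\<infinity>j\<in>J. c j * complex_of_real ((cmod (special_hermite_propagator t (u j) z))\<^sup>2))) p \<partial>lebesgue_on {-pi..pi})
      \<le> (\<integral>\<^sup>+t. ennreal_powr (W t) (p / q) \<partial>lebesgue_on {-pi..pi})"
  proof (rule nn_integral_mono_AE)
    show "AE t in lebesgue_on {-pi..pi}. ennreal_powr (Lq_norm q (\<lambda>z. \<Sum>\<^sub>\<infinity>j\<in>J. c j * complex_of_real ((cmod (special_hermite_propagator t (u j) z))\<^sup>2))) p
        \<le> ennreal_powr (W t) (p / q)"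
      using fin
    proof eventually_elim
      case (elim t)
      have "ennreal_powr (Lq_norm q (\<lambda>z. \<Sum>\<^sub>\<infinity>j\<in>J. c j * complex_of_real ((cmod (special_hermite_propagator t (u j) z))\<^sup>2))) p
          \<le> ennreal_powr (ennreal_powr (W t) (1 / q)) p"
        using p0 by (intro ennreal_powr_mono series(3)[OF _ _ elim]) auto
      then show ?case by (simp add: ennreal_powr_powr)
    qed
  qed
  also note W_le
  finally show "(\<integral>\<^sup>+t. ennreal_powr (Lq_norm q (\<lambda>z. \<Sum>\<^sub>\<infinity>j\<in>J. c j * complex_of_real ((cmod (special_hermite_propagator t (u j) z))\<^sup>2))) p \<partial>lebesgue_on {-pi..pi})
      \<le> ennreal ((?C * S powr (1 / \<alpha>)) powr p)" .
qed

text \<open>At q = 1 the energy bound holds at every single time, so the supremum in t costs nothing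
  once the slice norm is known to be measurable.\<close>

lemma strichartz_infinite_exponent:
  fixes u :: "nat \<Rightarrow> complex ^ 'n \<Rightarrow> complex"
  assumes u: "L2_orthonormal J u" and S: "(\<Sum>\<^sub>\<infinity>j\<in>J. ennreal (cmod (c j))) \<le> ennreal S" "0 \<le> S"
  shows "AE z in lebesgue. (\<lambda>j. c j * complex_of_real ((cmod (special_hermite_propagator t (u j) z))\<^sup>2)) summable_on J"
    and "esssup (lebesgue_on {-pi..pi}) (\<lambda>t. Lq_norm 1 (\<lambda>z. \<Sum>\<^sub>\<infinity>j\<in>J. c j * complex_of_real ((cmod (special_hermite_propagator t (u j) z))\<^sup>2))) \<le> ennreal S"
proof -
  let ?b = "\<lambda>j. cmod (c j)"
  let ?D = "\<lambda>t z. \<Sum>\<^sub>\<infinity>j\<in>J. c j * complex_of_real ((cmod (special_hermite_propagator t (u j) z))\<^sup>2)"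
  obtain G where G: "\<And>j. j \<in> J \<Longrightarrow> G j \<in> borel_measurable borel"
      "\<And>j t. j \<in> J \<Longrightarrow> AE z in lebesgue. special_hermite_propagator t (u j) z = G j (t, z)"
    and energy: "\<And>F b t. finite F \<Longrightarrow> F \<subseteq> J \<Longrightarrow> (\<And>j. 0 \<le> b j) \<Longrightarrow>
      (\<integral>\<^sup>+z. ennreal (\<Sum>j\<in>F. b j * (cmod (G j (t, z)))\<^sup>2) \<partial>lborel) \<le> ennreal (\<Sum>j\<in>F. b j)"
  proof (rule propagator_representative[OF u], goal_cases)
    case (1 G)
    show thesis by (rule that[of G]) (rule 1; assumption)+
  qed
  define W where "W t = (\<integral>\<^sup>+z. maximal_density 1 J ?b G (t, z) \<partial>lborel)" for t
  have W_le: "W t \<le> ennreal S" for t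
  proof -
    have "W t = (SUP m. \<integral>\<^sup>+z. ennreal (partial_density J ?b G m (t, z) powr 1) \<partial>lborel)"
      unfolding W_def
      by (rule nn_integral_maximal_density) (auto intro: measurable_compose[OF _ G(1)])
    also have "\<dots> \<le> ennreal S"
    proof (rule SUP_least)
      fix m
      have "(\<integral>\<^sup>+z. ennreal (partial_density J ?b G m (t, z) powr 1) \<partial>lborel)
          = (\<integral>\<^sup>+z. ennreal (\<Sum>j\<in>J \<inter> {..<m}. ?b j * (cmod (G j (t, z)))\<^sup>2) \<partial>lborel)"
        by (simp add: partial_density_def sum_nonneg)
      also have "\<dots> \<le> ennreal (\<Sum>j\<in>J \<inter> {..<m}. ?b j)" by (rule energy) auto
      also have "\<dots> \<le> ennreal S" by (intro ennreal_leI sum_le_infsum_ennreal[OF _ S]) auto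
      finally show "(\<integral>\<^sup>+z. ennreal (partial_density J ?b G m (t, z) powr 1) \<partial>lborel) \<le> ennreal S" .
    qed
    finally show ?thesis .
  qed
  have fin: "W t < \<infinity>" for t using W_le[of t] by (rule le_less_trans) simp
  note series = propagator_series[OF zero_less_one, of J G _ u c, OF G, folded W_def, OF _ _ fin]
  show "AE z in lebesgue. (\<lambda>j. c j * complex_of_real ((cmod (special_hermite_propagator t (u j) z))\<^sup>2)) summable_on J"
    by (rule series(1))
  \<comment> \<open>\<open>esssup_I\<close> asks for measurability in t, which the separately chosen
    propagators do not offer; the limit H of these sums is a jointly Borel version of the
    density.\<close>
  define P where "P m x = (\<Sum>j\<in>J \<inter> {..<m}. c j * complex_of_real ((cmod (G j x))\<^sup>2))" for m x
  define H where "H x = lim (\<lambda>m. P m x)" for x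
  have H_meas: "H \<in> borel_measurable borel"
    unfolding H_def[abs_def]
  proof (rule borel_measurable_lim_metric)
    show "P m \<in> borel_measurable borel" for m
      unfolding P_def[abs_def] using G(1)
      by (intro borel_measurable_sum borel_measurable_times borel_measurable_of_real borel_measurable_power borel_measurable_norm borel_measurable_const) auto
  qed
  have norm_eq: "Lq_norm 1 (?D t) = (\<integral>\<^sup>+z. ennreal (cmod (H (t, z))) \<partial>lborel)" for t
  proof -
    have [measurable]: "(\<lambda>z. H (t, z)) \<in> borel_measurable borel"
      by (rule measurable_compose[OF _ H_meas]) simp
    have "AE z in lebesgue. (\<lambda>m. P m (t, z)) \<longlonglongrightarrow> ?D t z"
      unfolding P_def by (rule series(2))
    then have "AE z in lebesgue. ?D t z = H (t, z)"
      unfolding H_def by eventually_elim (rule limI[symmetric])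
    then have "(\<integral>\<^sup>+z. ennreal (cmod (?D t z) powr 1) \<partial>lebesgue) = (\<integral>\<^sup>+z. ennreal (cmod (H (t, z))) \<partial>lebesgue)"
      by (intro nn_integral_cong_AE) (auto elim!: eventually_mono)
    also have "\<dots> = (\<integral>\<^sup>+z. ennreal (cmod (H (t, z))) \<partial>lborel)"
      by (rule nn_integral_completion) measurable
    finally show ?thesis by (simp add: Lq_norm_def ennreal_powr_1)
  qed
  show "esssup (lebesgue_on {-pi..pi}) (\<lambda>t. Lq_norm 1 (?D t)) \<le> ennreal S"
  proof (rule esssup_I)
    note H_meas [measurable]
    have "(\<lambda>t. \<integral>\<^sup>+z. ennreal (cmod (H (t, z))) \<partial>lborel) \<in> borel_measurable borel"
      by (rule borel_measurable_slice_integral) measurable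
    then have "(\<lambda>t. Lq_norm 1 (?D t)) \<in> borel_measurable lebesgue"
      unfolding norm_eq by (intro measurable_completion) simp
    then show "(\<lambda>t. Lq_norm 1 (?D t)) \<in> borel_measurable (lebesgue_on {-pi..pi})"
      by (rule measurable_restrict_space1)
    show "AE t in lebesgue_on {-pi..pi}. Lq_norm 1 (?D t) \<le> ennreal S"
    proof (rule AE_I2)
      fix t
      have "Lq_norm 1 (?D t) \<le> ennreal_powr (W t) (1 / 1)" by (rule series(3))
      also have "\<dots> = W t" by (simp add: ennreal_powr_1)
      also note W_le
      finally show "Lq_norm 1 (?D t) \<le> ennreal S" .
    qed
  qed
qed

text \<open>For finite p the number 1/p = N - N/q is positive, which excludes q = 1; conversely p =
  \<infinity> forces q = 1. These are the two cases of the proof.\<close>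

lemma admissible_exponents:
  fixes p :: ereal and q N :: real
  assumes "1 \<le> q" "0 < N" "1 < p" "1 / p + ereal (N / q) = ereal N"
  shows "q = 1 \<and> p = \<infinity> \<or> 1 < q \<and> p = ereal (1 / (N - N / q)) \<and> 0 < 1 / (N - N / q)"
proof (cases p)
  case (real r)
  then have r: "1 < r" using assms(3) by simp
  then have e: "1 / r + N / q = N" using assms(4) real by (simp add: one_ereal_def)
  then have "1 / r = N - N / q" by simp
  moreover have "q \<noteq> 1" using e r by auto
  moreover have "1 / (1 / r) = r" by simp
  ultimately show ?thesis using r real assms(1) by simp
next
  case PInf
  then have "N / q = N" using assms(4) by simp
  then have "N * q = N * 1" using assms(1) by (simp add: field_simps)
  then show ?thesis using PInf assms(2) by simp
next
  case MInf
  then show ?thesis using assms(3) by simp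
qed

text \<open>Orthonormal systems in a separable Hilbert space are countable, so subsets of the
  natural numbers serve as index sets. The clause on convergence guards the norm bound: a divergent
  density would enter the mixed norm with the default value 0.\<close>

theorem theorem1p6:
  fixes q :: real
  assumes "1 \<le> q" and "q \<le> 1 + 1 / real CARD('n::finite)"
  shows "\<exists>C>0. \<forall>p::ereal. 1 < p \<and> 1 / p + ereal (real CARD('n) / q) = ereal (real CARD('n)) \<longrightarrow>
    (\<forall>(J :: nat set) (u :: nat \<Rightarrow> complex ^ 'n \<Rightarrow> complex) (c :: nat \<Rightarrow> complex).
       L2_orthonormal J u \<longrightarrow>
       ((\<lambda>j. cmod (c j) powr (2 * q / (q + 1))) summable_on J \<longrightarrow>
          (AE t in lebesgue_on {-pi..pi}. AE z in lebesgue.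
             (\<lambda>j. c j * complex_of_real ((cmod (special_hermite_propagator t (u j) z))\<^sup>2))
               summable_on J)) \<and>
       mixed_norm p q
         (\<lambda>t z. \<Sum>\<^sub>\<infinity>j\<in>J. c j * complex_of_real ((cmod (special_hermite_propagator t (u j) z))\<^sup>2))
       \<le> ennreal C *
          ennreal_powr (\<Sum>\<^sub>\<infinity>j\<in>J. ennreal (cmod (c j) powr (2 * q / (q + 1)))) ((q + 1) / (2 * q)))"
proof -
  define C where "C = strichartz_constant TYPE('n) powr ((real CARD('n) + 1) * (1 - 1 / q))"
  have C: "0 < C" using strichartz_constant_pos[where 'n='n] by (simp add: C_def)
  show ?thesis
  proof (intro exI[of _ C] conjI C allI impI)
    fix p :: ereal and J and u :: "nat \<Rightarrow> complex ^ 'n \<Rightarrow> complex" and c :: "nat \<Rightarrow> complex"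
    assume p: "1 < p \<and> 1 / p + ereal (real CARD('n) / q) = ereal (real CARD('n))" and u: "L2_orthonormal J u"
    define X where "X = (\<Sum>\<^sub>\<infinity>j\<in>J. ennreal (cmod (c j) powr (2 * q / (q + 1))))"
    note exponents = admissible_exponents[OF assms(1) _ conjunct1[OF p] conjunct2[OF p]]
    \<comment> \<open>An infinite coefficient sum makes the right-hand side infinite, since C > 0;
      so the work lies in the case of a finite sum S.\<close>
    have main: "(AE t in lebesgue_on {-pi..pi}. AE z in lebesgue.
             (\<lambda>j. c j * complex_of_real ((cmod (special_hermite_propagator t (u j) z))\<^sup>2)) summable_on J) \<and>
       mixed_norm p q (\<lambda>t z. \<Sum>\<^sub>\<infinity>j\<in>J. c j * complex_of_real ((cmod (special_hermite_propagator t (u j) z))\<^sup>2))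
       \<le> ennreal (C * S powr ((q + 1) / (2 * q)))" if S: "X = ennreal S" "0 \<le> S" for S
    proof -
      consider "q = 1" "p = \<infinity>" | "1 < q" "p = ereal (1 / (real CARD('n) - real CARD('n) / q))" "0 < 1 / (real CARD('n) - real CARD('n) / q)"
        using exponents by auto
      then show ?thesis
      proof cases
        case 1
        have "(\<Sum>\<^sub>\<infinity>j\<in>J. ennreal (cmod (c j))) \<le> ennreal S" using S(1) 1(1) by (simp add: X_def)
        note bound = strichartz_infinite_exponent[OF u this S(2)]
        \<comment> \<open>At q = 1 the exponent 1 - 1/q in C vanishes.\<close>
        have "C = 1" using strichartz_constant_pos[where 'n='n] 1 by (simp add: C_def)
        then show ?thesis using bound 1 S(2) by (simp add: mixed_norm_def)
      next
        case 2
        define r where "r = 1 / (real CARD('n) - real CARD('n) / q)"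
        note bound = strichartz_finite_exponent[OF 2(1) assms(2) u S(1)[unfolded X_def, THEN eq_refl] S(2), folded r_def C_def]
        have e: "1 / (2 * q / (q + 1)) = (q + 1) / (2 * q)" by simp
        have "0 < r" using 2(3) by (simp add: r_def)
        have "mixed_norm p q (\<lambda>t z. \<Sum>\<^sub>\<infinity>j\<in>J. c j * complex_of_real ((cmod (special_hermite_propagator t (u j) z))\<^sup>2))
            = ennreal_powr (\<integral>\<^sup>+t. ennreal_powr (Lq_norm q (\<lambda>z. \<Sum>\<^sub>\<infinity>j\<in>J. c j * complex_of_real ((cmod (special_hermite_propagator t (u j) z))\<^sup>2))) r \<partial>lebesgue_on {-pi..pi}) (1 / r)"
          unfolding mixed_norm_def 2(2) r_def[symmetric] by simp
        also have "\<dots> \<le> ennreal_powr (ennreal ((C * S powr ((q + 1) / (2 * q))) powr r)) (1 / r)"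
          using bound(2) \<open>0 < r\<close> unfolding e by (intro ennreal_powr_mono) auto
        also have "\<dots> = ennreal (C * S powr ((q + 1) / (2 * q)))"
          using \<open>0 < r\<close> C by (simp add: ennreal_powr_ennreal powr_powr)
        finally show ?thesis using bound(1) by simp
      qed
    qed
    show "AE t in lebesgue_on {-pi..pi}. AE z in lebesgue.
             (\<lambda>j. c j * complex_of_real ((cmod (special_hermite_propagator t (u j) z))\<^sup>2)) summable_on J"
      if "(\<lambda>j. cmod (c j) powr (2 * q / (q + 1))) summable_on J"
    proof (cases X)
      case (real S)
      then show ?thesis using main by blast
    next
      case top
      then show ?thesis using infsum_ennreal_finite[OF _ that] by (simp add: X_def)
    qed
    show "mixed_norm p q (\<lambda>t z. \<Sum>\<^sub>\<infinity>j\<in>J. c j * complex_of_real ((cmod (special_hermite_propagator t (u j) z))\<^sup>2))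
       \<le> ennreal C * ennreal_powr (\<Sum>\<^sub>\<infinity>j\<in>J. ennreal (cmod (c j) powr (2 * q / (q + 1)))) ((q + 1) / (2 * q))"
      unfolding X_def[symmetric]
    proof (cases X)
      case (real S)
      then show "mixed_norm p q (\<lambda>t z. \<Sum>\<^sub>\<infinity>j\<in>J. c j * complex_of_real ((cmod (special_hermite_propagator t (u j) z))\<^sup>2))
          \<le> ennreal C * ennreal_powr X ((q + 1) / (2 * q))"
        using main C by (simp add: ennreal_powr_ennreal ennreal_mult)
    next
      case top
      then show "mixed_norm p q (\<lambda>t z. \<Sum>\<^sub>\<infinity>j\<in>J. c j * complex_of_real ((cmod (special_hermite_propagator t (u j) z))\<^sup>2))
          \<le> ennreal C * ennreal_powr X ((q + 1) / (2 * q))"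
        using C by (simp add: ennreal_powr_def ennreal_mult_top)
    qed
  qed
qed

end
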